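(* Suppose that $U\le O_{2n}(q)$, and let $\chi$ be an irreducible character of $U$. Let $D\subseteq\Phi$ be the (unique) basic subset and $\phi\colon D\to\mathbb{F}_q^\times$ the (unique) map such that $\langle\chi,\xi_{D,\phi}\rangle\neq 0$. Then the following holds. (i) If $n$ is even, then $\chi$ has maximum degree (among the irreducible characters of $U$) if and only if $$D=\{\varepsilon_1+\varepsilon_2,\varepsilon_3+\varepsilon_4,\dots,\varepsilon_{n-3}+\varepsilon_{n-2}\}\cup D_1$$ where $D_1\subsetneq\{\varepsilon_{n-1}-\varepsilon_n,\varepsilon_{n-1}+\varepsilon_n\}$. (ii) If $n$ is odd, then $\chi$ has maximum degree if and only if $$D=\{\varepsilon_1+\varepsilon_2,\varepsilon_3+\varepsilon_4,\dots,\varepsilon_{n-2}+\varepsilon_{n-1}\}.$$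
   Context: Let $p\ge 3$ be a prime, $q=p^e$ ($e\ge 1$), $\mathbb{F}_q$ the field with $q$ elements, and $n\ge 1$. Let $U_k(q)$ be the group of unipotent upper-triangular $k\times k$ matrices over $\mathbb{F}_q$, and $U=O_{2n}(q)\cap U_{2n}(q)$, a Sylow $p$-subgroup of $O_{2n}(q)$. Explicitly, with $J$ the $n\times n$ matrix with 1's on the anti-diagonal and 0's elsewhere, $U$ consists of all block matrices $\begin{pmatrix} x & xz \\ 0 & Jx^{-T}J\end{pmatrix}$ with $x\in U_n(q)$ and $z$ an $n\times n$ matrix over $\mathbb{F}_q$ with $Jz^T+zJ=0$. Rows and columns of $2n\times 2n$ matrices are indexed, in order, by $1,\dots,n,-n,\dots,-1$; this order is denoted $\prec$. Roots: $\Phi=\{\varepsilon_i\pm\varepsilon_j:1\le i<j\le n\}$, where $\varepsilon_1,\dots,\varepsilon_n$ are the coordinate functions on the diagonal torus. Entries: for $i<j$, $\mathcal{E}(\varepsilon_i-\varepsilon_j)=\{(i,j),(-j,-i)\}$, $\mathcal{E}(\varepsilon_i+\varepsilon_j)=\{(i,-j),(j,-i)\}$. For $D\subseteq\Phi$, $\mathcal{E}(D)=\bigcup_{\alpha\in D}\mathcal{E}(\alpha)$. For each $\alpha\in\Phi$ there is exactly one $(i,j)\in\mathcal{E}(\alpha)$ with $1\le i\le n$ and $i\prec j\preceq -i$. A subset $D\subseteq\Phi$ is basic if $\mathcal{E}(D)$ contains at most one entry from each row and at most one entry from each column. Supercharacters: for $i<j$, $U_{\varepsilon_i-\varepsilon_j}=\{x\in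 U: x_{i,k}=0,\ i<k<j\}$; $U_{\varepsilon_i+\varepsilon_j}=\{x\in U:x_{i,k}=x_{j,l}=0,\ i<k\le n,\ j<l\le n\}$. Fix a nontrivial linear character $\vartheta\colon\mathbb{F}_q^+\to\mathbb{C}^\times$. For $\alpha\in\Phi$, $r\in\mathbb{F}_q^\times$, $\lambda_{\alpha,r}(x)=\vartheta(rx_{i,j})$ (with $(i,j)$ the distinguished entry of $\mathcal{E}(\alpha)$ above) is a linear character of $U_\alpha$, and $\xi_{\alpha,r}=(\lambda_{\alpha,r})^U$ (induced character). For a basic $D\subseteq\Phi$ and $\phi\colon D\to\mathbb{F}_q^\times$, $\xi_{D,\phi}=\prod_{\alpha\in D}\xi_{\alpha,\phi(\alpha)}$ (the trivial character $1_U$ if $D=\emptyset$). Every irreducible character of $U$ is a constituent of $\xi_{D,\phi}$ for exactly one pair $(D,\phi)$. $\langle\cdot,\cdot\rangle$ is the usual scalar product of class functions on $U$. A list such as $\{\varepsilon_1+\varepsilon_2,\dots\}$ of consecutive pairs is empty when there are no such pairs. *)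

theory Defs
  imports "Jordan_Normal_Form.VS_Connect" "Jordan_Normal_Form.Determinant"
    "HOL-Computational_Algebra.Primes" "HOL-Library.Cardinality"
begin

section \<open>Complex characters of finite groups\<close>

definition mat_trace :: "'a::comm_monoid_add mat \<Rightarrow> 'a" where
  "mat_trace A = (\<Sum>i<dim_row A. A $$ (i, i))"

definition representation :: "('g, 'm) monoid_scheme \<Rightarrow> nat \<Rightarrow> ('g \<Rightarrow> complex mat) \<Rightarrow> bool" where
  "representation G d \<rho> \<longleftrightarrow> \<rho> \<in> hom G (units_of (ring_mat TYPE(complex) d ()))"

definition irreducible_representation ::
    "('g, 'm) monoid_scheme \<Rightarrow> nat \<Rightarrow> ('g \<Rightarrow> complex mat) \<Rightarrow> bool" where
  "irreducible_representation G d \<rho> \<longleftrightarrow> representation G d \<rho> \<and> d > 0 \<and>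
     (\<forall>W. VectorSpace.subspace class_ring W (module_vec TYPE(complex) d) \<longrightarrow>
        (\<forall>g\<in>carrier G. \<forall>w\<in>W. \<rho> g *\<^sub>v w \<in> W) \<longrightarrow>
        W = {0\<^sub>v d} \<or> W = carrier_vec d)"

definition irr_characters :: "('g, 'm) monoid_scheme \<Rightarrow> ('g \<Rightarrow> complex) set" where
  "irr_characters G =
     {\<chi>. \<exists>d \<rho>. irreducible_representation G d \<rho> \<and> \<chi> = (\<lambda>g\<in>carrier G. mat_trace (\<rho> g))}"

text \<open>The value of a character at the identity is the dimension of an affording representation
  (see \<open>char_degree_irr\<close> below); the real part only serves to land in an ordered type.\<close>

definition char_degree :: "('g, 'm) monoid_scheme \<Rightarrow> ('g \<Rightarrow> complex) \<Rightarrow> real" where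
  "char_degree G \<chi> = Re (\<chi> \<one>\<^bsub>G\<^esub>)"

definition has_max_degree :: "('g, 'm) monoid_scheme \<Rightarrow> ('g \<Rightarrow> complex) \<Rightarrow> bool" where
  "has_max_degree G \<chi> \<longleftrightarrow> (\<forall>\<psi>\<in>irr_characters G. char_degree G \<psi> \<le> char_degree G \<chi>)"

definition char_inner :: "('g, 'm) monoid_scheme \<Rightarrow> ('g \<Rightarrow> complex) \<Rightarrow> ('g \<Rightarrow> complex) \<Rightarrow> complex" where
  "char_inner G \<chi> \<psi> = (\<Sum>g\<in>carrier G. \<chi> g * cnj (\<psi> g)) / of_nat (card (carrier G))"

definition induced_char ::
    "('g, 'm) monoid_scheme \<Rightarrow> 'g set \<Rightarrow> ('g \<Rightarrow> complex) \<Rightarrow> 'g \<Rightarrow> complex" where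
  "induced_char G H f g =
     (\<Sum>x\<in>carrier G. let y = inv\<^bsub>G\<^esub> x \<otimes>\<^bsub>G\<^esub> g \<otimes>\<^bsub>G\<^esub> x in if y \<in> H then f y else 0)
       / of_nat (card H)"

definition nontrivial_additive_character :: "('a::ab_group_add \<Rightarrow> complex) \<Rightarrow> bool" where
  "nontrivial_additive_character \<theta> \<longleftrightarrow>
     (\<forall>a. \<theta> a \<noteq> 0) \<and> (\<forall>a b. \<theta> (a + b) = \<theta> a * \<theta> b) \<and> (\<exists>a. \<theta> a \<noteq> 1)"


section \<open>The Sylow subgroup of the even orthogonal group\<close>

definition unitriangular :: "nat \<Rightarrow> 'a::semiring_1 mat set" where
  "unitriangular k = {A \<in> carrier_mat k k. upper_triangular A \<and> (\<forall>i<k. A $$ (i, i) = 1)}"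

definition antidiag :: "nat \<Rightarrow> 'a::semiring_1 mat" where
  "antidiag n = mat n n (\<lambda>(i, j). if i + j + 1 = n then 1 else 0)"

text \<open>Here \<open>x'\<close> is the inverse of \<open>x\<close>.\<close>

definition orth_unip_set :: "nat \<Rightarrow> 'a::field mat set" where
  "orth_unip_set n =
     {four_block_mat x (x * z) (0\<^sub>m n n) (antidiag n * transpose_mat x' * antidiag n) | x x' z.
        x \<in> unitriangular n \<and> x' \<in> carrier_mat n n \<and> inverts_mat x x' \<and> inverts_mat x' x \<and>
        z \<in> carrier_mat n n \<and>
        antidiag n * transpose_mat z + z * antidiag n = 0\<^sub>m n n}"

definition orth_unip :: "nat \<Rightarrow> 'a::field mat monoid" where
  "orth_unip n = \<lparr>carrier = orth_unip_set n, mult = (*), one = 1\<^sub>m (2 * n)\<rparr>"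

text \<open>Rows and columns are labelled, in order, by \<open>1, \<dots>, n, -n, \<dots>, -1\<close>;
  \<open>pos n\<close> translates a label to the corresponding index in \<open>{0..<2 * n}\<close>.\<close>

definition pos :: "nat \<Rightarrow> int \<Rightarrow> nat" where
  "pos n i = nat (if i > 0 then i - 1 else 2 * int n + i)"

definition entry :: "nat \<Rightarrow> 'a mat \<Rightarrow> int \<Rightarrow> int \<Rightarrow> 'a" where
  "entry n A i j = A $$ (pos n i, pos n j)"


section \<open>Roots and supercharacters\<close>

text \<open>\<open>EMinus i j\<close> and \<open>EPlus i j\<close> with \<open>i < j\<close> stand for \<open>\<epsilon>\<^sub>i - \<epsilon>\<^sub>j\<close> and \<open>\<epsilon>\<^sub>i + \<epsilon>\<^sub>j\<close>;
  by linear independence of the \<open>\<epsilon>\<^sub>i\<close> these are pairwise distinct.\<close>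

datatype eps_root = EMinus nat nat | EPlus nat nat

definition Phi :: "nat \<Rightarrow> eps_root set" where
  "Phi n = {EMinus i j | i j. 1 \<le> i \<and> i < j \<and> j \<le> n} \<union> {EPlus i j | i j. 1 \<le> i \<and> i < j \<and> j \<le> n}"

fun root_entries :: "eps_root \<Rightarrow> (int \<times> int) set" where
  "root_entries (EMinus i j) = {(int i, int j), (- int j, - int i)}"
| "root_entries (EPlus i j) = {(int i, - int j), (int j, - int i)}"

definition basic :: "nat \<Rightarrow> eps_root set \<Rightarrow> bool" where
  "basic n D \<longleftrightarrow> D \<subseteq> Phi n \<and>
     (let E = \<Union> (root_entries ` D) in
        (\<forall>i j j'. (i, j) \<in> E \<and> (i, j') \<in> E \<longrightarrow> j = j') \<and>
        (\<forall>i i' j. (i, j) \<in> E \<and> (i', j) \<in> E \<longrightarrow> i = i'))"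

definition main_entry :: "nat \<Rightarrow> eps_root \<Rightarrow> int \<times> int" where
  "main_entry n \<alpha> = (THE (i, j). (i, j) \<in> root_entries \<alpha> \<and> 1 \<le> i \<and> i \<le> int n \<and>
     pos n i < pos n j \<and> pos n j \<le> pos n (- i))"

fun root_subgroup :: "nat \<Rightarrow> eps_root \<Rightarrow> 'a::field mat set" where
  "root_subgroup n (EMinus i j) =
     {x \<in> orth_unip_set n. \<forall>k. i < k \<and> k < j \<longrightarrow> entry n x (int i) (int k) = 0}"
| "root_subgroup n (EPlus i j) =
     {x \<in> orth_unip_set n. (\<forall>k. i < k \<and> k \<le> n \<longrightarrow> entry n x (int i) (int k) = 0) \<and>
        (\<forall>l. j < l \<and> l \<le> n \<longrightarrow> entry n x (int j) (int l) = 0)}"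

definition root_linear_char :: "nat \<Rightarrow> ('a::field \<Rightarrow> complex) \<Rightarrow> eps_root \<Rightarrow> 'a \<Rightarrow> 'a mat \<Rightarrow> complex" where
  "root_linear_char n \<theta> \<alpha> r x = \<theta> (r * (case main_entry n \<alpha> of (i, j) \<Rightarrow> entry n x i j))"

definition elementary_char :: "nat \<Rightarrow> ('a::field \<Rightarrow> complex) \<Rightarrow> eps_root \<Rightarrow> 'a \<Rightarrow> 'a mat \<Rightarrow> complex" where
  "elementary_char n \<theta> \<alpha> r =
     induced_char (orth_unip n) (root_subgroup n \<alpha>) (root_linear_char n \<theta> \<alpha> r)"

definition supercharacter ::
    "nat \<Rightarrow> ('a::field \<Rightarrow> complex) \<Rightarrow> eps_root set \<Rightarrow> (eps_root \<Rightarrow> 'a) \<Rightarrow> 'a mat \<Rightarrow> complex" where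
  "supercharacter n \<theta> D \<phi> g = (\<Prod>\<alpha>\<in>D. elementary_char n \<theta> \<alpha> (\<phi> \<alpha>) g)"


section \<open>Sanity checks\<close>

text \<open>\<open>orth_unip_set_eq\<close> identifies the group with the unitriangular matrices preserving the
  symmetric form with Gram matrix \<open>antidiag (2 * n)\<close>.\<close>

lemma sq_mult: "A \<in> carrier_mat n n \<Longrightarrow> B \<in> carrier_mat n n \<Longrightarrow> A * B \<in> carrier_mat n n"
  by simp

lemma antidiag_carrier [simp]: "antidiag n \<in> carrier_mat n n"
  by (simp add: antidiag_def)

lemma antidiag_dim [simp]: "dim_row (antidiag n) = n" "dim_col (antidiag n) = n"
  by (simp_all add: antidiag_def)

lemma transpose_antidiag [simp]: "transpose_mat (antidiag n) = antidiag n"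
  by (rule eq_matI) (auto simp: antidiag_def)

lemma antidiag_mult_index:
  assumes "A \<in> carrier_mat n m" "i < n" "j < m"
  shows "(antidiag n * A) $$ (i, j) = A $$ (n - 1 - i, j)"
proof -
  have "(antidiag n * A) $$ (i, j) = (\<Sum>k = 0..<n. (if i + k + 1 = n then 1 else 0) * A $$ (k, j))"
    using assms by (auto simp: antidiag_def scalar_prod_def intro!: sum.cong)
  also have "\<dots> = (\<Sum>k = 0..<n. if k = n - 1 - i then A $$ (k, j) else 0)"
    using assms by (intro sum.cong) auto
  also have "\<dots> = A $$ (n - 1 - i, j)" using assms by (simp add: sum.delta)
  finally show ?thesis .
qed

lemma mult_antidiag_index:
  assumes "A \<in> carrier_mat m n" "i < m" "j < n"
  shows "(A * antidiag n) $$ (i, j) = A $$ (i, n - 1 - j)"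
proof -
  have "(A * antidiag n) $$ (i, j) = (\<Sum>k = 0..<n. A $$ (i, k) * (if k + j + 1 = n then 1 else 0))"
    using assms by (auto simp: antidiag_def scalar_prod_def intro!: sum.cong)
  also have "\<dots> = (\<Sum>k = 0..<n. if k = n - 1 - j then A $$ (i, k) else 0)"
    using assms by (intro sum.cong) auto
  also have "\<dots> = A $$ (i, n - 1 - j)" using assms by (simp add: sum.delta)
  finally show ?thesis .
qed

lemma antidiag_square [simp]: "antidiag n * antidiag n = 1\<^sub>m n"
proof (rule eq_matI)
  fix i j assume "i < dim_row (1\<^sub>m n)" "j < dim_col (1\<^sub>m n :: 'a mat)"
  then have "i < n" "j < n" by auto
  then show "(antidiag n * antidiag n :: 'a mat) $$ (i, j) = 1\<^sub>m n $$ (i, j)"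
    using antidiag_mult_index[of "antidiag n :: 'a mat" n n i j] by (auto simp: antidiag_def)
qed auto

lemma antidiag_double: "antidiag (2 * n) = four_block_mat (0\<^sub>m n n) (antidiag n) (antidiag n) (0\<^sub>m n n)"
  by (rule eq_matI) (auto simp: antidiag_def)

lemma antidiag_conj_index:
  assumes "A \<in> carrier_mat n n" "i < n" "j < n"
  shows "(antidiag n * transpose_mat A * antidiag n) $$ (i, j) = A $$ (n - 1 - j, n - 1 - i)"
proof -
  have "(antidiag n * transpose_mat A * antidiag n) $$ (i, j) = (antidiag n * transpose_mat A) $$ (i, n - 1 - j)"
    using assms by (intro mult_antidiag_index) auto
  also have "\<dots> = transpose_mat A $$ (n - 1 - i, n - 1 - j)"
    using assms by (intro antidiag_mult_index) auto
  finally show ?thesis using assms by simp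
qed

lemma unitriangular_antidiag_conj:
  assumes "A \<in> unitriangular n"
  shows "antidiag n * transpose_mat A * antidiag n \<in> unitriangular n"
proof -
  have c: "A \<in> carrier_mat n n" using assms by (simp add: unitriangular_def)
  then have "(antidiag n * transpose_mat A * antidiag n) $$ (i, j) = (if i = j then 1 else 0)"
    if "j \<le> i" "i < n" for i j
    using assms that unfolding unitriangular_def upper_triangular_def
    by (subst antidiag_conj_index) auto
  then show ?thesis
    using c by (auto simp: unitriangular_def upper_triangular_def simp del: index_mult_mat(1))
qed

lemma unitriangular_mult:
  assumes "A \<in> unitriangular n" "B \<in> unitriangular n"
  shows "A * B \<in> unitriangular n"
proof -
  have c: "A \<in> carrier_mat n n" "B \<in> carrier_mat n n" using assms by (auto simp: unitriangular_def)
  have A: "A $$ (i, j) = (if i = j then 1 else 0)" if "j \<le> i" "i < n" for i j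
    using assms c that by (auto simp: unitriangular_def upper_triangular_def)
  have B: "B $$ (i, j) = (if i = j then 1 else 0)" if "j \<le> i" "i < n" for i j
    using assms c that by (auto simp: unitriangular_def upper_triangular_def)
  have "(A * B) $$ (i, j) = (if i = j then 1 else 0)" if "j \<le> i" "i < n" for i j
  proof -
    have "(A * B) $$ (i, j) = (\<Sum>k = 0..<n. A $$ (i, k) * B $$ (k, j))"
      using c that by (auto simp: scalar_prod_def intro!: sum.cong)
    also have "\<dots> = (\<Sum>k = 0..<n. if k = i then (if i = j then 1 else 0) else 0)"
    proof (intro sum.cong refl)
      fix k assume "k \<in> {0..<n}"
      then show "A $$ (i, k) * B $$ (k, j) = (if k = i then (if i = j then 1 else 0) else 0)"
        using A[of k i] B[of j k] that by (cases "k \<le> i") (auto)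
    qed
    also have "\<dots> = (if i = j then 1 else 0)" using that by (simp add: sum.delta)
    finally show ?thesis .
  qed
  then show ?thesis using c by (auto simp: unitriangular_def upper_triangular_def)
qed

lemma unitriangular_inverse:
  fixes x y :: "'a::field mat"
  assumes "x \<in> unitriangular n" "y \<in> carrier_mat n n" "x * y = 1\<^sub>m n"
  shows "y \<in> unitriangular n"
proof -
  have c: "x \<in> carrier_mat n n" using assms by (auto simp: unitriangular_def)
  have x: "x $$ (i, j) = (if i = j then 1 else 0)" if "j \<le> i" "i < n" for i j
    using assms c that by (auto simp: unitriangular_def upper_triangular_def)
  have "y $$ (i, j) = (if i = j then 1 else 0)" if "j \<le> i" "i < n" for i j
    using that
  proof (induction "n - i" arbitrary: i rule: less_induct)
    case less
    have "(if i = j then 1 else 0) = (x * y) $$ (i, j)"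
      using less.prems assms by simp
    also have "\<dots> = (\<Sum>k = 0..<n. x $$ (i, k) * y $$ (k, j))"
      using c assms(2) less.prems by (auto simp: scalar_prod_def intro!: sum.cong)
    also have "\<dots> = (\<Sum>k = 0..<n. if k = i then y $$ (i, j) else 0)"
    proof (intro sum.cong refl)
      fix k assume k: "k \<in> {0..<n}"
      show "x $$ (i, k) * y $$ (k, j) = (if k = i then y $$ (i, j) else 0)"
      proof (cases "k \<le> i")
        case True then show ?thesis using x[of k i] less.prems by auto
      next
        case False
        then have "y $$ (k, j) = 0" using less.hyps[of k] less.prems k by auto
        then show ?thesis using False by auto
      qed
    qed
    also have "\<dots> = y $$ (i, j)" using less.prems by (simp add: sum.delta)
    finally show ?case by simp
  qed
  then show ?thesis using assms by (auto simp: unitriangular_def upper_triangular_def)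
qed

lemma unitriangular_invertible:
  fixes x :: "'a::field mat"
  assumes "x \<in> unitriangular n"
  obtains y where "y \<in> carrier_mat n n" "x * y = 1\<^sub>m n" "y * x = 1\<^sub>m n"
proof -
  have c: "x \<in> carrier_mat n n" and u: "upper_triangular x" and d: "\<And>i. i < n \<Longrightarrow> x $$ (i, i) = 1"
    using assms by (auto simp: unitriangular_def)
  have "diag_mat x = map (\<lambda>i. 1) [0..<n]" using c d by (auto simp: diag_mat_def)
  then have "det x = 1" using det_upper_triangular[OF u c] by (simp add: map_replicate_const)
  then have "x \<in> Units (ring_mat TYPE('a) n ())"
    using det_non_zero_imp_unit[OF c, of "()"] by simp
  then show ?thesis using that by (auto simp: Units_def ring_mat_simps)
qed

lemma antidiag_conj_form:
  fixes z :: "'a::field mat"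
  assumes "z \<in> carrier_mat n n"
  shows "antidiag n * z + transpose_mat z * antidiag n =
    antidiag n * (antidiag n * transpose_mat z + z * antidiag n) * antidiag n" (is "?J * z + ?z * ?J = _")
proof -
  have "?J * (?J * ?z + z * ?J) = ?J * (?J * ?z) + ?J * (z * ?J)"
    using assms by (intro mult_add_distrib_mat[of _ n n _ n]) auto
  also have "\<dots> = (?J * ?J) * ?z + ?J * z * ?J"
    using assms by (simp add: sq_mult assoc_mult_mat[of _ n n _ n _ n] del: antidiag_square)
  also have "\<dots> = ?z + ?J * z * ?J" using assms by simp
  finally have "?J * (?J * ?z + z * ?J) * ?J = ?z * ?J + ?J * z * ?J * ?J"
    using assms by (simp add: add_mult_distrib_mat[of _ n n _ _ n] sq_mult)
  also have "?J * z * ?J * ?J = ?J * z * (?J * ?J)"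
    using assms by (simp add: sq_mult assoc_mult_mat[of _ n n _ n _ n] del: antidiag_square)
  also have "\<dots> = ?J * z" using assms by (simp add: sq_mult)
  also have "?z * ?J + ?J * z = ?J * z + ?z * ?J"
    using assms by (intro comm_add_mat[of _ n n]) (auto intro: sq_mult)
  finally show ?thesis by simp
qed

lemma orth_unip_set_eq:
  "orth_unip_set n = {A \<in> unitriangular (2 * n).
     transpose_mat A * antidiag (2 * n) * A = antidiag (2 * n)}" (is "?L = ?R")
proof -
  let ?J = "antidiag n :: 'a mat"
  have form: "transpose_mat (four_block_mat x b (0\<^sub>m n n) w) * antidiag (2 * n) * four_block_mat x b (0\<^sub>m n n) w
     = four_block_mat (0\<^sub>m n n) (transpose_mat x * ?J * w) (transpose_mat w * ?J * x)
        (transpose_mat w * ?J * b + transpose_mat b * ?J * w)"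
    if c: "x \<in> carrier_mat n n" "b \<in> carrier_mat n n" "w \<in> carrier_mat n n" for x b w
    using c by (simp add: antidiag_double transpose_four_block_mat[of _ n n _ n _ n]
        mult_four_block_mat[of _ n n _ n _ n _ _ n _ n] sq_mult)
  have tri: "four_block_mat x b (0\<^sub>m n n) w \<in> unitriangular (2 * n) \<longleftrightarrow>
      x \<in> unitriangular n \<and> w \<in> unitriangular n"
    if c: "x \<in> carrier_mat n n" "b \<in> carrier_mat n n" "w \<in> carrier_mat n n" for x b w :: "'a mat"
  proof
    assume "x \<in> unitriangular n \<and> w \<in> unitriangular n"
    then show "four_block_mat x b (0\<^sub>m n n) w \<in> unitriangular (2 * n)"
      using c by (auto simp: unitriangular_def upper_triangular_def)
  next
    assume l: "four_block_mat x b (0\<^sub>m n n) w \<in> unitriangular (2 * n)"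
    have e: "four_block_mat x b (0\<^sub>m n n) w $$ (i, j) = (if i = j then 1 else 0)" if "j \<le> i" "i < 2 * n" for i j
      using l that by (auto simp: unitriangular_def upper_triangular_def)
    have "x $$ (i, j) = (if i = j then 1 else 0)" if "j \<le> i" "i < n" for i j
      using e[of j i] c that by auto
    moreover have "w $$ (i, j) = (if i = j then 1 else 0)" if "j \<le> i" "i < n" for i j
      using e[of "j + n" "i + n"] c that by auto
    ultimately show "x \<in> unitriangular n \<and> w \<in> unitriangular n"
      using c by (auto simp: unitriangular_def upper_triangular_def)
  qed
  show ?thesis
  proof (intro equalityI subsetI)
    fix A assume "A \<in> ?L"
    then obtain x x' z where A: "A = four_block_mat x (x * z) (0\<^sub>m n n) (?J * transpose_mat x' * ?J)"
      and x: "x \<in> unitriangular n" and x': "x' \<in> carrier_mat n n" and z: "z \<in> carrier_mat n n"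
      and inv: "inverts_mat x x'" "inverts_mat x' x"
      and zz: "?J * transpose_mat z + z * ?J = 0\<^sub>m n n"
      by (auto simp: orth_unip_set_def)
    have xc: "x \<in> carrier_mat n n" using x by (simp add: unitriangular_def)
    have inv': "x * x' = 1\<^sub>m n" "x' * x = 1\<^sub>m n" using inv xc x' by (auto simp: inverts_mat_def)
    have tinv: "transpose_mat x * transpose_mat x' = 1\<^sub>m n" "transpose_mat x' * transpose_mat x = 1\<^sub>m n"
      by (metis inv' transpose_mult[OF xc x'] transpose_mult[OF x' xc] transpose_one)+
    let ?w = "?J * transpose_mat x' * ?J"
    have w: "?w \<in> unitriangular n"
      using unitriangular_antidiag_conj[OF unitriangular_inverse[OF x x' inv'(1)]] .
    have wc: "?w \<in> carrier_mat n n" using x' by auto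
    have tw: "transpose_mat ?w = ?J * x' * ?J"
      using x' by (simp add: transpose_mult[of _ n n _ n] sq_mult assoc_mult_mat[of _ n n _ n _ n])
    have "transpose_mat x * ?J * ?w = transpose_mat x * (?J * ?J) * transpose_mat x' * ?J"
      using xc x' by (simp add: sq_mult assoc_mult_mat[of _ n n _ n _ n] del: antidiag_square)
    then have 1: "transpose_mat x * ?J * ?w = ?J" using xc x' tinv by simp
    have "transpose_mat ?w * ?J * x = ?J * x' * (?J * ?J) * x"
      unfolding tw using xc x' by (simp add: sq_mult assoc_mult_mat[of _ n n _ n _ n] del: antidiag_square)
    also have "\<dots> = ?J * (x' * x)" using xc x' by (simp add: sq_mult assoc_mult_mat[of _ n n _ n _ n])
    finally have 2: "transpose_mat ?w * ?J * x = ?J" by (simp add: inv')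
    have "transpose_mat ?w * ?J * (x * z) = transpose_mat ?w * ?J * x * z"
      using wc xc z by (simp add: sq_mult assoc_mult_mat[of _ n n _ n _ n])
    then have 3: "transpose_mat ?w * ?J * (x * z) = ?J * z" by (simp add: 2)
    have "transpose_mat (x * z) * ?J * ?w = transpose_mat z * (transpose_mat x * ?J * ?w)"
      using wc xc z by (simp add: transpose_mult[of _ n n _ n] sq_mult assoc_mult_mat[of _ n n _ n _ n])
    then have 4: "transpose_mat (x * z) * ?J * ?w = transpose_mat z * ?J" by (simp add: 1)
    have "?J * z + transpose_mat z * ?J = ?J * (?J * transpose_mat z + z * ?J) * ?J"
      by (rule antidiag_conj_form[OF z])
    then have 5: "?J * z + transpose_mat z * ?J = 0\<^sub>m n n" by (simp add: zz)
    show "A \<in> ?R"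
      using form[OF xc _ wc, of "x * z"] tri[OF xc _ wc, of "x * z"] xc z x w
      by (simp add: A 1 2 3 4 5 antidiag_double)
  next
    fix A assume AR: "A \<in> ?R"
    have Ac: "A \<in> carrier_mat (2 * n) (2 * n)" using AR by (auto simp: unitriangular_def)
    define x where "x = mat n n (\<lambda>(i, j). A $$ (i, j))"
    define b where "b = mat n n (\<lambda>(i, j). A $$ (i, j + n))"
    define w where "w = mat n n (\<lambda>(i, j). A $$ (i + n, j + n))"
    have xc: "x \<in> carrier_mat n n" and bc: "b \<in> carrier_mat n n" and wc: "w \<in> carrier_mat n n"
      by (auto simp: x_def b_def w_def)
    have A: "A = four_block_mat x b (0\<^sub>m n n) w"
      by (rule eq_matI) (use AR Ac in \<open>auto simp: x_def b_def w_def unitriangular_def upper_triangular_def\<close>)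
    have x: "x \<in> unitriangular n" and w: "w \<in> unitriangular n"
      using AR tri[OF xc bc wc] unfolding A by auto
    have eq: "four_block_mat (0\<^sub>m n n) (transpose_mat x * ?J * w) (transpose_mat w * ?J * x)
        (transpose_mat w * ?J * b + transpose_mat b * ?J * w) =
        four_block_mat (0\<^sub>m n n) ?J ?J (0\<^sub>m n n)"
      using AR form[OF xc bc wc] unfolding A antidiag_double by simp
    have blk: "B2 = C2 \<and> B3 = C3 \<and> B4 = C4"
      if "four_block_mat (0\<^sub>m n n) B2 B3 B4 = four_block_mat (0\<^sub>m n n) C2 C3 C4"
        "B2 \<in> carrier_mat n n" "B3 \<in> carrier_mat n n" "B4 \<in> carrier_mat n n"
        "C2 \<in> carrier_mat n n" "C3 \<in> carrier_mat n n" "C4 \<in> carrier_mat n n"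
      for B2 B3 B4 C2 C3 C4 :: "'a mat"
    proof -
      have e: "four_block_mat (0\<^sub>m n n) B2 B3 B4 $$ ij = four_block_mat (0\<^sub>m n n) C2 C3 C4 $$ ij" for ij
        using that by simp
      have "B2 $$ (i, j) = C2 $$ (i, j)" if "i < n" "j < n" for i j
        using e[of "(i, j + n)"] that \<open>B2 \<in> _\<close> \<open>B3 \<in> _\<close> \<open>B4 \<in> _\<close> \<open>C2 \<in> _\<close> \<open>C3 \<in> _\<close> \<open>C4 \<in> _\<close> by auto
      moreover have "B3 $$ (i, j) = C3 $$ (i, j)" if "i < n" "j < n" for i j
        using e[of "(i + n, j)"] that \<open>B2 \<in> _\<close> \<open>B3 \<in> _\<close> \<open>B4 \<in> _\<close> \<open>C2 \<in> _\<close> \<open>C3 \<in> _\<close> \<open>C4 \<in> _\<close> by auto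
      moreover have "B4 $$ (i, j) = C4 $$ (i, j)" if "i < n" "j < n" for i j
        using e[of "(i + n, j + n)"] that \<open>B2 \<in> _\<close> \<open>B3 \<in> _\<close> \<open>B4 \<in> _\<close> \<open>C2 \<in> _\<close> \<open>C3 \<in> _\<close> \<open>C4 \<in> _\<close> by auto
      ultimately show ?thesis using that by (auto intro!: eq_matI)
    qed
    have eqs: "transpose_mat x * ?J * w = ?J" "transpose_mat w * ?J * x = ?J"
        "transpose_mat w * ?J * b + transpose_mat b * ?J * w = 0\<^sub>m n n"
      using blk[OF eq] xc bc wc by auto
    obtain x' where x': "x' \<in> carrier_mat n n" "x * x' = 1\<^sub>m n" "x' * x = 1\<^sub>m n"
      using unitriangular_invertible[OF x] by metis
    have tinv: "transpose_mat x' * transpose_mat x = 1\<^sub>m n"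
      by (metis x' transpose_mult[OF xc x'(1)] transpose_one)
    define z where "z = x' * b"
    have zc: "z \<in> carrier_mat n n" using x' bc by (simp add: z_def)
    have xz: "x * z = b" using xc x' bc unfolding z_def
      by (simp add: assoc_mult_mat[of x n n x' n b n, symmetric])
    have "?J * transpose_mat x' * ?J = ?J * transpose_mat x' * (transpose_mat x * ?J * w)"
      by (simp add: eqs)
    also have "\<dots> = ?J * (transpose_mat x' * transpose_mat x) * (?J * w)"
      using xc x' wc by (simp add: sq_mult assoc_mult_mat[of _ n n _ n _ n])
    also have "\<dots> = (?J * ?J) * w"
      unfolding tinv using wc by (simp add: sq_mult assoc_mult_mat[of _ n n _ n _ n] del: antidiag_square)
    finally have ww: "w = ?J * transpose_mat x' * ?J" using wc by simp
    have "transpose_mat w * ?J * b = transpose_mat w * ?J * x * z"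
      using wc xc zc by (simp add: xz[symmetric] sq_mult assoc_mult_mat[of _ n n _ n _ n])
    then have 3: "transpose_mat w * ?J * b = ?J * z" by (simp add: eqs)
    have "transpose_mat b * ?J * w = transpose_mat z * (transpose_mat x * ?J * w)"
      using wc xc zc by (simp add: xz[symmetric] transpose_mult[of _ n n _ n] sq_mult assoc_mult_mat[of _ n n _ n _ n])
    then have 4: "transpose_mat b * ?J * w = transpose_mat z * ?J" by (simp add: eqs)
    have "?J * transpose_mat z + z * ?J = ?J * (?J * z + transpose_mat z * ?J) * ?J"
      using antidiag_conj_form[of "transpose_mat z"] zc by simp
    then have "?J * transpose_mat z + z * ?J = 0\<^sub>m n n" using eqs(3) by (simp add: 3 4)
    then show "A \<in> ?L"
      unfolding orth_unip_set_def A ww xz[symmetric] using x x' zc xc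
      by (auto simp: inverts_mat_def)
  qed
qed

lemma group_orth_unip: "group (orth_unip n :: 'a::field mat monoid)"
proof (rule groupI)
  let ?N = "2 * n"
  let ?J = "antidiag ?N :: 'a mat"
  note [simp] = orth_unip_def
  have c: "A \<in> carrier_mat ?N ?N" if "A \<in> carrier (orth_unip n)" for A :: "'a mat"
    using that by (simp add: orth_unip_set_eq unitriangular_def)
  show "A \<otimes>\<^bsub>orth_unip n\<^esub> B \<in> carrier (orth_unip n)"
    if "A \<in> carrier (orth_unip n)" "B \<in> carrier (orth_unip n)" for A B :: "'a mat"
  proof -
    have AB: "A \<in> carrier_mat ?N ?N" "B \<in> carrier_mat ?N ?N" using that c by auto
    have "transpose_mat (A * B) * ?J * (A * B) = transpose_mat B * (transpose_mat A * ?J * A) * B"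
      using AB by (simp add: transpose_mult[of _ ?N ?N _ ?N] sq_mult assoc_mult_mat[of _ ?N ?N _ ?N _ ?N])
    then show ?thesis using that unitriangular_mult[of A ?N B] by (simp add: orth_unip_set_eq)
  qed
  show "\<one>\<^bsub>orth_unip n\<^esub> \<in> carrier (orth_unip n :: 'a mat monoid)"
    by (auto simp: orth_unip_set_eq unitriangular_def upper_triangular_def)
  show "A \<otimes>\<^bsub>orth_unip n\<^esub> B \<otimes>\<^bsub>orth_unip n\<^esub> C = A \<otimes>\<^bsub>orth_unip n\<^esub> (B \<otimes>\<^bsub>orth_unip n\<^esub> C)"
    if "A \<in> carrier (orth_unip n)" "B \<in> carrier (orth_unip n)" "C \<in> carrier (orth_unip n)" for A B C :: "'a mat"
    using c[OF that(1)] c[OF that(2)] c[OF that(3)] by (simp add: sq_mult assoc_mult_mat[of _ ?N ?N _ ?N _ ?N])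
  show "\<one>\<^bsub>orth_unip n\<^esub> \<otimes>\<^bsub>orth_unip n\<^esub> A = A" if "A \<in> carrier (orth_unip n)" for A :: "'a mat"
    using c[OF that] by simp
  show "\<exists>B\<in>carrier (orth_unip n). B \<otimes>\<^bsub>orth_unip n\<^esub> A = \<one>\<^bsub>orth_unip n\<^esub>"
    if "A \<in> carrier (orth_unip n)" for A :: "'a mat"
  proof -
    let ?B = "?J * transpose_mat A * ?J"
    have A: "A \<in> carrier_mat ?N ?N" using c that by simp
    have u: "A \<in> unitriangular ?N" and f: "transpose_mat A * ?J * A = ?J"
      using that by (auto simp: orth_unip_set_eq)
    have "?B * A = ?J * (transpose_mat A * ?J * A)"
      using A by (simp add: sq_mult assoc_mult_mat[of _ ?N ?N _ ?N _ ?N])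
    then have BA: "?B * A = 1\<^sub>m ?N" by (simp add: f)
    have Bc: "?B \<in> carrier_mat ?N ?N" using A by auto
    have AB: "A * ?B = 1\<^sub>m ?N" using mat_mult_left_right_inverse[OF Bc A BA] .
    have "transpose_mat ?B = ?J * A * ?J"
      using A by (simp add: transpose_mult[of _ ?N ?N _ ?N] sq_mult assoc_mult_mat[of _ ?N ?N _ ?N _ ?N])
    then have "transpose_mat ?B * ?J * ?B = ?J * A * (?J * ?J) * ?B"
      using A by (simp add: sq_mult assoc_mult_mat[of _ ?N ?N _ ?N _ ?N] del: antidiag_square)
    also have "\<dots> = ?J * (A * ?B)"
      using A Bc by (simp add: sq_mult assoc_mult_mat[of _ ?N ?N _ ?N _ ?N] )
    finally have "transpose_mat ?B * ?J * ?B = ?J" by (simp add: AB)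
    then have "?B \<in> carrier (orth_unip n)"
      using unitriangular_antidiag_conj[OF u] by (simp add: orth_unip_set_eq)
    then show ?thesis using BA by (intro bexI[of _ ?B]) auto
  qed
qed

lemma main_entry_EMinus:
  assumes "1 \<le> i" "i < j" "j \<le> n"
  shows "main_entry n (EMinus i j) = (int i, int j)"
  unfolding main_entry_def
  by (rule the_equality) (use assms in \<open>auto simp: pos_def split: prod.splits if_splits\<close>)

lemma main_entry_EPlus:
  assumes "1 \<le> i" "i < j" "j \<le> n"
  shows "main_entry n (EPlus i j) = (int i, - int j)"
  unfolding main_entry_def
  by (rule the_equality) (use assms in \<open>auto simp: pos_def split: prod.splits if_splits\<close>)

lemma char_degree_irr:
  assumes G: "group G" and "irreducible_representation G d \<rho>"
  shows "char_degree G (\<lambda>g\<in>carrier G. mat_trace (\<rho> g)) = real d"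
proof -
  interpret group G by fact
  let ?R = "ring_mat TYPE(complex) d ()"
  interpret R: Ring.ring ?R by (rule ring_mat)
  have "\<rho> \<in> hom G (units_of ?R)"
    using assms by (auto simp: irreducible_representation_def representation_def)
  then have "\<rho> \<one>\<^bsub>G\<^esub> = \<one>\<^bsub>units_of ?R\<^esub>"
    using hom_one[of \<rho> G "units_of ?R"] R.units_group G by blast
  then have "\<rho> \<one>\<^bsub>G\<^esub> = 1\<^sub>m d" by (simp add: units_of_one ring_mat_simps)
  then show ?thesis by (simp add: char_degree_def mat_trace_def)
qed

end

theory Submission
  imports Defs
begin

text \<open>Write \<open>q\<close> for the order of the field and \<open>U\<^sub>n\<close> for the group. The elements of \<open>U\<^sub>n\<^sub>+\<^sub>1\<close> that differ
  from the identity only in the first row and the last column form an elementary abelian normal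
  subgroup \<open>N\<close> with quotient \<open>U\<^sub>n\<close>. An irreducible representation contains an eigenvector of \<open>N\<close>, and
  root elements move its weight to one supported on an index and its mirror image. Such a weight is
  fixed by a copy of \<open>U\<^sub>n\<^sub>-\<^sub>1\<close>, possibly enlarged by a root subgroup family, so the degree is bounded
  by the index of the stabiliser times a degree of \<open>U\<^sub>n\<^sub>-\<^sub>1\<close>. By induction every degree of \<open>U\<^sub>n\<close> is at
  most \<open>q\<close> to the power \<open>mexp n\<close>, and for \<open>n \<ge> 3\<close> the inequality is strict if the centre acts trivially.

  If \<open>\<epsilon>\<^sub>1 + \<epsilon>\<^sub>2 \<notin> D\<close>, all factors of \<open>\<xi>\<close> are constant on the cosets of the centre, so the centre lies in
  the kernel of \<open>\<chi>\<close>. If \<open>\<epsilon>\<^sub>1 + \<epsilon>\<^sub>2 \<in> D\<close>, the other factors are inflated from \<open>U\<^sub>n\<^sub>-\<^sub>2\<close>, and Clifford theory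
  shows that \<open>\<chi>(1)\<close> is \<open>q\<close> to the power \<open>2(n - 2)\<close> times the degree of a constituent of the supercharacter
  of \<open>U\<^sub>n\<^sub>-\<^sub>2\<close> attached to the other roots; now induct. The bound is attained since the supercharacters
  of the sets in the theorem do have constituents.\<close>

section \<open>Matrices and subspaces\<close>

text \<open>The exponent comes from counting. Since N has order q^(2n) in U_(n+1), |U_(m+2)| = |U_m|
  q^(2m) q^(2m+2), and a weight supported on a mirrored pair of indices is fixed by U_m N, whose
  index is q^(2m); iterating over U_m gives \<open>mexp\<close>. An upper bound alone does not tell
  which D reach it. What separates the two cases is the centre: if it acts trivially, the last
  coordinate of every weight vanishes, so neither member of the pair is an end index, and the first
  row has room for a one-parameter group that fixes the weight and commutes with U_m. The bound then
  drops by a factor q. In the other case the reduction gives an equality d = q^(2m) k, so maximality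
  passes in both directions. Odd q enters through the quadratic form: an element of N has corner
  entry -Q(a)/2, and dividing by 2 is what makes the inner first row a free coordinate. Complete
  reducibility is never invoked: an invariant subspace makes the matrices block triangular, traces
  add, and constituents are found by induction on the degree.\<close>

lemma mat_assoc:
  "dim_col A = dim_row B \<Longrightarrow> dim_col B = dim_row C \<Longrightarrow> A * B * C = A * (B * C :: 'a::semiring_0 mat)"
  by (rule assoc_mult_mat[of A "dim_row A" "dim_col A" B "dim_col B" C "dim_col C"]) auto

lemma mat_vec_assoc:
  "dim_col A = dim_row B \<Longrightarrow> dim_col B = dim_vec v \<Longrightarrow> A * B *\<^sub>v v = A *\<^sub>v (B *\<^sub>v v :: 'a::semiring_0 vec)"
  by (rule assoc_mult_mat_vec[of A "dim_row A" "dim_col A" B "dim_col B"]) (auto intro: carrier_vecI)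

lemma mat_vec_index:
  "A \<in> carrier_mat m n \<Longrightarrow> v \<in> carrier_vec n \<Longrightarrow> i < m \<Longrightarrow> (A *\<^sub>v v) $ i = (\<Sum>j<n. A $$ (i, j) * v $ j)"
  by (auto simp: scalar_prod_def atLeast0LessThan intro!: sum.cong)

lemma mat_mult_index:
  "A \<in> carrier_mat m n \<Longrightarrow> B \<in> carrier_mat n l \<Longrightarrow> i < m \<Longrightarrow> j < l \<Longrightarrow>
    (A * B) $$ (i, j) = (\<Sum>k<n. A $$ (i, k) * B $$ (k, j))"
  by (auto simp: scalar_prod_def atLeast0LessThan intro!: sum.cong)

lemma mat_unit_vec_col:
  fixes A :: "'a::semiring_1 mat"
  assumes "A \<in> carrier_mat m n" "j < n"
  shows "A *\<^sub>v unit_vec n j = col A j"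
  by (rule eq_vecI) (use assms in auto)

lemma zero_mat_mult_vec:
  "v \<in> carrier_vec n \<Longrightarrow> 0\<^sub>m m n *\<^sub>v v = (0\<^sub>v m :: 'a::semiring_0 vec)"
  by (rule eq_vecI) (auto simp: scalar_prod_def)

lemma mat_mult_zero_vec:
  "A \<in> carrier_mat m n \<Longrightarrow> A *\<^sub>v 0\<^sub>v n = (0\<^sub>v m :: 'a::semiring_0 vec)"
  by (rule eq_vecI) (auto simp: scalar_prod_def)

lemma mat_eqI_vec:
  fixes A B :: "'a::semiring_1 mat"
  assumes "A \<in> carrier_mat m n" "B \<in> carrier_mat m n" "\<And>v. v \<in> carrier_vec n \<Longrightarrow> A *\<^sub>v v = B *\<^sub>v v"
  shows "A = B"
proof (rule mat_col_eqI)
  show "col A j = col B j" if "j < dim_col B" for j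
    using assms(3)[of "unit_vec n j"] that assms(1,2) by (simp add: mat_unit_vec_col[of _ m n])
qed (use assms in auto)

lemma mat_trace_comm:
  fixes A B :: "'a::comm_semiring_0 mat"
  assumes "A \<in> carrier_mat m n" "B \<in> carrier_mat n m"
  shows "mat_trace (A * B) = mat_trace (B * A)"
proof -
  have "mat_trace (A * B) = (\<Sum>i<m. \<Sum>k<n. A $$ (i, k) * B $$ (k, i))"
    using assms unfolding mat_trace_def by (intro sum.cong) (auto simp: mat_mult_index simp del: index_mult_mat(1))
  also have "\<dots> = (\<Sum>k<n. \<Sum>i<m. B $$ (k, i) * A $$ (i, k))"
    by (subst sum.swap) (simp add: mult.commute)
  also have "\<dots> = mat_trace (B * A)"
    using assms unfolding mat_trace_def by (intro sum.cong) (auto simp: mat_mult_index simp del: index_mult_mat(1))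
  finally show ?thesis .
qed

lemma mat_trace_add:
  "A \<in> carrier_mat n n \<Longrightarrow> B \<in> carrier_mat n n \<Longrightarrow> mat_trace (A + B) = mat_trace A + mat_trace B"
  by (simp add: mat_trace_def sum.distrib)

lemma mat_trace_one: "mat_trace (1\<^sub>m n) = of_nat n"
  by (simp add: mat_trace_def)

lemma mat_trace_smult:
  "A \<in> carrier_mat n n \<Longrightarrow> mat_trace (c \<cdot>\<^sub>m A) = c * mat_trace (A :: 'a::comm_semiring_0 mat)"
  by (simp add: mat_trace_def sum_distrib_left)

text \<open>Matrices of all sizes share one type without a common zero, so sums over a set are taken
  entrywise, with the dimensions as explicit parameters.\<close>

definition mat_sum :: "nat \<Rightarrow> nat \<Rightarrow> ('b \<Rightarrow> 'a::comm_ring_1 mat) \<Rightarrow> 'b set \<Rightarrow> 'a mat" where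
  "mat_sum m n F S = mat m n (\<lambda>(i, j). \<Sum>s\<in>S. F s $$ (i, j))"

lemma mat_sum_carrier [simp]: "mat_sum m n F S \<in> carrier_mat m n"
  and mat_sum_dim [simp]: "dim_row (mat_sum m n F S) = m" "dim_col (mat_sum m n F S) = n"
  by (simp_all add: mat_sum_def)

lemma mat_sum_mult_left:
  assumes "A \<in> carrier_mat l m" "\<And>s. s \<in> S \<Longrightarrow> F s \<in> carrier_mat m n"
  shows "A * mat_sum m n F S = mat_sum l n (\<lambda>s. A * F s) S"
proof (rule eq_matI)
  fix i j assume "i < dim_row (mat_sum l n (\<lambda>s. A * F s) S)" "j < dim_col (mat_sum l n (\<lambda>s. A * F s) S)"
  then have ij: "i < l" "j < n" by auto
  have "(A * mat_sum m n F S) $$ (i, j) = (\<Sum>k<m. A $$ (i, k) * (\<Sum>s\<in>S. F s $$ (k, j)))"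
    using ij assms by (subst mat_mult_index[of _ l m _ n]) (auto simp: mat_sum_def)
  also have "\<dots> = (\<Sum>s\<in>S. \<Sum>k<m. A $$ (i, k) * F s $$ (k, j))"
    by (simp add: sum_distrib_left) (rule sum.swap)
  also have "\<dots> = mat_sum l n (\<lambda>s. A * F s) S $$ (i, j)"
    using ij assms by (auto simp: mat_sum_def mat_mult_index[of _ l m _ n] simp del: index_mult_mat(1) intro!: sum.cong)
  finally show "(A * mat_sum m n F S) $$ (i, j) = mat_sum l n (\<lambda>s. A * F s) S $$ (i, j)" .
qed (use assms in auto)

lemma mat_sum_mult_right:
  assumes "A \<in> carrier_mat n l" "\<And>s. s \<in> S \<Longrightarrow> F s \<in> carrier_mat m n"
  shows "mat_sum m n F S * A = mat_sum m l (\<lambda>s. F s * A) S"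
proof (rule eq_matI)
  fix i j assume "i < dim_row (mat_sum m l (\<lambda>s. F s * A) S)" "j < dim_col (mat_sum m l (\<lambda>s. F s * A) S)"
  then have ij: "i < m" "j < l" by auto
  have "(mat_sum m n F S * A) $$ (i, j) = (\<Sum>k<n. (\<Sum>s\<in>S. F s $$ (i, k)) * A $$ (k, j))"
    using ij assms by (subst mat_mult_index[of _ m n _ l]) (auto simp: mat_sum_def)
  also have "\<dots> = (\<Sum>s\<in>S. \<Sum>k<n. F s $$ (i, k) * A $$ (k, j))"
    by (simp add: sum_distrib_right) (rule sum.swap)
  also have "\<dots> = mat_sum m l (\<lambda>s. F s * A) S $$ (i, j)"
    using ij assms by (auto simp: mat_sum_def mat_mult_index[of _ m n _ l] simp del: index_mult_mat(1) intro!: sum.cong)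
  finally show "(mat_sum m n F S * A) $$ (i, j) = mat_sum m l (\<lambda>s. F s * A) S $$ (i, j)" .
qed (use assms in auto)

lemma mat_sum_cong:
  "(\<And>s. s \<in> S \<Longrightarrow> F s = F' s) \<Longrightarrow> mat_sum m n F S = mat_sum m n F' S"
  by (simp add: mat_sum_def)

lemma mat_sum_reindex:
  "bij_betw h S T \<Longrightarrow> mat_sum m n F T = mat_sum m n (\<lambda>s. F (h s)) S"
  by (auto simp: mat_sum_def sum.reindex_bij_betw[of h S T, symmetric])

lemma mat_sum_smult:
  assumes "\<And>s. s \<in> S \<Longrightarrow> F s \<in> carrier_mat m n"
  shows "c \<cdot>\<^sub>m mat_sum m n F S = mat_sum m n (\<lambda>s. c \<cdot>\<^sub>m F s) S"
  by (rule eq_matI) (auto simp: mat_sum_def sum_distrib_left carrier_matD[OF assms] intro!: sum.cong)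

text \<open>Evaluates averages over a group whose terms are constant on a subgroup and vanish
  elsewhere; the membership test stays inside the summand for that purpose.\<close>

lemma mat_sum_const:
  assumes "M \<in> carrier_mat m n" "T \<subseteq> S" "finite S"
  shows "mat_sum m n (\<lambda>s. if s \<in> T then M else 0\<^sub>m m n) S = of_nat (card T) \<cdot>\<^sub>m M"
proof (rule eq_matI)
  fix i j assume "i < dim_row (of_nat (card T) \<cdot>\<^sub>m M)" "j < dim_col (of_nat (card T) \<cdot>\<^sub>m M)"
  then have "i < m" "j < n" using assms by auto
  then have "mat_sum m n (\<lambda>s. if s \<in> T then M else 0\<^sub>m m n) S $$ (i, j) = (\<Sum>s\<in>S. if s \<in> T then M $$ (i, j) else 0)"
    by (auto simp: mat_sum_def intro!: sum.cong)
  also have "\<dots> = of_nat (card T) * M $$ (i, j)"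
    using assms by (simp add: sum.If_cases Int_absorb1)
  finally show "mat_sum m n (\<lambda>s. if s \<in> T then M else 0\<^sub>m m n) S $$ (i, j) = (of_nat (card T) \<cdot>\<^sub>m M) $$ (i, j)"
    using \<open>i < m\<close> \<open>j < n\<close> assms by simp
qed (use assms in auto)

lemma mat_trace_sum:
  assumes "\<And>s. s \<in> S \<Longrightarrow> F s \<in> carrier_mat n n"
  shows "mat_trace (mat_sum n n F S) = (\<Sum>s\<in>S. mat_trace (F s))"
  unfolding mat_trace_def mat_sum_def by (simp add: carrier_matD[OF assms], rule sum.swap)

section \<open>Linear subspaces of complex column vectors and bases adapted to them\<close>

definition lin_subspace :: "nat \<Rightarrow> complex vec set \<Rightarrow> bool" where
  "lin_subspace d W \<longleftrightarrow> W \<subseteq> carrier_vec d \<and> 0\<^sub>v d \<in> W \<and> (\<forall>v\<in>W. \<forall>w\<in>W. v + w \<in> W) \<and> (\<forall>c. \<forall>v\<in>W. c \<cdot>\<^sub>v v \<in> W)"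

text \<open>With the matrices of a representation as \<open>M\<close>, this is the largest invariant
  subspace inside \<open>W\<close>; irreducibility is mostly applied to subspaces of this
  shape.\<close>

lemma lin_subspace_preimage:
  assumes W: "lin_subspace m W" and M: "\<And>i. i \<in> I \<Longrightarrow> M i \<in> carrier_mat m d"
  shows "lin_subspace d {v \<in> carrier_vec d. \<forall>i\<in>I. M i *\<^sub>v v \<in> W}"
proof -
  have "M i *\<^sub>v 0\<^sub>v d = 0\<^sub>v m" if "i \<in> I" for i
    using M[OF that] by (rule mat_mult_zero_vec)
  moreover have "M i *\<^sub>v (v + w) = M i *\<^sub>v v + M i *\<^sub>v w"
    if "i \<in> I" "v \<in> carrier_vec d" "w \<in> carrier_vec d" for i v w
    using M[OF that(1)] that(2,3) by (rule mult_add_distrib_mat_vec)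
  moreover have "M i *\<^sub>v (c \<cdot>\<^sub>v v) = c \<cdot>\<^sub>v (M i *\<^sub>v v)"
    if "i \<in> I" "v \<in> carrier_vec d" for i v c
    using M[OF that(1)] that(2) by (rule mult_mat_vec)
  ultimately show ?thesis using W by (simp add: lin_subspace_def)
qed

lemma lin_subspace_eigen:
  assumes M: "\<And>i. i \<in> I \<Longrightarrow> M i \<in> carrier_mat d d"
  shows "lin_subspace d {v \<in> carrier_vec d. \<forall>i\<in>I. M i *\<^sub>v v = c i \<cdot>\<^sub>v v}"
proof -
  have "M i *\<^sub>v 0\<^sub>v d = c i \<cdot>\<^sub>v 0\<^sub>v d" if "i \<in> I" for i
    using mat_mult_zero_vec[OF M[OF that]] by auto
  moreover have "M i *\<^sub>v (v + w) = M i *\<^sub>v v + M i *\<^sub>v w"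
    if "i \<in> I" "v \<in> carrier_vec d" "w \<in> carrier_vec d" for i v w
    using M[OF that(1)] that(2,3) by (rule mult_add_distrib_mat_vec)
  moreover have "M i *\<^sub>v (b \<cdot>\<^sub>v v) = b \<cdot>\<^sub>v (M i *\<^sub>v v)"
    if "i \<in> I" "v \<in> carrier_vec d" for i v b
    using M[OF that(1)] that(2) by (rule mult_mat_vec)
  moreover have "b \<cdot>\<^sub>v (c i \<cdot>\<^sub>v v) = c i \<cdot>\<^sub>v (b \<cdot>\<^sub>v v)" for i b and v :: "complex vec"
    by (simp add: smult_smult_assoc mult.commute)
  ultimately show ?thesis by (auto simp: lin_subspace_def smult_add_distrib_vec)
qed

lemma subspace_iff: "VectorSpace.subspace class_ring W (module_vec TYPE(complex) d) \<longleftrightarrow> lin_subspace d W"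
proof
  assume "VectorSpace.subspace class_ring W (module_vec TYPE(complex) d)"
  then interpret submodule class_ring W "module_vec TYPE(complex) d" by (simp add: VectorSpace.subspace_def)
  show "lin_subspace d W"
    using subset m_closed zero_closed smult_closed by (auto simp: lin_subspace_def module_vec_simps class_ring_simps)
next
  assume "lin_subspace d W"
  then show "VectorSpace.subspace class_ring W (module_vec TYPE(complex) d)"
    unfolding VectorSpace.subspace_def submodule_def
    by (auto simp: lin_subspace_def module_vec_simps class_ring_simps vec_vs vec_module)
qed

text \<open>Exchange argument: among the invertible matrices take one with the largest number k of
  leading columns in \<open>W\<close>. A vector of \<open>W\<close> with a nonzero coordinate at
  some m >= k could replace a column and raise k.\<close>

lemma subspace_basis_matrix:
  assumes W: "lin_subspace d W"
  obtains k P P' where "k \<le> d" "P \<in> carrier_mat d d" "P' \<in> carrier_mat d d" "P * P' = 1\<^sub>m d" "P' * P = 1\<^sub>m d"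
    "\<And>w. w \<in> carrier_vec d \<Longrightarrow> w \<in> W \<longleftrightarrow> (\<forall>i. k \<le> i \<and> i < d \<longrightarrow> (P' *\<^sub>v w) $ i = 0)"
proof -
  define good where "good k \<longleftrightarrow> k \<le> d \<and> (\<exists>P. P \<in> carrier_mat d d \<and> det P \<noteq> 0 \<and> (\<forall>i<k. col P i \<in> W))" for k
  have "good 0" unfolding good_def by (auto intro!: exI[of _ "1\<^sub>m d"])
  moreover have bd: "\<forall>k. good k \<longrightarrow> k \<le> d" by (simp add: good_def)
  ultimately obtain k where k: "good k" and kmax: "\<And>k'. good k' \<Longrightarrow> k' \<le> k"
    using Nat.ex_has_greatest_nat[of good 0 d] by auto
  then obtain P where P: "P \<in> carrier_mat d d" "det P \<noteq> 0" "\<And>i. i < k \<Longrightarrow> col P i \<in> W" and kd: "k \<le> d"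
    by (auto simp: good_def)
  obtain P' where P': "P' \<in> carrier_mat d d" "P * P' = 1\<^sub>m d" "P' * P = 1\<^sub>m d"
    using det_non_zero_imp_unit[OF P(1,2), of "()"] by (auto simp: Units_def ring_mat_simps)
  have "w \<in> W \<longleftrightarrow> (\<forall>i. k \<le> i \<and> i < d \<longrightarrow> (P' *\<^sub>v w) $ i = 0)" if w: "w \<in> carrier_vec d" for w
  proof
    define u where "u = P' *\<^sub>v w"
    have u: "u \<in> carrier_vec d" using P' w by (simp add: u_def)
    have Pu: "P *\<^sub>v u = w"
      unfolding u_def using P P' w by (simp flip: assoc_mult_mat_vec)
    {
      assume z: "\<forall>i. k \<le> i \<and> i < d \<longrightarrow> (P' *\<^sub>v w) $ i = 0"
      have "P *\<^sub>v vec d (\<lambda>i. if i < m then u $ i else 0) \<in> W" if "m \<le> k" for m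
        using that
      proof (induction m)
        case 0
        have "P *\<^sub>v vec d (\<lambda>i. if i < 0 then u $ i else 0) = 0\<^sub>v d"
          using P by (intro eq_vecI) (auto simp: scalar_prod_def)
        then show ?case using W by (simp add: lin_subspace_def)
      next
        case (Suc m)
        have "P *\<^sub>v vec d (\<lambda>i. if i < Suc m then u $ i else 0) =
          P *\<^sub>v vec d (\<lambda>i. if i < m then u $ i else 0) + u $ m \<cdot>\<^sub>v col P m"
        proof (rule eq_vecI)
          fix i assume "i < dim_vec (P *\<^sub>v vec d (\<lambda>i. if i < m then u $ i else 0) + u $ m \<cdot>\<^sub>v col P m)"
          then have i: "i < d" using P by simp
          have "(\<Sum>j<d. P $$ (i, j) * (if j < Suc m then u $ j else 0)) =
            (\<Sum>j<d. P $$ (i, j) * (if j < m then u $ j else 0)) + (\<Sum>j<d. if j = m then P $$ (i, j) * u $ j else 0)"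
            unfolding sum.distrib[symmetric] by (intro sum.cong) auto
          then show "(P *\<^sub>v vec d (\<lambda>i. if i < Suc m then u $ i else 0)) $ i =
            (P *\<^sub>v vec d (\<lambda>i. if i < m then u $ i else 0) + u $ m \<cdot>\<^sub>v col P m) $ i"
            using i P Suc.prems kd by (simp add: mat_vec_index[of _ d d] del: index_mult_mat_vec)
        qed (use P in auto)
        then show ?case using Suc W P(3)[of m] by (auto simp: lin_subspace_def)
      qed
      from this[of k] have "P *\<^sub>v vec d (\<lambda>i. if i < k then u $ i else 0) \<in> W" by simp
      moreover have "vec d (\<lambda>i. if i < k then u $ i else 0) = u"
        using z u unfolding u_def[symmetric] by (intro eq_vecI) auto
      ultimately show "w \<in> W" using Pu by simp
    }
    {
      assume wW: "w \<in> W"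
      show "\<forall>i. k \<le> i \<and> i < d \<longrightarrow> (P' *\<^sub>v w) $ i = 0"
      proof (rule ccontr)
        assume "\<not> ?thesis"
        then obtain m where m: "k \<le> m" "m < d" "u $ m \<noteq> 0" by (auto simp: u_def)
        \<comment> \<open>Right multiplication by \<open>Q\<close> puts w into column k and moves
          the old column k to place m; for m = k it only replaces the column, since the first test
          wins.\<close>
        define Q where "Q = mat d d (\<lambda>(i, j). if j = k then u $ i else if j = m then (if i = k then 1 else 0)
            else if i = j then 1 else 0)"
        have Qc: "Q \<in> carrier_mat d d" by (simp add: Q_def)
        have "det Q \<noteq> 0"
        proof
          assume "det Q = 0"
          then obtain v where v: "v \<in> carrier_vec d" "v \<noteq> 0\<^sub>v d" "Q *\<^sub>v v = 0\<^sub>v d"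
            using det_0_iff_vec_prod_zero[OF Qc] by auto
          have Qv: "(\<Sum>j<d. Q $$ (i, j) * v $ j) = 0" if "i < d" for i
            using mat_vec_index[OF Qc v(1) that] v(3) that by simp
          \<comment> \<open>The only nonzero entry of row m is \<open>u $ m\<close> in column k, so
            a kernel vector has k-th coordinate 0; the remaining rows then kill the other
            coordinates.\<close>
          have "(\<Sum>j<d. Q $$ (m, j) * v $ j) = (\<Sum>j<d. if j = k then u $ m * v $ k else 0)"
            using m by (intro sum.cong) (auto simp: Q_def)
          then have vk: "v $ k = 0" using Qv[OF m(2)] m by simp
          have vi: "v $ i = 0" if i: "i < d" "i \<noteq> k" "i \<noteq> m" for i
          proof -
            have "(\<Sum>j<d. Q $$ (i, j) * v $ j) = (\<Sum>j<d. if j = i then v $ i else 0)"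
              using i vk by (intro sum.cong) (auto simp: Q_def)
            then show ?thesis using Qv[OF i(1)] i by simp
          qed
          have "v $ m = 0"
          proof (cases "m = k")
            case False
            have "(\<Sum>j<d. Q $$ (k, j) * v $ j) = (\<Sum>j<d. if j = m then v $ m else 0)"
              using m vk vi False by (intro sum.cong) (auto simp: Q_def)
            then show ?thesis using Qv[of k] m by simp
          qed (use vk in simp)
          with vk vi have "v = 0\<^sub>v d" using v(1) by (intro eq_vecI) auto
          with v(2) show False ..
        qed
        then have "det (P * Q) \<noteq> 0" using P by (simp add: det_mult[OF P(1) Qc])
        moreover have "col (P * Q) i \<in> W" if "i < Suc k" for i
        proof (cases "i = k")
          case True
          have "col Q k = u" using u m by (intro eq_vecI) (auto simp: Q_def)
          moreover have "col (P * Q) k = P *\<^sub>v col Q k" using m by (intro col_mult2[OF P(1) Qc]) auto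
          ultimately show ?thesis using True Pu wW by (simp only:)
        next
          case False
          have "col Q i = unit_vec d i" using that False m by (intro eq_vecI) (auto simp: Q_def unit_vec_def)
          moreover have "i < d" using that m by auto
          then have "col (P * Q) i = P *\<^sub>v col Q i" "P *\<^sub>v unit_vec d i = col P i"
            by (rule col_mult2[OF P(1) Qc], rule mat_unit_vec_col[OF P(1)])
          moreover have "col P i \<in> W" using that False P by simp
          ultimately show ?thesis by (simp only:)
        qed
        ultimately have "good (Suc k)"
          using P Qc m unfolding good_def by (intro conjI exI[of _ "P * Q"]) auto
        then show False using kmax by force
      qed
    }
  qed
  with that[OF kd P(1) P'] show thesis by blast
qed

text \<open>The columns of \<open>B\<close> and \<open>D\<close> are bases of \<open>W\<close> and
  of a complement, \<open>C\<close> and \<open>F\<close> the matching coordinate maps. Restriction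
  to \<open>W\<close> and passage to the quotient thereby become matrix products.\<close>

lemma subspace_splitting:
  assumes W: "lin_subspace d W"
  obtains k l B C D F where "k + l = d" "B \<in> carrier_mat d k" "C \<in> carrier_mat k d" "D \<in> carrier_mat d l" "F \<in> carrier_mat l d"
    "C * B = 1\<^sub>m k" "F * D = 1\<^sub>m l" "F * B = 0\<^sub>m l k" "C * D = 0\<^sub>m k l" "B * C + D * F = 1\<^sub>m d"
    "\<And>w. w \<in> carrier_vec d \<Longrightarrow> w \<in> W \<longleftrightarrow> F *\<^sub>v w = 0\<^sub>v l"
proof -
  obtain k P P' where k: "k \<le> d" and P: "P \<in> carrier_mat d d" "P' \<in> carrier_mat d d" "P * P' = 1\<^sub>m d" "P' * P = 1\<^sub>m d"
    and W': "\<And>w. w \<in> carrier_vec d \<Longrightarrow> w \<in> W \<longleftrightarrow> (\<forall>i. k \<le> i \<and> i < d \<longrightarrow> (P' *\<^sub>v w) $ i = 0)"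
    by (rule subspace_basis_matrix[OF W]) (rule that)
  define l where "l = d - k"
  define B where "B = mat d k (\<lambda>(i, j). P $$ (i, j))"
  define C where "C = mat k d (\<lambda>(i, j). P' $$ (i, j))"
  define D where "D = mat d l (\<lambda>(i, j). P $$ (i, j + k))"
  define F where "F = mat l d (\<lambda>(i, j). P' $$ (i + k, j))"
  have c: "B \<in> carrier_mat d k" "C \<in> carrier_mat k d" "D \<in> carrier_mat d l" "F \<in> carrier_mat l d"
    by (auto simp: B_def C_def D_def F_def)
  have PP: "(\<Sum>m<d. P' $$ (i, m) * P $$ (m, j)) = (if i = j then 1 else 0)" if "i < d" "j < d" for i j
    using mat_mult_index[OF P(2,1) that] that P(4) by simp
  have split: "(\<Sum>m<d. g m) = (\<Sum>m<k. g m) + (\<Sum>m<l. g (m + k))" for g :: "nat \<Rightarrow> complex"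
  proof -
    have "{..<d} = {..<k} \<union> {k..<k + l}" using k by (auto simp: l_def)
    then have "(\<Sum>m<d. g m) = (\<Sum>m<k. g m) + (\<Sum>m\<in>{k..<k + l}. g m)"
      by (simp add: sum.union_disjoint ivl_disj_int)
    also have "(\<Sum>m\<in>{k..<k + l}. g m) = (\<Sum>m<l. g (m + k))"
      by (rule sum.reindex_bij_witness[of _ "\<lambda>m. m + k" "\<lambda>m. m - k"]) auto
    finally show ?thesis .
  qed
  show thesis
  proof (rule that[OF _ c])
    show "k + l = d" using k by (simp add: l_def)
    show "C * B = 1\<^sub>m k"
      by (rule eq_matI) (use c k in \<open>auto simp: mat_mult_index[of _ k d _ k] C_def B_def PP simp del: index_mult_mat(1)\<close>)
    show "F * D = 1\<^sub>m l"
      by (rule eq_matI) (use c k in \<open>auto simp: mat_mult_index[of _ l d _ l] F_def D_def PP l_def simp del: index_mult_mat(1)\<close>)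
    show "F * B = 0\<^sub>m l k"
      by (rule eq_matI) (use c k in \<open>auto simp: mat_mult_index[of _ l d _ k] F_def B_def PP l_def simp del: index_mult_mat(1)\<close>)
    show "C * D = 0\<^sub>m k l"
      by (rule eq_matI) (use c k in \<open>auto simp: mat_mult_index[of _ k d _ l] C_def D_def PP l_def simp del: index_mult_mat(1)\<close>)
    show "B * C + D * F = 1\<^sub>m d"
    proof (rule eq_matI)
      fix i j assume "i < dim_row (1\<^sub>m d :: complex mat)" "j < dim_col (1\<^sub>m d :: complex mat)"
      then have ij: "i < d" "j < d" by auto
      have "(\<Sum>m<d. P $$ (i, m) * P' $$ (m, j)) = (1\<^sub>m d :: complex mat) $$ (i, j)"
        using mat_mult_index[OF P(1,2) ij] P(3) by simp
      moreover have "(B * C + D * F) $$ (i, j) =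
          (\<Sum>m<k. B $$ (i, m) * C $$ (m, j)) + (\<Sum>m<l. D $$ (i, m) * F $$ (m, j))"
        using ij c by (simp add: mat_mult_index[of B d k C d] mat_mult_index[of D d l F d] del: index_mult_mat(1))
      ultimately show "(B * C + D * F) $$ (i, j) = (1\<^sub>m d :: complex mat) $$ (i, j)"
        using ij by (simp add: split B_def C_def D_def F_def)
    qed (use c in auto)
    fix w :: "complex vec" assume w: "w \<in> carrier_vec d"
    have Fw: "(F *\<^sub>v w) $ i = (P' *\<^sub>v w) $ (i + k)" if "i < l" for i
      using that k mat_vec_index[OF c(4) w that] mat_vec_index[OF P(2) w, of "i + k"]
      by (simp add: F_def l_def del: index_mult_mat_vec)
    have "F *\<^sub>v w = 0\<^sub>v l \<longleftrightarrow> (\<forall>i<l. (P' *\<^sub>v w) $ (i + k) = 0)"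
    proof
      assume "F *\<^sub>v w = 0\<^sub>v l"
      then show "\<forall>i<l. (P' *\<^sub>v w) $ (i + k) = 0" using Fw by (metis index_zero_vec(1))
    next
      assume "\<forall>i<l. (P' *\<^sub>v w) $ (i + k) = 0"
      then show "F *\<^sub>v w = 0\<^sub>v l" using Fw c by (intro eq_vecI) (auto simp del: index_mult_mat_vec)
    qed
    also have "\<dots> \<longleftrightarrow> w \<in> W"
      unfolding W'[OF w]
    proof (intro iffI allI impI)
      fix i assume "\<forall>i<l. (P' *\<^sub>v w) $ (i + k) = 0" "k \<le> i \<and> i < d"
      then show "(P' *\<^sub>v w) $ i = 0" by (auto dest!: spec[of _ "i - k"] simp: l_def)
    next
      fix i assume "\<forall>i. k \<le> i \<and> i < d \<longrightarrow> (P' *\<^sub>v w) $ i = 0" "i < l"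
      then show "(P' *\<^sub>v w) $ (i + k) = 0" by (auto simp: l_def)
    qed
    finally show "w \<in> W \<longleftrightarrow> F *\<^sub>v w = 0\<^sub>v l" ..
  qed
qed

section \<open>Representations\<close>

text \<open>Invertibility of the matrices is left out because it follows from the group inverse, see
  \<open>is_rep_inv\<close>; \<open>representation_iff\<close> ties this to the original
  notion.\<close>

definition is_rep :: "('g, 'm) monoid_scheme \<Rightarrow> nat \<Rightarrow> ('g \<Rightarrow> complex mat) \<Rightarrow> bool" where
  "is_rep G d \<rho> \<longleftrightarrow> (\<forall>g\<in>carrier G. \<rho> g \<in> carrier_mat d d) \<and>
     (\<forall>g\<in>carrier G. \<forall>h\<in>carrier G. \<rho> (g \<otimes>\<^bsub>G\<^esub> h) = \<rho> g * \<rho> h) \<and> \<rho> \<one>\<^bsub>G\<^esub> = 1\<^sub>m d"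

definition irr_rep :: "('g, 'm) monoid_scheme \<Rightarrow> nat \<Rightarrow> ('g \<Rightarrow> complex mat) \<Rightarrow> bool" where
  "irr_rep G d \<rho> \<longleftrightarrow> is_rep G d \<rho> \<and> d > 0 \<and>
     (\<forall>W. lin_subspace d W \<longrightarrow> (\<forall>g\<in>carrier G. \<forall>w\<in>W. \<rho> g *\<^sub>v w \<in> W) \<longrightarrow> W = {0\<^sub>v d} \<or> W = carrier_vec d)"

lemma is_repD:
  assumes "is_rep G d \<rho>" "g \<in> carrier G"
  shows "\<rho> g \<in> carrier_mat d d" "dim_row (\<rho> g) = d" "dim_col (\<rho> g) = d"
  using assms by (auto simp: is_rep_def)

lemma is_rep_mult:
  "is_rep G d \<rho> \<Longrightarrow> g \<in> carrier G \<Longrightarrow> h \<in> carrier G \<Longrightarrow> \<rho> (g \<otimes>\<^bsub>G\<^esub> h) = \<rho> g * \<rho> h"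
  by (auto simp: is_rep_def)

lemma is_rep_inv:
  fixes G (structure)
  assumes "group G" "is_rep G d \<rho>" "g \<in> carrier G"
  shows "\<rho> g * \<rho> (inv\<^bsub>G\<^esub> g) = 1\<^sub>m d" "\<rho> (inv\<^bsub>G\<^esub> g) * \<rho> g = 1\<^sub>m d"
proof -
  interpret group G by fact
  show "\<rho> g * \<rho> (inv g) = 1\<^sub>m d" "\<rho> (inv g) * \<rho> g = 1\<^sub>m d"
    using is_rep_mult[OF assms(2), of g "inv g"] is_rep_mult[OF assms(2), of "inv g" g] assms
    by (auto simp: is_rep_def)
qed

lemma representation_iff:
  fixes G (structure)
  assumes "group G"
  shows "representation G d \<rho> \<longleftrightarrow> is_rep G d \<rho>"
proof
  interpret group G by fact
  let ?R = "ring_mat TYPE(complex) d ()"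
  interpret R: Ring.ring ?R by (rule ring_mat)
  {
    assume "representation G d \<rho>"
    then have h: "\<rho> \<in> hom G (units_of ?R)" by (simp add: representation_def)
    have "\<rho> \<one> = \<one>\<^bsub>units_of ?R\<^esub>" using hom_one[OF h assms R.units_group] .
    then show "is_rep G d \<rho>"
      using h by (auto simp: is_rep_def hom_def units_of_def Units_def Pi_def ring_mat_simps)
  next
    assume r: "is_rep G d \<rho>"
    have "\<rho> g \<in> Units ?R" if g: "g \<in> carrier G" for g
      using is_rep_inv[OF assms r g] is_repD(1)[OF r] g
      by (auto simp: Units_def ring_mat_simps intro!: bexI[of _ "\<rho> (inv g)"])
    then show "representation G d \<rho>"
      using r by (auto simp: representation_def hom_def units_of_def ring_mat_simps is_rep_def)
  }
qed

lemma irreducible_representation_iff: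
  "group G \<Longrightarrow> irreducible_representation G d \<rho> \<longleftrightarrow> irr_rep G d \<rho>"
  by (simp add: irreducible_representation_def irr_rep_def representation_iff subspace_iff)

lemma irr_rep_cases:
  assumes "irr_rep G d \<rho>" "lin_subspace d W" "\<forall>g\<in>carrier G. \<forall>w\<in>W. \<rho> g *\<^sub>v w \<in> W"
    "w \<in> W" "w \<noteq> 0\<^sub>v d"
  shows "W = carrier_vec d"
  using assms by (auto simp: irr_rep_def)

lemma is_rep_comp:
  assumes "is_rep G d \<rho>" "group G" "group K" "\<iota> \<in> hom K G"
  shows "is_rep K d (\<lambda>u. \<rho> (\<iota> u))"
  using assms hom_one[OF assms(4,3,2)] by (auto simp: is_rep_def hom_def Pi_def)

text \<open>In the adapted basis an invariant subspace makes every matrix block triangular. Both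
  diagonal blocks are then representations, on the subspace and on the quotient, and the trace is
  the sum of theirs although the complement need not be invariant.\<close>

lemma rep_splitting:
  fixes G (structure)
  assumes G: "group G" and \<rho>: "is_rep G d \<rho>" and W: "lin_subspace d W"
    and inv: "\<forall>g\<in>carrier G. \<forall>w\<in>W. \<rho> g *\<^sub>v w \<in> W"
  obtains k l B C D F where "k + l = d" "B \<in> carrier_mat d k" "C \<in> carrier_mat k d" "D \<in> carrier_mat d l" "F \<in> carrier_mat l d"
    "C * B = 1\<^sub>m k" "\<And>v. v \<in> carrier_vec k \<Longrightarrow> B *\<^sub>v v \<in> W" "\<And>w. w \<in> W \<Longrightarrow> B *\<^sub>v (C *\<^sub>v w) = w"
    "is_rep G k (\<lambda>g. C * \<rho> g * B)" "is_rep G l (\<lambda>g. F * \<rho> g * D)"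
    "\<And>g. g \<in> carrier G \<Longrightarrow> \<rho> g * B = B * (C * \<rho> g * B)"
    "\<And>g. g \<in> carrier G \<Longrightarrow> mat_trace (\<rho> g) = mat_trace (C * \<rho> g * B) + mat_trace (F * \<rho> g * D)"
proof -
  obtain k l B C D F where kl: "k + l = d" and c: "B \<in> carrier_mat d k" "C \<in> carrier_mat k d" "D \<in> carrier_mat d l" "F \<in> carrier_mat l d"
    and e: "C * B = 1\<^sub>m k" "F * D = 1\<^sub>m l" "F * B = 0\<^sub>m l k" "C * D = 0\<^sub>m k l" "B * C + D * F = 1\<^sub>m d"
    and W': "\<And>w. w \<in> carrier_vec d \<Longrightarrow> w \<in> W \<longleftrightarrow> F *\<^sub>v w = 0\<^sub>v l"
    by (rule subspace_splitting[OF W]) (rule that)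
  note r = is_repD[OF \<rho>]
  note dims = c[THEN carrier_matD(1)] c[THEN carrier_matD(2)]
  have BW: "B *\<^sub>v v \<in> W" if "v \<in> carrier_vec k" for v
    using that c e(3) W'[of "B *\<^sub>v v"] by (simp add: zero_mat_mult_vec flip: assoc_mult_mat_vec)
  have WB: "B *\<^sub>v (C *\<^sub>v w) = w" if w: "w \<in> W" for w
  proof -
    have wc: "w \<in> carrier_vec d" using W w by (auto simp: lin_subspace_def)
    have "w = (B * C + D * F) *\<^sub>v w" using wc e by simp
    also have "\<dots> = B *\<^sub>v (C *\<^sub>v w) + D *\<^sub>v (F *\<^sub>v w)"
      using wc c by (simp add: add_mult_distrib_mat_vec[of _ d d])
    also have "F *\<^sub>v w = 0\<^sub>v l" using W' w wc by simp
    also have "B *\<^sub>v (C *\<^sub>v w) + D *\<^sub>v 0\<^sub>v l = B *\<^sub>v (C *\<^sub>v w)"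
      using c wc by (simp add: mat_mult_zero_vec[of D d l] right_zero_vec[of _ d])
    finally show ?thesis ..
  qed
  \<comment> \<open>Invariance of \<open>W\<close> in matrix form: the block from \<open>W\<close>
    to the quotient vanishes.\<close>
  have F0: "F * (\<rho> g * B) = 0\<^sub>m l k" if g: "g \<in> carrier G" for g
  proof (rule mat_eqI_vec)
    fix v :: "complex vec" assume v: "v \<in> carrier_vec k"
    have "F *\<^sub>v (\<rho> g *\<^sub>v (B *\<^sub>v v)) = 0\<^sub>v l"
      using inv g BW[OF v] W' W by (auto simp: lin_subspace_def)
    then show "F * (\<rho> g * B) *\<^sub>v v = 0\<^sub>m l k *\<^sub>v v"
      using c r[OF g] v by (simp add: mat_vec_assoc zero_mat_mult_vec)
  qed (use c r[OF g] in auto)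
  have RB: "\<rho> g * B = B * (C * \<rho> g * B)" if g: "g \<in> carrier G" for g
  proof -
    have "\<rho> g * B = (B * C + D * F) * (\<rho> g * B)" using e r[OF g] c by simp
    also have "\<dots> = B * C * (\<rho> g * B) + D * F * (\<rho> g * B)"
      using c r[OF g] by (simp add: add_mult_distrib_mat[of _ d d _ _ k])
    also have "D * F * (\<rho> g * B) = 0\<^sub>m d k"
      using c r[OF g] F0[OF g] by (simp add: mat_assoc)
    finally show ?thesis using c r[OF g] by (simp add: mat_assoc)
  qed
  have FR: "F * \<rho> g = F * \<rho> g * D * F" if g: "g \<in> carrier G" for g
  proof -
    have "F * \<rho> g = F * \<rho> g * (B * C + D * F)" using e r[OF g] c by simp
    also have "\<dots> = F * \<rho> g * (B * C) + F * \<rho> g * (D * F)"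
      using c r[OF g] by (simp add: mult_add_distrib_mat[of _ l d _ d])
    also have "F * \<rho> g * (B * C) = F * (\<rho> g * B) * C"
      using c r[OF g] by (simp add: mat_assoc)
    also have "\<dots> = 0\<^sub>m l d" using c F0[OF g] by simp
    also have "0\<^sub>m l d + F * \<rho> g * (D * F) = F * \<rho> g * D * F"
      using c r[OF g] by (simp add: mat_assoc)
    finally show ?thesis .
  qed
  interpret group G by fact
  have s: "is_rep G k (\<lambda>g. C * \<rho> g * B)"
    unfolding is_rep_def
  proof (intro conjI ballI)
    fix g h assume g: "g \<in> carrier G" and h: "h \<in> carrier G"
    have "C * \<rho> (g \<otimes> h) * B = C * \<rho> g * (\<rho> h * B)"
      using c r[OF g] r[OF h] is_rep_mult[OF \<rho> g h] by (simp add: mat_assoc)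
    also have "\<dots> = C * \<rho> g * (B * (C * \<rho> h * B))" by (subst RB[OF h]) simp
    finally show "C * \<rho> (g \<otimes> h) * B = C * \<rho> g * B * (C * \<rho> h * B)"
      using c r[OF g] r[OF h] by (simp add: mat_assoc)
  qed (use c r \<rho> e in \<open>auto simp: is_rep_def\<close>)
  have t: "is_rep G l (\<lambda>g. F * \<rho> g * D)"
    unfolding is_rep_def
  proof (intro conjI ballI)
    fix g h assume g: "g \<in> carrier G" and h: "h \<in> carrier G"
    have "F * \<rho> (g \<otimes> h) * D = F * \<rho> g * (\<rho> h * D)"
      using c r[OF g] r[OF h] is_rep_mult[OF \<rho> g h] by (simp add: mat_assoc)
    also have "\<dots> = F * \<rho> g * D * F * (\<rho> h * D)" by (subst FR[OF g]) simp
    finally show "F * \<rho> (g \<otimes> h) * D = F * \<rho> g * D * (F * \<rho> h * D)"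
      using c r[OF g] r[OF h] by (simp add: mat_assoc)
  qed (use c r \<rho> e in \<open>auto simp: is_rep_def\<close>)
  have tr: "mat_trace (\<rho> g) = mat_trace (C * \<rho> g * B) + mat_trace (F * \<rho> g * D)" if g: "g \<in> carrier G" for g
  proof -
    have "\<rho> g = \<rho> g * (B * C + D * F)" using e r[OF g] by simp
    also have "\<dots> = \<rho> g * B * C + \<rho> g * D * F"
      using c r[OF g] by (simp add: mult_add_distrib_mat[of _ d d _ d] mat_assoc)
    finally have "mat_trace (\<rho> g) = mat_trace (\<rho> g * B * C + \<rho> g * D * F)" by simp
    also have "\<dots> = mat_trace (\<rho> g * B * C) + mat_trace (\<rho> g * D * F)"
      using c r[OF g] by (intro mat_trace_add) auto
    also have "mat_trace (\<rho> g * B * C) = mat_trace (C * (\<rho> g * B))"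
      using c r[OF g] by (intro mat_trace_comm) auto
    also have "mat_trace (\<rho> g * D * F) = mat_trace (F * (\<rho> g * D))"
      using c r[OF g] by (intro mat_trace_comm) auto
    finally show ?thesis using c r[OF g] by (simp add: mat_assoc)
  qed
  show thesis
    by (rule that[OF kl c e(1) BW WB s t RB tr])
qed

lemma rep_reducible:
  assumes G: "group G" and \<rho>: "is_rep G d \<rho>" "d > 0" "\<not> irr_rep G d \<rho>"
  obtains k l B C D F where "k + l = d" "0 < k" "0 < l" "B \<in> carrier_mat d k" "C \<in> carrier_mat k d"
    "C * B = 1\<^sub>m k" "is_rep G k (\<lambda>g. C * \<rho> g * B)" "is_rep G l (\<lambda>g. F * \<rho> g * D)"
    "\<And>g. g \<in> carrier G \<Longrightarrow> \<rho> g * B = B * (C * \<rho> g * B)"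
    "\<And>g. g \<in> carrier G \<Longrightarrow> mat_trace (\<rho> g) = mat_trace (C * \<rho> g * B) + mat_trace (F * \<rho> g * D)"
proof -
  obtain W where W: "lin_subspace d W" "\<forall>g\<in>carrier G. \<forall>w\<in>W. \<rho> g *\<^sub>v w \<in> W"
    and nt: "W \<noteq> {0\<^sub>v d}" "W \<noteq> carrier_vec d"
    using \<rho> by (auto simp: irr_rep_def)
  obtain k l B C D F where *: "k + l = d" "B \<in> carrier_mat d k" "C \<in> carrier_mat k d" "D \<in> carrier_mat d l" "F \<in> carrier_mat l d"
    "C * B = 1\<^sub>m k" "\<And>v. v \<in> carrier_vec k \<Longrightarrow> B *\<^sub>v v \<in> W" "\<And>w. w \<in> W \<Longrightarrow> B *\<^sub>v (C *\<^sub>v w) = w"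
    "is_rep G k (\<lambda>g. C * \<rho> g * B)" "is_rep G l (\<lambda>g. F * \<rho> g * D)"
    "\<And>g. g \<in> carrier G \<Longrightarrow> \<rho> g * B = B * (C * \<rho> g * B)"
    "\<And>g. g \<in> carrier G \<Longrightarrow> mat_trace (\<rho> g) = mat_trace (C * \<rho> g * B) + mat_trace (F * \<rho> g * D)"
    by (rule rep_splitting[OF G \<rho>(1) W]) (rule that)
  have "k \<noteq> 0"
  proof
    assume k0: "k = 0"
    have "w = 0\<^sub>v d" if "w \<in> W" for w
    proof -
      have "w = B *\<^sub>v (C *\<^sub>v w)" using *(8)[OF that] by simp
      also have "\<dots> = 0\<^sub>v d" using *(2,3) k0 by (intro eq_vecI) (auto simp: scalar_prod_def)
      finally show ?thesis .
    qed
    then show False using nt(1) W(1) by (auto simp: lin_subspace_def)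
  qed
  moreover have "l \<noteq> 0"
  proof
    assume l0: "l = 0"
    then have "B * C = 1\<^sub>m d" using *(1,2,3,6) mat_mult_left_right_inverse[of C d B] by simp
    have "w \<in> W" if "w \<in> carrier_vec d" for w
    proof -
      have "w = B * C *\<^sub>v w" using \<open>B * C = 1\<^sub>m d\<close> that by simp
      also have "\<dots> = B *\<^sub>v (C *\<^sub>v w)" using *(2,3) that by (intro assoc_mult_mat_vec) auto
      also have "\<dots> \<in> W" using *(3) that by (intro *(7)) simp
      finally show ?thesis .
    qed
    then show False using nt(2) W(1) by (auto simp: lin_subspace_def)
  qed
  ultimately show thesis using that[OF *(1) _ _ *(2,3,6,9-12)] by simp
qed

text \<open>Induction on the degree. The embedding is kept as a matrix \<open>B\<close> with left
  inverse \<open>C\<close>, a form that survives composition of successive embeddings.\<close>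

lemma irreducible_subrep:
  assumes "group G" "is_rep G d \<rho>" "d > 0"
  shows "\<exists>k B C \<sigma>. B \<in> carrier_mat d k \<and> C \<in> carrier_mat k d \<and> C * B = 1\<^sub>m k \<and> irr_rep G k \<sigma> \<and>
    (\<forall>g\<in>carrier G. \<rho> g * B = B * \<sigma> g)"
  using assms(2,3)
proof (induction d arbitrary: \<rho> rule: less_induct)
  case (less d)
  show ?case
  proof (cases "irr_rep G d \<rho>")
    case True
    then show ?thesis
      using less.prems is_repD[OF less.prems(1)]
      by (intro exI[of _ d] exI[of _ "1\<^sub>m d"] exI[of _ \<rho>]) auto
  next
    case False
    obtain k l B C D F where *: "k + l = d" "0 < k" "0 < l" "B \<in> carrier_mat d k" "C \<in> carrier_mat k d"
      "C * B = 1\<^sub>m k" "is_rep G k (\<lambda>g. C * \<rho> g * B)" "is_rep G l (\<lambda>g. F * \<rho> g * D)"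
      "\<And>g. g \<in> carrier G \<Longrightarrow> \<rho> g * B = B * (C * \<rho> g * B)"
      "\<And>g. g \<in> carrier G \<Longrightarrow> mat_trace (\<rho> g) = mat_trace (C * \<rho> g * B) + mat_trace (F * \<rho> g * D)"
      by (rule rep_reducible[OF assms(1) less.prems False]) (rule that)
    obtain k' B' C' \<sigma> where I: "B' \<in> carrier_mat k k'" "C' \<in> carrier_mat k' k" "C' * B' = 1\<^sub>m k'" "irr_rep G k' \<sigma>"
      "\<forall>g\<in>carrier G. (C * \<rho> g * B) * B' = B' * \<sigma> g"
      using less.IH[OF _ *(7)] * by auto
    have "is_rep G k' \<sigma>" using I(4) by (simp add: irr_rep_def)
    note s = is_repD[OF this] and r = is_repD[OF less.prems(1)]
    have "(C' * C) * (B * B') = C' * (C * B) * B'"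
      using I(1,2) *(4,5) by (simp add: mat_assoc)
    then have "(C' * C) * (B * B') = 1\<^sub>m k'" using I by (simp add: *(6))
    moreover have "\<rho> g * (B * B') = B * B' * \<sigma> g" if g: "g \<in> carrier G" for g
    proof -
      have "\<rho> g * (B * B') = \<rho> g * B * B'" using *(4) I r[OF g] by (simp add: mat_assoc)
      also have "\<dots> = B * (C * \<rho> g * B) * B'" by (subst *(9)[OF g]) simp
      also have "\<dots> = B * ((C * \<rho> g * B) * B')" using *(4,5) I r[OF g] by (simp add: mat_assoc)
      also have "\<dots> = B * (B' * \<sigma> g)" using I(5) g by simp
      finally show ?thesis using *(4) I s[OF g] by (simp add: mat_assoc)
    qed
    ultimately show ?thesis
      using I *(4,5) by (intro exI[of _ k'] exI[of _ "B * B'"] exI[of _ "C' * C"] exI[of _ \<sigma>]) auto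
  qed
qed

text \<open>The sum is additive over the two diagonal blocks, so it is nonzero on one of them. With
  \<open>c\<close> the conjugate of a class function this produces an irreducible constituent
  without semisimplicity.\<close>

lemma irreducible_constituent:
  fixes c :: "'g \<Rightarrow> complex"
  assumes "group G" "is_rep G d \<rho>" "(\<Sum>g\<in>carrier G. mat_trace (\<rho> g) * c g) \<noteq> 0"
  shows "\<exists>k \<sigma>. irr_rep G k \<sigma> \<and> (\<Sum>g\<in>carrier G. mat_trace (\<sigma> g) * c g) \<noteq> 0"
  using assms(2,3)
proof (induction d arbitrary: \<rho> rule: less_induct)
  case (less d)
  have "d \<noteq> 0"
  proof
    assume "d = 0"
    then have "mat_trace (\<rho> g) = 0" if "g \<in> carrier G" for g
      using is_repD[OF less.prems(1) that] by (simp add: mat_trace_def)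
    then show False using less.prems(2) by simp
  qed
  show ?case
  proof (cases "irr_rep G d \<rho>")
    case False
    obtain k l B C D F where *: "k + l = d" "0 < k" "0 < l" "B \<in> carrier_mat d k" "C \<in> carrier_mat k d"
      "C * B = 1\<^sub>m k" "is_rep G k (\<lambda>g. C * \<rho> g * B)" "is_rep G l (\<lambda>g. F * \<rho> g * D)"
      "\<And>g. g \<in> carrier G \<Longrightarrow> \<rho> g * B = B * (C * \<rho> g * B)"
      "\<And>g. g \<in> carrier G \<Longrightarrow> mat_trace (\<rho> g) = mat_trace (C * \<rho> g * B) + mat_trace (F * \<rho> g * D)"
      by (rule rep_reducible[OF assms(1) less.prems(1) _ False]) (use \<open>d \<noteq> 0\<close> in simp, rule that)
    have "(\<Sum>g\<in>carrier G. mat_trace (\<rho> g) * c g) = (\<Sum>g\<in>carrier G. mat_trace (C * \<rho> g * B) * c g) +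
      (\<Sum>g\<in>carrier G. mat_trace (F * \<rho> g * D) * c g)"
      by (simp add: *(10) distrib_right sum.distrib)
    then consider "(\<Sum>g\<in>carrier G. mat_trace (C * \<rho> g * B) * c g) \<noteq> 0"
      | "(\<Sum>g\<in>carrier G. mat_trace (F * \<rho> g * D) * c g) \<noteq> 0"
      using less.prems(2) by fastforce
    then show ?thesis
      using less.IH[OF _ *(7)] less.IH[OF _ *(8)] * by cases auto
  qed (use less.prems in blast)
qed

text \<open>Applied to weight spaces: these are stable under a smaller group, and an irreducible
  piece inside them supplies the factor k of the degree bound.\<close>

lemma irreducible_subrep_in:
  assumes "group G" "is_rep G d \<rho>" "lin_subspace d W" "\<forall>g\<in>carrier G. \<forall>w\<in>W. \<rho> g *\<^sub>v w \<in> W"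
    and w: "w \<in> W" "w \<noteq> 0\<^sub>v d"
  obtains k B \<sigma> where "B \<in> carrier_mat d k" "B \<noteq> 0\<^sub>m d k" "irr_rep G k \<sigma>" "\<And>v. v \<in> carrier_vec k \<Longrightarrow> B *\<^sub>v v \<in> W"
    "\<And>g. g \<in> carrier G \<Longrightarrow> \<rho> g * B = B * \<sigma> g"
proof -
  obtain k l B C D F where *: "k + l = d" "B \<in> carrier_mat d k" "C \<in> carrier_mat k d" "D \<in> carrier_mat d l" "F \<in> carrier_mat l d"
    "C * B = 1\<^sub>m k" "\<And>v. v \<in> carrier_vec k \<Longrightarrow> B *\<^sub>v v \<in> W" "\<And>w. w \<in> W \<Longrightarrow> B *\<^sub>v (C *\<^sub>v w) = w"
    "is_rep G k (\<lambda>g. C * \<rho> g * B)" "is_rep G l (\<lambda>g. F * \<rho> g * D)"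
    "\<And>g. g \<in> carrier G \<Longrightarrow> \<rho> g * B = B * (C * \<rho> g * B)"
    "\<And>g. g \<in> carrier G \<Longrightarrow> mat_trace (\<rho> g) = mat_trace (C * \<rho> g * B) + mat_trace (F * \<rho> g * D)"
    by (rule rep_splitting[OF assms(1-4)]) (rule that)
  have "k > 0"
  proof (rule ccontr)
    assume "\<not> k > 0"
    then have "B *\<^sub>v (C *\<^sub>v w) = 0\<^sub>v d" using *(2,3) by (intro eq_vecI) (auto simp: scalar_prod_def)
    with *(8)[OF w(1)] w show False by simp
  qed
  then obtain k' B' C' \<sigma> where I: "B' \<in> carrier_mat k k'" "C' \<in> carrier_mat k' k" "C' * B' = 1\<^sub>m k'" "irr_rep G k' \<sigma>"
      "\<forall>g\<in>carrier G. (C * \<rho> g * B) * B' = B' * \<sigma> g"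
    using irreducible_subrep[OF assms(1) *(9)] by auto
  have "is_rep G k' \<sigma>" and k': "k' > 0" using I(4) by (simp_all add: irr_rep_def)
  note s = is_repD[OF this(1)] and r = is_repD[OF assms(2)]
  have "(C' * C) * (B * B') = C' * (C * B) * B'"
    using I(1,2) *(2,3) by (simp add: mat_assoc)
  then have id: "(C' * C) * (B * B') = 1\<^sub>m k'" using I by (simp add: *(6))
  show thesis
  proof (rule that)
    show "irr_rep G k' \<sigma>" by fact
    show "B * B' \<in> carrier_mat d k'" using *(2) I by simp
    show "B * B' \<noteq> 0\<^sub>m d k'"
    proof
      assume "B * B' = 0\<^sub>m d k'"
      then have "1\<^sub>m k' = (0\<^sub>m k' k' :: complex mat)" using id I *(3) by simp
      then have "(1\<^sub>m k' :: complex mat) $$ (0, 0) = 0" using k' by simp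
      then show False using k' by simp
    qed
    show "B * B' *\<^sub>v v \<in> W" if "v \<in> carrier_vec k'" for v
      using *(7)[of "B' *\<^sub>v v"] that I *(2) by simp
    show "\<rho> g * (B * B') = B * B' * \<sigma> g" if g: "g \<in> carrier G" for g
    proof -
      have "\<rho> g * (B * B') = \<rho> g * B * B'" using *(2) I r[OF g] by (simp add: mat_assoc)
      also have "\<dots> = B * (C * \<rho> g * B) * B'" by (subst *(11)[OF g]) simp
      also have "\<dots> = B * ((C * \<rho> g * B) * B')" using *(2,3) I r[OF g] by (simp add: mat_assoc)
      also have "\<dots> = B * (B' * \<sigma> g)" using I(5) g by simp
      finally show ?thesis using *(2) I s[OF g] by (simp add: mat_assoc)
    qed
  qed
qed

section \<open>Degrees and subgroups: the index bound and Clifford theory\<close>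

lemma spanning_columns:
  fixes M :: "'a::field mat"
  assumes M: "M \<in> carrier_mat d m" and surj: "\<And>v. v \<in> carrier_vec d \<Longrightarrow> \<exists>x\<in>carrier_vec m. M *\<^sub>v x = v"
  shows "d \<le> m"
proof (rule ccontr)
  assume "\<not> d \<le> m"
  then have md: "m < d" by simp
  \<comment> \<open>Padding with zero columns gives a square matrix with a right inverse but
    determinant 0, which is absurd.\<close>
  define M' where "M' = mat d d (\<lambda>(i, j). if j < m then M $$ (i, j) else 0)"
  define x where "x j = (SOME x. x \<in> carrier_vec m \<and> M *\<^sub>v x = unit_vec d j)" for j
  define X where "X = mat d d (\<lambda>(i, j). if i < m then x j $ i else 0)"
  have M': "M' \<in> carrier_mat d d" by (simp add: M'_def)
  have X: "X \<in> carrier_mat d d" by (simp add: X_def)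
  have "M' * X = 1\<^sub>m d"
  proof (rule mat_col_eqI)
    fix j assume "j < dim_col (1\<^sub>m d :: 'a mat)"
    then have j: "j < d" by simp
    have x: "x j \<in> carrier_vec m" "M *\<^sub>v x j = unit_vec d j"
      using someI_ex[of "\<lambda>x. x \<in> carrier_vec m \<and> M *\<^sub>v x = unit_vec d j"] surj[of "unit_vec d j"]
      by (auto simp: x_def)
    have cX: "col X j = vec d (\<lambda>i. if i < m then x j $ i else 0)"
      using j md by (intro eq_vecI) (auto simp: X_def)
    have "M' *\<^sub>v vec d (\<lambda>i. if i < m then x j $ i else 0) = M *\<^sub>v x j"
    proof (rule eq_vecI)
      fix i assume "i < dim_vec (M *\<^sub>v x j)"
      then have i: "i < d" using M by simp
      have "{..<d} = {..<m} \<union> {m..<d}" using md by auto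
      then have "(\<Sum>l<d. M' $$ (i, l) * (vec d (\<lambda>i. if i < m then x j $ i else 0)) $ l) =
        (\<Sum>l<m. M' $$ (i, l) * (vec d (\<lambda>i. if i < m then x j $ i else 0)) $ l) +
        (\<Sum>l\<in>{m..<d}. M' $$ (i, l) * (vec d (\<lambda>i. if i < m then x j $ i else 0)) $ l)"
        by (simp add: sum.union_disjoint ivl_disj_int)
      also have "\<dots> = (\<Sum>l<m. M $$ (i, l) * x j $ l)"
        using i md by (simp add: M'_def)
      finally show "(M' *\<^sub>v vec d (\<lambda>i. if i < m then x j $ i else 0)) $ i = (M *\<^sub>v x j) $ i"
        using mat_vec_index[OF M' _ i] mat_vec_index[OF M x(1) i] by (simp del: index_mult_mat_vec)
    qed (use M M' in auto)
    then show "col (M' * X) j = col (1\<^sub>m d) j"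
      unfolding col_mult2[OF M' X j] cX x(2) by (simp add: j)
  qed (use M' X in auto)
  then have "det M' * det X = 1" using det_mult[OF M' X] by simp
  moreover have "det M' = 0"
  proof -
    have "M' *\<^sub>v unit_vec d m = 0\<^sub>v d"
      using md by (subst mat_unit_vec_col[OF M' md]) (auto simp: M'_def)
    moreover have "unit_vec d m \<noteq> (0\<^sub>v d :: 'a vec)"
      using md by (metis index_unit_vec(1) index_zero_vec(1) zero_neq_one)
    ultimately show ?thesis using det_0_iff_vec_prod_zero[OF M'] unit_vec_carrier[of d m] by blast
  qed
  ultimately show False by simp
qed

text \<open>Left translation by an element is injective, hence onto on a finite set, and so hits the
  identity.\<close>

lemma (in group) finite_submonoid_subgroup:
  assumes "finite S" "S \<subseteq> carrier G" "\<one> \<in> S" "\<And>g h. g \<in> S \<Longrightarrow> h \<in> S \<Longrightarrow> g \<otimes> h \<in> S"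
  shows "subgroup S G"
proof (rule subgroupI)
  fix g assume g: "g \<in> S"
  have "inj_on (\<lambda>h. g \<otimes> h) S" using inj_on_cmult[of g] g assms(2) by (meson inj_on_subset subsetD)
  moreover have "(\<lambda>h. g \<otimes> h) ` S \<subseteq> S" using g assms(4) by auto
  ultimately have "(\<lambda>h. g \<otimes> h) ` S = S" using assms(1) by (simp add: endo_inj_surj)
  then obtain h where h: "h \<in> S" "g \<otimes> h = \<one>" using assms(3) by (metis imageE)
  have gh: "g \<in> carrier G" "h \<in> carrier G" using g h assms(2) by auto
  have "inv g = h" using inv_equality[OF inv_comm[OF h(2) gh] gh] .
  then show "inv g \<in> S" using h by simp
qed (use assms in auto)

text \<open>The translates of the column space of \<open>B\<close> by coset representatives of its
  stabiliser span an invariant subspace, hence everything. So d is at most k times the index, and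
  \<open>S\<close> bounds the order of the stabiliser from below.\<close>

lemma degree_le_index:
  fixes G (structure)
  assumes "group G" "finite (carrier G)" and irr: "irr_rep G d \<rho>"
    and B: "B \<in> carrier_mat d k" "B \<noteq> 0\<^sub>m d k"
    and S: "S \<subseteq> carrier G" "\<And>s. s \<in> S \<Longrightarrow> \<exists>A\<in>carrier_mat k k. \<rho> s * B = B * A"
  shows "d * card S \<le> card (carrier G) * k"
proof -
  interpret group G by fact
  have \<rho>: "is_rep G d \<rho>" using irr by (simp add: irr_rep_def)
  note r = is_repD[OF \<rho>]
  \<comment> \<open>The full stabiliser of the column space; it contains \<open>S\<close> and is a
    subgroup, which \<open>S\<close> itself is not assumed to be.\<close>
  define H where "H = {g\<in>carrier G. \<exists>A\<in>carrier_mat k k. \<rho> g * B = B * A}"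
  have "subgroup H G"
  proof (rule finite_submonoid_subgroup)
    show "\<one> \<in> H" using \<rho> B by (auto simp: H_def is_rep_def intro!: bexI[of _ "1\<^sub>m k"])
    fix g h assume "g \<in> H" "h \<in> H"
    then obtain A A' where A: "A \<in> carrier_mat k k" "\<rho> g * B = B * A" "A' \<in> carrier_mat k k" "\<rho> h * B = B * A'"
      and gh: "g \<in> carrier G" "h \<in> carrier G" by (auto simp: H_def)
    have "\<rho> (g \<otimes> h) * B = \<rho> g * (\<rho> h * B)"
      using r[OF gh(1)] r[OF gh(2)] B is_rep_mult[OF \<rho> gh] by (simp add: mat_assoc)
    also have "\<dots> = \<rho> g * B * A'" unfolding A(4) using r[OF gh(1)] B(1) A(1,3) by (simp add: mat_assoc)
    also have "\<dots> = B * (A * A')" unfolding A(2) using B(1) A(1,3) by (simp add: mat_assoc)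
    finally show "g \<otimes> h \<in> H" using gh A by (auto simp: H_def intro!: bexI[of _ "A * A'"])
  qed (use assms(2) in \<open>auto simp: H_def\<close>)
  have SH: "card S \<le> card H" using S assms(2) by (intro card_mono) (auto simp: H_def)
  define R where "R = rcosets H"
  have lag: "card R * card H = card (carrier G)"
    using lagrange[OF \<open>subgroup H G\<close>] by (simp add: R_def Coset.order_def)
  have finR: "finite R" using assms(2) by (simp add: R_def RCOSETS_def)
  obtain e where e: "bij_betw e {0..<card R} R" using ex_bij_betw_nat_finite[OF finR] by auto
  \<comment> \<open>The cosets at hand are right cosets; inverting a representative turns them into
    a left transversal, as needed for g = t s with s in \<open>H\<close>.\<close>
  define t where "t c = inv (SOME x. x \<in> carrier G \<and> e c = H #> x)" for c
  have tprop: "inv (t c) \<in> carrier G \<and> e c = H #> inv (t c) \<and> t c \<in> carrier G" if c: "c < card R" for c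
  proof -
    have "e c \<in> R" using e c by (auto simp: bij_betw_def)
    then have "\<exists>x. x \<in> carrier G \<and> e c = H #> x" by (auto simp: R_def RCOSETS_def)
    from someI_ex[OF this] show ?thesis by (simp add: t_def)
  qed
  have rep: "\<exists>c<card R. \<exists>s\<in>H. g = t c \<otimes> s" if g: "g \<in> carrier G" for g
  proof -
    have "H #> inv g \<in> R" using g by (auto simp: R_def RCOSETS_def)
    then have "H #> inv g \<in> e ` {0..<card R}" using e by (simp add: bij_betw_def)
    then obtain c where c: "c < card R" "e c = H #> inv g" by (metis imageE atLeastLessThan_iff)
    have "inv g \<in> H #> inv (t c)"
      using c tprop[OF c(1)] rcos_self[OF _ \<open>subgroup H G\<close>, of "inv g"] g by simp
    then obtain s where s: "s \<in> H" "inv g = s \<otimes> inv (t c)" by (auto simp: r_coset_def)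
    have sG: "s \<in> carrier G" using s(1) by (simp add: H_def)
    have "g = inv (s \<otimes> inv (t c))" using s(2) g by (metis inv_inv)
    also have "\<dots> = t c \<otimes> inv s" using sG tprop[OF c(1)] by (simp add: inv_mult_group)
    finally show ?thesis using c(1) subgroup.m_inv_closed[OF \<open>subgroup H G\<close> s(1)] by blast
  qed
  \<comment> \<open>The blocks \<rho>(t c) B side by side: the quotient of the column index by k
    selects the coset, the remainder the column of \<open>B\<close>.\<close>
  define M where "M = mat d (card R * k) (\<lambda>(i, l). (\<rho> (t (l div k)) * B) $$ (i, l mod k))"
  have Mc: "M \<in> carrier_mat d (card R * k)" by (simp add: M_def)
  have "k > 0"
  proof (rule ccontr)
    assume "\<not> k > 0"
    then have "B = 0\<^sub>m d k" using B(1) by (intro eq_matI) auto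
    then show False using B(2) by simp
  qed
  have Mblock: "\<exists>x\<in>carrier_vec (card R * k). M *\<^sub>v x = \<rho> (t c) * B *\<^sub>v y"
    if c: "c < card R" and y: "y \<in> carrier_vec k" for c y
  proof (intro bexI)
    define x where "x = vec (card R * k) (\<lambda>l. if l div k = c then y $ (l mod k) else 0)"
    show "x \<in> carrier_vec (card R * k)" by (simp add: x_def)
    show "M *\<^sub>v x = \<rho> (t c) * B *\<^sub>v y"
    proof (rule eq_vecI)
      fix i assume "i < dim_vec (\<rho> (t c) * B *\<^sub>v y)"
      then have i: "i < d" using r[of "t c"] tprop[OF c] by simp
      have tB: "\<rho> (t c) * B \<in> carrier_mat d k" using r[of "t c"] tprop[OF c] B by simp
      have "(M *\<^sub>v x) $ i = (\<Sum>l<card R * k. M $$ (i, l) * x $ l)"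
        using i Mc by (intro mat_vec_index) (auto simp: x_def)
      also have "\<dots> = (\<Sum>l<card R * k. if l div k = c then (\<rho> (t c) * B) $$ (i, l mod k) * y $ (l mod k) else 0)"
        using i by (intro sum.cong) (auto simp: M_def x_def)
      also have "\<dots> = (\<Sum>l\<in>{l\<in>{..<card R * k}. l div k = c}. (\<rho> (t c) * B) $$ (i, l mod k) * y $ (l mod k))"
        by (rule sum.inter_filter[symmetric]) simp
      also have "\<dots> = (\<Sum>j<k. (\<rho> (t c) * B) $$ (i, j) * y $ j)"
      proof (rule sum.reindex_bij_witness[of _ "\<lambda>j. c * k + j" "\<lambda>l. l mod k"])
        fix j assume j: "j \<in> {..<k}"
        then have "c * k + j < Suc c * k" by simp
        also have "\<dots> \<le> card R * k" using c by (intro mult_le_mono1) simp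
        finally show "(c * k + j) mod k = j" "c * k + j \<in> {l \<in> {..<card R * k}. l div k = c}"
          using j by auto
      qed (use \<open>k > 0\<close> in auto)
      also have "\<dots> = (\<rho> (t c) * B *\<^sub>v y) $ i"
        by (rule mat_vec_index[OF tB y i, symmetric])
      finally show "(M *\<^sub>v x) $ i = (\<rho> (t c) * B *\<^sub>v y) $ i" .
    qed (use Mc r[of "t c"] tprop[OF c] in auto)
  qed
  define W where "W = {v \<in> carrier_vec d. \<exists>x\<in>carrier_vec (card R * k). M *\<^sub>v x = v}"
  have "lin_subspace d W"
    unfolding lin_subspace_def
  proof (intro conjI ballI allI)
    show "0\<^sub>v d \<in> W" using Mc by (auto simp: W_def mat_mult_zero_vec intro!: bexI[of _ "0\<^sub>v (card R * k)"])
    fix v w assume "v \<in> W" "w \<in> W"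
    then obtain x y where "x \<in> carrier_vec (card R * k)" "y \<in> carrier_vec (card R * k)" "M *\<^sub>v x = v" "M *\<^sub>v y = w"
      "v \<in> carrier_vec d" "w \<in> carrier_vec d" by (auto simp: W_def)
    then show "v + w \<in> W" using Mc
      by (auto simp: W_def mult_add_distrib_mat_vec intro!: bexI[of _ "x + y"])
  next
    fix c v assume "v \<in> W"
    then obtain x where "x \<in> carrier_vec (card R * k)" "M *\<^sub>v x = v" "v \<in> carrier_vec d" by (auto simp: W_def)
    then show "c \<cdot>\<^sub>v v \<in> W" using Mc by (auto simp: W_def mult_mat_vec intro!: bexI[of _ "c \<cdot>\<^sub>v x"])
  qed (auto simp: W_def)
  have gBW: "\<rho> g * B *\<^sub>v y \<in> W" if g: "g \<in> carrier G" and y: "y \<in> carrier_vec k" for g y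
  proof -
    obtain c s where c: "c < card R" "s \<in> H" "g = t c \<otimes> s" using rep[OF g] by auto
    obtain A where A: "A \<in> carrier_mat k k" "\<rho> s * B = B * A" and sG: "s \<in> carrier G"
      using c(2) by (auto simp: H_def)
    have tG: "t c \<in> carrier G" using tprop[OF c(1)] by simp
    have "\<rho> g * B = \<rho> (t c) * (\<rho> s * B)"
      using r[OF tG] r[OF sG] is_rep_mult[OF \<rho> tG sG] B c(3) by (simp add: mat_assoc)
    also have "\<dots> = \<rho> (t c) * B * A" unfolding A(2) using r[OF tG] A(1) B(1) by (simp add: mat_assoc)
    finally have "\<rho> g * B *\<^sub>v y = \<rho> (t c) * B *\<^sub>v (A *\<^sub>v y)"
      using r[OF tG] A B y by (simp add: mat_vec_assoc)
    then show ?thesis using Mblock[OF c(1), of "A *\<^sub>v y"] A y r[OF tG] B by (auto simp: W_def)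
  qed
  have Mcols: "M *\<^sub>v x \<in> W" if "x \<in> carrier_vec (card R * k)" for x
    using that Mc by (auto simp: W_def)
  \<comment> \<open>The largest invariant subspace inside the span of the columns of
    \<open>M\<close>; it contains the columns of \<open>B\<close>, so irreducibility makes it
    everything.\<close>
  define Y where "Y = {v \<in> carrier_vec d. \<forall>g\<in>carrier G. \<rho> g *\<^sub>v v \<in> W}"
  have "lin_subspace d Y"
    unfolding Y_def using \<open>lin_subspace d W\<close> r(1) by (rule lin_subspace_preimage)
  moreover have "\<forall>g\<in>carrier G. \<forall>v\<in>Y. \<rho> g *\<^sub>v v \<in> Y"
  proof (intro ballI)
    fix g v assume g: "g \<in> carrier G" and v: "v \<in> Y"
    have "\<rho> h *\<^sub>v (\<rho> g *\<^sub>v v) \<in> W" if h: "h \<in> carrier G" for h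
    proof -
      have "\<rho> h *\<^sub>v (\<rho> g *\<^sub>v v) = \<rho> (h \<otimes> g) *\<^sub>v v"
        using is_rep_mult[OF \<rho> h g] r[OF g] r[OF h] v by (simp add: mat_vec_assoc Y_def)
      then show ?thesis using v g h by (simp add: Y_def)
    qed
    then show "\<rho> g *\<^sub>v v \<in> Y" using r[OF g] v by (simp add: Y_def)
  qed
  moreover obtain y where y: "y \<in> carrier_vec k" "B *\<^sub>v y \<noteq> 0\<^sub>v d"
    using mat_eqI_vec[OF B(1), of "0\<^sub>m d k"] B(2) by (auto simp: zero_mat_mult_vec)
  moreover have "B *\<^sub>v y \<in> Y"
  proof -
    have "\<rho> g *\<^sub>v (B *\<^sub>v y) = \<rho> g * B *\<^sub>v y" if "g \<in> carrier G" for g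
      using that r y B by (simp add: mat_vec_assoc)
    then show ?thesis using gBW y B by (auto simp: Y_def)
  qed
  ultimately have YW: "Y = carrier_vec d" using irr_rep_cases[OF irr] by blast
  have "v \<in> W" if "v \<in> carrier_vec d" for v
  proof -
    have "\<rho> \<one> *\<^sub>v v \<in> W" using that unfolding YW[symmetric] by (auto simp: Y_def)
    then show ?thesis using that \<rho> by (simp add: is_rep_def)
  qed
  then have "d \<le> card R * k" using spanning_columns[OF Mc] by (auto simp: W_def)
  then have "d * card S \<le> card R * k * card H" using SH by (simp add: mult_le_mono)
  then show ?thesis using lag by (simp add: ac_simps)
qed

text \<open>Clifford theory in idempotent form: if \<open>f\<close> is a linear character of \<open>S\<close> and no element outside \<open>S\<close>
  fixes the restriction of \<open>f\<close> to the normal subgroup \<open>Q\<close> of \<open>S\<close>, then the \<open>f\<close>-isotypic part of an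
  irreducible representation is an irreducible representation of \<open>S\<close>, from which the whole is induced.\<close>

lemma isotypic_component_irreducible:
  fixes G (structure) and f :: "'g \<Rightarrow> complex"
  assumes "group G" "finite (carrier G)" and irr: "irr_rep G d \<rho>" and S: "subgroup S G" and Q: "subgroup Q G" "Q \<subseteq> S"
    and fm: "\<And>s t. s \<in> S \<Longrightarrow> t \<in> S \<Longrightarrow> f (s \<otimes> t) = f s * f t" and f0: "\<And>s. s \<in> S \<Longrightarrow> f s \<noteq> 0"
    and normal: "\<And>s q. s \<in> S \<Longrightarrow> q \<in> Q \<Longrightarrow> s \<otimes> q \<otimes> inv s \<in> Q"
    and K: "group K" "\<iota> \<in> hom K G" "\<And>u. u \<in> carrier K \<Longrightarrow> \<iota> u \<in> S"
    and SQ: "\<And>s. s \<in> S \<Longrightarrow> \<exists>q\<in>Q. \<exists>u\<in>carrier K. s = q \<otimes> \<iota> u"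
    and sep: "\<And>g. g \<in> carrier G \<Longrightarrow> g \<notin> S \<Longrightarrow> \<exists>a\<in>Q. g \<otimes> a \<otimes> inv g \<in> Q \<and> f (g \<otimes> a \<otimes> inv g) \<noteq> f a"
    and E_def: "E = mat_sum d d (\<lambda>q. (inverse (f q) / of_nat (card Q)) \<cdot>\<^sub>m \<rho> q) Q" and E0: "E \<noteq> 0\<^sub>m d d"
  obtains k \<sigma> where "irr_rep K k \<sigma>" "d * card S = card (carrier G) * k"
    "\<And>u. u \<in> carrier K \<Longrightarrow> mat_trace (\<sigma> u) = mat_trace (E * \<rho> (\<iota> u))"
proof -
  interpret group G by fact
  interpret Q: subgroup Q G by fact
  interpret S: subgroup S G by fact
  have \<rho>: "is_rep G d \<rho>" using irr by (simp add: irr_rep_def)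
  note r = is_repD[OF \<rho>]
  have QG: "q \<in> carrier G" if "q \<in> Q" for q using that by (rule Q.mem_carrier)
  have SG: "s \<in> carrier G" if "s \<in> S" for s using that by (rule S.mem_carrier)
  have finQ: "finite Q" using finite_subset[OF Q.subset assms(2)] .
  have cQ: "of_nat (card Q) \<noteq> (0::complex)" using finQ Q.one_closed by (metis card_eq_0_iff empty_iff of_nat_eq_0_iff)
  have E: "E \<in> carrier_mat d d" by (simp add: E_def)
  have f1: "f \<one> = 1" using fm[of \<one> \<one>] f0[of \<one>] S.one_closed by simp
  have finv: "f (inv s) = inverse (f s)" if "s \<in> S" for s
    using fm[of s "inv s"] that f0[OF that] S.mem_carrier[OF that] f1 by (simp add: field_simps)
  \<comment> \<open>\<open>E\<close> is the projector onto the vectors on which Q acts through f;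
    translating the summation index by q produces the factor \<open>f q\<close>.\<close>
  have EQr: "\<rho> q * E = f q \<cdot>\<^sub>m E" if q: "q \<in> Q" for q
  proof -
    have bij: "bij_betw (\<lambda>x. inv q \<otimes> x) Q Q"
      by (rule bij_betw_byWitness[of _ "\<lambda>x. q \<otimes> x"]) (use q QG in \<open>auto simp: m_assoc[symmetric]\<close>)
    have "\<rho> q * E = mat_sum d d (\<lambda>x. \<rho> q * ((inverse (f x) / of_nat (card Q)) \<cdot>\<^sub>m \<rho> x)) Q"
      unfolding E_def using r QG q by (intro mat_sum_mult_left) auto
    also have "\<dots> = mat_sum d d (\<lambda>x. (inverse (f x) / of_nat (card Q)) \<cdot>\<^sub>m \<rho> (q \<otimes> x)) Q"
      using r QG q by (intro mat_sum_cong) (simp add: mult_smult_distrib[of _ d d _ d] is_rep_mult[OF \<rho>])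
    also have "\<dots> = mat_sum d d (\<lambda>x. (inverse (f (inv q \<otimes> x)) / of_nat (card Q)) \<cdot>\<^sub>m \<rho> (q \<otimes> (inv q \<otimes> x))) Q"
      by (rule mat_sum_reindex[OF bij])
    also have "\<dots> = mat_sum d d (\<lambda>x. f q \<cdot>\<^sub>m ((inverse (f x) / of_nat (card Q)) \<cdot>\<^sub>m \<rho> x)) Q"
    proof (rule mat_sum_cong)
      fix x assume x: "x \<in> Q"
      have "inv q \<in> S" "x \<in> S" "q \<in> S" using x q Q(2) Q.m_inv_closed[OF q] by blast+
      then have "f (inv q \<otimes> x) = inverse (f q) * f x" using fm[of "inv q" x] finv[of q] by simp
      moreover have "q \<otimes> (inv q \<otimes> x) = x" using x q QG by (simp add: m_assoc[symmetric])
      ultimately show "(inverse (f (inv q \<otimes> x)) / of_nat (card Q)) \<cdot>\<^sub>m \<rho> (q \<otimes> (inv q \<otimes> x)) =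
        f q \<cdot>\<^sub>m ((inverse (f x) / of_nat (card Q)) \<cdot>\<^sub>m \<rho> x)"
        by (intro eq_matI) (auto simp: field_simps)
    qed
    also have "\<dots> = f q \<cdot>\<^sub>m E"
      unfolding E_def using r QG by (intro mat_sum_smult[symmetric]) auto
    finally show ?thesis .
  qed
  \<comment> \<open>S normalises Q, and a multiplicative f on S satisfies f(s x s^-1) = f(x), so
    conjugation only permutes the terms of \<open>E\<close>.\<close>
  have sE: "\<rho> s * E = E * \<rho> s" if s: "s \<in> S" for s
  proof -
    have c1: "inv s \<otimes> (s \<otimes> a) = a" "s \<otimes> (inv s \<otimes> a) = a" if "a \<in> carrier G" for a
      using that SG[OF s] by (simp_all add: m_assoc[symmetric])
    have bij: "bij_betw (\<lambda>x. s \<otimes> x \<otimes> inv s) Q Q"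
    proof (rule bij_betw_byWitness[of _ "\<lambda>x. inv s \<otimes> x \<otimes> s"])
      show "(\<lambda>x. inv s \<otimes> x \<otimes> s) ` Q \<subseteq> Q" using normal[of "inv s"] s SG by auto
      show "(\<lambda>x. s \<otimes> x \<otimes> inv s) ` Q \<subseteq> Q" using normal[OF s] by auto
      show "\<forall>a\<in>Q. inv s \<otimes> (s \<otimes> a \<otimes> inv s) \<otimes> s = a"
        using SG[OF s] QG by (simp add: m_assoc c1)
      show "\<forall>a\<in>Q. s \<otimes> (inv s \<otimes> a \<otimes> s) \<otimes> inv s = a"
        using SG[OF s] QG by (simp add: m_assoc c1)
    qed
    have "E * \<rho> s = mat_sum d d (\<lambda>x. (inverse (f x) / of_nat (card Q)) \<cdot>\<^sub>m \<rho> x * \<rho> s) Q"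
      unfolding E_def using r QG SG[OF s] by (intro mat_sum_mult_right) auto
    also have "\<dots> = mat_sum d d (\<lambda>x. (inverse (f x) / of_nat (card Q)) \<cdot>\<^sub>m \<rho> (x \<otimes> s)) Q"
      using r QG SG[OF s] by (intro mat_sum_cong) (simp add: mult_smult_assoc_mat[of _ d d _ d] is_rep_mult[OF \<rho>])
    also have "\<dots> = mat_sum d d (\<lambda>x. (inverse (f (s \<otimes> x \<otimes> inv s)) / of_nat (card Q)) \<cdot>\<^sub>m \<rho> (s \<otimes> x \<otimes> inv s \<otimes> s)) Q"
      by (rule mat_sum_reindex[OF bij])
    also have "\<dots> = mat_sum d d (\<lambda>x. \<rho> s * ((inverse (f x) / of_nat (card Q)) \<cdot>\<^sub>m \<rho> x)) Q"
    proof (rule mat_sum_cong)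
      fix x assume x: "x \<in> Q"
      have "x \<in> S" "s \<otimes> x \<in> S" "inv s \<in> S" using x s Q(2) S.m_inv_closed[OF s] by auto
      then have "f (s \<otimes> x \<otimes> inv s) = f x"
        using fm[of "s \<otimes> x" "inv s"] fm[OF s, of x] finv[OF s] f0[OF s] by simp
      moreover have "s \<otimes> x \<otimes> inv s \<otimes> s = s \<otimes> x" using x s QG SG by (simp add: m_assoc)
      ultimately show "(inverse (f (s \<otimes> x \<otimes> inv s)) / of_nat (card Q)) \<cdot>\<^sub>m \<rho> (s \<otimes> x \<otimes> inv s \<otimes> s) =
        \<rho> s * ((inverse (f x) / of_nat (card Q)) \<cdot>\<^sub>m \<rho> x)"
        using r QG[OF x] SG[OF s] by (simp add: mult_smult_distrib[of _ d d _ d] is_rep_mult[OF \<rho>])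
    qed
    also have "\<dots> = \<rho> s * E"
      unfolding E_def using r QG SG[OF s] by (intro mat_sum_mult_left[symmetric]) auto
    finally show ?thesis ..
  qed
  have EE: "E * E = E"
  proof -
    have "E * E = mat_sum d d (\<lambda>q. (inverse (f q) / of_nat (card Q)) \<cdot>\<^sub>m \<rho> q * E) Q"
      by (subst (1) E_def) (use r QG E in \<open>intro mat_sum_mult_right, auto\<close>)
    also have "\<dots> = mat_sum d d (\<lambda>q. if q \<in> Q then inverse (of_nat (card Q)) \<cdot>\<^sub>m E else 0\<^sub>m d d) Q"
    proof (rule mat_sum_cong)
      fix q assume q: "q \<in> Q"
      have "(inverse (f q) / of_nat (card Q)) \<cdot>\<^sub>m \<rho> q * E = (inverse (f q) / of_nat (card Q)) \<cdot>\<^sub>m (f q \<cdot>\<^sub>m E)"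
        using r[OF QG[OF q]] E EQr[OF q] by (simp add: mult_smult_assoc_mat[of _ d d _ d])
      also have "\<dots> = inverse (of_nat (card Q)) \<cdot>\<^sub>m E"
        using f0[of q] q Q(2) by (intro eq_matI) (auto simp: field_simps)
      finally show "(inverse (f q) / of_nat (card Q)) \<cdot>\<^sub>m \<rho> q * E =
        (if q \<in> Q then inverse (of_nat (card Q)) \<cdot>\<^sub>m E else 0\<^sub>m d d)" using q by simp
    qed
    also have "\<dots> = of_nat (card Q) \<cdot>\<^sub>m (inverse (of_nat (card Q)) \<cdot>\<^sub>m E)"
      using E finQ by (intro mat_sum_const) auto
    also have "\<dots> = E" using cQ by (intro eq_matI) auto
    finally show ?thesis .
  qed
  have EQl: "E * \<rho> q = f q \<cdot>\<^sub>m E" if "q \<in> Q" for q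
    using EQr[OF that] sE[of q] that Q(2) by auto
  \<comment> \<open>Mackey-type orthogonality: for X = E \<rho>(g) E, absorbing a on the right gives
    f(a) X, absorbing g a g^-1 on the left gives f(g a g^-1) X. The two scalars differ, so X =
    0.\<close>
  have EgE: "E * (\<rho> g * E) = 0\<^sub>m d d" if g: "g \<in> carrier G" "g \<notin> S" for g
  proof -
    obtain a where a: "a \<in> Q" "g \<otimes> a \<otimes> inv g \<in> Q" "f (g \<otimes> a \<otimes> inv g) \<noteq> f a"
      using sep[OF g] by auto
    let ?h = "g \<otimes> a \<otimes> inv g"
    let ?X = "E * (\<rho> g * E)"
    have X: "?X \<in> carrier_mat d d" using E r[OF g(1)] by simp
    have "f a \<cdot>\<^sub>m ?X = E * (\<rho> g * (f a \<cdot>\<^sub>m E))"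
      using E r[OF g(1)] by (simp add: mult_smult_distrib[of _ d d _ d])
    also have "\<dots> = E * (\<rho> (g \<otimes> a) * E)"
      unfolding EQr[OF a(1), symmetric]
      using E r[OF g(1)] r[OF QG[OF a(1)]] is_rep_mult[OF \<rho> g(1) QG[OF a(1)]] by (simp add: mat_assoc)
    also have "g \<otimes> a = ?h \<otimes> g" using g(1) QG[OF a(1)] by (simp add: m_assoc)
    also have "E * (\<rho> (?h \<otimes> g) * E) = E * \<rho> ?h * (\<rho> g * E)"
      using E r[OF g(1)] r[OF QG[OF a(2)]] is_rep_mult[OF \<rho> QG[OF a(2)] g(1)] by (simp add: mat_assoc)
    also have "\<dots> = f ?h \<cdot>\<^sub>m ?X"
      unfolding EQl[OF a(2)] using E r[OF g(1)] by (simp add: mult_smult_assoc_mat[of _ d d _ d])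
    finally have eq: "f a \<cdot>\<^sub>m ?X = f ?h \<cdot>\<^sub>m ?X" .
    have "?X $$ (i, j) = 0" if "i < d" "j < d" for i j
    proof -
      have "(f a \<cdot>\<^sub>m ?X) $$ (i, j) = (f ?h \<cdot>\<^sub>m ?X) $$ (i, j)" using eq by simp
      then have "f a * ?X $$ (i, j) = f ?h * ?X $$ (i, j)" using that carrier_matD[OF X] by (simp del: index_mult_mat)
      then show ?thesis using a(3) by (metis mult_cancel_right)
    qed
    then show ?thesis using carrier_matD[OF X] by (intro eq_matI) (auto simp del: index_mult_mat)
  qed
  define W where "W = {v \<in> carrier_vec d. \<forall>i\<in>{()}. E *\<^sub>v v = 1 \<cdot>\<^sub>v v}"
  have W: "lin_subspace d W" unfolding W_def using E by (intro lin_subspace_eigen)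
  obtain k l B C D F where kl: "k + l = d" and c: "B \<in> carrier_mat d k" "C \<in> carrier_mat k d" "D \<in> carrier_mat d l" "F \<in> carrier_mat l d"
    and e: "C * B = 1\<^sub>m k" "F * D = 1\<^sub>m l" "F * B = 0\<^sub>m l k" "C * D = 0\<^sub>m k l" "B * C + D * F = 1\<^sub>m d"
    and W': "\<And>w. w \<in> carrier_vec d \<Longrightarrow> w \<in> W \<longleftrightarrow> F *\<^sub>v w = 0\<^sub>v l"
    by (rule subspace_splitting[OF W]) (rule that)
  have EB: "E * B = B"
  proof (rule mat_eqI_vec)
    fix v :: "complex vec" assume v: "v \<in> carrier_vec k"
    have "F *\<^sub>v (B *\<^sub>v v) = 0\<^sub>v l"
      using c e(3) v by (simp add: zero_mat_mult_vec flip: assoc_mult_mat_vec)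
    then have "B *\<^sub>v v \<in> W" using W'[of "B *\<^sub>v v"] c v by simp
    then show "E * B *\<^sub>v v = B *\<^sub>v v" using E c v by (simp add: W_def)
  qed (use E c in auto)
  have FE: "F * E = 0\<^sub>m l d"
  proof (rule mat_eqI_vec)
    fix v :: "complex vec" assume v: "v \<in> carrier_vec d"
    have "E *\<^sub>v (E *\<^sub>v v) = E *\<^sub>v v" using E v EE by (simp flip: assoc_mult_mat_vec)
    then have "E *\<^sub>v v \<in> W" using E v by (simp add: W_def)
    then show "F * E *\<^sub>v v = 0\<^sub>m l d *\<^sub>v v" using W'[of "E *\<^sub>v v"] E v c by (simp add: zero_mat_mult_vec)
  qed (use E c in auto)
  have BCE: "B * (C * E) = E"
  proof -
    have "E = (B * C + D * F) * E" using e E by simp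
    also have "\<dots> = B * C * E + D * F * E" using E c by (simp add: add_mult_distrib_mat[of _ d d _ _ d])
    also have "D * F * E = 0\<^sub>m d d" using E c FE by (simp add: mat_assoc)
    also have "B * C * E + 0\<^sub>m d d = B * (C * E)" using E c by (simp add: mat_assoc)
    finally show ?thesis ..
  qed
  \<comment> \<open>Rank factorisation of the projector: B A = E and A B = 1, with k the rank.
    Compressing to k by k matrices is X -> A X B.\<close>
  define A where "A = C * E"
  have A: "A \<in> carrier_mat k d" using E c by (simp add: A_def)
  have AB: "A * B = 1\<^sub>m k" using EB e(1) E c by (simp add: A_def mat_assoc)
  have BA: "B * A = E" using BCE by (simp add: A_def)
  have AE: "A * E = A" using EE E c by (simp add: A_def mat_assoc)
  have ArB: "A * \<rho> g * B = 0\<^sub>m k k" if "g \<in> carrier G" "g \<notin> S" for g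
  proof -
    have "A * \<rho> g * B = C * (E * (\<rho> g * E)) * B"
      using E c r[OF that(1)] EB by (simp add: A_def mat_assoc)
    then show ?thesis using EgE[OF that] c by simp
  qed
  have trE: "mat_trace E = of_nat k"
    using mat_trace_comm[OF c(1) A] AB BA by (simp add: mat_trace_one)
  have k0: "k > 0"
  proof (rule ccontr)
    assume "\<not> k > 0"
    then have "B * A = 0\<^sub>m d d" using c A by (intro eq_matI) (auto simp: scalar_prod_def)
    then show False using BA E0 by simp
  qed
  have iS: "\<iota> u \<in> S" "\<iota> u \<in> carrier G" if "u \<in> carrier K" for u using K(3)[OF that] SG by auto
  define \<sigma> where "\<sigma> u = A * \<rho> (\<iota> u) * B" for u
  have \<sigma>c: "\<sigma> u \<in> carrier_mat k k" if "u \<in> carrier K" for u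
    using A c r[OF iS(2)[OF that]] by (simp add: \<sigma>_def)
  interpret K: group K by fact
  have "is_rep K k \<sigma>"
    unfolding is_rep_def
  proof (intro conjI ballI)
    fix u v assume u: "u \<in> carrier K" and v: "v \<in> carrier K"
    have "\<rho> (\<iota> (u \<otimes>\<^bsub>K\<^esub> v)) = \<rho> (\<iota> u) * \<rho> (\<iota> v)"
      using u v K(2) iS is_rep_mult[OF \<rho>] by (simp add: hom_def)
    moreover have "\<sigma> u * \<sigma> v = A * \<rho> (\<iota> u) * (B * A) * \<rho> (\<iota> v) * B"
      unfolding \<sigma>_def using A c r[OF iS(2)[OF u]] r[OF iS(2)[OF v]] by (simp add: mat_assoc)
    moreover have "A * \<rho> (\<iota> u) * E * \<rho> (\<iota> v) * B = A * (\<rho> (\<iota> u) * E) * (\<rho> (\<iota> v) * B)"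
      using A E c r[OF iS(2)[OF u]] r[OF iS(2)[OF v]] by (simp add: mat_assoc)
    moreover have "A * (E * \<rho> (\<iota> u)) * (\<rho> (\<iota> v) * B) = (A * E) * (\<rho> (\<iota> u) * \<rho> (\<iota> v)) * B"
      using A E c r[OF iS(2)[OF u]] r[OF iS(2)[OF v]] by (simp add: mat_assoc)
    ultimately show "\<sigma> (u \<otimes>\<^bsub>K\<^esub> v) = \<sigma> u * \<sigma> v"
      by (simp only: BA AE sE[OF iS(1)[OF u]] \<sigma>_def)
  next
    have "\<iota> \<one>\<^bsub>K\<^esub> = \<one>" using hom_one[OF K(2,1)] group_axioms by blast
    then show "\<sigma> \<one>\<^bsub>K\<^esub> = 1\<^sub>m k" using A AB \<rho> by (simp add: \<sigma>_def is_rep_def)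
  qed (use \<sigma>c in auto)
  have "irr_rep K k \<sigma>"
    unfolding irr_rep_def
  proof (intro conjI allI impI)
    fix Y assume Y: "lin_subspace k Y" and inv: "\<forall>u\<in>carrier K. \<forall>y\<in>Y. \<sigma> u *\<^sub>v y \<in> Y"
    have Yc: "y \<in> carrier_vec k" if "y \<in> Y" for y using that Y by (auto simp: lin_subspace_def)
    show "Y = {0\<^sub>v k} \<or> Y = carrier_vec k"
    proof (rule ccontr)
      assume "\<not> ?thesis"
      then obtain y where y: "y \<in> Y" "y \<noteq> 0\<^sub>v k" and Yn: "Y \<noteq> carrier_vec k"
        using Y by (auto simp: lin_subspace_def)
      \<comment> \<open>Vectors all of whose translates project into Y. This space is invariant, and
        it contains B y because A \<rho>(g) B is zero outside S and a multiple of some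
        \<open>\<sigma> u\<close> on S.\<close>
      define X where "X = {v \<in> carrier_vec d. \<forall>g\<in>carrier G. A * \<rho> g *\<^sub>v v \<in> Y}"
      have X: "lin_subspace d X"
        unfolding X_def using Y by (rule lin_subspace_preimage) (use A r in simp)
      have Xinv: "\<forall>g\<in>carrier G. \<forall>v\<in>X. \<rho> g *\<^sub>v v \<in> X"
      proof (intro ballI)
        fix g v assume g: "g \<in> carrier G" and v: "v \<in> X"
        then have vc: "v \<in> carrier_vec d" by (simp add: X_def)
        have "A * \<rho> h *\<^sub>v (\<rho> g *\<^sub>v v) \<in> Y" if h: "h \<in> carrier G" for h
        proof -
          have "A * \<rho> h *\<^sub>v (\<rho> g *\<^sub>v v) = A * \<rho> (h \<otimes> g) *\<^sub>v v"
            using is_rep_mult[OF \<rho> h g] r[OF g] r[OF h] carrier_vecD[OF vc] A by (simp add: mat_vec_assoc)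
          then show ?thesis using v g h by (simp add: X_def)
        qed
        then show "\<rho> g *\<^sub>v v \<in> X" using r[OF g] v by (simp add: X_def)
      qed
      have "A * \<rho> g *\<^sub>v (B *\<^sub>v y) \<in> Y" if g: "g \<in> carrier G" for g
      proof (cases "g \<in> S")
        case False
        have "A * \<rho> g *\<^sub>v (B *\<^sub>v y) = A * \<rho> g * B *\<^sub>v y" using A r[OF g] c carrier_vecD[OF Yc[OF y(1)]] by (simp add: mat_vec_assoc)
        also have "\<dots> = 0\<^sub>v k" using ArB[OF g False] Yc[OF y(1)] by (simp add: zero_mat_mult_vec)
        finally show ?thesis using Y by (simp add: lin_subspace_def)
      next
        case True
        obtain q u where qu: "q \<in> Q" "u \<in> carrier K" "g = q \<otimes> \<iota> u" using SQ[OF True] by auto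
        note r1 = r[OF QG[OF qu(1)]] and r2 = r[OF iS(2)[OF qu(2)]]
        have "A * \<rho> g * B = C * (E * \<rho> q) * \<rho> (\<iota> u) * B"
          using qu E c r1 r2 is_rep_mult[OF \<rho> QG[OF qu(1)] iS(2)[OF qu(2)]] by (simp add: A_def mat_assoc)
        also have "\<dots> = f q \<cdot>\<^sub>m \<sigma> u"
          unfolding EQl[OF qu(1)] \<sigma>_def A_def using E c r2
          by (simp add: mult_smult_distrib[of _ k d _ d] mult_smult_assoc_mat[of _ k d _ d] mult_smult_assoc_mat[of _ k d _ k])
        finally have ArBf: "A * \<rho> g * B = f q \<cdot>\<^sub>m \<sigma> u" .
        have "A * \<rho> g *\<^sub>v (B *\<^sub>v y) = A * \<rho> g * B *\<^sub>v y"
          using A r[OF g] c carrier_vecD[OF Yc[OF y(1)]] by (simp add: mat_vec_assoc)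
        also have "\<dots> = (f q \<cdot>\<^sub>m \<sigma> u) *\<^sub>v y" unfolding ArBf ..
        also have "\<dots> = f q \<cdot>\<^sub>v (\<sigma> u *\<^sub>v y)"
          using \<sigma>c[OF qu(2)] Yc[OF y(1)] by (intro eq_vecI) auto
        finally show ?thesis using inv qu(2) y(1) Y by (simp add: lin_subspace_def)
      qed
      then have "B *\<^sub>v y \<in> X" using c Yc[OF y(1)] by (simp add: X_def)
      moreover have "B *\<^sub>v y \<noteq> 0\<^sub>v d"
      proof
        assume "B *\<^sub>v y = 0\<^sub>v d"
        then have "A *\<^sub>v (B *\<^sub>v y) = 0\<^sub>v k" using A by (simp add: mat_mult_zero_vec)
        then have "1\<^sub>m k *\<^sub>v y = 0\<^sub>v k" unfolding AB[symmetric] using A c carrier_vecD[OF Yc[OF y(1)]] by (simp add: mat_vec_assoc)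
        then show False using y Yc[OF y(1)] by simp
      qed
      ultimately have XU: "X = carrier_vec d" using irr_rep_cases[OF irr X Xinv] by blast
      have "x \<in> Y" if x: "x \<in> carrier_vec k" for x
      proof -
        have "B *\<^sub>v x \<in> X" unfolding XU using c x by simp
        then have "A * \<rho> \<one> *\<^sub>v (B *\<^sub>v x) \<in> Y" by (auto simp: X_def)
        moreover have "A * \<rho> \<one> *\<^sub>v (B *\<^sub>v x) = A * B *\<^sub>v x" using \<rho> A c carrier_vecD[OF x] by (simp add: is_rep_def mat_vec_assoc)
        ultimately show ?thesis using AB x by simp
      qed
      then show False using Yn Yc by auto
    qed
  qed (use \<open>is_rep K k \<sigma>\<close> k0 in auto)
  moreover have "mat_trace (\<sigma> u) = mat_trace (E * \<rho> (\<iota> u))" if u: "u \<in> carrier K" for u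
  proof -
    note r' = r[OF iS(2)[OF u]]
    have "mat_trace (\<sigma> u) = mat_trace (A * (\<rho> (\<iota> u) * B))" unfolding \<sigma>_def using A r' c by (simp add: mat_assoc)
    also have "\<dots> = mat_trace (\<rho> (\<iota> u) * B * A)" using A r' c by (intro mat_trace_comm[of A k d]) auto
    also have "\<dots> = mat_trace (\<rho> (\<iota> u) * E)" using A r' c BA by (simp add: mat_assoc)
    finally show ?thesis using sE[OF iS(1)[OF u]] by simp
  qed
  moreover have "d * card S = card (carrier G) * k"
  proof -
    \<comment> \<open>The sum of all conjugates of \<open>E\<close> commutes with the group.
      Multiplied by \<open>E\<close>, only the terms from S survive, so |S| is an eigenvalue; its
      eigenspace is invariant and \<open>T\<close> is that scalar. Comparing traces gives d |S| =
      |G| k.\<close>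
    define T where "T = mat_sum d d (\<lambda>g. \<rho> g * E * \<rho> (inv g)) (carrier G)"
    have T: "T \<in> carrier_mat d d" by (simp add: T_def)
    have Tc: "\<rho> g * E * \<rho> (inv g) \<in> carrier_mat d d" if "g \<in> carrier G" for g
      using E r(1)[OF that] r(1)[of "inv g"] that by simp
    have Tcomm: "\<rho> h * T = T * \<rho> h" if h: "h \<in> carrier G" for h
    proof -
      have bij: "bij_betw (\<lambda>x. h \<otimes> x) (carrier G) (carrier G)"
        by (rule bij_betw_byWitness[of _ "\<lambda>x. inv h \<otimes> x"]) (use h in \<open>auto simp: m_assoc[symmetric]\<close>)
      have "T * \<rho> h = mat_sum d d (\<lambda>g. \<rho> g * E * \<rho> (inv g) * \<rho> h) (carrier G)"
        unfolding T_def using r(1)[OF h] Tc by (intro mat_sum_mult_right) auto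
      also have "\<dots> = mat_sum d d (\<lambda>g. \<rho> (h \<otimes> g) * E * \<rho> (inv (h \<otimes> g)) * \<rho> h) (carrier G)"
        by (rule mat_sum_reindex[OF bij])
      also have "\<dots> = mat_sum d d (\<lambda>g. \<rho> h * (\<rho> g * E * \<rho> (inv g))) (carrier G)"
      proof (rule mat_sum_cong)
        fix g assume g: "g \<in> carrier G"
        have "inv (h \<otimes> g) \<otimes> h = inv g" using g h by (simp add: inv_mult_group m_assoc)
        then have "\<rho> (inv (h \<otimes> g)) * \<rho> h = \<rho> (inv g)"
          using is_rep_mult[OF \<rho>, of "inv (h \<otimes> g)" h] g h by simp
        then show "\<rho> (h \<otimes> g) * E * \<rho> (inv (h \<otimes> g)) * \<rho> h = \<rho> h * (\<rho> g * E * \<rho> (inv g))"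
          using is_rep_mult[OF \<rho> h g] r[OF g] r[OF h] r[of "inv g"] r[of "inv (h \<otimes> g)"] E g h
          by (simp add: mat_assoc)
      qed
      also have "\<dots> = \<rho> h * T"
        unfolding T_def using r(1)[OF h] Tc by (intro mat_sum_mult_left[symmetric]) auto
      finally show ?thesis ..
    qed
    have TE: "T * E = of_nat (card S) \<cdot>\<^sub>m E"
    proof -
      have "T * E = mat_sum d d (\<lambda>g. \<rho> g * E * \<rho> (inv g) * E) (carrier G)"
        unfolding T_def using E Tc by (intro mat_sum_mult_right) auto
      also have "\<dots> = mat_sum d d (\<lambda>g. if g \<in> S then E else 0\<^sub>m d d) (carrier G)"
      proof (rule mat_sum_cong)
        fix g assume g: "g \<in> carrier G"
        note r' = r[OF g] r[OF inv_closed[OF g]]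
        show "\<rho> g * E * \<rho> (inv g) * E = (if g \<in> S then E else 0\<^sub>m d d)"
        proof (cases "g \<in> S")
          case True
          have "\<rho> g * E * \<rho> (inv g) * E = \<rho> g * (E * \<rho> (inv g)) * E" using E r' by (simp add: mat_assoc)
          also have "E * \<rho> (inv g) = \<rho> (inv g) * E" using sE[of "inv g"] True by simp
          also have "\<rho> g * (\<rho> (inv g) * E) * E = (\<rho> g * \<rho> (inv g)) * (E * E)"
            using E r' by (simp add: mat_assoc)
          finally show ?thesis using True is_rep_inv[OF \<open>group G\<close> \<rho> g] EE E by simp
        next
          case False
          then have "inv g \<notin> S" using S.m_inv_closed[of "inv g"] g by auto
          have "\<rho> g * E * \<rho> (inv g) * E = \<rho> g * (E * (\<rho> (inv g) * E))" using E r' by (simp add: mat_assoc)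
          then show ?thesis using EgE[of "inv g"] \<open>inv g \<notin> S\<close> False g r' by simp
        qed
      qed
      also have "\<dots> = of_nat (card S) \<cdot>\<^sub>m E" using E assms(2) S.subset by (intro mat_sum_const) auto
      finally show ?thesis .
    qed
    define V where "V = {v \<in> carrier_vec d. \<forall>i\<in>{()}. T *\<^sub>v v = of_nat (card S) \<cdot>\<^sub>v v}"
    have V: "lin_subspace d V" unfolding V_def using T by (intro lin_subspace_eigen)
    have Vinv: "\<forall>g\<in>carrier G. \<forall>v\<in>V. \<rho> g *\<^sub>v v \<in> V"
    proof (intro ballI)
      fix g v assume g: "g \<in> carrier G" and v: "v \<in> V"
      have vc: "v \<in> carrier_vec d" using v by (simp add: V_def)
      have "T *\<^sub>v (\<rho> g *\<^sub>v v) = T * \<rho> g *\<^sub>v v" using T r[OF g] vc by simp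
      also have "\<dots> = \<rho> g *\<^sub>v (T *\<^sub>v v)"
        unfolding Tcomm[OF g, symmetric] using T r[OF g] vc by simp
      also have "\<dots> = of_nat (card S) \<cdot>\<^sub>v (\<rho> g *\<^sub>v v)" using v r(1)[OF g] by (simp add: V_def mult_mat_vec)
      finally show "\<rho> g *\<^sub>v v \<in> V" using v r[OF g] by (simp add: V_def)
    qed
    obtain v where v: "v \<in> carrier_vec d" "E *\<^sub>v v \<noteq> 0\<^sub>v d"
      using mat_eqI_vec[OF E, of "0\<^sub>m d d"] E0 by (auto simp: zero_mat_mult_vec)
    have "T *\<^sub>v (E *\<^sub>v v) = (of_nat (card S) \<cdot>\<^sub>m E) *\<^sub>v v"
      unfolding TE[symmetric] using T E v by simp
    also have "\<dots> = of_nat (card S) \<cdot>\<^sub>v (E *\<^sub>v v)" using E v by (intro eq_vecI) auto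
    finally have "E *\<^sub>v v \<in> V" using E v by (simp add: V_def)
    then have VU: "V = carrier_vec d" using irr_rep_cases[OF irr V Vinv] v by blast
    have "T = of_nat (card S) \<cdot>\<^sub>m 1\<^sub>m d"
    proof (rule mat_eqI_vec)
      fix v :: "complex vec" assume v: "v \<in> carrier_vec d"
      then have "T *\<^sub>v v = of_nat (card S) \<cdot>\<^sub>v v" using VU by (auto simp: V_def)
      also have "\<dots> = (of_nat (card S) \<cdot>\<^sub>m 1\<^sub>m d) *\<^sub>v v" using v by (intro eq_vecI) auto
      finally show "T *\<^sub>v v = (of_nat (card S) \<cdot>\<^sub>m 1\<^sub>m d) *\<^sub>v v" .
    qed (use T in auto)
    then have "mat_trace T = of_nat (card S) * of_nat d"
      by (simp add: mat_trace_smult[of _ d] mat_trace_one)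
    moreover have "mat_trace T = of_nat (card (carrier G)) * of_nat k"
    proof -
      have "mat_trace (\<rho> g * E * \<rho> (inv g)) = of_nat k" if g: "g \<in> carrier G" for g
      proof -
        note r' = r[OF g] r[OF inv_closed[OF g]]
        have "mat_trace (\<rho> g * E * \<rho> (inv g)) = mat_trace (\<rho> (inv g) * (\<rho> g * E))"
          using E r' by (intro mat_trace_comm[of _ d d]) auto
        also have "\<rho> (inv g) * (\<rho> g * E) = \<rho> (inv g) * \<rho> g * E" using E r' by (simp add: mat_assoc)
        finally show ?thesis using is_rep_inv[OF \<open>group G\<close> \<rho> g] E trE by simp
      qed
      then show ?thesis unfolding T_def using Tc by (simp add: mat_trace_sum)
    qed
    ultimately have "of_nat (d * card S) = (of_nat (card (carrier G) * k) :: complex)"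
      by (simp add: mult.commute)
    then show ?thesis by (simp only: of_nat_eq_iff)
  qed
  ultimately show thesis using that by blast
qed

section \<open>The groups \<open>U\<close> and their first rows\<close>

lemma sum_ends: "(\<Sum>k<Suc (Suc n). f k) = f 0 + (\<Sum>k<n. f (Suc k)) + (f (Suc n) :: 'a::comm_monoid_add)"
  by (simp only: sum.lessThan_Suc[of f "Suc n"] sum.lessThan_Suc_shift[of f n])

text \<open>The condition A^T J A = J entry by entry: columns i and j pair to 1 exactly if they are
  mirror images, where the mirror of k is 2n - 1 - k in positions counted from 0.\<close>

lemma orth_unip_iff:
  "A \<in> orth_unip_set n \<longleftrightarrow> A \<in> carrier_mat (2 * n) (2 * n) \<and>
     (\<forall>i j. j \<le> i \<longrightarrow> i < 2 * n \<longrightarrow> A $$ (i, j) = (if i = j then 1 else 0)) \<and>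
     (\<forall>i<2 * n. \<forall>j<2 * n. (\<Sum>k<2 * n. A $$ (k, i) * A $$ (2 * n - 1 - k, j)) = (if i + j + 1 = 2 * n then 1 else 0))"
    (is "_ \<longleftrightarrow> ?C \<and> ?T \<and> ?F")
proof -
  have T: "A \<in> unitriangular (2 * n) \<longleftrightarrow> ?C \<and> ?T"
    by (auto simp: unitriangular_def upper_triangular_def)
  have F: "transpose_mat A * antidiag (2 * n) * A = antidiag (2 * n) \<longleftrightarrow> ?F" if A: ?C
  proof -
    have e: "(transpose_mat A * antidiag (2 * n) * A) $$ (i, j) = (\<Sum>k<2 * n. A $$ (k, i) * A $$ (2 * n - 1 - k, j))"
      if "i < 2 * n" "j < 2 * n" for i j
    proof -
      have "transpose_mat A * antidiag (2 * n) * A = transpose_mat A * (antidiag (2 * n) * A)"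
        using A by (simp add: mat_assoc)
      also have "\<dots> $$ (i, j) = (\<Sum>k<2 * n. transpose_mat A $$ (i, k) * (antidiag (2 * n) * A) $$ (k, j))"
        using A that by (intro mat_mult_index[of _ _ "2 * n" _ "2 * n"]) auto
      also have "\<dots> = (\<Sum>k<2 * n. A $$ (k, i) * A $$ (2 * n - 1 - k, j))"
        using A that by (intro sum.cong) (auto simp: antidiag_mult_index[OF A] simp del: index_mult_mat(1))
      finally show ?thesis .
    qed
    have "transpose_mat A * antidiag (2 * n) * A = antidiag (2 * n) \<longleftrightarrow>
      (\<forall>i<2 * n. \<forall>j<2 * n. (transpose_mat A * antidiag (2 * n) * A) $$ (i, j) = (antidiag (2 * n) :: 'a mat) $$ (i, j))"
      using A by (auto simp del: index_mult_mat(1) intro!: eq_matI)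
    also have "\<dots> \<longleftrightarrow> ?F" using e by (auto simp: antidiag_def simp del: index_mult_mat(1))
    finally show ?thesis .
  qed
  show ?thesis using T F by (auto simp: orth_unip_set_eq)
qed

lemma orth_unipD:
  assumes "A \<in> orth_unip_set n"
  shows "A \<in> carrier_mat (2 * n) (2 * n)" "dim_row A = 2 * n" "dim_col A = 2 * n"
    and "j \<le> i \<Longrightarrow> i < 2 * n \<Longrightarrow> A $$ (i, j) = (if i = j then 1 else 0)"
    and "i < 2 * n \<Longrightarrow> j < 2 * n \<Longrightarrow>
      (\<Sum>k<2 * n. A $$ (k, i) * A $$ (2 * n - 1 - k, j)) = (if i + j + 1 = 2 * n then 1 else 0)"
  using assms by (auto simp: orth_unip_iff)

lemma orth_unip_simps:
  "carrier (orth_unip n) = orth_unip_set n" "A \<otimes>\<^bsub>orth_unip n\<^esub> B = A * B" "\<one>\<^bsub>orth_unip n\<^esub> = 1\<^sub>m (2 * n)"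
  by (simp_all add: orth_unip_def)

lemma orth_unip_mult: "A \<in> orth_unip_set n \<Longrightarrow> B \<in> orth_unip_set n \<Longrightarrow> A * B \<in> orth_unip_set (n :: nat)"
  for A B :: "'a::field mat"
  using group.is_monoid[OF group_orth_unip[of n]] monoid.m_closed[of "orth_unip n" A B]
  by (simp add: orth_unip_simps)

lemma orth_unip_one: "1\<^sub>m (2 * n) \<in> (orth_unip_set n :: 'a::field mat set)"
  using group.is_monoid[OF group_orth_unip[of n]] monoid.one_closed[of "orth_unip n :: 'a mat monoid"]
  by (simp add: orth_unip_simps)

lemma orth_unip_inv_closed: "A \<in> orth_unip_set n \<Longrightarrow> inv\<^bsub>orth_unip n\<^esub> A \<in> orth_unip_set (n :: nat)"
  for A :: "'a::field mat"
  using group.inv_closed[OF group_orth_unip[of n], of A] by (simp add: orth_unip_simps)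

lemma orth_unip_inv_mult:
  fixes A :: "'a::field mat"
  assumes "A \<in> orth_unip_set n"
  shows "inv\<^bsub>orth_unip n\<^esub> A * A = 1\<^sub>m (2 * n)" "A * inv\<^bsub>orth_unip n\<^esub> A = 1\<^sub>m (2 * n)"
  using group.l_inv[OF group_orth_unip[of n], of A] group.r_inv[OF group_orth_unip[of n], of A] assms
  by (simp_all add: orth_unip_simps)

text \<open>From A^T J A = J the inverse is J A^T J, the reflection of A in the
  antidiagonal.\<close>

lemma orth_unip_inv_index:
  fixes A :: "'a::field mat"
  assumes A: "A \<in> orth_unip_set n" and ij: "i < 2 * n" "j < 2 * n"
  shows "(inv\<^bsub>orth_unip n\<^esub> A) $$ (i, j) = A $$ (2 * n - 1 - j, 2 * n - 1 - i)"
proof -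
  let ?N = "2 * n" and ?J = "antidiag (2 * n) :: 'a mat"
  let ?B = "?J * transpose_mat A * ?J"
  note Ac = orth_unipD[OF A] and Ic = orth_unipD[OF orth_unip_inv_closed[OF A]]
  have f: "transpose_mat A * ?J * A = ?J" using A by (simp add: orth_unip_set_eq)
  have "?B * A = ?J * (transpose_mat A * ?J * A)" using Ac by (simp add: mat_assoc)
  then have BA: "?B * A = 1\<^sub>m ?N" by (simp add: f)
  have "?B = ?B * (A * inv\<^bsub>orth_unip n\<^esub> A)" using orth_unip_inv_mult(2)[OF A] Ac by simp
  also have "\<dots> = ?B * A * inv\<^bsub>orth_unip n\<^esub> A" using Ac Ic by (simp add: mat_assoc)
  also have "\<dots> = inv\<^bsub>orth_unip n\<^esub> A" using BA Ic by simp
  finally show ?thesis using antidiag_conj_index[OF Ac(1) ij] by simp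
qed

text \<open>The first basis vector e is isotropic and fixed by the group; this is the induced action
  on the orthogonal complement of e modulo e. Its kernel is the subgroup N.\<close>

definition mid :: "nat \<Rightarrow> 'a mat \<Rightarrow> 'a mat" where
  "mid n A = mat (2 * n) (2 * n) (\<lambda>(i, j). A $$ (Suc i, Suc j))"

lemma mid_index: "i < 2 * n \<Longrightarrow> j < 2 * n \<Longrightarrow> mid n A $$ (i, j) = A $$ (Suc i, Suc j)"
  by (simp add: mid_def)

lemma mid_dim [simp]: "mid n A \<in> carrier_mat (2 * n) (2 * n)" "dim_row (mid n A) = 2 * n" "dim_col (mid n A) = 2 * n"
  by (simp_all add: mid_def)

lemma mid_closed:
  fixes A :: "'a::field mat"
  assumes A: "A \<in> orth_unip_set (Suc n)"
  shows "mid n A \<in> orth_unip_set n"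
  unfolding orth_unip_iff
proof (intro conjI allI impI)
  fix i j assume "j \<le> i" "i < 2 * n"
  then show "mid n A $$ (i, j) = (if i = j then 1 else 0)"
    using orth_unipD(4)[OF A, of "Suc j" "Suc i"] by (simp add: mid_index)
next
  fix i j assume ij: "i < 2 * n" "j < 2 * n"
  have "(\<Sum>k<2 * n. A $$ (Suc k, Suc i) * A $$ (2 * n - k, Suc j)) =
    (\<Sum>k<2 * Suc n. A $$ (k, Suc i) * A $$ (2 * Suc n - 1 - k, Suc j))"
    using orth_unipD(4)[OF A, of "Suc j" "Suc (2 * n)"] orth_unipD(4)[OF A, of "Suc i" "Suc (2 * n)"] ij
    by (simp add: sum_ends del: sum.lessThan_Suc)
  also have "\<dots> = (if i + j + 1 = 2 * n then 1 else 0)"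
    using orth_unipD(5)[OF A, of "Suc i" "Suc j"] ij by simp
  finally have "(\<Sum>k<2 * n. A $$ (Suc k, Suc i) * A $$ (2 * n - k, Suc j)) = (if i + j + 1 = 2 * n then 1 else 0)" .
  moreover have "(\<Sum>k<2 * n. mid n A $$ (k, i) * mid n A $$ (2 * n - 1 - k, j)) =
    (\<Sum>k<2 * n. A $$ (Suc k, Suc i) * A $$ (2 * n - k, Suc j))"
    using ij by (intro sum.cong) (auto simp: mid_index Suc_diff_Suc)
  ultimately show "(\<Sum>k<2 * n. mid n A $$ (k, i) * mid n A $$ (2 * n - 1 - k, j)) = (if i + j + 1 = 2 * n then 1 else 0)"
    by simp
qed simp

lemma mid_mult:
  fixes A B :: "'a::field mat"
  assumes A: "A \<in> orth_unip_set (Suc n)" and B: "B \<in> orth_unip_set (Suc n)"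
  shows "mid n (A * B) = mid n A * mid n B"
proof (rule eq_matI)
  fix i j assume "i < dim_row (mid n A * mid n B)" "j < dim_col (mid n A * mid n B)"
  then have ij: "i < 2 * n" "j < 2 * n" by auto
  have "mid n (A * B) $$ (i, j) = (\<Sum>k<Suc (Suc (2 * n)). A $$ (Suc i, k) * B $$ (k, Suc j))"
    using ij mat_mult_index[OF orth_unipD(1)[OF A] orth_unipD(1)[OF B], of "Suc i" "Suc j"]
    by (simp add: mid_index del: index_mult_mat(1) sum.lessThan_Suc)
  also have "\<dots> = (\<Sum>k<2 * n. A $$ (Suc i, Suc k) * B $$ (Suc k, Suc j))"
    using orth_unipD(4)[OF A, of 0 "Suc i"] orth_unipD(4)[OF B, of "Suc j" "Suc (2 * n)"] ij
    by (simp add: sum_ends del: sum.lessThan_Suc)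
  also have "\<dots> = (\<Sum>k<2 * n. mid n A $$ (i, k) * mid n B $$ (k, j))"
    using ij by (intro sum.cong) (auto simp: mid_index)
  also have "\<dots> = (mid n A * mid n B) $$ (i, j)"
    by (rule mat_mult_index[symmetric]) (use ij in auto)
  finally show "mid n (A * B) $$ (i, j) = (mid n A * mid n B) $$ (i, j)" .
qed auto

lemma mid_one: "mid n (1\<^sub>m (2 * Suc n)) = 1\<^sub>m (2 * n)"
  by (rule eq_matI) (auto simp: mid_index)

lemma mid_hom: "mid n \<in> hom (orth_unip (Suc n)) (orth_unip n :: 'a::field mat monoid)"
  by (auto simp: hom_def orth_unip_simps mid_closed mid_mult)

text \<open>\<open>ins n k\<close> skips the index \<open>k\<close> and its mirror image, so that \<open>emb n k\<close> embeds \<open>U\<^sub>n\<close> into \<open>U\<^sub>n\<^sub>+\<^sub>1\<close>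
  as a group acting trivially on these two coordinates.\<close>

definition ins :: "nat \<Rightarrow> nat \<Rightarrow> nat \<Rightarrow> nat" where
  "ins n k i = (if i < k then i else if i < 2 * n - k then Suc i else Suc (Suc i))"

definition emb :: "nat \<Rightarrow> nat \<Rightarrow> 'a::semiring_1 mat \<Rightarrow> 'a mat" where
  "emb n k A = mat (2 * Suc n) (2 * Suc n) (\<lambda>(i, j).
     if i = j then 1 else if i \<in> ins n k ` {..<2 * n} \<and> j \<in> ins n k ` {..<2 * n}
     then A $$ (inv_into {..<2 * n} (ins n k) i, inv_into {..<2 * n} (ins n k) j) else 0)"

lemma ins_strict_mono: "i < j \<Longrightarrow> ins n k i < ins n k j"
  by (auto simp: ins_def)

lemma ins_less_iff [simp]: "ins n k i < ins n k j \<longleftrightarrow> i < j"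
  by (metis ins_strict_mono less_asym' linorder_neqE_nat)

lemma ins_eq_iff [simp]: "ins n k i = ins n k j \<longleftrightarrow> i = j"
  by (metis ins_less_iff less_irrefl linorder_neqE_nat)

lemma ins_range:
  assumes "k \<le> n" "i < 2 * n"
  shows "ins n k i < 2 * Suc n" "ins n k i \<noteq> k" "ins n k i \<noteq> 2 * n + 1 - k"
  using assms by (auto simp: ins_def)

text \<open>Skipping a mirrored pair commutes with reflection; this is why \<open>emb\<close>
  preserves the form.\<close>

lemma ins_bar:
  assumes "k \<le> n" "i < 2 * n"
  shows "2 * n + 1 - ins n k i = ins n k (2 * n - 1 - i)"
  using assms by (auto simp: ins_def)

lemma ins_image: "k \<le> n \<Longrightarrow> ins n k ` {..<2 * n} = {..<2 * Suc n} - {k, 2 * n + 1 - k}"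
proof (intro equalityI subsetI)
  fix m assume k: "k \<le> n" and m: "m \<in> {..<2 * Suc n} - {k, 2 * n + 1 - k}"
  show "m \<in> ins n k ` {..<2 * n}"
  proof (rule image_eqI)
    let ?i = "if m < k then m else if m < 2 * n + 1 - k then m - 1 else m - 2"
    show "m = ins n k ?i" "?i \<in> {..<2 * n}" using k m by (auto simp: ins_def)
  qed
qed (use ins_range in auto)

lemma emb_dim [simp]: "emb n k A \<in> carrier_mat (2 * Suc n) (2 * Suc n)"
  "dim_row (emb n k A) = 2 * Suc n" "dim_col (emb n k A) = 2 * Suc n"
  by (simp_all add: emb_def)

text \<open>\<open>emb\<close> writes 1 on the diagonal without consulting \<open>A\<close>, so the
  diagonal entry of \<open>A\<close> has to be 1 for the entries to be copied faithfully.\<close>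

lemma emb_ins:
  assumes "k \<le> n" "i < 2 * n" "j < 2 * n" "A $$ (i, i) = 1"
  shows "emb n k A $$ (ins n k i, ins n k j) = A $$ (i, j)"
proof -
  have inj: "inj_on (ins n k) {..<2 * n}" by (auto simp: inj_on_def)
  then show ?thesis using assms ins_range[OF assms(1)] by (auto simp: emb_def inv_into_f_f[OF inj])
qed

lemma emb_row:
  assumes "k \<le> n" "i = k \<or> i = 2 * n + 1 - k" "j < 2 * Suc n"
  shows "emb n k A $$ (i, j) = (if i = j then 1 else 0)" "emb n k A $$ (j, i) = (if i = j then 1 else 0)"
  using assms by (auto simp: emb_def ins_image)

lemma sum_ins:
  assumes "k \<le> n"
  shows "(\<Sum>m<2 * Suc n. f m) = f k + f (2 * n + 1 - k) + (\<Sum>i<2 * n. f (ins n k i) :: 'a::comm_monoid_add)"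
proof -
  have "{..<2 * Suc n} = {k, 2 * n + 1 - k} \<union> ins n k ` {..<2 * n}"
    using assms by (auto simp: ins_image)
  then have "(\<Sum>m<2 * Suc n. f m) = (\<Sum>m\<in>{k, 2 * n + 1 - k}. f m) + (\<Sum>m\<in>ins n k ` {..<2 * n}. f m)"
    using assms by (simp only:) (subst sum.union_disjoint, auto simp: ins_image)
  also have "(\<Sum>m\<in>ins n k ` {..<2 * n}. f m) = (\<Sum>i<2 * n. f (ins n k i))"
    by (subst sum.reindex) (auto simp: inj_on_def)
  also have "(\<Sum>m\<in>{k, 2 * n + 1 - k}. f m) = f k + f (2 * n + 1 - k)"
    using assms by simp
  finally show ?thesis .
qed

lemma ins_cases:
  assumes "k \<le> n" "m < 2 * Suc n"
  obtains "m = k \<or> m = 2 * n + 1 - k" | i where "i < 2 * n" "m = ins n k i"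
  using assms ins_image[OF assms(1)] by auto

lemma emb_closed:
  fixes A :: "'a::field mat"
  assumes k: "k \<le> n" and A: "A \<in> orth_unip_set n"
  shows "emb n k A \<in> orth_unip_set (Suc n)"
  unfolding orth_unip_iff
proof (intro conjI allI impI)
  have d: "A $$ (i, i) = 1" if "i < 2 * n" for i using orth_unipD(4)[OF A, of i i] that by simp
  {
    fix i j assume ij: "j \<le> i" "i < 2 * Suc n"
    then have j: "j < 2 * Suc n" by simp
    show "emb n k A $$ (i, j) = (if i = j then 1 else 0)"
    proof (cases rule: ins_cases[OF k ij(2)])
      case 1
      then show ?thesis using emb_row(1)[OF k _ j, of i A] by blast
    next
      case (2 i')
      show ?thesis
      proof (cases rule: ins_cases[OF k j])
        case 1
        then show ?thesis using emb_row(2)[OF k _ ij(2), of j A] by (auto simp: eq_commute[of i j])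
      next
        case j': (2 j')
        then have "j' \<le> i'" using ij 2 by (metis ins_less_iff leD leI)
        then show ?thesis using emb_ins[OF k 2(1) j'(1), of A] d[OF 2(1)] 2 j' orth_unipD(4)[OF A, of j' i'] by simp
      qed
    qed
  next
    fix i j assume ij: "i < 2 * Suc n" "j < 2 * Suc n"
    let ?E = "emb n k A"
    have bar: "2 * Suc n - 1 - m = 2 * n + 1 - m" for m by simp
    have r: "?E $$ (a, m) = (if a = m then 1 else 0)" "?E $$ (m, a) = (if a = m then 1 else 0)"
      if "a = k \<or> a = 2 * n + 1 - k" "m < 2 * Suc n" for a m using emb_row[OF k that] .
    have "(\<Sum>m<2 * Suc n. ?E $$ (m, i) * ?E $$ (2 * n + 1 - m, j)) = (if i + j = 2 * n + 1 then 1 else 0)"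
    proof (cases rule: ins_cases[OF k ij(1)])
      case 1
      then have i': "2 * n + 1 - i = k \<or> 2 * n + 1 - i = 2 * n + 1 - k" using k by auto
      have "(\<Sum>m<2 * Suc n. ?E $$ (m, i) * ?E $$ (2 * n + 1 - m, j)) =
        (\<Sum>m<2 * Suc n. if m = i then ?E $$ (2 * n + 1 - i, j) else 0)"
        using r(2)[OF 1] by (intro sum.cong) auto
      also have "\<dots> = ?E $$ (2 * n + 1 - i, j)" using ij by (subst sum.delta) auto
      also have "\<dots> = (if 2 * n + 1 - i = j then 1 else 0)" by (rule r(1)[OF i' ij(2)])
      also have "\<dots> = (if i + j = 2 * n + 1 then 1 else 0)" using ij by auto
      finally show ?thesis .
    next
      case i: (2 i')
      show ?thesis
      proof (cases rule: ins_cases[OF k ij(2)])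
        case 1
        then have j': "2 * n + 1 - j = k \<or> 2 * n + 1 - j = 2 * n + 1 - k" using k by auto
        have "(\<Sum>m<2 * Suc n. ?E $$ (m, i) * ?E $$ (2 * n + 1 - m, j)) =
          (\<Sum>m<2 * Suc n. if m = 2 * n + 1 - j then ?E $$ (2 * n + 1 - j, i) else 0)"
        proof (intro sum.cong refl)
          fix m assume "m \<in> {..<2 * Suc n}"
          then have m: "m < 2 * Suc n" "2 * n + 1 - m = j \<longleftrightarrow> m = 2 * n + 1 - j" using ij by auto
          have "?E $$ (2 * n + 1 - m, j) = (if 2 * n + 1 - m = j then 1 else 0)"
            using r(2)[OF 1, of "2 * n + 1 - m"] by auto
          then show "?E $$ (m, i) * ?E $$ (2 * n + 1 - m, j) =
              (if m = 2 * n + 1 - j then ?E $$ (2 * n + 1 - j, i) else 0)"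
            unfolding m(2) by simp
        qed
        also have "\<dots> = ?E $$ (2 * n + 1 - j, i)" using ij by (subst sum.delta) auto
        also have "\<dots> = (if 2 * n + 1 - j = i then 1 else 0)" by (rule r(1)[OF j' ij(1)])
        also have "\<dots> = (if i + j = 2 * n + 1 then 1 else 0)" using ij by auto
        finally show ?thesis .
      next
        case j: (2 j')
        have "(\<Sum>m<2 * Suc n. ?E $$ (m, i) * ?E $$ (2 * n + 1 - m, j)) =
          (\<Sum>l<2 * n. ?E $$ (ins n k l, i) * ?E $$ (2 * n + 1 - ins n k l, j))"
          using r(1)[of k i] r(1)[of "2 * n + 1 - k" i] i ij ins_range[OF k i(1)] by (subst sum_ins[OF k]) auto
        also have "\<dots> = (\<Sum>l<2 * n. A $$ (l, i') * A $$ (2 * n - 1 - l, j'))"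
          using i j emb_ins[OF k _ i(1), of _ A] emb_ins[OF k _ j(1), of _ A] d
          by (intro sum.cong) (auto simp: ins_bar[OF k, simplified])
        also have "\<dots> = (if i' + j' + 1 = 2 * n then 1 else 0)" using orth_unipD(5)[OF A i(1) j(1)] .
        also have "i' + j' + 1 = 2 * n \<longleftrightarrow> j = 2 * n + 1 - i"
          using i j ins_bar[OF k i(1)] by auto
        also have "\<dots> \<longleftrightarrow> i + j = 2 * n + 1" using ij by auto
        finally show ?thesis .
      qed
    qed
    then show "(\<Sum>m<2 * Suc n. ?E $$ (m, i) * ?E $$ (2 * Suc n - 1 - m, j)) = (if i + j + 1 = 2 * Suc n then 1 else 0)"
      unfolding bar by simp
  }
qed (rule emb_dim)

lemma emb_mult:
  fixes A B :: "'a::field mat"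
  assumes k: "k \<le> n" and A: "A \<in> orth_unip_set n" and B: "B \<in> orth_unip_set n"
  shows "emb n k (A * B) = emb n k A * emb n k B"
proof (rule eq_matI)
  note AB = orth_unip_mult[OF A B]
  have d: "C $$ (i, i) = 1" if "i < 2 * n" "C \<in> orth_unip_set n" for i and C :: "'a mat"
    using orth_unipD(4)[OF that(2), of i i] that by simp
  fix i j assume "i < dim_row (emb n k A * emb n k B)" "j < dim_col (emb n k A * emb n k B)"
  then have ij: "i < 2 * Suc n" "j < 2 * Suc n" by auto
  have r: "emb n k C $$ (a, m) = (if a = m then 1 else 0)" "emb n k C $$ (m, a) = (if a = m then 1 else 0)"
    if "a = k \<or> a = 2 * n + 1 - k" "m < 2 * Suc n" for a m and C :: "'a mat" using emb_row[OF k that] .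
  have "(emb n k A * emb n k B) $$ (i, j) = (\<Sum>m<2 * Suc n. emb n k A $$ (i, m) * emb n k B $$ (m, j))"
    by (rule mat_mult_index) (use ij in auto)
  also have "\<dots> = emb n k (A * B) $$ (i, j)"
  proof (cases rule: ins_cases[OF k ij(1)])
    case 1
    have "(\<Sum>m<2 * Suc n. emb n k A $$ (i, m) * emb n k B $$ (m, j)) =
      (\<Sum>m<2 * Suc n. if m = i then emb n k B $$ (i, j) else 0)"
      using r(1)[OF 1] by (intro sum.cong) auto
    also have "\<dots> = emb n k B $$ (i, j)" using ij by simp
    also have "\<dots> = emb n k (A * B) $$ (i, j)" by (simp only: r(1)[OF 1 ij(2)])
    finally show ?thesis .
  next
    case i: (2 i')
    show ?thesis
    proof (cases rule: ins_cases[OF k ij(2)])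
      case 1
      have "(\<Sum>m<2 * Suc n. emb n k A $$ (i, m) * emb n k B $$ (m, j)) =
        (\<Sum>m<2 * Suc n. if m = j then emb n k A $$ (i, j) else 0)"
        using r(2)[OF 1] by (intro sum.cong) auto
      also have "\<dots> = emb n k A $$ (i, j)" using ij by simp
      also have "\<dots> = emb n k (A * B) $$ (i, j)" by (simp only: r(2)[OF 1 ij(1)])
      finally show ?thesis .
    next
      case j: (2 j')
      have "(\<Sum>m<2 * Suc n. emb n k A $$ (i, m) * emb n k B $$ (m, j)) =
        (\<Sum>l<2 * n. emb n k A $$ (i, ins n k l) * emb n k B $$ (ins n k l, j))"
        using r(2)[of k i A] r(2)[of "2 * n + 1 - k" i A] i ij ins_range[OF k i(1)] by (subst sum_ins[OF k]) auto
      also have "\<dots> = (\<Sum>l<2 * n. A $$ (i', l) * B $$ (l, j'))"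
        using i j emb_ins[OF k i(1), of _ A] emb_ins[OF k _ j(1), of _ B] d[OF _ A] d[OF _ B]
        by (intro sum.cong) auto
      also have "\<dots> = (A * B) $$ (i', j')"
        by (rule mat_mult_index[symmetric]) (use i j orth_unipD[OF A] orth_unipD[OF B] in auto)
      also have "\<dots> = emb n k (A * B) $$ (i, j)"
        using emb_ins[OF k i(1) j(1), of "A * B"] d[OF i(1) AB] i j by simp
      finally show ?thesis .
    qed
  qed
  finally show "emb n k (A * B) $$ (i, j) = (emb n k A * emb n k B) $$ (i, j)" ..
qed auto

lemma emb_hom: "k \<le> n \<Longrightarrow> emb n k \<in> hom (orth_unip n) (orth_unip (Suc n) :: 'a::field mat monoid)"
  by (auto simp: hom_def orth_unip_simps emb_closed emb_mult)

lemma emb_inj: 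
  fixes A B :: "'a::field mat"
  assumes k: "k \<le> n" and A: "A \<in> orth_unip_set n" and B: "B \<in> orth_unip_set n" and e: "emb n k A = emb n k B"
  shows "A = B"
proof (rule eq_matI)
  fix i j assume "i < dim_row B" "j < dim_col B"
  then have ij: "i < 2 * n" "j < 2 * n" using orth_unipD[OF B] by auto
  show "A $$ (i, j) = B $$ (i, j)"
    using emb_ins[OF k ij, of A] emb_ins[OF k ij, of B] orth_unipD(4)[OF A, of i i] orth_unipD(4)[OF B, of i i] ij e
    by simp
qed (use orth_unipD[OF A] orth_unipD[OF B] in auto)

lemma mid_emb:
  fixes A :: "'a::field mat"
  assumes A: "A \<in> orth_unip_set n"
  shows "mid n (emb n 0 A) = A"
proof (rule eq_matI)
  fix i j assume "i < dim_row A" "j < dim_col A"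
  then have ij: "i < 2 * n" "j < 2 * n" using orth_unipD[OF A] by auto
  then show "mid n (emb n 0 A) $$ (i, j) = A $$ (i, j)"
    using emb_ins[of 0 n i j A] orth_unipD(4)[OF A, of i i] by (simp add: mid_index ins_def)
qed (use orth_unipD[OF A] in auto)

lemma emb0_row: 
  assumes "j < 2 * Suc n"
  shows "emb n 0 A $$ (0, j) = (if j = 0 then 1 else 0)" "emb n 0 A $$ (j, Suc (2 * n)) = (if j = Suc (2 * n) then 1 else 0)"
  using emb_row[of 0 n 0 j A] emb_row[of 0 n "Suc (2 * n)" j A] assms by auto

text \<open>The kernel of \<open>mid\<close>: the inner part \<open>a\<close> of the first row is arbitrary and determines the rest.\<close>

definition Nel :: "nat \<Rightarrow> (nat \<Rightarrow> 'a::field) \<Rightarrow> 'a mat" where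
  "Nel n a = mat (2 * Suc n) (2 * Suc n) (\<lambda>(i, j).
     if i = j then 1
     else if i = 0 then (if j \<le> 2 * n then a (j - 1) else - (\<Sum>l<2 * n. a l * a (2 * n - 1 - l)) / 2)
     else if j = Suc (2 * n) then - a (2 * n - i) else 0)"

lemma Nel_dim [simp]: "Nel n a \<in> carrier_mat (2 * Suc n) (2 * Suc n)"
  "dim_row (Nel n a) = 2 * Suc n" "dim_col (Nel n a) = 2 * Suc n"
  by (simp_all add: Nel_def)

lemma Nel_index:
  "m < 2 * n \<Longrightarrow> Nel n a $$ (0, Suc m) = a m"
  "m < 2 * n \<Longrightarrow> Nel n a $$ (Suc m, Suc (2 * n)) = - a (2 * n - 1 - m)"
  "Nel n a $$ (0, Suc (2 * n)) = - (\<Sum>l<2 * n. a l * a (2 * n - 1 - l)) / 2"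
  "l < 2 * n \<Longrightarrow> m < 2 * n \<Longrightarrow> Nel n a $$ (Suc l, Suc m) = (if l = m then 1 else 0)"
  "j \<le> i \<Longrightarrow> i < 2 * Suc n \<Longrightarrow> Nel n a $$ (i, j) = (if i = j then 1 else 0)"
  by (auto simp: Nel_def)

lemma ends_cases:
  assumes "i < 2 * Suc n"
  obtains "i = 0" | m where "m < 2 * n" "i = Suc m" | "i = Suc (2 * n)"
  using assms by (cases i) (auto simp: less_Suc_eq)

lemma Nel_closed:
  fixes a :: "nat \<Rightarrow> 'a::field"
  assumes two: "(2 :: 'a) \<noteq> 0"
  shows "Nel n a \<in> orth_unip_set (Suc n)"
  unfolding orth_unip_iff
proof (intro conjI allI impI)
  fix p q assume pq: "p < 2 * Suc n" "q < 2 * Suc n"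
  let ?A = "Nel n a"
  have "(\<Sum>k<2 * Suc n. ?A $$ (k, p) * ?A $$ (2 * Suc n - 1 - k, q)) =
    ?A $$ (0, p) * ?A $$ (Suc (2 * n), q) + (\<Sum>k<2 * n. ?A $$ (Suc k, p) * ?A $$ (2 * n - k, q))
      + ?A $$ (Suc (2 * n), p) * ?A $$ (0, q)"
    by (simp add: sum_ends del: sum.lessThan_Suc)
  also have "(\<Sum>k<2 * n. ?A $$ (Suc k, p) * ?A $$ (2 * n - k, q)) =
    (\<Sum>k<2 * n. ?A $$ (Suc k, p) * ?A $$ (Suc (2 * n - 1 - k), q))"
    by (intro sum.cong) (auto simp: Suc_diff_Suc)
  also have "?A $$ (0, p) * ?A $$ (Suc (2 * n), q) + (\<Sum>k<2 * n. ?A $$ (Suc k, p) * ?A $$ (Suc (2 * n - 1 - k), q))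
      + ?A $$ (Suc (2 * n), p) * ?A $$ (0, q) = (if p + q = 2 * n + 1 then 1 else 0)"
  proof (cases rule: ends_cases[OF pq(1)])
    case 1
    have "(\<Sum>k<2 * n. ?A $$ (Suc k, 0) * ?A $$ (Suc (2 * n - 1 - k), q)) = 0"
      by (intro sum.neutral) (auto simp: Nel_index(5))
    then show ?thesis using 1 pq by (auto simp: Nel_index(5))
  next
    case p: (2 m)
    have "(\<Sum>k<2 * n. ?A $$ (Suc k, p) * ?A $$ (Suc (2 * n - 1 - k), q)) =
        (\<Sum>k<2 * n. if k = m then ?A $$ (Suc (2 * n - 1 - m), q) else 0)"
      using p by (intro sum.cong) (auto simp: Nel_index)
    then have s: "(\<Sum>k<2 * n. ?A $$ (Suc k, p) * ?A $$ (Suc (2 * n - 1 - k), q)) = ?A $$ (Suc (2 * n - 1 - m), q)"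
      using p by simp
    have z: "?A $$ (Suc (2 * n), p) = 0" using p by (simp add: Nel_index(5))
    show ?thesis
    proof (cases rule: ends_cases[OF pq(2)])
      case 1
      then show ?thesis unfolding s z using p by (auto simp: Nel_index(5))
    next
      case (2 l)
      then show ?thesis unfolding s z using p by (auto simp: Nel_index)
    next
      case 3
      then show ?thesis unfolding s z using p Nel_index(2)[of "2 * n - 1 - m" n a] by (auto simp: Nel_index)
    qed
  next
    case p: 3
    show ?thesis
    proof (cases rule: ends_cases[OF pq(2)])
      case 1
      have "(\<Sum>k<2 * n. ?A $$ (Suc k, p) * ?A $$ (Suc (2 * n - 1 - k), 0)) = 0"
        by (intro sum.neutral) (auto simp: Nel_index(5))
      then show ?thesis using 1 p by (auto simp: Nel_index(5))
    next
      case q: (2 l)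
      have "(\<Sum>k<2 * n. ?A $$ (Suc k, p) * ?A $$ (Suc (2 * n - 1 - k), q)) =
          (\<Sum>k<2 * n. if k = 2 * n - 1 - l then - a l else 0)"
        using p q by (intro sum.cong) (auto simp: Nel_index)
      also have "\<dots> = - a l" using q by simp
      finally show ?thesis using p q by (auto simp: Nel_index)
    next
      case q: 3
      have "(\<Sum>k<2 * n. ?A $$ (Suc k, p) * ?A $$ (Suc (2 * n - 1 - k), q)) =
          (\<Sum>l<2 * n. a l * a (2 * n - 1 - l))"
      proof (intro sum.cong refl)
        fix k assume "k \<in> {..<2 * n}"
        then have k: "k < 2 * n" by simp
        then have "2 * n - 1 - (2 * n - 1 - k) = k" by simp
        then show "?A $$ (Suc k, p) * ?A $$ (Suc (2 * n - 1 - k), q) = a k * a (2 * n - 1 - k)"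
          using k p q Nel_index(2)[OF k, of a] Nel_index(2)[of "2 * n - 1 - k" n a] by (simp add: mult.commute)
      qed
      moreover define Q where "Q = (\<Sum>l<2 * n. a l * a (2 * n - 1 - l))"
      moreover have "?A $$ (Suc (2 * n), Suc (2 * n)) = 1" by (simp add: Nel_index(5))
      \<comment> \<open>The last column must be isotropic: twice the corner entry plus Q has to
        vanish, which is the origin of the corner -Q/2 and of the need for 2 to be
        invertible.\<close>
      moreover have "- Q / 2 * 1 + Q + 1 * (- Q / 2) = 0" using two by (simp add: field_simps)
      ultimately show ?thesis using p q by (simp only: Nel_index(3)) simp
    qed
  qed
  finally show "(\<Sum>k<2 * Suc n. ?A $$ (k, p) * ?A $$ (2 * Suc n - 1 - k, q)) = (if p + q + 1 = 2 * Suc n then 1 else 0)"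
    by simp
qed (auto simp: Nel_index(5) simp del: mult_Suc_right)

lemma mid_Nel: "mid n (Nel n a) = 1\<^sub>m (2 * n)"
  by (rule eq_matI) (auto simp: mid_index Nel_index)

text \<open>Pairing an inner column with the last one determines the last column; pairing the last
  column with itself gives twice the corner entry, which vanishes because 2 is invertible.\<close>

lemma orth_unip_eq_one:
  fixes A :: "'a::field mat"
  assumes two: "(2 :: 'a) \<noteq> 0" and A: "A \<in> orth_unip_set (Suc n)" and m: "mid n A = 1\<^sub>m (2 * n)"
    and z: "\<And>m. m < 2 * n \<Longrightarrow> A $$ (0, Suc m) = 0"
  shows "A = 1\<^sub>m (2 * Suc n)"
proof -
  have mm: "A $$ (Suc i, Suc j) = (if i = j then 1 else 0)" if "i < 2 * n" "j < 2 * n" for i j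
    using mid_index[of i n j A] that m by simp
  have t: "A $$ (i, j) = (if i = j then 1 else 0)" if "j \<le> i" "i < 2 * Suc n" for i j
    using orth_unipD(4)[OF A that] .
  have f: "A $$ (0, p) * A $$ (Suc (2 * n), q) + (\<Sum>k<2 * n. A $$ (Suc k, p) * A $$ (2 * n - k, q))
      + A $$ (Suc (2 * n), p) * A $$ (0, q) = (if p + q = 2 * n + 1 then 1 else 0)"
    if "p < 2 * Suc n" "q < 2 * Suc n" for p q
    using orth_unipD(5)[OF A that] by (simp add: sum_ends del: sum.lessThan_Suc)
  have l: "A $$ (2 * n - m, Suc (2 * n)) = 0" if m: "m < 2 * n" for m
  proof -
    have "(\<Sum>k<2 * n. A $$ (Suc k, Suc m) * A $$ (2 * n - k, Suc (2 * n))) =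
        (\<Sum>k<2 * n. if k = m then A $$ (2 * n - m, Suc (2 * n)) else 0)"
      using m by (intro sum.cong) (auto simp: mm)
    then show ?thesis using f[of "Suc m" "Suc (2 * n)"] m z[OF m] t[of "Suc m" "Suc (2 * n)"] by simp
  qed
  then have l': "A $$ (Suc k, Suc (2 * n)) = 0" if "k < 2 * n" for k
    using l[of "2 * n - 1 - k"] that by (simp add: Suc_diff_Suc)
  have "(\<Sum>k<2 * n. A $$ (Suc k, Suc (2 * n)) * A $$ (2 * n - k, Suc (2 * n))) = 0"
    using l' by (intro sum.neutral) auto
  then have "2 * A $$ (0, Suc (2 * n)) = 0"
    using f[of "Suc (2 * n)" "Suc (2 * n)"] t[of "Suc (2 * n)" "Suc (2 * n)"] by simp
  then have c: "A $$ (0, Suc (2 * n)) = 0" using two by simp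
  show ?thesis
  proof (rule eq_matI)
    fix i j assume "i < dim_row (1\<^sub>m (2 * Suc n) :: 'a mat)" "j < dim_col (1\<^sub>m (2 * Suc n) :: 'a mat)"
    then have ij: "i < 2 * Suc n" "j < 2 * Suc n" by auto
    have "A $$ (i, j) = (if i = j then 1 else 0)"
    proof (cases "j \<le> i")
      case False
      show ?thesis
      proof (cases rule: ends_cases[OF ij(1)])
        case 1
        show ?thesis by (cases rule: ends_cases[OF ij(2)]) (use 1 False z c in auto)
      next
        case i: (2 m)
        show ?thesis by (cases rule: ends_cases[OF ij(2)]) (use i False mm l' in auto)
      next
        case 3
        then show ?thesis using False ij by simp
      qed
    qed (use t ij in blast)
    then show "A $$ (i, j) = 1\<^sub>m (2 * Suc n) $$ (i, j)" using ij by simp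
  qed (use orth_unipD[OF A] in auto)
qed

text \<open>The twisted addition law of a semidirect product; with \<open>mid\<close> as second
  coordinate it describes the whole multiplication of U_(n+1).\<close>

lemma mult_first_row:
  fixes A B :: "'a::field mat"
  assumes A: "A \<in> orth_unip_set (Suc n)" and B: "B \<in> orth_unip_set (Suc n)" and m: "m < 2 * n"
  shows "(A * B) $$ (0, Suc m) = B $$ (0, Suc m) + (\<Sum>l<2 * n. A $$ (0, Suc l) * mid n B $$ (l, m))"
proof -
  have "(A * B) $$ (0, Suc m) = (\<Sum>k<2 * Suc n. A $$ (0, k) * B $$ (k, Suc m))"
    by (rule mat_mult_index[OF orth_unipD(1)[OF A] orth_unipD(1)[OF B]]) (use m in auto)
  also have "\<dots> = A $$ (0, 0) * B $$ (0, Suc m) + (\<Sum>l<2 * n. A $$ (0, Suc l) * B $$ (Suc l, Suc m)) +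
      A $$ (0, Suc (2 * n)) * B $$ (Suc (2 * n), Suc m)"
    by (simp add: sum_ends del: sum.lessThan_Suc)
  also have "(\<Sum>l<2 * n. A $$ (0, Suc l) * B $$ (Suc l, Suc m)) = (\<Sum>l<2 * n. A $$ (0, Suc l) * mid n B $$ (l, m))"
    using m by (intro sum.cong) (auto simp: mid_index)
  finally show ?thesis using orth_unipD(4)[OF A, of 0 0] orth_unipD(4)[OF B, of "Suc m" "Suc (2 * n)"] m by simp
qed

text \<open>Reduction to \<open>orth_unip_eq_one\<close> for A^-1 B. Identities between group
  elements are from here on checked on two coordinates only, \<open>mid\<close> and the inner first
  row.\<close>

lemma orth_unip_eqI:
  fixes A B :: "'a::field mat"
  assumes two: "(2 :: 'a) \<noteq> 0" and A: "A \<in> orth_unip_set (Suc n)" and B: "B \<in> orth_unip_set (Suc n)"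
    and m: "mid n A = mid n B" and z: "\<And>m. m < 2 * n \<Longrightarrow> A $$ (0, Suc m) = B $$ (0, Suc m)"
  shows "A = B"
proof -
  let ?I = "inv\<^bsub>orth_unip (Suc n)\<^esub> A"
  let ?D = "?I * B"
  have I: "?I \<in> orth_unip_set (Suc n)" using orth_unip_inv_closed[OF A] .
  have D: "?D \<in> orth_unip_set (Suc n)" using orth_unip_mult[OF I B] .
  have "mid n ?D = mid n ?I * mid n A" using mid_mult[OF I B] m by simp
  also have "\<dots> = mid n (?I * A)" by (rule mid_mult[OF I A, symmetric])
  also have "\<dots> = 1\<^sub>m (2 * n)" unfolding orth_unip_inv_mult(1)[OF A] by (rule mid_one)
  finally have mD: "mid n ?D = 1\<^sub>m (2 * n)" .
  have AD: "A * ?D = B"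
  proof -
    have "A * ?D = A * ?I * B" using orth_unipD[OF A] orth_unipD[OF I] orth_unipD[OF B] by (simp add: mat_assoc)
    then show ?thesis using orth_unip_inv_mult(2)[OF A] orth_unipD[OF B] by simp
  qed
  have "?D $$ (0, Suc m) = 0" if m: "m < 2 * n" for m
  proof -
    have "B $$ (0, Suc m) = ?D $$ (0, Suc m) + (\<Sum>l<2 * n. A $$ (0, Suc l) * mid n ?D $$ (l, m))"
      using mult_first_row[OF A D m] AD by simp
    also have "(\<Sum>l<2 * n. A $$ (0, Suc l) * mid n ?D $$ (l, m)) = (\<Sum>l<2 * n. if l = m then A $$ (0, Suc m) else 0)"
      unfolding mD using m by (intro sum.cong) auto
    also have "\<dots> = A $$ (0, Suc m)" using m by simp
    finally show ?thesis using z[OF m] by simp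
  qed
  then have "?D = 1\<^sub>m (2 * Suc n)" by (rule orth_unip_eq_one[OF two D mD])
  then show ?thesis using AD orth_unipD[OF A] by simp
qed

lemma emb0_first_row: "m < 2 * n \<Longrightarrow> emb n 0 A $$ (0, Suc m) = 0"
  using emb0_row(1)[of "Suc m" n A] by simp

lemma emb0_Nel:
  fixes h :: "'a::field mat"
  assumes two: "(2 :: 'a) \<noteq> 0" and h: "h \<in> orth_unip_set n"
  shows "emb n 0 h * Nel n b \<in> orth_unip_set (Suc n)" "mid n (emb n 0 h * Nel n b) = h"
    "m < 2 * n \<Longrightarrow> (emb n 0 h * Nel n b) $$ (0, Suc m) = b m"
proof -
  note e = emb_closed[OF _ h, of 0] and N = Nel_closed[OF two, of n b]
  show "emb n 0 h * Nel n b \<in> orth_unip_set (Suc n)" using e N by (simp add: orth_unip_mult)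
  show "mid n (emb n 0 h * Nel n b) = h"
    using mid_mult[OF e N] mid_emb[OF h] mid_Nel[of n b] orth_unipD[OF h] by simp
  show "(emb n 0 h * Nel n b) $$ (0, Suc m) = b m" if "m < 2 * n"
    using mult_first_row[OF e N that] that by (simp add: emb0_first_row Nel_index)
qed

text \<open>Conjugation acts on N linearly, by multiplying the row vector \<open>a\<close> with
  \<open>mid n g\<close>. Dually, this is how group elements move weights.\<close>

lemma Nel_mult_right:
  fixes g :: "'a::field mat"
  assumes two: "(2 :: 'a) \<noteq> 0" and g: "g \<in> orth_unip_set (Suc n)"
  shows "Nel n a * g = g * Nel n (\<lambda>m. \<Sum>l<2 * n. a l * mid n g $$ (l, m))" (is "_ = g * Nel n ?b")
proof -
  note N = Nel_closed[OF two, of n a] Nel_closed[OF two, of n ?b]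
  show ?thesis
  proof (rule orth_unip_eqI[OF two orth_unip_mult[OF N(1) g] orth_unip_mult[OF g N(2)]])
    show "mid n (Nel n a * g) = mid n (g * Nel n ?b)"
      using mid_mult[OF N(1) g] mid_mult[OF g N(2)] by (simp add: mid_Nel)
    fix m assume m: "m < 2 * n"
    have "(\<Sum>l<2 * n. g $$ (0, Suc l) * mid n (Nel n ?b) $$ (l, m)) = (\<Sum>l<2 * n. if l = m then g $$ (0, Suc m) else 0)"
      unfolding mid_Nel using m by (intro sum.cong) auto
    then show "(Nel n a * g) $$ (0, Suc m) = (g * Nel n ?b) $$ (0, Suc m)"
      using mult_first_row[OF N(1) g m] mult_first_row[OF g N(2) m] m by (simp add: Nel_index)
  qed
qed

text \<open>The corner entry is quadratic in \<open>a\<close>, yet N is additive: both coordinates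
  used by \<open>orth_unip_eqI\<close> are.\<close>

lemma Nel_mult:
  fixes a b :: "nat \<Rightarrow> 'a::field"
  assumes two: "(2 :: 'a) \<noteq> 0"
  shows "Nel n a * Nel n b = Nel n (\<lambda>m. a m + b m)"
proof -
  note N = Nel_closed[OF two, of n]
  show ?thesis
  proof (rule orth_unip_eqI[OF two orth_unip_mult[OF N N] N])
    show "mid n (Nel n a * Nel n b) = mid n (Nel n (\<lambda>m. a m + b m))"
      using mid_mult[OF N N, of a b] by (simp add: mid_Nel)
    fix m assume m: "m < 2 * n"
    have "(\<Sum>l<2 * n. a l * (1\<^sub>m (2 * n) :: 'a mat) $$ (l, m)) = (\<Sum>l<2 * n. if l = m then a m else 0)"
      using m by (intro sum.cong) auto
    then show "(Nel n a * Nel n b) $$ (0, Suc m) = Nel n (\<lambda>m. a m + b m) $$ (0, Suc m)"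
      using mult_first_row[OF N N m, of a b] m by (simp add: Nel_index mid_Nel)
  qed
qed

lemma Nel_cong: "(\<And>m. m < 2 * n \<Longrightarrow> a m = b m) \<Longrightarrow> Nel n a = Nel n b"
  by (rule eq_matI) (auto simp: Nel_def intro!: sum.cong)

lemma Nel_zero:
  assumes "\<And>m. m < 2 * n \<Longrightarrow> a m = 0"
  shows "Nel n a = 1\<^sub>m (2 * Suc n)"
proof -
  have "Nel n a = Nel n (\<lambda>_. 0)" using assms by (intro Nel_cong) auto
  also have "\<dots> = 1\<^sub>m (2 * Suc n)" by (rule eq_matI) (simp_all add: Nel_def del: mult_Suc_right)
  finally show ?thesis .
qed

section \<open>Free coordinates on the group and the orders of subsets defined by them\<close>

lemma orth_unip_bij:
  assumes two: "(2 :: 'a::field) \<noteq> 0"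
  shows "bij_betw (\<lambda>g. (mid n g, \<lambda>m\<in>{..<2 * n}. g $$ (0, Suc m)))
    (orth_unip_set (Suc n) :: 'a mat set) (orth_unip_set n \<times> ({..<2 * n} \<rightarrow>\<^sub>E UNIV))"
    (is "bij_betw ?f _ _")
  unfolding bij_betw_def
proof (intro conjI equalityI subsetI)
  show "inj_on ?f (orth_unip_set (Suc n))"
  proof (rule inj_onI)
    fix g h :: "'a mat" assume gh: "g \<in> orth_unip_set (Suc n)" "h \<in> orth_unip_set (Suc n)" "?f g = ?f h"
    show "g = h"
    proof (rule orth_unip_eqI[OF two gh(1,2)])
      show "mid n g = mid n h" using gh(3) by simp
      fix m assume m: "m < 2 * n"
      have e: "(\<lambda>m\<in>{..<2 * n}. g $$ (0, Suc m)) = (\<lambda>m\<in>{..<2 * n}. h $$ (0, Suc m))" using gh(3) by simp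
      show "g $$ (0, Suc m) = h $$ (0, Suc m)" using fun_cong[OF e, of m] m by simp
    qed
  qed
next
  fix y assume "y \<in> (orth_unip_set n :: 'a mat set) \<times> ({..<2 * n} \<rightarrow>\<^sub>E (UNIV :: 'a set))"
  then obtain h b where y: "y = (h, b)" "h \<in> orth_unip_set n" "b \<in> {..<2 * n} \<rightarrow>\<^sub>E UNIV" by auto
  have fe: "?f (emb n 0 h * Nel n b) = (h, b)"
  proof (rule prod_eqI)
    show "snd (?f (emb n 0 h * Nel n b)) = snd (h, b)"
      unfolding snd_conv
    proof (rule extensionalityI[of _ "{..<2 * n}"])
      show "b \<in> extensional {..<2 * n}" using y(3) by (simp add: PiE_def)
    qed (use emb0_Nel(3)[OF two y(2), where b = b] in auto)
  qed (use emb0_Nel(2)[OF two y(2), where b = b] in simp)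
  show "y \<in> ?f ` orth_unip_set (Suc n)"
    unfolding y(1) by (rule image_eqI[where f = ?f, OF fe[symmetric] emb0_Nel(1)[OF two y(2)]])
qed (auto simp: mid_closed split: if_splits)

lemma orth_unip_0: "orth_unip_set 0 = {1\<^sub>m 0 :: 'a::field mat}"
proof -
  have "A = 1\<^sub>m 0" if "A \<in> orth_unip_set 0" for A :: "'a mat"
    using orth_unipD(1)[OF that] by (intro eq_matI) auto
  then show ?thesis using orth_unip_one[of 0] by auto
qed

lemma orth_unip_finite:
  assumes two: "(2 :: 'a::{field,finite}) \<noteq> 0"
  shows "finite (orth_unip_set n :: 'a mat set)"
proof (induction n)
  case (Suc n)
  have "finite ((orth_unip_set n :: 'a mat set) \<times> ({..<2 * n} \<rightarrow>\<^sub>E (UNIV :: 'a set)))"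
    using Suc by (intro finite_cartesian_product finite_PiE) auto
  then show ?case using bij_betw_finite[OF orth_unip_bij[OF two, of n]] by simp
qed (simp add: orth_unip_0)

text \<open>One count for several uses: the order of the group, of the stabiliser of a weight, and
  of \<open>polar m\<close> are all of this form.\<close>

lemma card_orth_unip_filter:
  fixes M :: "'a::{field,finite} mat set"
  assumes two: "(2 :: 'a) \<noteq> 0" and M: "M \<subseteq> orth_unip_set n" and Z: "Z \<subseteq> {..<2 * n}"
  shows "card {g \<in> orth_unip_set (Suc n). mid n g \<in> M \<and> (\<forall>m\<in>Z. g $$ (0, Suc m) = (0 :: 'a))} =
    card M * CARD('a) ^ (card ({..<2 * n} - Z))"
proof -
  let ?f = "\<lambda>g :: 'a mat. (mid n g, \<lambda>m\<in>{..<2 * n}. g $$ (0, Suc m))"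
  let ?P = "PiE {..<2 * n} (\<lambda>m. if m \<in> Z then {0 :: 'a} else UNIV)"
  have b: "bij_betw ?f (orth_unip_set (Suc n)) (orth_unip_set n \<times> ({..<2 * n} \<rightarrow>\<^sub>E UNIV))" by (rule orth_unip_bij[OF two])
  have "?f ` {g \<in> orth_unip_set (Suc n). mid n g \<in> M \<and> (\<forall>m\<in>Z. g $$ (0, Suc m) = 0)} = M \<times> ?P"
  proof (intro equalityI subsetI)
    fix y assume y: "y \<in> M \<times> ?P"
    then have "y \<in> orth_unip_set n \<times> ({..<2 * n} \<rightarrow>\<^sub>E UNIV)" using M by (auto simp: PiE_iff)
    then have "y \<in> ?f ` orth_unip_set (Suc n)" by (simp only: bij_betw_imp_surj_on[OF b])
    then obtain g where g: "g \<in> orth_unip_set (Suc n)" "y = ?f g" by (rule imageE)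
    have "g $$ (0, Suc m) = 0" if "m \<in> Z" for m
    proof -
      have "m \<in> {..<2 * n}" "snd y \<in> ?P" using that Z y by (auto simp: mem_Times_iff simp del: lessThan_iff)
      then have "snd y m \<in> (if m \<in> Z then {0} else UNIV)" by (rule PiE_mem[rotated])
      then show ?thesis using that \<open>m \<in> {..<2 * n}\<close> unfolding g(2) by simp
    qed
    then show "y \<in> ?f ` {g \<in> orth_unip_set (Suc n). mid n g \<in> M \<and> (\<forall>m\<in>Z. g $$ (0, Suc m) = 0)}"
      using g y by auto
  qed (auto split: if_splits)
  moreover have "inj_on ?f {g \<in> orth_unip_set (Suc n). mid n g \<in> M \<and> (\<forall>m\<in>Z. g $$ (0, Suc m) = 0)}"
    using b by (auto simp: bij_betw_def intro: inj_on_subset)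
  ultimately have "card {g \<in> orth_unip_set (Suc n). mid n g \<in> M \<and> (\<forall>m\<in>Z. g $$ (0, Suc m) = (0 :: 'a))} = card (M \<times> ?P)"
    by (metis (no_types, lifting) card_image)
  also have "\<dots> = card M * (\<Prod>m<2 * n. card (if m \<in> Z then {0 :: 'a} else UNIV))"
    by (simp add: card_cartesian_product card_PiE)
  also have "(\<Prod>m<2 * n. card (if m \<in> Z then {0 :: 'a} else UNIV)) = (\<Prod>m\<in>{..<2 * n} - Z. CARD('a))"
    by (rule prod.mono_neutral_cong_right) auto
  finally show ?thesis by simp
qed

lemma card_orth_unip_Suc:
  assumes two: "(2 :: 'a::{field,finite}) \<noteq> 0"
  shows "card (orth_unip_set (Suc n) :: 'a mat set) = card (orth_unip_set n :: 'a mat set) * CARD('a) ^ (2 * n)"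
proof -
  have "{g \<in> orth_unip_set (Suc n). mid n g \<in> orth_unip_set n \<and> (\<forall>m\<in>{}. g $$ (0, Suc m) = (0 :: 'a))} = orth_unip_set (Suc n)"
    using mid_closed by auto
  then show ?thesis using card_orth_unip_filter[OF two, of "orth_unip_set n" n "{}"] by simp
qed

section \<open>Additive characters\<close>

lemma additive_character_zero:
  assumes "nontrivial_additive_character \<theta>" shows "\<theta> 0 = 1"
  using assms unfolding nontrivial_additive_character_def by (metis add_0 mult_cancel_left1)

lemma additive_character_add:
  "nontrivial_additive_character \<theta> \<Longrightarrow> \<theta> (a + b) = \<theta> a * \<theta> b"
  by (simp add: nontrivial_additive_character_def)

text \<open>For r different from 0, replacing t by t + a/r multiplies the sum by a value of \<theta>
  other than 1.\<close>

lemma additive_character_sum: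
  fixes \<theta> :: "'a::{field,finite} \<Rightarrow> complex"
  assumes \<theta>: "nontrivial_additive_character \<theta>"
  shows "(\<Sum>t\<in>UNIV. \<theta> (r * t)) = (if r = 0 then of_nat CARD('a) else 0)"
proof (cases "r = 0")
  case False
  obtain a where a: "\<theta> a \<noteq> 1" using \<theta> by (auto simp: nontrivial_additive_character_def)
  have "(\<Sum>t\<in>UNIV. \<theta> (r * t)) = (\<Sum>t\<in>UNIV. \<theta> (r * (t + a / r)))"
    by (rule sum.reindex_bij_witness[of _ "\<lambda>t. t + a / r" "\<lambda>t. t - a / r"]) auto
  also have "\<dots> = (\<Sum>t\<in>UNIV. \<theta> (r * t)) * \<theta> a"
    using False by (simp add: distrib_left additive_character_add[OF \<theta>] sum_distrib_right)
  finally show ?thesis using a False by simp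
qed (simp add: additive_character_zero[OF \<theta>])

text \<open>Adding 1 permutes the ring, so the sum of all elements equals itself plus the
  cardinality.\<close>

lemma of_nat_card_eq_0: "of_nat CARD('a) = (0 :: 'a::{ring_1,finite})"
proof -
  have "(\<Sum>x\<in>(UNIV :: 'a set). x) = (\<Sum>x\<in>UNIV. x + 1)"
    by (rule sum.reindex_bij_witness[of _ "\<lambda>x. x + 1" "\<lambda>x. x - 1"]) auto
  then show ?thesis by (simp add: sum.distrib)
qed

lemma two_neq_0:
  assumes "odd (CARD('a))" shows "(2 :: 'a::{field,finite}) \<noteq> 0"
proof
  assume "(2 :: 'a) = 0"
  moreover obtain k where "CARD('a) = 2 * k + 1" using assms by (rule oddE)
  ultimately show False using of_nat_card_eq_0[where 'a = 'a] by simp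
qed

lemma additive_character_of_nat:
  assumes "nontrivial_additive_character (\<theta> :: 'a::field \<Rightarrow> complex)" shows "\<theta> (of_nat k * a) = \<theta> a ^ k"
  by (induction k) (simp_all add: additive_character_zero[OF assms] additive_character_add[OF assms] distrib_right)

text \<open>The cardinality is 0 in the field, so every value of \<theta> is a root of unity of that
  order.\<close>

lemma additive_character_norm:
  fixes \<theta> :: "'a::{field,finite} \<Rightarrow> complex"
  assumes \<theta>: "nontrivial_additive_character \<theta>"
  shows "norm (\<theta> a) = 1"
proof -
  have "\<theta> a ^ CARD('a) = 1"
    using additive_character_of_nat[OF \<theta>, of "CARD('a)" a] of_nat_card_eq_0[where 'a = 'a]
    by (simp add: additive_character_zero[OF \<theta>])
  then show ?thesis using power_eq_1_iff by fastforce
qed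

lemma additive_character_cnj:
  fixes \<theta> :: "'a::{field,finite} \<Rightarrow> complex"
  assumes \<theta>: "nontrivial_additive_character \<theta>"
  shows "cnj (\<theta> a) = inverse (\<theta> a)"
  using additive_character_norm[OF \<theta>, of a] inverse_unique[of "\<theta> a" "cnj (\<theta> a)"]
    complex_norm_square[of "\<theta> a"] by simp

lemma mat_sum_vec_in:
  assumes W: "lin_subspace m W" and v: "v \<in> carrier_vec n" and S: "finite S"
    and F: "\<And>s. s \<in> S \<Longrightarrow> F s \<in> carrier_mat m n" "\<And>s. s \<in> S \<Longrightarrow> F s *\<^sub>v v \<in> W"
  shows "mat_sum m n F S *\<^sub>v v \<in> W"
  using S F
proof (induction S rule: finite_induct)
  case empty
  have "mat_sum m n F {} = 0\<^sub>m m n" by (rule eq_matI) (auto simp: mat_sum_def)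
  then show ?case using W v by (simp add: zero_mat_mult_vec lin_subspace_def)
next
  case (insert x S)
  have "mat_sum m n F (insert x S) = F x + mat_sum m n F S"
    using insert.hyps insert.prems(1)[of x] by (intro eq_matI) (auto simp: mat_sum_def)
  then have "mat_sum m n F (insert x S) *\<^sub>v v = F x *\<^sub>v v + mat_sum m n F S *\<^sub>v v"
    using insert.prems(1)[of x] v by (simp add: add_mult_distrib_mat_vec[of _ m n])
  then show ?case using W insert by (simp add: lin_subspace_def)
qed

lemma lin_subspace_zero: "lin_subspace d {0\<^sub>v d}"
  by (auto simp: lin_subspace_def)

text \<open>\<open>P r\<close> is, up to the factor q, the projector onto the part where T acts by
  \<theta>(r t). By orthogonality these sum to q times the identity, so one of them does not kill
  w.\<close>

lemma one_parameter_eigenvector: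
  fixes \<theta> :: "'a::{field,finite} \<Rightarrow> complex" and T :: "'a \<Rightarrow> complex mat"
  assumes \<theta>: "nontrivial_additive_character \<theta>" and Tc: "\<And>t. T t \<in> carrier_mat d d"
    and T0: "T 0 = 1\<^sub>m d" and Tadd: "\<And>s t. T (s + t) = T s * T t"
    and W: "lin_subspace d W" "\<And>t w. w \<in> W \<Longrightarrow> T t *\<^sub>v w \<in> W" and w: "w \<in> W" "w \<noteq> 0\<^sub>v d"
  shows "\<exists>r. \<exists>w'\<in>W. w' \<noteq> 0\<^sub>v d \<and> (\<forall>t. T t *\<^sub>v w' = \<theta> (r * t) \<cdot>\<^sub>v w')"
proof -
  define P where "P r = mat_sum d d (\<lambda>t. \<theta> (- (r * t)) \<cdot>\<^sub>m T t) UNIV" for r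
  have Pc: "P r \<in> carrier_mat d d" for r by (simp add: P_def)
  have wc: "w \<in> carrier_vec d" using W w by (auto simp: lin_subspace_def)
  have "mat_sum d d P UNIV = of_nat CARD('a) \<cdot>\<^sub>m 1\<^sub>m d"
  proof (rule eq_matI)
    fix i j assume "i < dim_row (of_nat CARD('a) \<cdot>\<^sub>m 1\<^sub>m d :: complex mat)" "j < dim_col (of_nat CARD('a) \<cdot>\<^sub>m 1\<^sub>m d :: complex mat)"
    then have ij: "i < d" "j < d" by auto
    have "mat_sum d d P UNIV $$ (i, j) = (\<Sum>r\<in>UNIV. \<Sum>t\<in>UNIV. \<theta> (- (r * t)) * T t $$ (i, j))"
      using ij carrier_matD[OF Tc] by (simp add: mat_sum_def P_def)
    also have "\<dots> = (\<Sum>t\<in>UNIV. (\<Sum>r\<in>UNIV. \<theta> (- t * r)) * T t $$ (i, j))"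
      unfolding sum_distrib_right by (subst sum.swap) (simp add: mult.commute)
    also have "\<dots> = (\<Sum>t\<in>(UNIV :: 'a set). if t = 0 then of_nat CARD('a) * T 0 $$ (i, j) else 0)"
      unfolding additive_character_sum[OF \<theta>] by (rule sum.cong) auto
    also have "\<dots> = (of_nat CARD('a) \<cdot>\<^sub>m 1\<^sub>m d :: complex mat) $$ (i, j)" using ij T0 by simp
    finally show "mat_sum d d P UNIV $$ (i, j) = (of_nat CARD('a) \<cdot>\<^sub>m 1\<^sub>m d :: complex mat) $$ (i, j)" .
  qed auto
  moreover have "(of_nat CARD('a) \<cdot>\<^sub>m 1\<^sub>m d) *\<^sub>v w = (of_nat CARD('a) :: complex) \<cdot>\<^sub>v w"
    using wc by (intro eq_vecI) auto
  moreover have "(of_nat CARD('a) :: complex) \<cdot>\<^sub>v w \<noteq> 0\<^sub>v d"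
  proof
    assume z: "(of_nat CARD('a) :: complex) \<cdot>\<^sub>v w = 0\<^sub>v d"
    have "w $ i = 0" if "i < d" for i
    proof -
      have "((of_nat CARD('a) :: complex) \<cdot>\<^sub>v w) $ i = 0" using z that by simp
      then show ?thesis using that wc by simp
    qed
    then have "w = 0\<^sub>v d" using wc by (intro eq_vecI) auto
    then show False using w by simp
  qed
  ultimately have "mat_sum d d P UNIV *\<^sub>v w \<noteq> 0\<^sub>v d" by simp
  then obtain r where r: "P r *\<^sub>v w \<noteq> 0\<^sub>v d"
    using mat_sum_vec_in[OF lin_subspace_zero[of d] wc finite_class.finite_UNIV, of P] Pc by blast
  have "P r *\<^sub>v w \<in> W"
    unfolding P_def
  proof (rule mat_sum_vec_in[OF W(1) wc])
    fix t
    have "(\<theta> (- (r * t)) \<cdot>\<^sub>m T t) *\<^sub>v w = \<theta> (- (r * t)) \<cdot>\<^sub>v (T t *\<^sub>v w)"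
      using Tc[of t] wc by (intro eq_vecI) auto
    then show "(\<theta> (- (r * t)) \<cdot>\<^sub>m T t) *\<^sub>v w \<in> W" using W w by (simp add: lin_subspace_def)
  qed (use Tc in auto)
  moreover have "T s *\<^sub>v (P r *\<^sub>v w) = \<theta> (r * s) \<cdot>\<^sub>v (P r *\<^sub>v w)" for s
  proof -
    have bij: "bij_betw (\<lambda>t. t - s) UNIV (UNIV :: 'a set)"
      by (rule bij_betw_byWitness[of _ "\<lambda>t. t + s"]) auto
    have "T s * P r = mat_sum d d (\<lambda>t. T s * (\<theta> (- (r * t)) \<cdot>\<^sub>m T t)) UNIV"
      unfolding P_def using Tc by (intro mat_sum_mult_left) auto
    also have "\<dots> = mat_sum d d (\<lambda>t. T s * (\<theta> (- (r * (t - s))) \<cdot>\<^sub>m T (t - s))) UNIV"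
      by (rule mat_sum_reindex[OF bij])
    also have "\<dots> = mat_sum d d (\<lambda>t. \<theta> (r * s) \<cdot>\<^sub>m (\<theta> (- (r * t)) \<cdot>\<^sub>m T t)) UNIV"
    proof (rule mat_sum_cong)
      fix t
      have "T s * T (t - s) = T t" using Tadd[of s "t - s"] by simp
      moreover have "\<theta> (- (r * (t - s))) = \<theta> (r * s) * \<theta> (- (r * t))"
        using additive_character_add[OF \<theta>, of "r * s" "- (r * t)"] by (simp add: algebra_simps)
      ultimately show "T s * (\<theta> (- (r * (t - s))) \<cdot>\<^sub>m T (t - s)) = \<theta> (r * s) \<cdot>\<^sub>m (\<theta> (- (r * t)) \<cdot>\<^sub>m T t)"
        using Tc by (simp add: mult_smult_distrib[of _ d d _ d]) (intro eq_matI, auto)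
    qed
    also have "\<dots> = \<theta> (r * s) \<cdot>\<^sub>m P r" unfolding P_def using Tc by (intro mat_sum_smult[symmetric]) auto
    finally have TP: "T s * P r = \<theta> (r * s) \<cdot>\<^sub>m P r" .
    have "T s *\<^sub>v (P r *\<^sub>v w) = T s * P r *\<^sub>v w" using Tc[of s] Pc[of r] wc by simp
    also have "\<dots> = \<theta> (r * s) \<cdot>\<^sub>v (P r *\<^sub>v w)" unfolding TP using Pc[of r] wc by (intro eq_vecI) auto
    finally show ?thesis .
  qed
  ultimately show ?thesis using r by blast
qed

lemma lin_subspace_Int: "lin_subspace d V \<Longrightarrow> lin_subspace d W \<Longrightarrow> lin_subspace d (V \<inter> W)"
  by (auto simp: lin_subspace_def)

section \<open>Root elements and weight spaces of the first row\<close>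

text \<open>The root element 1 + t (E_ij - E_j'i'), where k' = 2n - 1 - k is the mirror of k; the
  second term compensates the first in the invariant form.\<close>

definition xroot :: "nat \<Rightarrow> nat \<Rightarrow> nat \<Rightarrow> 'a::field \<Rightarrow> 'a mat" where
  "xroot n i j t = mat (2 * n) (2 * n) (\<lambda>(k, l).
     (if k = l then 1 else 0) + (if k = i \<and> l = j then t else 0) - (if k = 2 * n - 1 - j \<and> l = 2 * n - 1 - i then t else 0))"

lemma reflect_neq: "k < 2 * n \<Longrightarrow> 2 * n - 1 - k \<noteq> (k :: nat)"
  by arith

text \<open>Splits a row or column of a root element into three deltas, so that matrix products with
  it can be summed termwise.\<close>

lemma root_entry_mult:
  fixes t :: "'a::comm_ring_1"
  shows "((if k = p then 1 else 0) + (if k = i \<and> p = j then t else 0) - (if k = i' \<and> p = j' then t else 0)) * f k =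
      (if k = p then f p else 0) + (if k = i then (if p = j then t * f i else 0) else 0) -
      (if k = i' then (if p = j' then t * f i' else 0) else 0)"
  by (cases "k = p"; cases "k = i"; cases "k = i'"; cases "p = j"; cases "p = j'") (simp_all add: algebra_simps)

lemma xroot_closed:
  assumes ij: "i < j" "j < 2 * n" "i + j \<noteq> 2 * n - 1"
  shows "xroot n i j t \<in> orth_unip_set n"
  unfolding orth_unip_iff
proof (intro conjI allI impI)
  show "xroot n i j t \<in> carrier_mat (2 * n) (2 * n)" by (simp add: xroot_def)
  show "xroot n i j t $$ (k, l) = (if k = l then 1 else 0)" if "l \<le> k" "k < 2 * n" for k l
    using that ij by (auto simp: xroot_def)
  fix p q assume pq: "p < 2 * n" "q < 2 * n"
  let ?h = "xroot n i j t"
  let ?bi = "2 * n - 1 - i" and ?bj = "2 * n - 1 - j"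
  have h: "?h $$ (k, l) = (if k = l then 1 else 0) + (if k = i \<and> l = j then t else 0) - (if k = ?bj \<and> l = ?bi then t else 0)"
    if "k < 2 * n" "l < 2 * n" for k l using that by (simp add: xroot_def)
  have b: "k < 2 * n \<Longrightarrow> 2 * n - 1 - k < 2 * n" for k by simp
  have aux: "X + (if A \<and> B then t else 0) - (if C \<and> D then t else 0) + (if C then t * (if D then 1 else 0) else 0)
      - (if A then t * (if B then 1 else 0) else 0) = X" for X A B C D
    by (cases A; cases B; cases C; cases D) simp_all
  have "(\<Sum>k<2 * n. ?h $$ (k, p) * ?h $$ (2 * n - 1 - k, q)) =
    (\<Sum>k<2 * n. (if k = p then ?h $$ (2 * n - 1 - p, q) else 0) +
      (if k = i then (if p = j then t * ?h $$ (?bi, q) else 0) else 0) -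
      (if k = ?bj then (if p = ?bi then t * ?h $$ (j, q) else 0) else 0))"
  proof (intro sum.cong refl)
    fix k assume "k \<in> {..<2 * n}"
    then have hk: "?h $$ (k, p) = (if k = p then 1 else 0) + (if k = i \<and> p = j then t else 0) - (if k = ?bj \<and> p = ?bi then t else 0)"
      using h[of k p] pq by simp
    have bb: "2 * n - 1 - ?bj = j" using ij by simp
    show "?h $$ (k, p) * ?h $$ (2 * n - 1 - k, q) = (if k = p then ?h $$ (2 * n - 1 - p, q) else 0) +
      (if k = i then (if p = j then t * ?h $$ (?bi, q) else 0) else 0) -
      (if k = ?bj then (if p = ?bi then t * ?h $$ (j, q) else 0) else 0)"
      unfolding hk using root_entry_mult[of k p i j t ?bj ?bi "\<lambda>k. ?h $$ (2 * n - 1 - k, q)"] unfolding bb .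
  qed
  also have "\<dots> = ?h $$ (2 * n - 1 - p, q) + (if p = j then t * ?h $$ (?bi, q) else 0) -
      (if p = ?bi then t * ?h $$ (j, q) else 0)"
    using pq ij by (simp add: sum.distrib sum_subtractf)
  also have "?h $$ (2 * n - 1 - p, q) = (if p + q + 1 = 2 * n then 1 else 0) +
      (if p = ?bi \<and> q = j then t else 0) - (if p = j \<and> q = ?bi then t else 0)"
  proof -
    have "2 * n - 1 - p = q \<longleftrightarrow> p + q + 1 = 2 * n" "2 * n - 1 - p = i \<longleftrightarrow> p = ?bi" "2 * n - 1 - p = ?bj \<longleftrightarrow> p = j"
      using pq ij by auto
    then show ?thesis using h[OF b[OF pq(1)] pq(2)] by simp
  qed
  also have "?h $$ (?bi, q) = (if q = ?bi then 1 else 0)"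
  proof -
    have "?bi \<noteq> i" "?bi \<noteq> ?bj" "?bi < 2 * n" using reflect_neq[of i n] ij by auto
    then show ?thesis using h[OF _ pq(2), of ?bi] by (simp only: if_False simp_thms eq_commute[of q]) simp
  qed
  also have "?h $$ (j, q) = (if q = j then 1 else 0)"
  proof -
    have "j \<noteq> i" "j \<noteq> ?bj" using reflect_neq[of j n] ij by auto
    then show ?thesis using h[OF ij(2) pq(2)] by auto
  qed
  also have "(if p + q + 1 = 2 * n then 1 else 0) + (if p = ?bi \<and> q = j then t else 0) - (if p = j \<and> q = ?bi then t else 0)
      + (if p = j then t * (if q = ?bi then 1 else 0) else 0) - (if p = ?bi then t * (if q = j then 1 else 0) else 0) =
      (if p + q + 1 = 2 * n then 1 else 0)"
    by (rule aux)
  finally show "(\<Sum>k<2 * n. ?h $$ (k, p) * ?h $$ (2 * n - 1 - k, q)) = (if p + q + 1 = 2 * n then 1 else 0)" .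
qed

text \<open>The vector v stands for the character a -> \<theta>(v . a) of N. The redundant-looking
  bound \<open>UNIV\<close> gives the shape expected by \<open>lin_subspace_eigen\<close>.\<close>

definition weight_space ::
    "('a::field \<Rightarrow> complex) \<Rightarrow> nat \<Rightarrow> nat \<Rightarrow> ('a mat \<Rightarrow> complex mat) \<Rightarrow> (nat \<Rightarrow> 'a) \<Rightarrow> complex vec set" where
  "weight_space \<theta> n d \<rho> v =
     {w \<in> carrier_vec d. \<forall>a\<in>UNIV. \<rho> (Nel n a) *\<^sub>v w = \<theta> (\<Sum>l<2 * n. v l * a l) \<cdot>\<^sub>v w}"

lemma weight_space_cong: "(\<And>l. l < 2 * n \<Longrightarrow> v l = v' l) \<Longrightarrow> weight_space \<theta> n d \<rho> v = weight_space \<theta> n d \<rho> v'"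
  by (auto simp: weight_space_def)

context
  fixes n d :: nat and \<theta> :: "'a::{field,finite} \<Rightarrow> complex" and \<rho> :: "'a mat \<Rightarrow> complex mat"
  assumes two: "(2 :: 'a) \<noteq> 0" and \<theta>: "nontrivial_additive_character \<theta>"
    and \<rho>: "is_rep (orth_unip (Suc n)) d \<rho>"
begin

private lemma r: "g \<in> orth_unip_set (Suc n) \<Longrightarrow> \<rho> g \<in> carrier_mat d d"
  using is_repD[OF \<rho>] by (simp add: orth_unip_simps)

private lemma rm: "g \<in> orth_unip_set (Suc n) \<Longrightarrow> h \<in> orth_unip_set (Suc n) \<Longrightarrow> \<rho> (g * h) = \<rho> g * \<rho> h"
  using is_rep_mult[OF \<rho>] by (simp add: orth_unip_simps)

lemma weight_space_subspace: "lin_subspace d (weight_space \<theta> n d \<rho> v)"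
  unfolding weight_space_def using r[OF Nel_closed[OF two]] by (intro lin_subspace_eigen)

text \<open>Dual to \<open>Nel_mult_right\<close>: N acts on row vectors from the right, hence on
  weights, as column vectors, from the left.\<close>

lemma weight_space_move:
  assumes g: "g \<in> orth_unip_set (Suc n)" and w: "w \<in> weight_space \<theta> n d \<rho> v"
  shows "\<rho> g *\<^sub>v w \<in> weight_space \<theta> n d \<rho> (\<lambda>l. \<Sum>m<2 * n. mid n g $$ (l, m) * v m)"
proof -
  have wc: "w \<in> carrier_vec d" using w by (simp add: weight_space_def)
  have "\<rho> (Nel n a) *\<^sub>v (\<rho> g *\<^sub>v w) = \<theta> (\<Sum>l<2 * n. (\<Sum>m<2 * n. mid n g $$ (l, m) * v m) * a l) \<cdot>\<^sub>v (\<rho> g *\<^sub>v w)" for a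
  proof -
    let ?b = "\<lambda>m. \<Sum>l<2 * n. a l * mid n g $$ (l, m)"
    note N = Nel_closed[OF two, of n]
    have "\<rho> (Nel n a) *\<^sub>v (\<rho> g *\<^sub>v w) = \<rho> (Nel n a * g) *\<^sub>v w"
      using r[OF N[of a]] r[OF g] wc by (simp add: rm[OF N g])
    also have "\<dots> = \<rho> g *\<^sub>v (\<rho> (Nel n ?b) *\<^sub>v w)"
      unfolding Nel_mult_right[OF two g] using r[OF N[of ?b]] r[OF g] wc by (simp add: rm[OF g N])
    also have "\<rho> (Nel n ?b) *\<^sub>v w = \<theta> (\<Sum>m<2 * n. v m * ?b m) \<cdot>\<^sub>v w" using w by (simp add: weight_space_def)
    also have "(\<Sum>m<2 * n. v m * ?b m) = (\<Sum>l<2 * n. (\<Sum>m<2 * n. mid n g $$ (l, m) * v m) * a l)"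
      by (simp add: sum_distrib_left sum_distrib_right, subst sum.swap) (simp add: ac_simps)
    also have "\<rho> g *\<^sub>v (\<theta> (\<Sum>l<2 * n. (\<Sum>m<2 * n. mid n g $$ (l, m) * v m) * a l) \<cdot>\<^sub>v w) =
        \<theta> (\<Sum>l<2 * n. (\<Sum>m<2 * n. mid n g $$ (l, m) * v m) * a l) \<cdot>\<^sub>v (\<rho> g *\<^sub>v w)"
      using r[OF g] wc by (rule mult_mat_vec)
    finally show ?thesis .
  qed
  then show ?thesis using r[OF g] wc by (simp add: weight_space_def)
qed

lemma rep_vec_nonzero:
  assumes g: "g \<in> orth_unip_set (Suc n)" and w: "w \<in> carrier_vec d" "w \<noteq> 0\<^sub>v d"
  shows "\<rho> g *\<^sub>v w \<noteq> 0\<^sub>v d"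
proof
  assume z: "\<rho> g *\<^sub>v w = 0\<^sub>v d"
  let ?h = "inv\<^bsub>orth_unip (Suc n)\<^esub> g"
  have "\<rho> ?h * \<rho> g = 1\<^sub>m d" using is_rep_inv(2)[OF group_orth_unip \<rho>, of g] g by (simp add: orth_unip_simps)
  then have "w = \<rho> ?h *\<^sub>v (\<rho> g *\<^sub>v w)"
    using r[OF g] r[OF orth_unip_inv_closed[OF g]] w by (simp flip: assoc_mult_mat_vec)
  then show False using z w r[OF orth_unip_inv_closed[OF g]] by (simp add: mat_mult_zero_vec)
qed

text \<open>N is abelian, so an eigenvector for the first m coordinates can be refined to one for
  the next coordinate inside the same eigenspace.\<close>

lemma weight_exists:
  assumes "d > 0"
  shows "\<exists>v. \<exists>w\<in>weight_space \<theta> n d \<rho> v. w \<noteq> 0\<^sub>v d"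
proof -
  note N = Nel_closed[OF two, of n]
  \<comment> \<open>Eigenvectors for those elements of N whose row vector is supported on indices
    below m.\<close>
  define E where "E m v = {w \<in> carrier_vec d. \<forall>a\<in>{a. \<forall>l. m \<le> l \<longrightarrow> a l = 0}.
      \<rho> (Nel n a) *\<^sub>v w = \<theta> (\<Sum>l<2 * n. v l * a l) \<cdot>\<^sub>v w}" for m and v :: "nat \<Rightarrow> 'a"
  have Esub: "lin_subspace d (E m v)" for m v
    unfolding E_def using r[OF N] by (intro lin_subspace_eigen)
  have "\<exists>v. \<exists>w\<in>E m v. w \<noteq> 0\<^sub>v d" if "m \<le> 2 * n" for m
    using that
  proof (induction m)
    case 0
    have "Nel n a = 1\<^sub>m (2 * Suc n)" if "\<forall>l. a l = 0" for a :: "nat \<Rightarrow> 'a"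
      using that by (intro Nel_zero) simp
    then have "\<rho> (Nel n a) = 1\<^sub>m d" if "\<forall>l. a l = 0" for a
      using that \<rho> by (simp add: is_rep_def orth_unip_simps)
    then have "E 0 (\<lambda>_. 0) = carrier_vec d"
      by (auto simp: E_def additive_character_zero[OF \<theta>])
    moreover have "unit_vec d 0 \<noteq> (0\<^sub>v d :: complex vec)"
      using assms by (metis index_unit_vec(1) index_zero_vec(1) zero_neq_one)
    ultimately show ?case by (metis unit_vec_carrier)
  next
    case (Suc m)
    then obtain v w where w: "w \<in> E m v" "w \<noteq> 0\<^sub>v d" by auto
    define T where "T t = \<rho> (Nel n (\<lambda>l. if l = m then t else 0))" for t
    have "\<exists>r. \<exists>w'\<in>E m v. w' \<noteq> 0\<^sub>v d \<and> (\<forall>t. T t *\<^sub>v w' = \<theta> (r * t) \<cdot>\<^sub>v w')"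
    proof (rule one_parameter_eigenvector[OF \<theta> _ _ _ Esub _ w])
      show Tc: "T t \<in> carrier_mat d d" for t using r[OF N] by (simp add: T_def)
      have "Nel n (\<lambda>l. if l = m then 0 else 0 :: 'a) = 1\<^sub>m (2 * Suc n)"
        by (rule Nel_zero) simp
      then show "T 0 = 1\<^sub>m d" using \<rho> by (simp add: T_def is_rep_def orth_unip_simps)
      show "T (s + t) = T s * T t" for s t
        unfolding T_def rm[OF N N, symmetric] Nel_mult[OF two] by (rule arg_cong[of _ _ \<rho>], rule Nel_cong) auto
      show "T t *\<^sub>v w \<in> E m v" if w: "w \<in> E m v" for t w
        unfolding E_def
      proof (clarsimp, intro conjI allI impI)
        have wc: "w \<in> carrier_vec d" using w by (simp add: E_def)
        show "T t *\<^sub>v w \<in> carrier_vec d" using Tc[of t] wc by simp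
        fix a :: "nat \<Rightarrow> 'a" assume a: "\<forall>l\<ge>m. a l = 0"
        let ?e = "\<lambda>l. if l = m then t else 0"
        have "Nel n a * Nel n ?e = Nel n ?e * Nel n a"
          unfolding Nel_mult[OF two] by (simp add: add.commute)
        then have c: "\<rho> (Nel n a) * T t = T t * \<rho> (Nel n a)"
          unfolding T_def rm[OF N N, symmetric] by simp
        have "\<rho> (Nel n a) *\<^sub>v (T t *\<^sub>v w) = \<rho> (Nel n a) * T t *\<^sub>v w" using r[OF N[of a]] Tc[of t] wc by simp
        also have "\<dots> = T t *\<^sub>v (\<rho> (Nel n a) *\<^sub>v w)" unfolding c using r[OF N[of a]] Tc[of t] wc by simp
        also have "\<rho> (Nel n a) *\<^sub>v w = \<theta> (\<Sum>l<2 * n. v l * a l) \<cdot>\<^sub>v w" using w a by (simp add: E_def)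
        finally show "\<rho> (Nel n a) *\<^sub>v (T t *\<^sub>v w) = \<theta> (\<Sum>l<2 * n. v l * a l) \<cdot>\<^sub>v (T t *\<^sub>v w)"
          using mult_mat_vec[OF Tc wc] by simp
      qed
    qed
    then obtain r' w' where w': "w' \<in> E m v" "w' \<noteq> 0\<^sub>v d" "\<And>t. T t *\<^sub>v w' = \<theta> (r' * t) \<cdot>\<^sub>v w'" by auto
    have wc: "w' \<in> carrier_vec d" using w' by (simp add: E_def)
    have "w' \<in> E (Suc m) (v(m := r'))"
      unfolding E_def
    proof (clarsimp simp: wc)
      fix a :: "nat \<Rightarrow> 'a" assume a: "\<forall>l\<ge>Suc m. a l = 0"
      let ?e = "\<lambda>l. if l = m then a m else 0" and ?a = "a(m := 0)"
      have "Nel n a = Nel n ?a * Nel n ?e"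
        unfolding Nel_mult[OF two] by (rule Nel_cong) auto
      then have "\<rho> (Nel n a) *\<^sub>v w' = \<rho> (Nel n ?a) *\<^sub>v (T (a m) *\<^sub>v w')"
        using r[OF N[of ?a]] r[OF N[of ?e]] wc by (simp add: rm[OF N N] T_def)
      also have "\<dots> = \<theta> (r' * a m) \<cdot>\<^sub>v (\<rho> (Nel n ?a) *\<^sub>v w')"
        using w'(3) mult_mat_vec[OF r[OF N] wc] by simp
      also have "\<rho> (Nel n ?a) *\<^sub>v w' = \<theta> (\<Sum>l<2 * n. v l * ?a l) \<cdot>\<^sub>v w'"
        using w'(1) a by (auto simp: E_def le_Suc_eq Suc_le_eq)
      also have "\<theta> (r' * a m) \<cdot>\<^sub>v (\<theta> (\<Sum>l<2 * n. v l * ?a l) \<cdot>\<^sub>v w') = \<theta> (r' * a m + (\<Sum>l<2 * n. v l * ?a l)) \<cdot>\<^sub>v w'"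
        by (simp add: smult_smult_assoc additive_character_add[OF \<theta>])
      also have "r' * a m + (\<Sum>l<2 * n. v l * ?a l) = (\<Sum>l<2 * n. (v(m := r')) l * a l)"
      proof -
        have "(\<Sum>l<2 * n. (v(m := r')) l * a l) = (\<Sum>l<2 * n. (if l = m then r' * a m else 0) + v l * ?a l)"
          by (intro sum.cong) auto
        then show ?thesis using Suc.prems by (simp add: sum.distrib)
      qed
      finally show "\<rho> (Nel n a) *\<^sub>v w' = \<theta> (\<Sum>l<2 * n. (if l = m then r' else v l) * a l) \<cdot>\<^sub>v w'" by simp
    qed
    then show ?case using w'(2) by blast
  qed
  then obtain v w where w: "w \<in> E (2 * n) v" "w \<noteq> 0\<^sub>v d" by blast
  have "w \<in> weight_space \<theta> n d \<rho> v"
    unfolding weight_space_def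
  proof (clarsimp, intro conjI allI)
    show "w \<in> carrier_vec d" using w by (simp add: E_def)
    fix a :: "nat \<Rightarrow> 'a"
    let ?a = "\<lambda>l. if l < 2 * n then a l else 0"
    have "Nel n a = Nel n ?a" by (rule Nel_cong) auto
    moreover have "\<rho> (Nel n ?a) *\<^sub>v w = \<theta> (\<Sum>l<2 * n. v l * ?a l) \<cdot>\<^sub>v w" using w by (simp add: E_def)
    moreover have "(\<Sum>l<2 * n. v l * ?a l) = (\<Sum>l<2 * n. v l * a l)" by (intro sum.cong) auto
    ultimately show "\<rho> (Nel n a) *\<^sub>v w = \<theta> (\<Sum>l<2 * n. v l * a l) \<cdot>\<^sub>v w" by simp
  qed
  then show ?thesis using w(2) by blast
qed

text \<open>The entry at j serves as a pivot. A root element clears an earlier index m but its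
  mirror term also changes the entry at the mirror of j, which is why that entry stays uncontrolled.
  The number of other nonzero entries drops.\<close>

lemma weight_normal_form:
  assumes w: "w \<in> weight_space \<theta> n d \<rho> v" "w \<noteq> 0\<^sub>v d"
    and j: "j < 2 * n" "v j \<noteq> 0" "\<And>m. j < m \<Longrightarrow> m < 2 * n \<Longrightarrow> m \<noteq> 2 * n - 1 - j \<Longrightarrow> v m = 0"
  shows "\<exists>v'. \<exists>w'\<in>weight_space \<theta> n d \<rho> v'. w' \<noteq> 0\<^sub>v d \<and> v' j \<noteq> 0 \<and>
    (\<forall>m<2 * n. m \<noteq> j \<longrightarrow> m \<noteq> 2 * n - 1 - j \<longrightarrow> v' m = 0)"
  using w j(2,3)
proof (induction "card {m. m < 2 * n \<and> m \<noteq> j \<and> m \<noteq> 2 * n - 1 - j \<and> v m \<noteq> 0}" arbitrary: v w rule: less_induct)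
  case less
  let ?bj = "2 * n - 1 - j"
  let ?S = "\<lambda>v :: nat \<Rightarrow> 'a. {m. m < 2 * n \<and> m \<noteq> j \<and> m \<noteq> ?bj \<and> v m \<noteq> 0}"
  have fin: "finite (?S v)" for v by simp
  show ?case
  proof (cases "?S v = {}")
    case True
    then show ?thesis using less.prems by blast
  next
    case False
    then obtain m where m: "m < 2 * n" "m \<noteq> j" "m \<noteq> ?bj" "v m \<noteq> 0" by auto
    then have mj: "m < j" using less.prems(4)[of m] by (meson linorder_neqE_nat)
    \<comment> \<open>Solves v_m + t v_j = 0.\<close>
    define t where "t = - v m / v j"
    define h where "h = xroot n m j t"
    have h: "h \<in> orth_unip_set n" unfolding h_def using mj m j(1) by (intro xroot_closed) auto
    define g where "g = emb n 0 h"
    have g: "g \<in> orth_unip_set (Suc n)" unfolding g_def using h by (intro emb_closed) auto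
    define v' where "v' l = (\<Sum>k<2 * n. mid n g $$ (l, k) * v k)" for l
    have v': "v' l = v l + (if l = m then t * v j else 0) - (if l = ?bj then t * v (2 * n - 1 - m) else 0)"
      if l: "l < 2 * n" for l
    proof -
      have "v' l = (\<Sum>k<2 * n. (if k = l then v l else 0) + (if k = j then (if l = m then t * v j else 0) else 0) -
          (if k = 2 * n - 1 - m then (if l = ?bj then t * v (2 * n - 1 - m) else 0) else 0))"
        unfolding v'_def g_def mid_emb[OF h]
      proof (intro sum.cong refl)
        fix k assume "k \<in> {..<2 * n}"
        then have "h $$ (l, k) = (if k = l then 1 else 0) + (if k = j \<and> l = m then t else 0) -
            (if k = 2 * n - 1 - m \<and> l = ?bj then t else 0)"
          using l by (simp add: h_def xroot_def conj_commute eq_commute[of k l])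
        then show "h $$ (l, k) * v k = (if k = l then v l else 0) + (if k = j then (if l = m then t * v j else 0) else 0) -
            (if k = 2 * n - 1 - m then (if l = ?bj then t * v (2 * n - 1 - m) else 0) else 0)"
          using root_entry_mult[of k l j m t "2 * n - 1 - m" ?bj v] by (simp only:)
      qed
      then show ?thesis using l j(1) m by (simp add: sum.distrib sum_subtractf)
    qed
    have w': "\<rho> g *\<^sub>v w \<in> weight_space \<theta> n d \<rho> v'"
      unfolding v'_def by (rule weight_space_move[OF g less.prems(1)])
    have wc: "w \<in> carrier_vec d" using less.prems(1) by (simp add: weight_space_def)
    have nz: "\<rho> g *\<^sub>v w \<noteq> 0\<^sub>v d" by (rule rep_vec_nonzero[OF g wc less.prems(2)])
    have jbj: "j \<noteq> ?bj" using reflect_neq[OF j(1)] by simp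
    have vj: "v' j = v j" using v'[OF j(1)] m jbj by auto
    have vm: "v' m = 0" using v'[OF m(1)] m less.prems(3) by (simp add: t_def)
    have vl: "v' l = v l" if "l < 2 * n" "l \<noteq> m" "l \<noteq> ?bj" for l using v'[OF that(1)] that by simp
    have "?S v' \<subset> ?S v"
    proof
      show "?S v' \<subseteq> ?S v" using vl vm m(4) by auto (metis vl vm)
      have "m \<in> ?S v" "m \<notin> ?S v'" using m vm by auto
      then show "?S v' \<noteq> ?S v" by blast
    qed
    then have "card (?S v') < card (?S v)" using fin by (intro psubset_card_mono)
    moreover have "v' l = 0" if "j < l" "l < 2 * n" "l \<noteq> ?bj" for l
      using vl[of l] less.prems(4)[of l] that mj by auto
    ultimately show ?thesis using less.hyps[OF _ w' nz] vj less.prems(3) by simp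
  qed
qed

end

section \<open>The upper bound for the degrees\<close>

text \<open>The step 2n is the exponent of q in |U_(n+2)| / (|U_n| |N|), where N has order q^(2n+2).
  The same number is the index exponent in \<open>card_polar\<close>, so bound and reduction
  agree.\<close>

fun mexp :: "nat \<Rightarrow> nat" where
  "mexp 0 = 0"
| "mexp (Suc 0) = 0"
| "mexp (Suc (Suc n)) = 2 * n + mexp n"

lemma mexp_mono: "mexp n \<le> mexp (Suc n)"
  by (induction n rule: mexp.induct) auto

lemma mexp_strict_mono: "2 \<le> n \<Longrightarrow> mexp n < mexp (Suc n)"
  using mexp_mono by (cases n rule: mexp.cases) (auto simp: less_Suc_eq_le le_SucI intro: le_trans)

lemma orth_unip_decomp:
  fixes g :: "'a::field mat"
  assumes two: "(2 :: 'a) \<noteq> 0" and g: "g \<in> orth_unip_set (Suc n)"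
  shows "g = emb n 0 (mid n g) * Nel n (\<lambda>m. g $$ (0, Suc m))"
  by (rule orth_unip_eqI[OF two g emb0_Nel(1)[OF two mid_closed[OF g]]])
    (simp_all add: emb0_Nel(2,3)[OF two mid_closed[OF g]] del: index_mult_mat)

lemma emb_one: "k \<le> n \<Longrightarrow> emb n k (1\<^sub>m (2 * n)) = (1\<^sub>m (2 * Suc n) :: 'a::field mat)"
  using hom_one[OF emb_hom group_orth_unip group_orth_unip, of k n] by (simp add: orth_unip_simps)

lemma rep_scalar_on_columns:
  fixes M B :: "complex mat"
  assumes "M \<in> carrier_mat d d" "B \<in> carrier_mat d k" "\<And>v. v \<in> carrier_vec k \<Longrightarrow> B *\<^sub>v v \<in> W"
    "\<And>w. w \<in> W \<Longrightarrow> M *\<^sub>v w = c \<cdot>\<^sub>v w"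
  shows "M * B = c \<cdot>\<^sub>m B"
proof (rule mat_eqI_vec)
  fix v :: "complex vec" assume v: "v \<in> carrier_vec k"
  have "M * B *\<^sub>v v = M *\<^sub>v (B *\<^sub>v v)" using assms(1,2) v by simp
  also have "\<dots> = c \<cdot>\<^sub>v (B *\<^sub>v v)" using assms(3,4) v by blast
  also have "\<dots> = (c \<cdot>\<^sub>m B) *\<^sub>v v" using assms(2) v by (intro eq_vecI) auto
  finally show "M * B *\<^sub>v v = (c \<cdot>\<^sub>m B) *\<^sub>v v" .
qed (use assms in auto)

text \<open>An irreducible U_n-piece of \<open>W\<close> is stable under X U_n N, because X and N
  act on \<open>W\<close> by scalars. This set has |X| |U_n| q^(2n+2) elements, so
  \<open>degree_le_index\<close> gives the factor q^(2n) / |X|. Taking X larger sharpens the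
  bound.\<close>

lemma degree_le_of_subgroup:
  fixes \<rho> :: "'a::{field,finite} mat \<Rightarrow> complex mat"
  assumes two: "(2 :: 'a) \<noteq> 0" and irr: "irr_rep (orth_unip (Suc (Suc n))) d \<rho>" and j: "j \<le> n"
    and W: "lin_subspace d W" "w \<in> W" "w \<noteq> 0\<^sub>v d"
    and Winv: "\<And>u w. u \<in> orth_unip_set n \<Longrightarrow> w \<in> W \<Longrightarrow> \<rho> (emb (Suc n) 0 (emb n j u)) *\<^sub>v w \<in> W"
    and X: "X \<subseteq> orth_unip_set (Suc n)" "inj_on (\<lambda>(x, u). x * emb n j u) (X \<times> orth_unip_set n)"
    and Xs: "\<And>x. x \<in> X \<Longrightarrow> \<exists>c. \<forall>w\<in>W. \<rho> (emb (Suc n) 0 x) *\<^sub>v w = c \<cdot>\<^sub>v w"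
    and Ns: "\<And>b. \<exists>c. \<forall>w\<in>W. \<rho> (Nel (Suc n) b) *\<^sub>v w = c \<cdot>\<^sub>v w"
    and IH: "\<And>k \<sigma>. irr_rep (orth_unip n :: 'a mat monoid) k \<sigma> \<Longrightarrow> k \<le> CARD('a) ^ mexp n"
  shows "d * card X \<le> CARD('a) ^ mexp (Suc (Suc n))"
proof -
  let ?G = "orth_unip (Suc (Suc n)) :: 'a mat monoid" and ?K = "orth_unip n :: 'a mat monoid"
  let ?\<kappa> = "\<lambda>u. emb (Suc n) 0 (emb n j u)"
  have \<rho>: "is_rep ?G d \<rho>" using irr by (simp add: irr_rep_def)
  have r: "\<rho> g \<in> carrier_mat d d" if "g \<in> orth_unip_set (Suc (Suc n))" for g
    using is_repD[OF \<rho>] that by (simp add: orth_unip_simps)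
  have rm: "\<rho> (g * h) = \<rho> g * \<rho> h" if "g \<in> orth_unip_set (Suc (Suc n))" "h \<in> orth_unip_set (Suc (Suc n))" for g h
    using is_rep_mult[OF \<rho>] that by (simp add: orth_unip_simps)
  have \<kappa>: "?\<kappa> \<in> hom ?K ?G"
    using j by (auto simp: hom_def orth_unip_simps emb_closed emb_mult)
  have finU: "finite (orth_unip_set m :: 'a mat set)" for m by (rule orth_unip_finite[OF two])
  obtain k B \<sigma> where B: "B \<in> carrier_mat d k" "B \<noteq> 0\<^sub>m d k" and \<sigma>: "irr_rep ?K k \<sigma>"
    and BW: "\<And>v. v \<in> carrier_vec k \<Longrightarrow> B *\<^sub>v v \<in> W" and B\<sigma>: "\<And>g. g \<in> carrier ?K \<Longrightarrow> \<rho> (?\<kappa> g) * B = B * \<sigma> g"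
    by (rule irreducible_subrep_in[OF group_orth_unip is_rep_comp[OF \<rho> group_orth_unip group_orth_unip \<kappa>] W(1) _ W(2,3)])
      (use Winv in \<open>auto simp: orth_unip_simps\<close>)
  have s: "\<sigma> u \<in> carrier_mat k k" if "u \<in> orth_unip_set n" for u
    using \<sigma> that is_repD(1)[of ?K k \<sigma> u] by (simp add: irr_rep_def orth_unip_simps)
  define M where "M = (\<lambda>(x, u). x * emb n j u) ` (X \<times> orth_unip_set n)"
  have M: "M \<subseteq> orth_unip_set (Suc n)"
    using X(1) j by (auto simp: M_def intro!: orth_unip_mult emb_closed)
  have cM: "card M = card X * card (orth_unip_set n :: 'a mat set)"
    unfolding M_def by (simp add: card_image[OF X(2)] card_cartesian_product)
  \<comment> \<open>The full preimage of \<open>M\<close> under \<open>mid\<close>, so it contains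
    N. The empty vanishing condition only matches the shape of
    \<open>card_orth_unip_filter\<close>.\<close>
  define S where "S = {g \<in> orth_unip_set (Suc (Suc n)). mid (Suc n) g \<in> M \<and> (\<forall>m\<in>{}. g $$ (0, Suc m) = (0 :: 'a))}"
  have cS: "card S = card M * CARD('a) ^ (2 * Suc n)"
    unfolding S_def using card_orth_unip_filter[OF two M, of "{}"] by simp
  have "\<exists>A\<in>carrier_mat k k. \<rho> g * B = B * A" if g: "g \<in> S" for g
  proof -
    have gG: "g \<in> orth_unip_set (Suc (Suc n))" using g by (simp add: S_def)
    obtain x u where xu: "x \<in> X" "u \<in> orth_unip_set n" "mid (Suc n) g = x * emb n j u"
      using g by (auto simp: S_def M_def)
    have x: "x \<in> orth_unip_set (Suc n)" using xu(1) X(1) by auto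
    define b where "b = (\<lambda>m. g $$ (0, Suc m))"
    have u': "emb n j u \<in> orth_unip_set (Suc n)" using emb_closed[OF j xu(2)] .
    have e: "emb (Suc n) 0 x \<in> orth_unip_set (Suc (Suc n))" "?\<kappa> u \<in> orth_unip_set (Suc (Suc n))"
      "Nel (Suc n) b \<in> orth_unip_set (Suc (Suc n))"
      using emb_closed[OF _ x, of 0] emb_closed[OF _ u', of 0] Nel_closed[OF two] by auto
    have "g = emb (Suc n) 0 (x * emb n j u) * Nel (Suc n) b"
      using orth_unip_decomp[OF two gG] by (simp add: xu(3) b_def)
    also have "\<dots> = emb (Suc n) 0 x * ?\<kappa> u * Nel (Suc n) b"
      using emb_mult[OF _ x u', of 0] by simp
    finally have g': "g = emb (Suc n) 0 x * ?\<kappa> u * Nel (Suc n) b" .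
    obtain c where c: "\<forall>w\<in>W. \<rho> (emb (Suc n) 0 x) *\<^sub>v w = c \<cdot>\<^sub>v w" using Xs[OF xu(1)] by auto
    obtain c' where c': "\<forall>w\<in>W. \<rho> (Nel (Suc n) b) *\<^sub>v w = c' \<cdot>\<^sub>v w" using Ns[of b] by auto
    have "\<rho> g = \<rho> (emb (Suc n) 0 x) * \<rho> (?\<kappa> u) * \<rho> (Nel (Suc n) b)"
      unfolding g' rm[OF orth_unip_mult[OF e(1,2)] e(3)] rm[OF e(1,2)] ..
    \<comment> \<open>In this order the three factors can be moved past \<open>B\<close> one after
      the other: scalar, matrix of \<sigma>, scalar.\<close>
    then have "\<rho> g * B = \<rho> (emb (Suc n) 0 x) * (\<rho> (?\<kappa> u) * (\<rho> (Nel (Suc n) b) * B))"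
      using r[OF e(1)] r[OF e(2)] r[OF e(3)] B(1) by (simp add: mat_assoc)
    also have "\<rho> (Nel (Suc n) b) * B = c' \<cdot>\<^sub>m B"
      by (rule rep_scalar_on_columns[OF r[OF e(3)] B(1) BW]) (use c' in auto)
    also have "\<rho> (?\<kappa> u) * (c' \<cdot>\<^sub>m B) = c' \<cdot>\<^sub>m (B * \<sigma> u)"
      using B\<sigma>[of u] xu(2) r[OF e(2)] B(1) by (simp add: mult_smult_distrib[of _ d d _ k] orth_unip_simps)
    also have "\<rho> (emb (Suc n) 0 x) * (c' \<cdot>\<^sub>m (B * \<sigma> u)) = c' \<cdot>\<^sub>m (\<rho> (emb (Suc n) 0 x) * B * \<sigma> u)"
      using r[OF e(1)] B(1) s[OF xu(2)] by (simp add: mult_smult_distrib[of _ d d _ k] mat_assoc)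
    also have "\<rho> (emb (Suc n) 0 x) * B = c \<cdot>\<^sub>m B"
      by (rule rep_scalar_on_columns[OF r[OF e(1)] B(1) BW]) (use c in auto)
    also have "c' \<cdot>\<^sub>m (c \<cdot>\<^sub>m B * \<sigma> u) = B * (c' \<cdot>\<^sub>m (c \<cdot>\<^sub>m \<sigma> u))"
      using B(1) s[OF xu(2)] by (simp add: mult_smult_distrib[of _ d k _ k] mult_smult_assoc_mat[of _ d k _ k])
    finally show ?thesis using s[OF xu(2)] by (intro bexI[of _ "c' \<cdot>\<^sub>m (c \<cdot>\<^sub>m \<sigma> u)"]) auto
  qed
  then have "d * card S \<le> card (carrier ?G) * k"
    by (intro degree_le_index[OF group_orth_unip _ irr B]) (auto simp: orth_unip_simps finU S_def)
  then have "(d * card X) * (card (orth_unip_set n :: 'a mat set) * CARD('a) ^ (2 * Suc n)) \<le>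
    (CARD('a) ^ (2 * n) * k) * (card (orth_unip_set n :: 'a mat set) * CARD('a) ^ (2 * Suc n))"
    by (simp add: cS cM orth_unip_simps card_orth_unip_Suc[OF two] ac_simps del: mult_Suc_right mult_le_cancel2 mult_le_cancel1)
  moreover have "card (orth_unip_set n :: 'a mat set) * CARD('a) ^ (2 * Suc n) > 0"
    using finU[of n] orth_unip_one[of n] by (auto simp: card_gt_0_iff)
  ultimately have "d * card X \<le> CARD('a) ^ (2 * n) * k" by (simp only: mult_le_cancel2)
  also have "\<dots> \<le> CARD('a) ^ (2 * n) * CARD('a) ^ mexp n" using IH[OF \<sigma>] by (rule mult_le_mono2)
  finally show ?thesis by (simp add: power_add)
qed

text \<open>The weight lives on exactly the two coordinates on which \<open>emb n j u\<close> acts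
  trivially.\<close>

lemma emb_weight_fixed:
  fixes u :: "'a::field mat"
  assumes j: "j \<le> n" and u: "u \<in> orth_unip_set n" and l: "l < 2 * Suc n"
    and v: "\<And>m. m < 2 * Suc n \<Longrightarrow> m \<noteq> j \<Longrightarrow> m \<noteq> 2 * n + 1 - j \<Longrightarrow> v m = 0"
  shows "(\<Sum>m<2 * Suc n. emb n j u $$ (l, m) * v m) = v l"
proof -
  have "emb n j u $$ (l, m) * v m = (if m = l then v l else 0)" if m: "m < 2 * Suc n" for m
  proof (cases "m = j \<or> m = 2 * n + 1 - j")
    case True
    then show ?thesis using emb_row(2)[OF j True l, of u] by auto
  next
    case False
    then show ?thesis using v[OF m] by auto
  qed
  then have "(\<Sum>m<2 * Suc n. emb n j u $$ (l, m) * v m) = (\<Sum>m<2 * Suc n. if m = l then v l else 0)"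
    by (intro sum.cong) auto
  then show ?thesis using l by simp
qed

text \<open>The first column of a unitriangular matrix is a unit vector, so a weight supported on
  index 0 is fixed by all of U_n. The whole group then stabilises the weight space and d is at most
  a degree of U_n.\<close>

lemma degree_le_weight_at_ends:
  fixes \<rho> :: "'a::{field,finite} mat \<Rightarrow> complex mat"
  assumes two: "(2 :: 'a) \<noteq> 0" and \<theta>: "nontrivial_additive_character \<theta>"
    and irr: "irr_rep (orth_unip (Suc n)) d \<rho>"
    and w: "w \<in> weight_space \<theta> n d \<rho> v" "w \<noteq> 0\<^sub>v d"
    and v: "\<And>m. 0 < m \<Longrightarrow> m < 2 * n \<Longrightarrow> v m = 0"
    and IH: "\<And>k \<sigma>. irr_rep (orth_unip n :: 'a mat monoid) k \<sigma> \<Longrightarrow> k \<le> CARD('a) ^ mexp n"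
  shows "d \<le> CARD('a) ^ mexp n"
proof -
  let ?G = "orth_unip (Suc n) :: 'a mat monoid" and ?K = "orth_unip n :: 'a mat monoid"
  have \<rho>: "is_rep ?G d \<rho>" using irr by (simp add: irr_rep_def)
  have r: "\<rho> g \<in> carrier_mat d d" if "g \<in> orth_unip_set (Suc n)" for g
    using is_repD[OF \<rho>] that by (simp add: orth_unip_simps)
  have rm: "\<rho> (g * h) = \<rho> g * \<rho> h" if "g \<in> orth_unip_set (Suc n)" "h \<in> orth_unip_set (Suc n)" for g h
    using is_rep_mult[OF \<rho>] that by (simp add: orth_unip_simps)
  let ?W = "weight_space \<theta> n d \<rho> v"
  have inv: "\<rho> (emb n 0 u) *\<^sub>v w \<in> ?W" if u: "u \<in> orth_unip_set n" and w: "w \<in> ?W" for u w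
  proof -
    have "weight_space \<theta> n d \<rho> (\<lambda>l. \<Sum>m<2 * n. mid n (emb n 0 u) $$ (l, m) * v m) = ?W"
    proof (rule weight_space_cong)
      fix l assume l: "l < 2 * n"
      have "u $$ (l, m) * v m = (if m = l then v l else 0)" if "m < 2 * n" for m
        using v[of m] that l orth_unipD(4)[OF u, of 0 l] by (cases "m = 0") auto
      then have "(\<Sum>m<2 * n. u $$ (l, m) * v m) = (\<Sum>m<2 * n. if m = l then v l else 0)"
        by (intro sum.cong) auto
      then show "(\<Sum>m<2 * n. mid n (emb n 0 u) $$ (l, m) * v m) = v l" using l by (simp add: mid_emb[OF u])
    qed
    then show ?thesis using weight_space_move[OF two \<theta> \<rho> emb_closed[OF _ u] w, of 0] by simp
  qed
  obtain k B \<sigma> where B: "B \<in> carrier_mat d k" "B \<noteq> 0\<^sub>m d k" and \<sigma>: "irr_rep ?K k \<sigma>"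
    and BW: "\<And>v. v \<in> carrier_vec k \<Longrightarrow> B *\<^sub>v v \<in> ?W" and B\<sigma>: "\<And>g. g \<in> carrier ?K \<Longrightarrow> \<rho> (emb n 0 g) * B = B * \<sigma> g"
    by (rule irreducible_subrep_in[OF group_orth_unip is_rep_comp[OF \<rho> group_orth_unip group_orth_unip emb_hom[of 0 n]]
        weight_space_subspace[OF two \<theta> \<rho>] _ w])
      (use inv in \<open>auto simp: orth_unip_simps\<close>)
  have s: "\<sigma> u \<in> carrier_mat k k" if "u \<in> orth_unip_set n" for u
    using \<sigma> that is_repD(1)[of ?K k \<sigma> u] by (simp add: irr_rep_def orth_unip_simps)
  have "\<exists>A\<in>carrier_mat k k. \<rho> g * B = B * A" if g: "g \<in> orth_unip_set (Suc n)" for g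
  proof -
    define b where "b = (\<lambda>m. g $$ (0, Suc m))"
    let ?u = "mid n g"
    have u: "?u \<in> orth_unip_set n" using mid_closed[OF g] .
    have e: "emb n 0 ?u \<in> orth_unip_set (Suc n)" "Nel n b \<in> orth_unip_set (Suc n)"
      using emb_closed[OF _ u, of 0] Nel_closed[OF two] by auto
    have g': "g = emb n 0 ?u * Nel n b" using orth_unip_decomp[OF two g] by (simp add: b_def)
    let ?c = "\<theta> (\<Sum>l<2 * n. v l * b l)"
    have "\<rho> g = \<rho> (emb n 0 ?u) * \<rho> (Nel n b)"
      by (subst g') (rule rm[OF e])
    then have "\<rho> g * B = \<rho> (emb n 0 ?u) * (\<rho> (Nel n b) * B)"
      using r[OF e(1)] r[OF e(2)] B(1) by (simp add: mat_assoc)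
    also have "\<rho> (Nel n b) * B = ?c \<cdot>\<^sub>m B"
      by (rule rep_scalar_on_columns[OF r[OF e(2)] B(1) BW]) (auto simp: weight_space_def)
    also have "\<rho> (emb n 0 ?u) * (?c \<cdot>\<^sub>m B) = B * (?c \<cdot>\<^sub>m \<sigma> ?u)"
      using B\<sigma>[of ?u] u r[OF e(1)] B(1) s[OF u]
      by (simp add: mult_smult_distrib[of _ d d _ k] mult_smult_distrib[of _ d k _ k] orth_unip_simps)
    finally show ?thesis using s[OF u] by (intro bexI[of _ "?c \<cdot>\<^sub>m \<sigma> ?u"]) auto
  qed
  then have "d * card (orth_unip_set (Suc n) :: 'a mat set) \<le> card (carrier ?G) * k"
    by (intro degree_le_index[OF group_orth_unip _ irr B]) (auto simp: orth_unip_simps orth_unip_finite[OF two])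
  moreover have "card (orth_unip_set (Suc n) :: 'a mat set) > 0"
    using orth_unip_finite[OF two, of "Suc n"] orth_unip_one[of "Suc n"] by (auto simp: card_gt_0_iff)
  ultimately have "d \<le> k" by (simp add: orth_unip_simps mult.commute)
  then show ?thesis using IH[OF \<sigma>] by simp
qed

text \<open>Dichotomy on the weight: either it is supported on index 0, or it has a pivot beyond 0
  and can be concentrated on the pivot and its mirror.\<close>

lemma weight_normal_form_exists:
  fixes \<rho> :: "'a::{field,finite} mat \<Rightarrow> complex mat"
  assumes two: "(2 :: 'a) \<noteq> 0" and \<theta>: "nontrivial_additive_character \<theta>"
    and \<rho>: "is_rep (orth_unip (Suc n)) d \<rho>" and "d > 0"
  obtains v w where "w \<in> weight_space \<theta> n d \<rho> v" "w \<noteq> 0\<^sub>v d" "\<And>m. 0 < m \<Longrightarrow> m < 2 * n \<Longrightarrow> v m = 0"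
  | v w j where "w \<in> weight_space \<theta> n d \<rho> v" "w \<noteq> 0\<^sub>v d" "0 < j" "j < 2 * n" "v j \<noteq> 0"
      "\<And>m. m < 2 * n \<Longrightarrow> m \<noteq> j \<Longrightarrow> m \<noteq> 2 * n - 1 - j \<Longrightarrow> v m = 0"
proof -
  obtain v w where w: "w \<in> weight_space \<theta> n d \<rho> v" "w \<noteq> 0\<^sub>v d"
    using weight_exists[OF two \<theta> \<rho> \<open>d > 0\<close>] by auto
  show thesis
  proof (cases "\<forall>m. 0 < m \<longrightarrow> m < 2 * n \<longrightarrow> v m = 0")
    case True
    then show ?thesis using that(1)[OF w] by blast
  next
    case False
    let ?J = "{m. 0 < m \<and> m < 2 * n \<and> v m \<noteq> 0}"
    have fin: "finite ?J" and ne: "?J \<noteq> {}" using False by auto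
    \<comment> \<open>The last nonzero index, so that only earlier entries remain to be
      cleared.\<close>
    define j where "j = Max ?J"
    have j: "0 < j" "j < 2 * n" "v j \<noteq> 0" using Max_in[OF fin ne] by (auto simp: j_def)
    have "v m = 0" if "j < m" "m < 2 * n" for m
    proof (rule ccontr)
      assume "v m \<noteq> 0"
      then have "m \<in> ?J" using that j(1) by simp
      from Max_ge[OF fin this] show False using that(1) by (simp add: j_def[symmetric])
    qed
    then obtain v' w' where "w' \<in> weight_space \<theta> n d \<rho> v'" "w' \<noteq> 0\<^sub>v d" "v' j \<noteq> 0"
      "\<forall>m<2 * n. m \<noteq> j \<longrightarrow> m \<noteq> 2 * n - 1 - j \<longrightarrow> v' m = 0"
      using weight_normal_form[OF two \<theta> \<rho> w j(2,3)] by blast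
    then show ?thesis using that(2)[of w' v' j] j by blast
  qed
qed

lemma weight_space_emb_inv:
  fixes \<rho> :: "'a::{field,finite} mat \<Rightarrow> complex mat"
  assumes two: "(2 :: 'a) \<noteq> 0" and \<theta>: "nontrivial_additive_character \<theta>"
    and \<rho>: "is_rep (orth_unip (Suc (Suc n))) d \<rho>" and j: "j \<le> n" and u: "u \<in> orth_unip_set n"
    and v: "\<And>m. m < 2 * Suc n \<Longrightarrow> m \<noteq> j \<Longrightarrow> m \<noteq> 2 * n + 1 - j \<Longrightarrow> v m = 0"
    and w: "w \<in> weight_space \<theta> (Suc n) d \<rho> v"
  shows "\<rho> (emb (Suc n) 0 (emb n j u)) *\<^sub>v w \<in> weight_space \<theta> (Suc n) d \<rho> v"
proof -
  have u': "emb n j u \<in> orth_unip_set (Suc n)" using emb_closed[OF j u] .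
  have "weight_space \<theta> (Suc n) d \<rho> (\<lambda>l. \<Sum>m<2 * Suc n. mid (Suc n) (emb (Suc n) 0 (emb n j u)) $$ (l, m) * v m) =
      weight_space \<theta> (Suc n) d \<rho> v"
    unfolding mid_emb[OF u'] by (rule weight_space_cong) (rule emb_weight_fixed[OF j u _ v])
  then show ?thesis using weight_space_move[OF two \<theta> \<rho> emb_closed[OF _ u'] w, of 0] by simp
qed

text \<open>The group is trivial, so the line through the first unit vector is stable and
  \<open>degree_le_index\<close> applies with index 1.\<close>

lemma degree_le_0:
  fixes \<rho> :: "'a::{field,finite} mat \<Rightarrow> complex mat"
  assumes two: "(2 :: 'a) \<noteq> 0" and irr: "irr_rep (orth_unip 0) d \<rho>"
  shows "d \<le> 1"
proof -
  let ?B = "mat_of_cols d [unit_vec d 0] :: complex mat"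
  have d: "d > 0" and \<rho>: "is_rep (orth_unip 0 :: 'a mat monoid) d \<rho>" using irr by (auto simp: irr_rep_def)
  have B: "?B \<in> carrier_mat d 1" using mat_of_cols_carrier(1)[of d "[unit_vec d 0]"] by simp
  have "?B $$ (0, 0) = 1" using d by (simp add: mat_of_cols_def)
  then have B0: "?B \<noteq> 0\<^sub>m d 1" using d by (metis index_zero_mat(1) less_one zero_neq_one)
  have "d * card {1\<^sub>m 0 :: 'a mat} \<le> card (carrier (orth_unip 0 :: 'a mat monoid)) * 1"
  proof (rule degree_le_index[OF group_orth_unip _ irr B B0])
    have "\<rho> (1\<^sub>m 0) = 1\<^sub>m d" using \<rho> by (simp add: is_rep_def orth_unip_simps)
    then show "\<exists>A\<in>carrier_mat 1 1. \<rho> s * ?B = ?B * A" if "s \<in> {1\<^sub>m 0}" for s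
      using that B by (auto intro!: bexI[of _ "1\<^sub>m 1"])
  qed (simp_all add: orth_unip_simps orth_unip_0)
  then show ?thesis by (simp add: orth_unip_simps orth_unip_0)
qed

lemma degree_le:
  fixes \<rho> :: "'a::{field,finite} mat \<Rightarrow> complex mat"
  assumes two: "(2 :: 'a) \<noteq> 0" and \<theta>: "nontrivial_additive_character (\<theta> :: 'a \<Rightarrow> complex)"
  shows "irr_rep (orth_unip n) d \<rho> \<Longrightarrow> d \<le> CARD('a) ^ mexp n"
proof (induction n arbitrary: d \<rho> rule: less_induct)
  case (less n)
  note irr = less.prems
  have d: "d > 0" and \<rho>: "is_rep (orth_unip n) d \<rho>" using irr by (auto simp: irr_rep_def)
  show ?case
  proof (cases n)
    case 0
    then show ?thesis using degree_le_0[OF two] irr by simp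
  next
    case n: (Suc n')
    have q: "CARD('a) > 0" by simp
    show ?thesis
    proof (cases rule: weight_normal_form_exists[OF two \<theta> \<rho>[unfolded n] d])
      case (1 v w)
      have "d \<le> CARD('a) ^ mexp n'"
        by (rule degree_le_weight_at_ends[OF two \<theta> irr[unfolded n] 1]) (use less.IH n in auto)
      also have "\<dots> \<le> CARD('a) ^ mexp n" unfolding n using q by (intro power_increasing mexp_mono) auto
      finally show ?thesis .
    next
      case (2 v w j)
      then obtain m where n': "n' = Suc m" by (cases n') auto
      \<comment> \<open>\<open>emb\<close> is indexed by the lower member of a mirrored
        pair.\<close>
      define i where "i = min j (2 * n' - 1 - j)"
      have i: "i \<le> m" using 2(4) by (auto simp: i_def n')
      have v: "v l = 0" if "l < 2 * Suc m" "l \<noteq> i" "l \<noteq> 2 * m + 1 - i" for l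
        using 2(6)[of l] that 2(4) by (auto simp: i_def n' min_def split: if_splits)
      \<comment> \<open>The general bound takes X trivial; a larger X is what
        \<open>degree_less\<close> adds.\<close>
      have "d * card {1\<^sub>m (2 * Suc m) :: 'a mat} \<le> CARD('a) ^ mexp (Suc (Suc m))"
      proof (rule degree_le_of_subgroup[OF two irr[unfolded n n'] i weight_space_subspace[OF two \<theta> \<rho>[unfolded n n']]
            2(1,2)[unfolded n']])
        show "\<rho> (emb (Suc m) 0 (emb m i u)) *\<^sub>v w \<in> weight_space \<theta> (Suc m) d \<rho> v"
          if "u \<in> orth_unip_set m" "w \<in> weight_space \<theta> (Suc m) d \<rho> v" for u w
          by (rule weight_space_emb_inv[OF two \<theta> \<rho>[unfolded n n'] i that(1) v that(2)])
        show "inj_on (\<lambda>(x, u). x * emb m i u) ({1\<^sub>m (2 * Suc m)} \<times> orth_unip_set m)"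
        proof -
          have "1\<^sub>m (2 * Suc m) * emb m i u = (emb m i u :: 'a mat)" for u
            by (rule left_mult_one_mat[OF emb_dim(1)])
          then show ?thesis by (auto simp: inj_on_def simp del: mult_Suc_right dest: emb_inj[OF i])
        qed
        have "emb (Suc m) 0 (1\<^sub>m (2 * Suc m)) = (1\<^sub>m (2 * Suc (Suc m)) :: 'a mat)" by (rule emb_one) simp
        then have "\<rho> (emb (Suc m) 0 (1\<^sub>m (2 * Suc m))) = 1\<^sub>m d"
          using \<rho>[unfolded n n'] by (simp add: is_rep_def orth_unip_simps)
        then show "\<exists>c. \<forall>w\<in>weight_space \<theta> (Suc m) d \<rho> v. \<rho> (emb (Suc m) 0 x) *\<^sub>v w = c \<cdot>\<^sub>v w"
          if "x \<in> {1\<^sub>m (2 * Suc m)}" for x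
          using that by (auto simp: weight_space_def intro!: exI[of _ 1])
        show "\<exists>c. \<forall>w\<in>weight_space \<theta> (Suc m) d \<rho> v. \<rho> (Nel (Suc m) b) *\<^sub>v w = c \<cdot>\<^sub>v w" for b
          by (auto simp: weight_space_def)
      qed (use less.IH n n' orth_unip_one[of "Suc m"] in auto)
      then show ?thesis by (simp add: n n')
    qed
  qed
qed

text \<open>A trivial centre forces the last weight coordinate to be 0, so a pivot and its mirror
  both lie strictly between the ends. Elements of the next smaller N supported on this pair can then
  fix the weight and commute with U_m, so X may be taken with q elements.\<close>

lemma degree_less:
  fixes \<rho> :: "'a::{field,finite} mat \<Rightarrow> complex mat"
  assumes two: "(2 :: 'a) \<noteq> 0" and \<theta>: "nontrivial_additive_character (\<theta> :: 'a \<Rightarrow> complex)"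
    and irr: "irr_rep (orth_unip (Suc (Suc m))) d \<rho>" and "m \<ge> 1"
    and Z: "\<And>t. \<rho> (Nel (Suc m) (\<lambda>l. if l = Suc (2 * m) then t else 0)) = 1\<^sub>m d"
  shows "d < CARD('a) ^ mexp (Suc (Suc m))"
proof -
  have d: "d > 0" and \<rho>: "is_rep (orth_unip (Suc (Suc m)) :: 'a mat monoid) d \<rho>" using irr by (auto simp: irr_rep_def)
  have r: "\<rho> g \<in> carrier_mat d d" if "g \<in> orth_unip_set (Suc (Suc m))" for g
    using is_repD[OF \<rho>] that by (simp add: orth_unip_simps)
  have rm: "\<rho> (g * h) = \<rho> g * \<rho> h" if "g \<in> orth_unip_set (Suc (Suc m))" "h \<in> orth_unip_set (Suc (Suc m))" for g h
    using is_rep_mult[OF \<rho>] that by (simp add: orth_unip_simps)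
  have q: "CARD('a) > 1"
    using card_mono[of "UNIV :: 'a set" "{0, 1}"] by simp
  show ?thesis
  proof (cases rule: weight_normal_form_exists[OF two \<theta> \<rho> d])
    case (1 v w)
    have "d \<le> CARD('a) ^ mexp (Suc m)"
      by (rule degree_le_weight_at_ends[OF two \<theta> irr 1 degree_le[OF two \<theta>]])
    also have "\<dots> < CARD('a) ^ mexp (Suc (Suc m))"
      using q \<open>m \<ge> 1\<close> by (intro power_strict_increasing mexp_strict_mono) auto
    finally show ?thesis .
  next
    case (2 v w j)
    \<comment> \<open>The central family acts on the weight vector through the last coordinate of v;
      a nonzero value there would make \<theta> trivial.\<close>
    have vlast: "v (Suc (2 * m)) = 0"
    proof (rule ccontr)
      assume nz: "v (Suc (2 * m)) \<noteq> 0"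
      obtain a where a: "\<theta> a \<noteq> 1" using \<theta> by (auto simp: nontrivial_additive_character_def)
      define t where "t = a / v (Suc (2 * m))"
      have wc: "w \<in> carrier_vec d" using 2(1) by (simp add: weight_space_def)
      have "(\<Sum>l<2 * Suc m. v l * (if l = Suc (2 * m) then t else 0)) = (\<Sum>l<2 * Suc m. if l = Suc (2 * m) then a else 0)"
        using nz by (intro sum.cong) (auto simp: t_def)
      also have "\<dots> = a" by (subst sum.delta) auto
      finally have sa: "(\<Sum>l<2 * Suc m. v l * (if l = Suc (2 * m) then t else 0)) = a" .
      have "\<rho> (Nel (Suc m) (\<lambda>l. if l = Suc (2 * m) then t else 0)) *\<^sub>v w =
          \<theta> (\<Sum>l<2 * Suc m. v l * (if l = Suc (2 * m) then t else 0)) \<cdot>\<^sub>v w"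
        using 2(1) unfolding weight_space_def by blast
      then have "w = \<theta> a \<cdot>\<^sub>v w" unfolding sa Z using wc by simp
      then have e: "w $ i = \<theta> a * w $ i" if "i < d" for i using wc that by (metis carrier_vecD index_smult_vec(1))
      have "w $ i = 0" if "i < d" for i using e[OF that] a by simp
      then have "w = 0\<^sub>v d" using wc by (intro eq_vecI) auto
      then show False using 2(2) by simp
    qed
    let ?bj = "2 * m + 1 - j"
    have j: "0 < j" "j \<le> 2 * m" "0 < ?bj" "?bj \<le> 2 * m" "?bj \<noteq> j"
    proof -
      have "j \<noteq> Suc (2 * m)" using 2(5) vlast by auto
      then show "0 < j" "j \<le> 2 * m" "0 < ?bj" "?bj \<le> 2 * m" "?bj \<noteq> j"
        using 2(3,4) reflect_neq[of j "Suc m"] by auto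
    qed
    define i where "i = min j ?bj"
    have i: "i \<le> m" using j by (auto simp: i_def)
    have ij: "j = i \<or> j = 2 * m + 1 - i" "?bj = i \<or> ?bj = 2 * m + 1 - i"
      using j by (auto simp: i_def)
    have v: "v l = 0" if "l < 2 * Suc m" "l \<noteq> i" "l \<noteq> 2 * m + 1 - i" for l
      using 2(6)[of l] that j by (auto simp: i_def min_def split: if_splits)
    \<comment> \<open>The row is orthogonal to the weight: t v_j v_j' - t v_j' v_j = 0 with j' the
      mirror of j. The indices drop by one because entry k of \<open>a\<close> sits in column k +
      1.\<close>
    define a where "a t l = (if l = ?bj - 1 then t * v j else if l = j - 1 then - t * v ?bj else 0)" for t l
    define x where "x t = Nel m (a t)" for t
    have x: "x t \<in> orth_unip_set (Suc m)" for t unfolding x_def by (rule Nel_closed[OF two])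
    have ex: "emb (Suc m) 0 (x t) \<in> orth_unip_set (Suc (Suc m))" for t using x by (intro emb_closed) auto
    have xadd: "x (s + t) = x s * x t" for s t
      unfolding x_def Nel_mult[OF two] by (rule Nel_cong) (auto simp: a_def algebra_simps)
    have xfix: "(\<Sum>k<2 * Suc m. x t $$ (l, k) * v k) = v l" if l: "l < 2 * Suc m" for t l
    proof -
      have s: "(\<Sum>k<2 * Suc m. x t $$ (l, k) * v k) = x t $$ (l, 0) * v 0 + (\<Sum>k<2 * m. x t $$ (l, Suc k) * v (Suc k))"
        using vlast by (simp add: sum_ends del: sum.lessThan_Suc)
      show ?thesis
      proof (cases rule: ends_cases[OF l])
        case 1
        have "(\<Sum>k<2 * m. x t $$ (0, Suc k) * v (Suc k)) =
          (\<Sum>k<2 * m. (if k = ?bj - 1 then t * v j * v ?bj else 0) + (if k = j - 1 then - t * v ?bj * v j else 0))"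
        proof (intro sum.cong refl)
          fix k assume "k \<in> {..<2 * m}"
          then have xk: "x t $$ (0, Suc k) = a t k" by (simp add: x_def Nel_index)
          have "Suc (?bj - 1) = ?bj" "Suc (j - 1) = j" "?bj - 1 \<noteq> j - 1" using j by auto
          then show "x t $$ (0, Suc k) * v (Suc k) =
              (if k = ?bj - 1 then t * v j * v ?bj else 0) + (if k = j - 1 then - t * v ?bj * v j else 0)"
            unfolding xk a_def by (cases "k = ?bj - 1"; cases "k = j - 1") simp_all
        qed
        also have "\<dots> = 0"
        proof -
          have "?bj - 1 < 2 * m" "j - 1 < 2 * m" using j by auto
          then show ?thesis unfolding sum.distrib by (simp add: sum.delta algebra_simps)
        qed
        finally show ?thesis unfolding s using 1 by (simp add: x_def Nel_index(5))
      next
        case (2 l')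
        have "(\<Sum>k<2 * m. x t $$ (Suc l', Suc k) * v (Suc k)) = (\<Sum>k<2 * m. if k = l' then v (Suc l') else 0)"
          using 2 by (intro sum.cong) (auto simp: x_def Nel_index)
        then show ?thesis unfolding s using 2 by (simp add: x_def Nel_index(5))
      next
        case 3
        have "(\<Sum>k<2 * m. x t $$ (Suc (2 * m), Suc k) * v (Suc k)) = 0"
          by (intro sum.neutral) (auto simp: x_def Nel_index(5))
        then show ?thesis unfolding s using 3 vlast by (simp add: x_def Nel_index(5))
      qed
    qed
    \<comment> \<open>The row \<open>a t\<close> is supported on the two coordinates that
      \<open>emb m i u\<close> leaves alone, so conjugation does not change it.\<close>
    have comm: "x t * emb m i u = emb m i u * x t" if u: "u \<in> orth_unip_set m" for t u
      unfolding x_def Nel_mult_right[OF two emb_closed[OF i u]]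
    proof (rule arg_cong[of _ _ "(*) (emb m i u)"], rule Nel_cong)
      fix k assume k: "k < 2 * m"
      have "a t l * mid m (emb m i u) $$ (l, k) = (if l = k then a t k else 0)" if l: "l < 2 * m" for l
      proof (cases "l = j - 1 \<or> l = ?bj - 1")
        case True
        then have sp: "Suc l = i \<or> Suc l = 2 * m + 1 - i" using j ij by auto
        have "emb m i u $$ (Suc l, Suc k) = (if Suc l = Suc k then 1 else 0)"
          by (rule emb_row(1)[OF i sp]) (use k in simp)
        then show ?thesis using l k by (simp add: mid_index)
      next
        case False
        then show ?thesis by (auto simp: a_def)
      qed
      then have "(\<Sum>l<2 * m. a t l * mid m (emb m i u) $$ (l, k)) = (\<Sum>l<2 * m. if l = k then a t k else 0)"
        by (intro sum.cong) auto
      then show "(\<Sum>l<2 * m. a t l * mid m (emb m i u) $$ (l, k)) = a t k" using k by simp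
    qed
    \<comment> \<open>Since the pivot v_j is nonzero, this entry recovers t from the product; that
      makes the factorisation x u unique.\<close>
    have first: "(x t * emb m i u) $$ (0, ?bj) = t * v j" if u: "u \<in> orth_unip_set m" for t u
    proof -
      define b where "b = ?bj - 1"
      have b: "?bj = Suc b" "b < 2 * m" using j by (auto simp: b_def)
      have sp: "Suc b = i \<or> Suc b = 2 * m + 1 - i" using ij(2) unfolding b(1) .
      have c: "emb m i u $$ (l, Suc b) = (if Suc b = l then 1 else 0)" if "l < 2 * Suc m" for l
        by (rule emb_row(2)[OF i sp that])
      have "(x t * emb m i u) $$ (0, Suc b) = (\<Sum>l<2 * m. x t $$ (0, Suc l) * mid m (emb m i u) $$ (l, b))"
        using mult_first_row[OF x[of t] emb_closed[OF i u] b(2)] c[of 0] by simp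
      also have "\<dots> = (\<Sum>l<2 * m. if l = b then t * v j else 0)"
        using b(2) c by (intro sum.cong) (auto simp: mid_index x_def Nel_index a_def b_def)
      finally show ?thesis unfolding b(1) using b(2) by simp
    qed
    define T where "T t = \<rho> (emb (Suc m) 0 (x t))" for t
    let ?V = "weight_space \<theta> (Suc m) d \<rho> v"
    have Vsub: "lin_subspace d ?V" by (rule weight_space_subspace[OF two \<theta> \<rho>])
    have Tc: "T t \<in> carrier_mat d d" for t unfolding T_def using r[OF ex] .
    have TV: "T t *\<^sub>v w \<in> ?V" if w: "w \<in> ?V" for t w
    proof -
      have "weight_space \<theta> (Suc m) d \<rho> (\<lambda>l. \<Sum>k<2 * Suc m. mid (Suc m) (emb (Suc m) 0 (x t)) $$ (l, k) * v k) = ?V"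
        unfolding mid_emb[OF x] by (rule weight_space_cong) (rule xfix)
      then show ?thesis unfolding T_def using weight_space_move[OF two \<theta> \<rho> ex w, of t] by simp
    qed
    \<comment> \<open>The family preserves the weight space but need not act by scalars there;
      passing to one of its eigenspaces achieves this.\<close>
    have "\<exists>r. \<exists>w'\<in>?V. w' \<noteq> 0\<^sub>v d \<and> (\<forall>t. T t *\<^sub>v w' = \<theta> (r * t) \<cdot>\<^sub>v w')"
    proof (rule one_parameter_eigenvector[OF \<theta> Tc _ _ Vsub TV 2(1,2)])
      show Tadd: "T (s + t) = T s * T t" for s t
        unfolding T_def xadd emb_mult[OF le0 x x] by (rule rm[OF ex ex])
      have "x 0 = 1\<^sub>m (2 * Suc m)" unfolding x_def by (rule Nel_zero) (simp add: a_def)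
      then show "T 0 = 1\<^sub>m d" using emb_one[of 0 "Suc m", where 'a = 'a] \<rho> by (simp add: T_def is_rep_def orth_unip_simps)
    qed
    then obtain r' w' where w': "w' \<in> ?V" "w' \<noteq> 0\<^sub>v d" "\<And>t. T t *\<^sub>v w' = \<theta> (r' * t) \<cdot>\<^sub>v w'" by auto
    let ?E = "{w \<in> carrier_vec d. \<forall>t\<in>UNIV. T t *\<^sub>v w = \<theta> (r' * t) \<cdot>\<^sub>v w}"
    have Wsub: "lin_subspace d (?V \<inter> ?E)"
      by (rule lin_subspace_Int[OF Vsub lin_subspace_eigen[OF Tc]])
    have wW: "w' \<in> ?V \<inter> ?E" using w' by (auto simp: weight_space_def)
    have inj: "inj_on (\<lambda>(x, u). x * emb m i u) (range x \<times> orth_unip_set m)"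
    proof (rule inj_onI, clarsimp)
      fix s t and u u' :: "'a mat" assume u: "u \<in> orth_unip_set m" "u' \<in> orth_unip_set m"
        and e: "x s * emb m i u = x t * emb m i u'"
      have "s * v j = t * v j" using first[OF u(1), of s] first[OF u(2), of t] e by simp
      then have st: "s = t" using 2(5) by simp
      interpret group "orth_unip (Suc m) :: 'a mat monoid" by (rule group_orth_unip)
      have "emb m i u = emb m i u'"
        using inj_onD[OF inj_on_cmult[of "x t"], of "emb m i u" "emb m i u'"] e x emb_closed[OF i u(1)] emb_closed[OF i u(2)]
        by (simp add: st orth_unip_simps)
      then show "x s = x t \<and> u = u'" using st emb_inj[OF i u] by simp
    qed
    have "d * card (range x) \<le> CARD('a) ^ mexp (Suc (Suc m))"
    proof (rule degree_le_of_subgroup[OF two irr i Wsub wW w'(2) _ _ inj _ _ degree_le[OF two \<theta>]])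
      show "\<rho> (emb (Suc m) 0 (emb m i u)) *\<^sub>v w \<in> ?V \<inter> ?E" if u: "u \<in> orth_unip_set m" and w: "w \<in> ?V \<inter> ?E" for u w
      proof -
        let ?k = "emb (Suc m) 0 (emb m i u)"
        have ek: "emb m i u \<in> orth_unip_set (Suc m)" by (rule emb_closed[OF i u])
        have kG: "?k \<in> orth_unip_set (Suc (Suc m))" by (rule emb_closed[OF le0 ek])
        have wc: "w \<in> carrier_vec d" using w by simp
        have "T t *\<^sub>v (\<rho> ?k *\<^sub>v w) = \<theta> (r' * t) \<cdot>\<^sub>v (\<rho> ?k *\<^sub>v w)" for t
        proof -
          have c: "T t * \<rho> ?k = \<rho> ?k * T t"
            unfolding T_def rm[OF ex kG, symmetric] rm[OF kG ex, symmetric] emb_mult[OF le0 x ek, symmetric]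
              emb_mult[OF le0 ek x, symmetric] comm[OF u] ..
          have "T t *\<^sub>v (\<rho> ?k *\<^sub>v w) = T t * \<rho> ?k *\<^sub>v w" using Tc[of t] r[OF kG] wc by simp
          also have "\<dots> = \<rho> ?k *\<^sub>v (T t *\<^sub>v w)" unfolding c using Tc[of t] r[OF kG] wc by simp
          also have "T t *\<^sub>v w = \<theta> (r' * t) \<cdot>\<^sub>v w" using w by simp
          finally show ?thesis using mult_mat_vec[OF r[OF kG] wc] by simp
        qed
        moreover have "\<rho> ?k *\<^sub>v w \<in> ?V"
          by (rule weight_space_emb_inv[OF two \<theta> \<rho> i u v]) (use w in auto)
        ultimately show ?thesis by (auto simp: weight_space_def)
      qed
      show "range x \<subseteq> orth_unip_set (Suc m)" using x by auto
      show "\<exists>c. \<forall>w\<in>?V \<inter> ?E. \<rho> (emb (Suc m) 0 y) *\<^sub>v w = c \<cdot>\<^sub>v w" if "y \<in> range x" for y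
        using that by (auto simp: T_def)
      show "\<exists>c. \<forall>w\<in>?V \<inter> ?E. \<rho> (Nel (Suc m) b) *\<^sub>v w = c \<cdot>\<^sub>v w" for b
        by (auto simp: weight_space_def)
    qed
    moreover have "card (range x) = CARD('a)"
    proof (rule card_image, rule injI)
      fix s t assume e: "x s = x t"
      show "s = t" using first[OF orth_unip_one, of s] first[OF orth_unip_one, of t] e 2(5) by simp
    qed
    ultimately have "d * CARD('a) \<le> CARD('a) ^ mexp (Suc (Suc m))" by simp
    moreover have "d < d * CARD('a)" using d q by simp
    ultimately show ?thesis by linarith
  qed
qed

section \<open>Induced characters\<close>

lemma mat_trace_conj:
  fixes G (structure)
  assumes "group G" "is_rep G d \<rho>" "g \<in> carrier G" "x \<in> carrier G"
  shows "mat_trace (\<rho> (x \<otimes> g \<otimes> inv x)) = mat_trace (\<rho> g)"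
proof -
  interpret group G by fact
  note r = is_repD[OF assms(2) assms(3)] is_repD[OF assms(2) assms(4)] is_repD[OF assms(2) inv_closed[OF assms(4)]]
  have "mat_trace (\<rho> (x \<otimes> g \<otimes> inv x)) = mat_trace (\<rho> x * (\<rho> g * \<rho> (inv x)))"
    using assms r by (simp add: is_rep_mult[OF assms(2)] mat_assoc)
  also have "\<dots> = mat_trace (\<rho> g * \<rho> (inv x) * \<rho> x)"
    using r by (intro mat_trace_comm[of _ d d]) auto
  also have "\<dots> = mat_trace (\<rho> g)"
    using r is_rep_inv(2)[OF assms(1,2,4)] by (simp add: mat_assoc)
  finally show ?thesis .
qed

lemma induced_char_conj:
  fixes G (structure)
  assumes "group G" "g \<in> carrier G" "h \<in> carrier G"
  shows "induced_char G H f (h \<otimes> g \<otimes> inv h) = induced_char G H f g"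
proof -
  interpret group G by fact
  have "(\<Sum>x\<in>carrier G. let y = inv x \<otimes> (h \<otimes> g \<otimes> inv h) \<otimes> x in if y \<in> H then f y else 0) =
    (\<Sum>x\<in>carrier G. let y = inv x \<otimes> g \<otimes> x in if y \<in> H then f y else 0)"
  proof (rule sum.reindex_bij_witness[of _ "\<lambda>x. h \<otimes> x" "\<lambda>x. inv h \<otimes> x"])
    fix x assume x: "x \<in> carrier G"
    then have "inv (inv h \<otimes> x) \<otimes> g \<otimes> (inv h \<otimes> x) = inv x \<otimes> (h \<otimes> g \<otimes> inv h) \<otimes> x"
      using assms by (simp add: inv_mult_group m_assoc)
    then show "(let y = inv (inv h \<otimes> x) \<otimes> g \<otimes> (inv h \<otimes> x) in if y \<in> H then f y else 0) =
      (let y = inv x \<otimes> (h \<otimes> g \<otimes> inv h) \<otimes> x in if y \<in> H then f y else 0)" by simp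
  qed (use assms in \<open>auto simp: m_assoc[symmetric]\<close>)
  then show ?thesis by (simp add: induced_char_def)
qed

text \<open>Every fibre is a coset of the kernel.\<close>

lemma sum_hom_fibres:
  fixes G (structure) and F :: "'h \<Rightarrow> complex"
  assumes "group G" "group G'" "finite (carrier G)" and \<pi>: "\<pi> \<in> hom G G'" "\<pi> ` carrier G = carrier G'"
  shows "(\<Sum>x\<in>carrier G. F (\<pi> x)) = of_nat (card {x \<in> carrier G. \<pi> x = \<one>\<^bsub>G'\<^esub>}) * (\<Sum>y\<in>carrier G'. F y)"
proof -
  interpret group G by fact
  interpret G': group G' by fact
  interpret \<pi>: group_hom G G' \<pi> using \<pi>(1) by unfold_locales
  have card_fibre: "card {x \<in> carrier G. \<pi> x = y} = card {x \<in> carrier G. \<pi> x = \<one>\<^bsub>G'\<^esub>}" if y: "y \<in> carrier G'" for y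
  proof -
    obtain x0 where x0: "x0 \<in> carrier G" "\<pi> x0 = y" using y \<pi>(2) by (metis imageE)
    have "bij_betw (\<lambda>x. x0 \<otimes> x) {x \<in> carrier G. \<pi> x = \<one>\<^bsub>G'\<^esub>} {x \<in> carrier G. \<pi> x = y}"
      by (rule bij_betw_byWitness[of _ "\<lambda>x. inv x0 \<otimes> x"]) (use x0 y in \<open>auto simp: m_assoc[symmetric]\<close>)
    then show ?thesis by (simp add: bij_betw_same_card)
  qed
  have fibre: "(\<Sum>x\<in>{x \<in> carrier G. \<pi> x = y}. F (\<pi> x)) = of_nat (card {x \<in> carrier G. \<pi> x = \<one>\<^bsub>G'\<^esub>}) * F y"
    if "y \<in> carrier G'" for y
  proof -
    have "(\<Sum>x\<in>{x \<in> carrier G. \<pi> x = y}. F (\<pi> x)) = of_nat (card {x \<in> carrier G. \<pi> x = y}) * F y" by simp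
    then show ?thesis by (simp only: card_fibre[OF that])
  qed
  have finG': "finite (carrier G')" using finite_imageI[OF assms(3), of \<pi>] by (simp only: \<pi>(2))
  have "(\<Sum>x\<in>carrier G. F (\<pi> x)) = (\<Sum>y\<in>carrier G'. \<Sum>x\<in>{x \<in> carrier G. \<pi> x = y}. F (\<pi> x))"
    by (rule sum.group[OF assms(3) finG' equalityD1[OF \<pi>(2)], symmetric])
  also have "\<dots> = (\<Sum>y\<in>carrier G'. of_nat (card {x \<in> carrier G. \<pi> x = \<one>\<^bsub>G'\<^esub>}) * F y)"
    by (rule sum.cong[OF refl fibre])
  finally show ?thesis by (simp only: sum_distrib_left)
qed

text \<open>Conjugation sum and order of the subgroup both grow by the order of the kernel, which
  cancels.\<close>

lemma induced_char_inflate: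
  fixes G (structure)
  assumes "group G" "group G'" "finite (carrier G)" and \<pi>: "\<pi> \<in> hom G G'" "\<pi> ` carrier G = carrier G'"
    and H: "H = {g \<in> carrier G. \<pi> g \<in> H'}" "H' \<subseteq> carrier G'" and f: "\<And>h. h \<in> H \<Longrightarrow> f h = f' (\<pi> h)"
    and g: "g \<in> carrier G"
  shows "induced_char G H f g = induced_char G' H' f' (\<pi> g)"
proof -
  interpret group G by fact
  interpret G': group G' by fact
  interpret \<pi>: group_hom G G' \<pi> using \<pi>(1) by unfold_locales
  let ?c = "card {x \<in> carrier G. \<pi> x = \<one>\<^bsub>G'\<^esub>}"
  let ?F = "\<lambda>x. let y = inv\<^bsub>G'\<^esub> x \<otimes>\<^bsub>G'\<^esub> \<pi> g \<otimes>\<^bsub>G'\<^esub> x in if y \<in> H' then f' y else 0"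
  have "(\<Sum>x\<in>carrier G. let y = inv x \<otimes> g \<otimes> x in if y \<in> H then f y else 0) = (\<Sum>x\<in>carrier G. ?F (\<pi> x))"
  proof (rule sum.cong)
    fix x assume x: "x \<in> carrier G"
    have y: "inv x \<otimes> g \<otimes> x \<in> carrier G" using x g by simp
    have e: "\<pi> (inv x \<otimes> g \<otimes> x) = inv\<^bsub>G'\<^esub> \<pi> x \<otimes>\<^bsub>G'\<^esub> \<pi> g \<otimes>\<^bsub>G'\<^esub> \<pi> x" using x g by simp
    show "(let y = inv x \<otimes> g \<otimes> x in if y \<in> H then f y else 0) = ?F (\<pi> x)"
      unfolding Let_def e[symmetric] using y f[of "inv x \<otimes> g \<otimes> x"] by (auto simp: H(1))
  qed simp
  also have "\<dots> = of_nat ?c * (\<Sum>y\<in>carrier G'. ?F y)"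
    by (rule sum_hom_fibres[OF assms(1-3) \<pi>])
  finally have 1: "(\<Sum>x\<in>carrier G. let y = inv x \<otimes> g \<otimes> x in if y \<in> H then f y else 0) = of_nat ?c * (\<Sum>y\<in>carrier G'. ?F y)" .
  have finG': "finite (carrier G')" using assms(3) \<pi>(2) by (metis finite_imageI)
  have "(of_nat (card H) :: complex) = (\<Sum>x\<in>carrier G. if \<pi> x \<in> H' then 1 else 0)"
    unfolding H(1) using sum.inter_filter[OF assms(3), of "\<lambda>_. 1 :: complex" "\<lambda>x. \<pi> x \<in> H'"] by simp
  also have "\<dots> = of_nat ?c * (\<Sum>y\<in>carrier G'. if y \<in> H' then 1 else 0)"
    by (rule sum_hom_fibres[OF assms(1-3) \<pi>])
  also have "(\<Sum>y\<in>carrier G'. if y \<in> H' then 1 else (0 :: complex)) = of_nat (card H')"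
    using finG' H(2) by (simp add: sum.If_cases Int_absorb1)
  finally have 2: "(of_nat (card H) :: complex) = of_nat ?c * of_nat (card H')" .
  have "\<one> \<in> {x \<in> carrier G. \<pi> x = \<one>\<^bsub>G'\<^esub>}" "finite {x \<in> carrier G. \<pi> x = \<one>\<^bsub>G'\<^esub>}" using assms(3) by auto
  then have "?c \<noteq> 0" by (metis card_eq_0_iff empty_iff)
  then show ?thesis unfolding induced_char_def 1 2 by simp
qed

lemma induced_char_one:
  assumes "group G" "\<one>\<^bsub>G\<^esub> \<in> H" "f \<one>\<^bsub>G\<^esub> = 1" "finite (carrier G)" "H \<subseteq> carrier G"
  shows "induced_char G H f \<one>\<^bsub>G\<^esub> \<noteq> 0"
proof -
  interpret group G by fact
  have "(\<Sum>x\<in>carrier G. let y = inv\<^bsub>G\<^esub> x \<otimes>\<^bsub>G\<^esub> \<one>\<^bsub>G\<^esub> \<otimes>\<^bsub>G\<^esub> x in if y \<in> H then f y else 0) = of_nat (card (carrier G))"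
    using assms(2,3) by simp
  moreover have "card H \<noteq> 0" "card (carrier G) \<noteq> 0"
    using assms(2,4,5) finite_subset[OF assms(5,4)] by (metis card_eq_0_iff empty_iff subsetD)+
  ultimately show ?thesis by (simp add: induced_char_def)
qed

text \<open>After conjugation every x contributes the same sum over P. The extra class function
  \<open>\<eta>\<close> carries along the remaining factors of a supercharacter.\<close>

lemma frobenius_reciprocity:
  fixes G (structure) and \<chi> \<eta> f :: "'g \<Rightarrow> complex"
  assumes "group G" "finite (carrier G)" and P: "P \<subseteq> carrier G"
    and \<chi>: "\<And>g x. g \<in> carrier G \<Longrightarrow> x \<in> carrier G \<Longrightarrow> \<chi> (x \<otimes> g \<otimes> inv x) = \<chi> g"
    and \<eta>: "\<And>g x. g \<in> carrier G \<Longrightarrow> x \<in> carrier G \<Longrightarrow> \<eta> (x \<otimes> g \<otimes> inv x) = \<eta> g"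
  shows "(\<Sum>g\<in>carrier G. \<chi> g * cnj (induced_char G P f g * \<eta> g)) =
    of_nat (card (carrier G)) / of_nat (card P) * (\<Sum>h\<in>P. \<chi> h * cnj (f h * \<eta> h))"
proof -
  interpret group G by fact
  let ?F = "\<lambda>y. if y \<in> P then \<chi> y * cnj (f y * \<eta> y) else 0"
  have inner: "(\<Sum>g\<in>carrier G. \<chi> g * cnj ((let y = inv x \<otimes> g \<otimes> x in if y \<in> P then f y else 0) * \<eta> g)) = (\<Sum>h\<in>P. \<chi> h * cnj (f h * \<eta> h))"
    if x: "x \<in> carrier G" for x
  proof -
    have "(\<Sum>g\<in>carrier G. \<chi> g * cnj ((let y = inv x \<otimes> g \<otimes> x in if y \<in> P then f y else 0) * \<eta> g)) = (\<Sum>y\<in>carrier G. ?F y)"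
    proof (rule sum.reindex_bij_witness[of _ "\<lambda>y. x \<otimes> y \<otimes> inv x" "\<lambda>g. inv x \<otimes> g \<otimes> x"])
      fix g assume g: "g \<in> carrier G"
      have c1: "inv x \<otimes> (x \<otimes> a) = a" "x \<otimes> (inv x \<otimes> a) = a" if "a \<in> carrier G" for a
        using that x by (simp_all add: m_assoc[symmetric])
      show "x \<otimes> (inv x \<otimes> g \<otimes> x) \<otimes> inv x = g" "inv x \<otimes> (x \<otimes> g \<otimes> inv x) \<otimes> x = g"
        using x g by (simp_all add: m_assoc c1)
      have "\<chi> (inv x \<otimes> g \<otimes> x) = \<chi> g" "\<eta> (inv x \<otimes> g \<otimes> x) = \<eta> g"
        using \<chi>[OF g, of "inv x"] \<eta>[OF g, of "inv x"] x by auto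
      then show "?F (inv x \<otimes> g \<otimes> x) = \<chi> g * cnj ((let y = inv x \<otimes> g \<otimes> x in if y \<in> P then f y else 0) * \<eta> g)"
        by (simp add: Let_def)
    qed (use x in auto)
    also have "\<dots> = (\<Sum>h\<in>P. \<chi> h * cnj (f h * \<eta> h))"
      using assms(2) P by (simp add: sum.If_cases Int_absorb1)
    finally show ?thesis .
  qed
  have "(\<Sum>g\<in>carrier G. \<chi> g * cnj (induced_char G P f g * \<eta> g)) =
    (\<Sum>g\<in>carrier G. \<Sum>x\<in>carrier G. \<chi> g * cnj ((let y = inv x \<otimes> g \<otimes> x in if y \<in> P then f y else 0) * \<eta> g)) / of_nat (card P)"
    unfolding induced_char_def sum_divide_distrib
    by (intro sum.cong refl) (simp add: sum_distrib_left sum_distrib_right sum_divide_distrib)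
  also have "(\<Sum>g\<in>carrier G. \<Sum>x\<in>carrier G. \<chi> g * cnj ((let y = inv x \<otimes> g \<otimes> x in if y \<in> P then f y else 0) * \<eta> g)) =
    (\<Sum>x\<in>carrier G. \<Sum>h\<in>P. \<chi> h * cnj (f h * \<eta> h))"
    by (subst sum.swap) (rule sum.cong[OF refl inner])
  finally show ?thesis by simp
qed

text \<open>Its trace is concentrated at the identity, so pairing it with any function that is
  nonzero there gives a nonzero sum; this is the source of constituents.\<close>

lemma regular_representation:
  fixes G (structure)
  assumes "group G" "finite (carrier G)"
  obtains \<rho> where "is_rep G (card (carrier G)) \<rho>"
    "\<And>g. g \<in> carrier G \<Longrightarrow> mat_trace (\<rho> g) = (if g = \<one> then of_nat (card (carrier G)) else 0)"
proof -
  interpret group G by fact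
  let ?d = "card (carrier G)"
  obtain e where e: "bij_betw e {..<?d} (carrier G)"
    using ex_bij_betw_nat_finite[OF assms(2)] by (auto simp: atLeast0LessThan)
  have eG: "e i \<in> carrier G" if "i < ?d" for i using e that by (auto simp: bij_betw_def)
  have inj: "e i = e j \<longleftrightarrow> i = j" if "i < ?d" "j < ?d" for i j
    using e that by (auto simp: bij_betw_def inj_on_def)
  define \<rho> where "\<rho> g = (mat ?d ?d (\<lambda>(i, j). if e i = g \<otimes> e j then 1 else 0) :: complex mat)" for g
  have "is_rep G ?d \<rho>"
    unfolding is_rep_def
  proof (intro conjI ballI)
    fix g h assume g: "g \<in> carrier G" and h: "h \<in> carrier G"
    show "\<rho> (g \<otimes> h) = \<rho> g * \<rho> h"
    proof (rule eq_matI)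
      fix i j assume "i < dim_row (\<rho> g * \<rho> h)" "j < dim_col (\<rho> g * \<rho> h)"
      then have ij: "i < ?d" "j < ?d" by (auto simp: \<rho>_def)
      have "(\<rho> g * \<rho> h) $$ (i, j) = (\<Sum>k<?d. \<rho> g $$ (i, k) * \<rho> h $$ (k, j))"
        by (rule mat_mult_index) (use ij in \<open>auto simp: \<rho>_def\<close>)
      also have "\<dots> = (\<Sum>k<?d. (if e i = g \<otimes> e k then 1 else 0) * (if e k = h \<otimes> e j then 1 else 0))"
        using ij by (intro sum.cong) (auto simp: \<rho>_def)
      also have "\<dots> = (\<Sum>x\<in>carrier G. (if e i = g \<otimes> x then 1 else 0) * (if x = h \<otimes> e j then 1 else 0))"
        by (rule sum.reindex_bij_betw[OF e])
      also have "\<dots> = (\<Sum>x\<in>carrier G. if x = h \<otimes> e j then (if e i = g \<otimes> (h \<otimes> e j) then 1 else 0) else 0)"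
        by (intro sum.cong) auto
      also have "\<dots> = \<rho> (g \<otimes> h) $$ (i, j)"
        using assms(2) ij g h eG by (simp add: \<rho>_def m_assoc)
      finally show "\<rho> (g \<otimes> h) $$ (i, j) = (\<rho> g * \<rho> h) $$ (i, j)" ..
    qed (auto simp: \<rho>_def)
  next
    show "\<rho> \<one> = 1\<^sub>m ?d" by (rule eq_matI) (use eG inj in \<open>auto simp: \<rho>_def\<close>)
  qed (auto simp: \<rho>_def)
  moreover have "mat_trace (\<rho> g) = (if g = \<one> then of_nat ?d else 0)" if g: "g \<in> carrier G" for g
  proof -
    have "e i = g \<otimes> e i \<longleftrightarrow> g = \<one>" if "i < ?d" for i
      using g eG[OF that] by (simp add: r_cancel_one')
    then have "(\<Sum>i<?d. \<rho> g $$ (i, i)) = (\<Sum>i<?d. if g = \<one> then 1 else (0 :: complex))"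
      by (intro sum.cong) (auto simp: \<rho>_def)
    then show ?thesis by (simp add: mat_trace_def \<rho>_def)
  qed
  ultimately show thesis by (rule that)
qed

section \<open>Elementary characters\<close>

text \<open>On characters this relabelling is inflation along \<open>mid\<close>, see
  \<open>elementary_char_shift\<close>.\<close>

fun shift_root :: "eps_root \<Rightarrow> eps_root" where
  "shift_root (EMinus i j) = EMinus (Suc i) (Suc j)"
| "shift_root (EPlus i j) = EPlus (Suc i) (Suc j)"

lemma inj_shift_root: "inj shift_root"
proof (rule injI)
  fix \<alpha> \<beta> assume "shift_root \<alpha> = shift_root \<beta>"
  then show "\<alpha> = \<beta>" by (cases \<alpha>; cases \<beta>) auto
qed

lemma pos_int [simp]: "k > 0 \<Longrightarrow> pos n (int k) = k - 1" "pos n (- int k) = 2 * n - k"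
  by (auto simp: pos_def nat_diff_distrib' nat_mult_distrib)

lemma Phi_cases:
  assumes "\<alpha> \<in> Phi n"
  obtains i j where "\<alpha> = EMinus i j" "1 \<le> i" "i < j" "j \<le> n" | i j where "\<alpha> = EPlus i j" "1 \<le> i" "i < j" "j \<le> n"
  using assms by (auto simp: Phi_def)

text \<open>Labels start at 1 and positions at 0: label k is position k - 1, label -k is position 2n
  - k.\<close>

lemma root_linear_char_index:
  assumes "1 \<le> i" "i < j" "j \<le> n"
  shows "root_linear_char n \<theta> (EMinus i j) r x = \<theta> (r * x $$ (i - 1, j - 1))"
    "root_linear_char n \<theta> (EPlus i j) r x = \<theta> (r * x $$ (i - 1, 2 * n - j))"
  using assms by (simp_all add: root_linear_char_def main_entry_EMinus main_entry_EPlus entry_def)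

lemma root_subgroup_index:
  assumes "1 \<le> i" "i < j" "j \<le> n"
  shows "x \<in> root_subgroup n (EMinus i j) \<longleftrightarrow> x \<in> orth_unip_set n \<and> (\<forall>k. i \<le> k \<and> Suc k < j \<longrightarrow> x $$ (i - 1, k) = 0)"
    "x \<in> root_subgroup n (EPlus i j) \<longleftrightarrow> x \<in> orth_unip_set n \<and> (\<forall>k. i \<le> k \<and> k < n \<longrightarrow> x $$ (i - 1, k) = 0) \<and>
      (\<forall>k. j \<le> k \<and> k < n \<longrightarrow> x $$ (j - 1, k) = 0)"
proof -
  have *: "(\<forall>k. i < k \<and> k < j' \<longrightarrow> entry n x (int i) (int k) = 0) \<longleftrightarrow> (\<forall>k. i \<le> k \<and> Suc k < j' \<longrightarrow> x $$ (i - 1, k) = 0)"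
    if "1 \<le> i" for i j'
  proof (intro iffI allI impI)
    fix k assume "\<forall>k. i < k \<and> k < j' \<longrightarrow> entry n x (int i) (int k) = 0" "i \<le> k \<and> Suc k < j'"
    then show "x $$ (i - 1, k) = 0" using that by (auto simp: entry_def simp del: of_nat_Suc dest!: spec[of _ "Suc k"])
  next
    fix k assume "\<forall>k. i \<le> k \<and> Suc k < j' \<longrightarrow> x $$ (i - 1, k) = 0" "i < k \<and> k < j'"
    then show "entry n x (int i) (int k) = 0" using that by (auto simp: entry_def dest!: spec[of _ "k - 1"])
  qed
  show "x \<in> root_subgroup n (EMinus i j) \<longleftrightarrow> x \<in> orth_unip_set n \<and> (\<forall>k. i \<le> k \<and> Suc k < j \<longrightarrow> x $$ (i - 1, k) = 0)"
    using *[of i j] assms by simp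
  show "x \<in> root_subgroup n (EPlus i j) \<longleftrightarrow> x \<in> orth_unip_set n \<and> (\<forall>k. i \<le> k \<and> k < n \<longrightarrow> x $$ (i - 1, k) = 0) \<and>
      (\<forall>k. j \<le> k \<and> k < n \<longrightarrow> x $$ (j - 1, k) = 0)"
    using *[of i "Suc n"] *[of j "Suc n"] assms by (simp add: less_Suc_eq_le Suc_le_eq)
qed

lemma root_subgroup_subset: "root_subgroup n \<alpha> \<subseteq> orth_unip_set n"
  by (cases \<alpha>) auto

lemma root_subgroup_shift:
  fixes g :: "'a::field mat"
  assumes \<alpha>: "\<alpha> \<in> Phi n" and g: "g \<in> orth_unip_set (Suc n)"
  shows "g \<in> root_subgroup (Suc n) (shift_root \<alpha>) \<longleftrightarrow> mid n g \<in> root_subgroup n \<alpha>"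
proof -
  have *: "(\<forall>k. Suc i \<le> k \<and> Suc k < Suc j' \<longrightarrow> g $$ (i, k) = 0) \<longleftrightarrow> (\<forall>k. i \<le> k \<and> Suc k < j' \<longrightarrow> mid n g $$ (i - 1, k) = 0)"
    if "1 \<le> i" "i \<le> n" "j' \<le> Suc n" for i j'
  proof (intro iffI allI impI)
    fix k assume h: "\<forall>k. Suc i \<le> k \<and> Suc k < Suc j' \<longrightarrow> g $$ (i, k) = 0" "i \<le> k \<and> Suc k < j'"
    have "mid n g $$ (i - 1, k) = g $$ (Suc (i - 1), Suc k)" using that h(2) by (intro mid_index) auto
    then show "mid n g $$ (i - 1, k) = 0" using that h by simp
  next
    fix k assume h: "\<forall>k. i \<le> k \<and> Suc k < j' \<longrightarrow> mid n g $$ (i - 1, k) = 0" "Suc i \<le> k \<and> Suc k < Suc j'"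
    have "mid n g $$ (i - 1, k - 1) = g $$ (Suc (i - 1), Suc (k - 1))" using that h(2) by (intro mid_index) auto
    moreover have "mid n g $$ (i - 1, k - 1) = 0" using h by (auto dest!: spec[of _ "k - 1"])
    moreover have "Suc (i - 1) = i" "Suc (k - 1) = k" using that h(2) by auto
    ultimately show "g $$ (i, k) = 0" by simp
  qed
  show ?thesis
    using \<alpha>
  proof (cases rule: Phi_cases)
    case (1 i j)
    then show ?thesis
      using *[of i j] g mid_closed[OF g] root_subgroup_index(1)[of "Suc i" "Suc j" "Suc n" g]
        root_subgroup_index(1)[of i j n "mid n g"] by simp
  next
    case (2 i j)
    then show ?thesis
      using *[of i "Suc n"] *[of j "Suc n"] g mid_closed[OF g] root_subgroup_index(2)[of "Suc i" "Suc j" "Suc n" g]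
        root_subgroup_index(2)[of i j n "mid n g"] by simp
  qed
qed

text \<open>Root subgroup and linear character of a shifted root read only entries that survive in
  \<open>mid n g\<close>, so the induced character is an inflation.\<close>

lemma elementary_char_shift:
  fixes g :: "'a::{field,finite} mat"
  assumes two: "(2 :: 'a) \<noteq> 0" and \<alpha>: "\<alpha> \<in> Phi n" and g: "g \<in> orth_unip_set (Suc n)"
  shows "elementary_char (Suc n) \<theta> (shift_root \<alpha>) r g = elementary_char n \<theta> \<alpha> r (mid n g)"
  unfolding elementary_char_def
proof (rule induced_char_inflate[OF group_orth_unip group_orth_unip])
  show "mid n ` carrier (orth_unip (Suc n)) = carrier (orth_unip n :: 'a mat monoid)"
  proof (intro equalityI subsetI)
    fix h :: "'a mat" assume "h \<in> carrier (orth_unip n)"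
    then have h: "h \<in> orth_unip_set n" by (simp add: orth_unip_simps)
    show "h \<in> mid n ` carrier (orth_unip (Suc n))"
      using image_eqI[of h "mid n", OF mid_emb[OF h, symmetric] emb_closed[OF le0 h]] by (simp add: orth_unip_simps)
  qed (auto simp: orth_unip_simps mid_closed)
  show "root_subgroup (Suc n) (shift_root \<alpha>) = {g \<in> carrier (orth_unip (Suc n)). mid n g \<in> root_subgroup n \<alpha>}"
    using root_subgroup_shift[OF \<alpha>] root_subgroup_subset by (auto simp: orth_unip_simps)
  show "root_linear_char (Suc n) \<theta> (shift_root \<alpha>) r h = root_linear_char n \<theta> \<alpha> r (mid n h)" for h :: "'a mat"
    using \<alpha>
  proof (cases rule: Phi_cases)
    case (1 i j)
    then show ?thesis
      using root_linear_char_index(1)[of "Suc i" "Suc j" "Suc n" \<theta> r h] root_linear_char_index(1)[of i j n \<theta> r "mid n h"]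
      by (simp add: mid_index)
  next
    case (2 i j)
    then show ?thesis
      using root_linear_char_index(2)[of "Suc i" "Suc j" "Suc n" \<theta> r h] root_linear_char_index(2)[of i j n \<theta> r "mid n h"]
      by (simp add: mid_index Suc_diff_le)
  qed
qed (use g root_subgroup_subset mid_hom in \<open>auto simp: orth_unip_simps orth_unip_finite[OF two]\<close>)

section \<open>Row operations by root elements, and the central root subgroup\<close>

lemma xroot_mult_index:
  fixes A :: "'a::field mat"
  assumes ij: "i < 2 * n" "j < 2 * n" and A: "A \<in> carrier_mat (2 * n) (2 * n)" and kl: "k < 2 * n" "l < 2 * n"
  shows "(xroot n i j t * A) $$ (k, l) = A $$ (k, l) + (if k = i then t * A $$ (j, l) else 0) -
    (if k = 2 * n - 1 - j then t * A $$ (2 * n - 1 - i, l) else 0)"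
proof -
  have "(xroot n i j t * A) $$ (k, l) = (\<Sum>m<2 * n. xroot n i j t $$ (k, m) * A $$ (m, l))"
    by (rule mat_mult_index[OF _ A kl]) (simp add: xroot_def)
  also have "\<dots> = (\<Sum>m<2 * n. (if m = k then A $$ (k, l) else 0) + (if m = j then (if k = i then t * A $$ (j, l) else 0) else 0) -
    (if m = 2 * n - 1 - i then (if k = 2 * n - 1 - j then t * A $$ (2 * n - 1 - i, l) else 0) else 0))"
  proof (intro sum.cong refl)
    fix m assume "m \<in> {..<2 * n}"
    then have "xroot n i j t $$ (k, m) = (if m = k then 1 else 0) + (if m = j \<and> k = i then t else 0) -
        (if m = 2 * n - 1 - i \<and> k = 2 * n - 1 - j then t else 0)"
      using kl by (simp add: xroot_def conj_commute eq_commute[of k m])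
    then show "xroot n i j t $$ (k, m) * A $$ (m, l) = (if m = k then A $$ (k, l) else 0) +
        (if m = j then (if k = i then t * A $$ (j, l) else 0) else 0) -
        (if m = 2 * n - 1 - i then (if k = 2 * n - 1 - j then t * A $$ (2 * n - 1 - i, l) else 0) else 0)"
      using root_entry_mult[of m k j i t "2 * n - 1 - i" "2 * n - 1 - j" "\<lambda>m. A $$ (m, l)"] by (simp only:)
  qed
  also have "\<dots> = A $$ (k, l) + (if k = i then t * A $$ (j, l) else 0) -
    (if k = 2 * n - 1 - j then t * A $$ (2 * n - 1 - i, l) else 0)"
    using kl ij by (simp add: sum.distrib sum_subtractf)
  finally show ?thesis .
qed

text \<open>The root subgroup of the highest root \<epsilon>_1 + \<epsilon>_2: index 2m + 1 of the
  row vector is column 2m + 2, which carries label -2.\<close>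

definition central_elem :: "nat \<Rightarrow> 'a::field \<Rightarrow> 'a mat" where
  "central_elem m t = Nel (Suc m) (\<lambda>l. if l = Suc (2 * m) then t else 0)"

lemma central_elem_closed: "(2 :: 'a::field) \<noteq> 0 \<Longrightarrow> central_elem m (t :: 'a) \<in> orth_unip_set (Suc (Suc m))"
  unfolding central_elem_def by (rule Nel_closed)

lemma central_elem_commute:
  fixes g :: "'a::field mat"
  assumes two: "(2 :: 'a) \<noteq> 0" and g: "g \<in> orth_unip_set (Suc (Suc m))"
  shows "central_elem m t * g = g * central_elem m t"
proof -
  have "(\<Sum>l<2 * Suc m. (if l = Suc (2 * m) then t else 0) * mid (Suc m) g $$ (l, k)) = (if k = Suc (2 * m) then t else 0)"
    if k: "k < 2 * Suc m" for k
  proof -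
    have "(\<Sum>l<2 * Suc m. (if l = Suc (2 * m) then t else 0) * mid (Suc m) g $$ (l, k)) =
        (\<Sum>l<2 * Suc m. if l = Suc (2 * m) then t * mid (Suc m) g $$ (Suc (2 * m), k) else 0)"
      by (intro sum.cong) auto
    also have "\<dots> = t * mid (Suc m) g $$ (Suc (2 * m), k)" by (subst sum.delta) auto
    also have "\<dots> = (if k = Suc (2 * m) then t else 0)"
      using orth_unipD(4)[OF mid_closed[OF g], of k "Suc (2 * m)"] k by auto
    finally show ?thesis .
  qed
  then show ?thesis
    unfolding central_elem_def Nel_mult_right[OF two g] by (intro arg_cong[of _ _ "(*) g"] Nel_cong)
qed

lemma central_elem_add: "(2 :: 'a::field) \<noteq> 0 \<Longrightarrow> central_elem m s * central_elem m t = central_elem m (s + t :: 'a)"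
  unfolding central_elem_def Nel_mult by (rule Nel_cong) simp

text \<open>As a row operation, the central element adds multiples of rows 2m + 2 and 2m + 3 to rows
  0 and 1. Those rows vanish left of the diagonal, so only entries in the top right corner can
  change.\<close>

lemma central_elem_mult_index:
  fixes y :: "'a::field mat"
  assumes two: "(2 :: 'a) \<noteq> 0" and y: "y \<in> orth_unip_set (Suc (Suc m))" and ij: "i < 2 * Suc (Suc m)" "j < 2 * Suc (Suc m)"
    and ij': "j < 2 * m + 2 \<or> (0 < i \<and> j \<noteq> Suc (Suc (Suc (2 * m))))"
  shows "(central_elem m t * y) $$ (i, j) = y $$ (i, j)"
proof -
  have c: "0 < 2 * Suc (Suc m)" "Suc (Suc (2 * m)) < 2 * Suc (Suc m)" "0 < Suc (Suc (2 * m))"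
    "0 + Suc (Suc (2 * m)) \<noteq> 2 * Suc (Suc m) - 1" by auto
  have xc: "xroot (Suc (Suc m)) 0 (Suc (Suc (2 * m))) t \<in> orth_unip_set (Suc (Suc m))"
    by (rule xroot_closed[OF c(3,2,4)])
  have "central_elem m t = xroot (Suc (Suc m)) 0 (Suc (Suc (2 * m))) t"
  proof (rule orth_unip_eqI[OF two central_elem_closed[OF two] xc])
    show "mid (Suc m) (central_elem m t) = mid (Suc m) (xroot (Suc (Suc m)) 0 (Suc (Suc (2 * m))) t)"
      unfolding central_elem_def mid_Nel by (rule eq_matI) (auto simp: mid_index xroot_def)
  qed (auto simp: central_elem_def Nel_index xroot_def)
  moreover have "y $$ (Suc (Suc (2 * m)), j) = 0" if "i = 0"
    using orth_unipD(4)[OF y, of j "Suc (Suc (2 * m))"] ij' that by auto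
  moreover have "y $$ (Suc (Suc (Suc (2 * m))), j) = 0" if "i = 1"
    using orth_unipD(4)[OF y, of j "Suc (Suc (Suc (2 * m)))"] ij ij' that by auto
  ultimately show ?thesis
    using xroot_mult_index[OF c(1,2) orth_unipD(1)[OF y] ij, of t] by auto
qed

text \<open>Only \<epsilon>_1 + \<epsilon>_2 has its distinguished entry in that corner, and no root
  subgroup condition involves it. Being central, the factor also passes through the conjugations of
  the induced character.\<close>

lemma elementary_char_central:
  fixes g :: "'a::{field,finite} mat"
  assumes two: "(2 :: 'a) \<noteq> 0" and \<alpha>: "\<alpha> \<in> Phi (Suc (Suc m))" "\<alpha> \<noteq> EPlus 1 2" and g: "g \<in> orth_unip_set (Suc (Suc m))"
  shows "elementary_char (Suc (Suc m)) \<theta> \<alpha> r (central_elem m t * g) = elementary_char (Suc (Suc m)) \<theta> \<alpha> r g"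
proof -
  let ?N = "Suc (Suc m)" and ?z = "central_elem m t"
  let ?G = "orth_unip ?N :: 'a mat monoid"
  interpret group ?G by (rule group_orth_unip)
  note z = central_elem_closed[OF two, of m t]
  note e = central_elem_mult_index[OF two, of _ m _ _ t]
  have H: "?z * y \<in> root_subgroup ?N \<alpha> \<longleftrightarrow> y \<in> root_subgroup ?N \<alpha>" if y: "y \<in> orth_unip_set ?N" for y
    using \<alpha>(1)
  proof (cases rule: Phi_cases)
    case (1 i j)
    have "(?z * y) $$ (i - 1, k) = y $$ (i - 1, k)" if "Suc k < j" for k
      using that 1 by (intro e[OF y]) auto
    then show ?thesis unfolding 1(1) root_subgroup_index(1)[OF 1(2-4)] using y orth_unip_mult[OF z y] by auto
  next
    case (2 i j)
    have "(?z * y) $$ (i - 1, k) = y $$ (i - 1, k)" "(?z * y) $$ (j - 1, k) = y $$ (j - 1, k)" if "k < ?N" for k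
      using that 2 by (auto intro!: e[OF y])
    then show ?thesis unfolding 2(1) root_subgroup_index(2)[OF 2(2-4)] using y orth_unip_mult[OF z y] by auto
  qed
  have L: "root_linear_char ?N \<theta> \<alpha> r (?z * y) = root_linear_char ?N \<theta> \<alpha> r y" if y: "y \<in> orth_unip_set ?N" for y
    using \<alpha>(1)
  proof (cases rule: Phi_cases)
    case (1 i j)
    then have "(?z * y) $$ (i - 1, j - 1) = y $$ (i - 1, j - 1)" by (intro e[OF y]) auto
    then show ?thesis using root_linear_char_index(1)[of i j ?N \<theta> r] 1 by simp
  next
    case (2 i j)
    then have "\<not> (i = 1 \<and> j = 2)" using \<alpha>(2) by auto
    then have "(?z * y) $$ (i - 1, 2 * ?N - j) = y $$ (i - 1, 2 * ?N - j)"
      using 2 by (intro e[OF y]) auto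
    then show ?thesis using root_linear_char_index(2)[of i j ?N \<theta> r] 2 by simp
  qed
  have "inv\<^bsub>?G\<^esub> x \<otimes>\<^bsub>?G\<^esub> (?z * g) \<otimes>\<^bsub>?G\<^esub> x = ?z * (inv\<^bsub>?G\<^esub> x \<otimes>\<^bsub>?G\<^esub> g \<otimes>\<^bsub>?G\<^esub> x)"
    "inv\<^bsub>?G\<^esub> x \<otimes>\<^bsub>?G\<^esub> g \<otimes>\<^bsub>?G\<^esub> x \<in> orth_unip_set ?N" if x: "x \<in> carrier ?G" for x
  proof -
    have i: "inv\<^bsub>?G\<^esub> x \<in> orth_unip_set ?N" "x \<in> orth_unip_set ?N" using x by (auto simp: orth_unip_simps orth_unip_inv_closed)
    show "inv\<^bsub>?G\<^esub> x \<otimes>\<^bsub>?G\<^esub> g \<otimes>\<^bsub>?G\<^esub> x \<in> orth_unip_set ?N" using i g by (simp add: orth_unip_simps orth_unip_mult)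
    have "inv\<^bsub>?G\<^esub> x * (?z * g) = ?z * inv\<^bsub>?G\<^esub> x * g"
      unfolding central_elem_commute[OF two i(1)]
      using orth_unipD[OF i(1)] orth_unipD[OF z] orth_unipD[OF g] by (simp add: mat_assoc)
    then show "inv\<^bsub>?G\<^esub> x \<otimes>\<^bsub>?G\<^esub> (?z * g) \<otimes>\<^bsub>?G\<^esub> x = ?z * (inv\<^bsub>?G\<^esub> x \<otimes>\<^bsub>?G\<^esub> g \<otimes>\<^bsub>?G\<^esub> x)"
      using orth_unipD[OF i(1)] orth_unipD[OF i(2)] orth_unipD[OF z] orth_unipD[OF g] by (simp add: orth_unip_simps mat_assoc)
  qed
  then show ?thesis
    unfolding elementary_char_def induced_char_def Let_def
    by (intro arg_cong2[of _ _ _ _ "(/)"] sum.cong refl) (simp add: H L)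
qed

lemma elementary_char_conj:
  fixes g :: "'a::field mat"
  assumes "g \<in> orth_unip_set n" "x \<in> orth_unip_set n"
  shows "elementary_char n \<theta> \<alpha> r (x \<otimes>\<^bsub>orth_unip n\<^esub> g \<otimes>\<^bsub>orth_unip n\<^esub> inv\<^bsub>orth_unip n\<^esub> x) = elementary_char n \<theta> \<alpha> r g"
  unfolding elementary_char_def using assms by (intro induced_char_conj[OF group_orth_unip]) (auto simp: orth_unip_simps)

lemma elementary_char_one:
  assumes two: "(2 :: 'a::{field,finite}) \<noteq> 0" and \<theta>: "nontrivial_additive_character \<theta>" and \<alpha>: "\<alpha> \<in> Phi n"
  shows "elementary_char n \<theta> \<alpha> (r :: 'a) (1\<^sub>m (2 * n)) \<noteq> 0"
proof -
  have "induced_char (orth_unip n) (root_subgroup n \<alpha>) (root_linear_char n \<theta> \<alpha> r) \<one>\<^bsub>orth_unip n :: 'a mat monoid\<^esub> \<noteq> 0"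
  proof (rule induced_char_one[OF group_orth_unip])
    show "\<one>\<^bsub>orth_unip n :: 'a mat monoid\<^esub> \<in> root_subgroup n \<alpha>"
      using \<alpha>
    proof (cases rule: Phi_cases)
      case (1 i j)
      show ?thesis unfolding 1(1) root_subgroup_index(1)[OF 1(2-4)] using 1(2-4) by (auto simp: orth_unip_simps orth_unip_one)
    next
      case (2 i j)
      show ?thesis unfolding 2(1) root_subgroup_index(2)[OF 2(2-4)] using 2(2-4) by (auto simp: orth_unip_simps orth_unip_one)
    qed
    show "root_linear_char n \<theta> \<alpha> r \<one>\<^bsub>orth_unip n\<^esub> = 1"
      using \<alpha>
    proof (cases rule: Phi_cases)
      case (1 i j)
      then show ?thesis using root_linear_char_index(1)[of i j n \<theta> r] additive_character_zero[OF \<theta>] by (auto simp: orth_unip_simps)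
    next
      case (2 i j)
      then show ?thesis using root_linear_char_index(2)[of i j n \<theta> r] additive_character_zero[OF \<theta>] by (auto simp: orth_unip_simps)
    qed
  qed (use root_subgroup_subset in \<open>auto simp: orth_unip_simps orth_unip_finite[OF two]\<close>)
  then show ?thesis by (simp add: elementary_char_def orth_unip_simps)
qed

section \<open>Characters nontrivial on the centre\<close>

text \<open>The inverse contributes reflected entries of g by \<open>orth_unip_inv_index\<close>, so
  each correction is a product of two entries of g.\<close>

lemma xroot_conj_index:
  fixes g :: "'a::field mat"
  assumes ij: "i < 2 * n" "j < 2 * n" and g: "g \<in> orth_unip_set n" and kl: "k < 2 * n" "l < 2 * n"
  shows "(g * xroot n i j t * inv\<^bsub>orth_unip n\<^esub> g) $$ (k, l) = (if k = l then 1 else 0) +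
    t * g $$ (k, i) * g $$ (2 * n - 1 - l, 2 * n - 1 - j) - t * g $$ (k, 2 * n - 1 - j) * g $$ (2 * n - 1 - l, i)"
proof -
  let ?I = "inv\<^bsub>orth_unip n\<^esub> g" and ?x = "xroot n i j t"
  have I: "?I \<in> orth_unip_set n" by (rule orth_unip_inv_closed[OF g])
  have x: "?x \<in> carrier_mat (2 * n) (2 * n)" by (simp add: xroot_def)
  have "(g * ?x * ?I) $$ (k, l) = (g * (?x * ?I)) $$ (k, l)"
    using orth_unipD[OF g] orth_unipD[OF I] x by (simp add: mat_assoc)
  also have "\<dots> = (\<Sum>m<2 * n. g $$ (k, m) * (?x * ?I) $$ (m, l))"
    by (rule mat_mult_index[OF orth_unipD(1)[OF g] _ kl]) (use x orth_unipD(1)[OF I] in simp)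
  also have "\<dots> = (\<Sum>m<2 * n. g $$ (k, m) * ?I $$ (m, l) + (if m = i then t * g $$ (k, i) * ?I $$ (j, l) else 0) -
      (if m = 2 * n - 1 - j then t * g $$ (k, 2 * n - 1 - j) * ?I $$ (2 * n - 1 - i, l) else 0))"
  proof (rule sum.cong[OF refl])
    have *: "c * (a + (if p then t * b else 0) - (if q then t * b' else 0)) =
        c * a + (if p then t * c1 * b else 0) - (if q then t * c2 * b' else 0)"
      if "p \<Longrightarrow> c = c1" "q \<Longrightarrow> c = c2" for a b b' c c1 c2 :: 'a and p q
      using that by (auto simp: algebra_simps)
    fix m assume "m \<in> {..<2 * n}"
    then have m: "m < 2 * n" by simp
    show "g $$ (k, m) * (?x * ?I) $$ (m, l) = g $$ (k, m) * ?I $$ (m, l) + (if m = i then t * g $$ (k, i) * ?I $$ (j, l) else 0) -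
      (if m = 2 * n - 1 - j then t * g $$ (k, 2 * n - 1 - j) * ?I $$ (2 * n - 1 - i, l) else 0)"
      unfolding xroot_mult_index[OF ij orth_unipD(1)[OF I] m kl(2)] by (rule *) simp_all
  qed
  also have "\<dots> = (\<Sum>m<2 * n. g $$ (k, m) * ?I $$ (m, l)) + t * g $$ (k, i) * ?I $$ (j, l) -
      t * g $$ (k, 2 * n - 1 - j) * ?I $$ (2 * n - 1 - i, l)"
    using ij by (simp add: sum.distrib sum_subtractf)
  also have "(\<Sum>m<2 * n. g $$ (k, m) * ?I $$ (m, l)) = (g * ?I) $$ (k, l)"
    by (rule mat_mult_index[OF orth_unipD(1)[OF g] orth_unipD(1)[OF I] kl, symmetric])
  also have "\<dots> = (if k = l then 1 else 0)" unfolding orth_unip_inv_mult(2)[OF g] using kl by simp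
  also have "?I $$ (j, l) = g $$ (2 * n - 1 - l, 2 * n - 1 - j)" by (rule orth_unip_inv_index[OF g ij(2) kl(2)])
  also have "?I $$ (2 * n - 1 - i, l) = g $$ (2 * n - 1 - l, i)"
    using orth_unip_inv_index[OF g _ kl(2), of "2 * n - 1 - i"] ij by simp
  finally show ?thesis .
qed

text \<open>The linear character attached to \<open>\<epsilon>\<^sub>1 + \<epsilon>\<^sub>2\<close> extends from its root subgroup to \<open>polar m\<close>; the extensions
  are the \<open>polar_char \<theta> m r s\<close>, one for each \<open>s\<close>.\<close>

definition polar :: "nat \<Rightarrow> 'a::field mat set" where
  "polar m = {g \<in> orth_unip_set (Suc (Suc m)). \<forall>c. 2 \<le> c \<and> c < m + 2 \<longrightarrow> g $$ (0, c) = 0 \<and> g $$ (1, c) = 0}"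

lemma polarD:
  assumes "g \<in> polar m"
  shows "g \<in> orth_unip_set (Suc (Suc m))" "2 \<le> c \<Longrightarrow> c < m + 2 \<Longrightarrow> g $$ (0, c) = 0" "2 \<le> c \<Longrightarrow> c < m + 2 \<Longrightarrow> g $$ (1, c) = 0"
  using assms by (auto simp: polar_def)

lemma polar_subgroup:
  assumes two: "(2 :: 'a::{field,finite}) \<noteq> 0"
  shows "subgroup (polar m :: 'a mat set) (orth_unip (Suc (Suc m)))"
proof -
  interpret group "orth_unip (Suc (Suc m)) :: 'a mat monoid" by (rule group_orth_unip)
  show ?thesis
  proof (rule finite_submonoid_subgroup)
    show "finite (polar m :: 'a mat set)"
      using orth_unip_finite[OF two, of "Suc (Suc m)"] by (rule finite_subset[rotated]) (auto simp: polar_def)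
    show "\<one>\<^bsub>orth_unip (Suc (Suc m))\<^esub> \<in> (polar m :: 'a mat set)"
      using orth_unip_one[of "Suc (Suc m)"] by (auto simp: polar_def orth_unip_simps)
    fix g h :: "'a mat" assume g: "g \<in> polar m" and h: "h \<in> polar m"
    note G = polarD(1)[OF g] and H = polarD(1)[OF h]
    have "(g * h) $$ (i, c) = 0" if i: "i = 0 \<or> i = 1" and c: "2 \<le> c" "c < m + 2" for i c
    proof -
      have "(g * h) $$ (i, c) = (\<Sum>j<2 * Suc (Suc m). g $$ (i, j) * h $$ (j, c))"
        by (rule mat_mult_index[OF orth_unipD(1)[OF G] orth_unipD(1)[OF H]]) (use i c in auto)
      also have "\<dots> = 0"
      proof (rule sum.neutral, rule ballI)
        fix j assume "j \<in> {..<2 * Suc (Suc m)}"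
        then consider "j = 0" | "j = 1" | "2 \<le> j" "j < m + 2" | "m + 2 \<le> j" "j < 2 * Suc (Suc m)" by fastforce
        then show "g $$ (i, j) * h $$ (j, c) = 0"
        proof cases
          case 4
          then show ?thesis using orth_unipD(4)[OF H, of c j] c by simp
        qed (use polarD(2,3)[OF g, of j] polarD(2,3)[OF h, of c] i c in auto)
      qed
      finally show ?thesis .
    qed
    then show "g \<otimes>\<^bsub>orth_unip (Suc (Suc m))\<^esub> h \<in> polar m"
      using orth_unip_mult[OF G H] by (simp add: polar_def orth_unip_simps del: index_mult_mat)
  qed (auto simp: polar_def orth_unip_simps)
qed

text \<open>The first part is membership of the inverse in \<open>polar m\<close>, reflected. The
  second is isotropy of column 2m + 2, whose self-pairing reduces to twice the entry in row 1; again
  2 has to be invertible.\<close>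

lemma polar_last:
  fixes g :: "'a::{field,finite} mat"
  assumes two: "(2 :: 'a) \<noteq> 0" and g: "g \<in> polar m"
  shows "m + 2 \<le> k \<Longrightarrow> k < 2 * m + 2 \<Longrightarrow> g $$ (k, 2 * m + 2) = 0" "g $$ (1, 2 * m + 2) = 0"
proof -
  note G = polarD(1)[OF g]
  have I: "inv\<^bsub>orth_unip (Suc (Suc m))\<^esub> g \<in> polar m"
    by (rule subgroup.m_inv_closed[OF polar_subgroup[OF two] g])
  show k: "g $$ (k, 2 * m + 2) = 0" if "m + 2 \<le> k" "k < 2 * m + 2" for k
    using polarD(3)[OF I, of "2 * m + 3 - k"] orth_unip_inv_index[OF G, of 1 "2 * m + 3 - k"] that by auto
  let ?q = "2 * m + 2"
  have "(\<Sum>i<2 * Suc (Suc m). g $$ (i, ?q) * g $$ (2 * Suc (Suc m) - 1 - i, ?q)) =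
    (\<Sum>i<2 * Suc (Suc m). (if i = 1 then g $$ (1, ?q) else 0) + (if i = ?q then g $$ (1, ?q) else 0))"
  proof (rule sum.cong[OF refl])
    fix i assume "i \<in> {..<2 * Suc (Suc m)}"
    then consider "i = 0" | "i = 1" | "2 \<le> i" "i < m + 2" | "m + 2 \<le> i" "i < 2 * m + 2" | "i = 2 * m + 2" | "i = 2 * m + 3"
      by fastforce
    then show "g $$ (i, ?q) * g $$ (2 * Suc (Suc m) - 1 - i, ?q) =
      (if i = 1 then g $$ (1, ?q) else 0) + (if i = ?q then g $$ (1, ?q) else 0)"
    proof cases
      case 1
      then show ?thesis using orth_unipD(4)[OF G, of ?q "Suc ?q"] by simp
    next
      case 2
      then show ?thesis using orth_unipD(4)[OF G, of ?q ?q] by simp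
    next
      case 3
      then show ?thesis using k[of "2 * Suc (Suc m) - 1 - i"] by simp
    next
      case 4
      then show ?thesis using k[of i] by simp
    next
      case 5
      then show ?thesis using orth_unipD(4)[OF G, of ?q ?q] by simp
    next
      case 6
      then show ?thesis using orth_unipD(4)[OF G, of ?q "2 * m + 3"] by simp
    qed
  qed
  also have "\<dots> = 2 * g $$ (1, ?q)"
    unfolding sum.distrib by (subst (1 2) sum.delta) auto
  finally show "g $$ (1, ?q) = 0" using orth_unipD(5)[OF G, of ?q ?q] two by simp
qed

definition polar_char :: "('a::field \<Rightarrow> complex) \<Rightarrow> nat \<Rightarrow> 'a \<Rightarrow> 'a \<Rightarrow> 'a mat \<Rightarrow> complex" where
  "polar_char \<theta> m r s g = \<theta> (r * g $$ (0, 2 * m + 2) + s * g $$ (0, 1))"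

text \<open>On \<open>polar m\<close> the entries of row 0 in columns 1 and 2m + 2 are additive:
  every cross term meets a zero of row 0, a zero below the diagonal, or a zero from
  \<open>polar_last\<close>.\<close>

lemma polar_char_mult:
  fixes g h :: "'a::{field,finite} mat"
  assumes two: "(2 :: 'a) \<noteq> 0" and \<theta>: "nontrivial_additive_character \<theta>" and g: "g \<in> polar m" and h: "h \<in> polar m"
  shows "polar_char \<theta> m r s (g * h) = polar_char \<theta> m r s g * polar_char \<theta> m r s h"
proof -
  note G = polarD(1)[OF g] and H = polarD(1)[OF h]
  have mult: "(g * h) $$ (0, c) = (\<Sum>j<2 * Suc (Suc m). g $$ (0, j) * h $$ (j, c))" if "c < 2 * Suc (Suc m)" for c
    by (rule mat_mult_index[OF orth_unipD(1)[OF G] orth_unipD(1)[OF H]]) (use that in auto)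
  have c: "1 < 2 * Suc (Suc m)" "2 * m + 2 < 2 * Suc (Suc m)" by auto
  have "(g * h) $$ (0, 1) = (\<Sum>j<2 * Suc (Suc m). (if j = 0 then h $$ (0, 1) else 0) + (if j = 1 then g $$ (0, 1) else 0))"
    unfolding mult[OF c(1)]
  proof (rule sum.cong)
    fix j assume "j \<in> {..<2 * Suc (Suc m)}"
    then consider "j = 0" | "j = 1" | "2 \<le> j" "j < 2 * Suc (Suc m)" by fastforce
    then show "g $$ (0, j) * h $$ (j, 1) = (if j = 0 then h $$ (0, 1) else 0) + (if j = 1 then g $$ (0, 1) else 0)"
      using orth_unipD(4)[OF G, of 0 0] orth_unipD(4)[OF H, of 1 j] by cases auto
  qed simp
  then have 1: "(g * h) $$ (0, 1) = h $$ (0, 1) + g $$ (0, 1)"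
    unfolding sum.distrib by (subst (asm) (1 2) sum.delta) auto
  let ?q = "2 * m + 2"
  have "(g * h) $$ (0, ?q) = (\<Sum>j<2 * Suc (Suc m). (if j = 0 then h $$ (0, ?q) else 0) + (if j = ?q then g $$ (0, ?q) else 0))"
    unfolding mult[OF c(2)]
  proof (rule sum.cong)
    fix i assume "i \<in> {..<2 * Suc (Suc m)}"
    then consider "i = 0" | "i = 1" | "2 \<le> i" "i < m + 2" | "m + 2 \<le> i" "i < 2 * m + 2" | "i = 2 * m + 2" | "i = 2 * m + 3"
      by fastforce
    then show "g $$ (0, i) * h $$ (i, ?q) = (if i = 0 then h $$ (0, ?q) else 0) + (if i = ?q then g $$ (0, ?q) else 0)"
      using orth_unipD(4)[OF G, of 0 0] orth_unipD(4)[OF H, of ?q ?q] orth_unipD(4)[OF H, of ?q "2 * m + 3"]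
        polarD(2)[OF g, of i] polar_last[OF two h] by cases auto
  qed simp
  then have 2: "(g * h) $$ (0, ?q) = h $$ (0, ?q) + g $$ (0, ?q)"
    unfolding sum.distrib by (subst (asm) (1 2) sum.delta) auto
  show ?thesis
    unfolding polar_char_def 1 2 additive_character_add[OF \<theta>, symmetric] by (rule arg_cong[of _ _ \<theta>]) (simp add: algebra_simps)
qed

text \<open>Membership imposes m vanishing coordinates in each of the two top rows, hence index
  q^(2m).\<close>

lemma card_polar:
  assumes two: "(2 :: 'a::{field,finite}) \<noteq> 0"
  shows "card (orth_unip_set (Suc (Suc m)) :: 'a mat set) = CARD('a) ^ (2 * m) * card (polar m :: 'a mat set)"
proof -
  let ?U = "\<lambda>n. orth_unip_set n :: 'a mat set"
  let ?S1 = "{h \<in> ?U (Suc m). mid m h \<in> ?U m \<and> (\<forall>c\<in>{..<m}. h $$ (0, Suc c) = 0)}"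
  have "polar m = {g \<in> ?U (Suc (Suc m)). mid (Suc m) g \<in> ?S1 \<and> (\<forall>c\<in>{1..m}. g $$ (0, Suc c) = 0)}" (is "_ = ?R")
  proof (intro equalityI subsetI)
    fix g :: "'a mat" assume g: "g \<in> polar m"
    have "mid (Suc m) g $$ (0, Suc c) = 0" if "c < m" for c
      using polarD(3)[OF g, of "Suc (Suc c)"] that by (simp add: mid_index)
    then show "g \<in> ?R"
      using polarD(1)[OF g] polarD(2)[OF g] mid_closed[OF polarD(1)[OF g]] mid_closed[OF mid_closed[OF polarD(1)[OF g]]] by auto
  next
    fix g :: "'a mat" assume g: "g \<in> ?R"
    have "g $$ (0, c) = 0 \<and> g $$ (1, c) = 0" if c: "2 \<le> c" "c < m + 2" for c
    proof
      have "c - 1 \<in> {1..m}" "Suc (c - 1) = c" using c by auto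
      then show "g $$ (0, c) = 0" using g by force
      have "c - 2 \<in> {..<m}" "Suc (Suc (c - 2)) = c" using c by auto
      moreover have "mid (Suc m) g $$ (0, Suc (c - 2)) = g $$ (Suc 0, Suc (Suc (c - 2)))" using c by (intro mid_index) auto
      ultimately show "g $$ (1, c) = 0" using g by force
    qed
    then show "g \<in> polar m" using g by (auto simp: polar_def)
  qed
  moreover have "card ?R = card ?S1 * CARD('a) ^ card ({..<2 * Suc m} - {1..m})"
    by (rule card_orth_unip_filter[OF two]) auto
  moreover have "card ?S1 = card (?U m) * CARD('a) ^ card ({..<2 * m} - {..<m})"
    by (rule card_orth_unip_filter[OF two]) auto
  moreover have "card ({..<2 * Suc m} - {1..m}) = m + 2" by (subst card_Diff_subset) auto
  moreover have "card ({..<2 * m} - {..<m}) = m" by (subst card_Diff_subset) auto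
  ultimately have "card (polar m :: 'a mat set) = card (?U m) * CARD('a) ^ (2 * m + 2)"
    by (simp add: power_add mult_2)
  moreover have "card (?U (Suc (Suc m))) = card (?U m) * CARD('a) ^ (2 * m) * CARD('a) ^ (2 * Suc m)"
    by (simp only: card_orth_unip_Suc[OF two])
  ultimately show ?thesis by simp
qed

lemma mid_hom2: "(\<lambda>g. mid m (mid (Suc m) g)) \<in> hom (orth_unip (Suc (Suc m))) (orth_unip m :: 'a::field mat monoid)"
  using hom_compose[OF mid_hom[of "Suc m"] mid_hom[of m, where 'a = 'a]] by (simp add: comp_def)

lemma emb_hom2: "(\<lambda>g. emb (Suc m) 0 (emb m 0 g)) \<in> hom (orth_unip m) (orth_unip (Suc (Suc m)) :: 'a::field mat monoid)"
  using hom_compose[OF emb_hom[of 0 m, where 'a = 'a] emb_hom[of 0 "Suc m"]] by (simp add: comp_def)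

text \<open>This copy of U_m is a complement, inside \<open>polar m\<close>, to the kernel of the
  double projection, and \<open>polar_char\<close> is trivial on it; so the isotypic part restricts
  to U_m without a twist.\<close>

lemma emb2_polar:
  fixes u :: "'a::field mat"
  assumes \<theta>: "nontrivial_additive_character \<theta>" and u: "u \<in> orth_unip_set m"
  shows "emb (Suc m) 0 (emb m 0 u) \<in> polar m" "polar_char \<theta> m r s (emb (Suc m) 0 (emb m 0 u)) = 1"
    "mid m (mid (Suc m) (emb (Suc m) 0 (emb m 0 u))) = u"
proof -
  have e: "emb m 0 u \<in> orth_unip_set (Suc m)" by (rule emb_closed[OF le0 u])
  have e0: "emb (Suc m) 0 (emb m 0 u) $$ (0, c) = 0" if "0 < c" "c < 2 * Suc (Suc m)" for c
    using emb0_row(1)[of c "Suc m" "emb m 0 u"] that by auto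
  have e1: "emb (Suc m) 0 (emb m 0 u) $$ (1, c) = 0" if "2 \<le> c" "c < m + 2" for c
  proof -
    have "mid (Suc m) (emb (Suc m) 0 (emb m 0 u)) $$ (0, c - 1) = emb (Suc m) 0 (emb m 0 u) $$ (Suc 0, Suc (c - 1))"
      using that by (intro mid_index) auto
    then show ?thesis using that emb0_row(1)[of "c - 1" m u] by (simp add: mid_emb[OF e])
  qed
  show "emb (Suc m) 0 (emb m 0 u) \<in> polar m"
    using e0 e1 emb_closed[OF le0 e] by (auto simp: polar_def)
  show "polar_char \<theta> m r s (emb (Suc m) 0 (emb m 0 u)) = 1"
    using e0[of 1] e0[of "2 * m + 2"] by (simp add: polar_char_def additive_character_zero[OF \<theta>])
  show "mid m (mid (Suc m) (emb (Suc m) 0 (emb m 0 u))) = u" by (simp add: mid_emb[OF e] mid_emb[OF u])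
qed

text \<open>An element outside the stabiliser \<open>polar m\<close> is detected by a root element
  \<open>1 + t (E\<^sub>i\<^sub>j - E\<^sub>k\<^sub>l)\<close> in one of the two top rows.\<close>

lemma polar_char_separates:
  fixes g :: "'a::{field,finite} mat"
  assumes two: "(2 :: 'a) \<noteq> 0" and \<theta>: "nontrivial_additive_character \<theta>" and r: "r \<noteq> 0"
    and g: "g \<in> orth_unip_set (Suc (Suc m))" "g \<notin> polar m"
  defines "Q \<equiv> {a \<in> polar m. mid m (mid (Suc m) a) = 1\<^sub>m (2 * m)}"
  shows "\<exists>a\<in>Q. g * a * inv\<^bsub>orth_unip (Suc (Suc m))\<^esub> g \<in> Q \<and>
    polar_char \<theta> m r s (g * a * inv\<^bsub>orth_unip (Suc (Suc m))\<^esub> g) \<noteq> polar_char \<theta> m r s a"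
proof -
  let ?N = "Suc (Suc m)"
  let ?I = "inv\<^bsub>orth_unip ?N\<^esub> g"
  \<comment> \<open>Conjugating a root element at (i, mirror of k) puts t times the 2 by 2 minor of
    rows 0, 1 and columns i, k into the entry read by \<open>polar_char\<close>. A nonzero minor x
    therefore suffices.\<close>
  have main: ?thesis
    if i: "i = 0 \<or> i = 1" and k: "2 \<le> k" "k < m + 2" and x: "x \<noteq> 0"
      and gx: "g $$ (0, i) * g $$ (1, k) - g $$ (0, k) * g $$ (1, i) = x" for i k x
  proof -
    obtain b where b: "\<theta> b \<noteq> 1" using \<theta> by (auto simp: nontrivial_additive_character_def)
    \<comment> \<open>Makes the value on the conjugate equal to \<open>\<theta> b\<close>, while the
      value on the root element itself is 1.\<close>
    define t where "t = b / (r * x)"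
    define j where "j = 2 * ?N - 1 - k"
    have j: "j < 2 * ?N" "i < j" "i + j \<noteq> 2 * ?N - 1" "2 * ?N - 1 - j = k" "m + 2 \<le> j" "j < 2 * m + 2"
      using i k by (auto simp: j_def)
    define a where "a = xroot ?N i j t"
    have aU: "a \<in> orth_unip_set ?N" unfolding a_def by (rule xroot_closed[OF j(2,1,3)])
    have aidx: "a $$ (p, l) = (if p = l then 1 else 0)" if "p < 2 * ?N" "l < 2 * m + 2" "l = j \<longrightarrow> p \<noteq> i" for p l
      using that i j by (auto simp: a_def xroot_def)
    have aQ: "a \<in> Q"
    proof -
      have "a \<in> polar m" using aU i j aidx by (auto simp: polar_def)
      moreover have "mid m (mid (Suc m) a) = 1\<^sub>m (2 * m)"
        by (rule eq_matI) (use i in \<open>auto simp: mid_index aidx\<close>)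
      ultimately show ?thesis by (simp add: Q_def)
    qed
    have fa: "polar_char \<theta> m r s a = 1"
    proof -
      have "a $$ (0, 2 * m + 2) = 0" "a $$ (0, 1) = 0" using i j by (auto simp: a_def xroot_def)
      then show ?thesis by (simp add: polar_char_def additive_character_zero[OF \<theta>])
    qed
    let ?h = "g * a * ?I"
    have hU: "?h \<in> orth_unip_set ?N" using g(1) aU orth_unip_inv_closed[OF g(1)] by (intro orth_unip_mult)
    have h: "?h $$ (p, l) = (if p = l then 1 else 0) + t * g $$ (p, i) * g $$ (2 * ?N - 1 - l, k) - t * g $$ (p, k) * g $$ (2 * ?N - 1 - l, i)"
      if "p < 2 * ?N" "l < 2 * ?N" for p l
      using xroot_conj_index[OF _ j(1) g(1) that, of i t] i unfolding a_def j(4) by auto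
    have h1: "?h $$ (p, l) = (if p = l then 1 else 0)" if "p < 2 * ?N" "l < m + 2" for p l
    proof -
      have l: "i < 2 * ?N - 1 - l" "k < 2 * ?N - 1 - l" "2 * ?N - 1 - l < 2 * ?N" using that i k by auto
      have "g $$ (2 * ?N - 1 - l, i) = 0" "g $$ (2 * ?N - 1 - l, k) = 0"
        using orth_unipD(4)[OF g(1) _ l(3), of i] orth_unipD(4)[OF g(1) _ l(3), of k] l(1,2) by simp_all
      then show ?thesis using h[of p l] that by (simp del: index_mult_mat)
    qed
    have h2: "?h $$ (p, l) = (if p = l then 1 else 0)" if "2 \<le> p" "p < 2 * ?N" "l < 2 * m + 2" for p l
    proof -
      have l: "i < 2 * ?N - 1 - l" "2 * ?N - 1 - l < 2 * ?N" "i < p" using that i by auto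
      have "g $$ (2 * ?N - 1 - l, i) = 0" "g $$ (p, i) = 0"
        using orth_unipD(4)[OF g(1) _ l(2), of i] orth_unipD(4)[OF g(1) _ that(2), of i] l by simp_all
      then show ?thesis using h[of p l] that by (simp del: index_mult_mat)
    qed
    have hQ: "?h \<in> Q"
    proof -
      have "?h \<in> polar m" using hU h1 by (auto simp: polar_def simp del: index_mult_mat)
      moreover have "mid m (mid (Suc m) ?h) = 1\<^sub>m (2 * m)"
        by (rule eq_matI) (auto simp: mid_index h2 simp del: index_mult_mat)
      ultimately show ?thesis by (simp add: Q_def)
    qed
    have "?h $$ (0, 2 * m + 2) = t * x"
      using h[of 0 "2 * m + 2"] gx by (simp add: algebra_simps del: index_mult_mat)
    moreover have "?h $$ (0, 1) = 0" using h1[of 0 1] by (simp del: index_mult_mat)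
    ultimately have "polar_char \<theta> m r s ?h = \<theta> b" using r x by (simp add: polar_char_def t_def del: index_mult_mat)
    then show ?thesis using aQ hQ fa b by auto
  qed
  have d: "g $$ (0, 0) = 1" "g $$ (1, 0) = 0" "g $$ (1, 1) = 1"
    using orth_unipD(4)[OF g(1), of 0 0] orth_unipD(4)[OF g(1), of 0 1] orth_unipD(4)[OF g(1), of 1 1] by auto
  show ?thesis
  \<comment> \<open>If row 1 has an offending entry, the minor with column 0 equals it; otherwise
    the minor with column 1 is minus the offending entry of row 0.\<close>
  proof (cases "\<exists>k. 2 \<le> k \<and> k < m + 2 \<and> g $$ (1, k) \<noteq> 0")
    case True
    then obtain k where k: "2 \<le> k" "k < m + 2" "g $$ (1, k) \<noteq> 0" by auto
    show ?thesis by (rule main[OF _ k(1,2,3), where i = 0]) (use d in auto)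
  next
    case False
    then obtain k where k: "2 \<le> k" "k < m + 2" "g $$ (0, k) \<noteq> 0" "g $$ (1, k) = 0" using g by (auto simp: polar_def)
    show ?thesis by (rule main[OF _ k(1,2), where x = "- g $$ (0, k)" and i = 1]) (use d k in auto)
  qed
qed

text \<open>The pairing moves from the whole group to the root subgroup by reciprocity, then to the
  larger \<open>polar m\<close> by summing over the extensions of the linear character. There it
  becomes a pairing of U_m with the isotypic part, whose dimension is d / q^(2m).\<close>

lemma reduction_step:
  fixes \<rho> :: "'a::{field,finite} mat \<Rightarrow> complex mat"
  assumes two: "(2 :: 'a) \<noteq> 0" and \<theta>: "nontrivial_additive_character \<theta>" and r0: "r \<noteq> 0"
    and irr: "irr_rep (orth_unip (Suc (Suc m))) d \<rho>"
    and \<eta>: "\<And>g x. g \<in> orth_unip_set m \<Longrightarrow> x \<in> orth_unip_set m \<Longrightarrow>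
      \<eta> (x \<otimes>\<^bsub>orth_unip m\<^esub> g \<otimes>\<^bsub>orth_unip m\<^esub> inv\<^bsub>orth_unip m\<^esub> x) = \<eta> g"
    and nz: "(\<Sum>g\<in>orth_unip_set (Suc (Suc m)). mat_trace (\<rho> g) *
      cnj (elementary_char (Suc (Suc m)) \<theta> (EPlus 1 2) r g * \<eta> (mid m (mid (Suc m) g)))) \<noteq> 0"
  obtains k \<sigma> where "irr_rep (orth_unip m) k \<sigma>" "d = CARD('a) ^ (2 * m) * k"
    "(\<Sum>u\<in>orth_unip_set m. mat_trace (\<sigma> u) * cnj (\<eta> u)) \<noteq> 0"
proof -
  let ?N = "Suc (Suc m)"
  let ?G = "orth_unip ?N :: 'a mat monoid" and ?K = "orth_unip m :: 'a mat monoid"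
  let ?\<pi> = "\<lambda>g :: 'a mat. mid m (mid (Suc m) g)" and ?\<iota> = "\<lambda>u :: 'a mat. emb (Suc m) 0 (emb m 0 u)"
  interpret group ?G by (rule group_orth_unip)
  interpret \<pi>: group_hom ?G ?K ?\<pi> by (rule group_hom.intro[OF group_orth_unip group_orth_unip], unfold_locales, rule mid_hom2)
  have \<rho>: "is_rep ?G d \<rho>" using irr by (simp add: irr_rep_def)
  note r = is_repD[OF \<rho>]
  have finU: "finite (orth_unip_set n :: 'a mat set)" for n by (rule orth_unip_finite[OF two])
  \<comment> \<open>S is the stabiliser, Q the kernel of its projection to U_m, and P the root
    subgroup of \<epsilon>_1 + \<epsilon>_2, cut out of S by one more vanishing entry.\<close>
  define S where "S = (polar m :: 'a mat set)"
  define Q where "Q = {a \<in> S. ?\<pi> a = 1\<^sub>m (2 * m)}"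
  define P where "P = {h \<in> S. h $$ (0, 1) = 0}"
  have SG: "S \<subseteq> carrier ?G" by (auto simp: S_def polar_def orth_unip_simps)
  have finS: "finite S" using finite_subset[OF SG] finU by (simp add: orth_unip_simps)
  have Ssub: "subgroup S ?G" unfolding S_def by (rule polar_subgroup[OF two])
  interpret S: subgroup S ?G by (rule Ssub)
  have \<pi>m: "?\<pi> (g \<otimes>\<^bsub>?G\<^esub> h) = ?\<pi> g * ?\<pi> h" if "g \<in> carrier ?G" "h \<in> carrier ?G" for g h
    using \<pi>.hom_mult[OF that] by (simp add: orth_unip_simps)
  have Qsub: "subgroup Q ?G"
  proof (rule finite_submonoid_subgroup)
    show "finite Q" using finS by (simp add: Q_def)
    show "Q \<subseteq> carrier ?G" using SG by (auto simp: Q_def)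
    show "\<one>\<^bsub>?G\<^esub> \<in> Q" using S.one_closed \<pi>.hom_one by (simp add: Q_def orth_unip_simps)
    show "g \<otimes>\<^bsub>?G\<^esub> h \<in> Q" if "g \<in> Q" "h \<in> Q" for g h
      using that SG \<pi>m[of g h] by (auto simp: Q_def S.m_closed)
  qed
  have \<iota>S: "?\<iota> u \<in> S" and \<iota>\<pi>: "?\<pi> (?\<iota> u) = u" and f\<iota>: "polar_char \<theta> m r s (?\<iota> u) = 1" if "u \<in> orth_unip_set m" for u s
    using emb2_polar[OF \<theta> that] by (auto simp: S_def)
  have \<pi>inv: "?\<pi> (g \<otimes>\<^bsub>?G\<^esub> inv\<^bsub>?G\<^esub> ?\<iota> (?\<pi> g)) = 1\<^sub>m (2 * m)" if g: "g \<in> carrier ?G" for g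
  proof -
    have pg: "?\<pi> g \<in> orth_unip_set m" using \<pi>.hom_closed[OF g] by (simp add: orth_unip_simps)
    have ig: "?\<iota> (?\<pi> g) \<in> carrier ?G" using \<iota>S[OF pg] SG by auto
    have "?\<pi> (g \<otimes>\<^bsub>?G\<^esub> inv\<^bsub>?G\<^esub> ?\<iota> (?\<pi> g)) = ?\<pi> g \<otimes>\<^bsub>?K\<^esub> inv\<^bsub>?K\<^esub> ?\<pi> (?\<iota> (?\<pi> g))"
      using \<pi>.hom_mult[OF g inv_closed[OF ig]] \<pi>.hom_inv[OF ig] by simp
    also have "\<dots> = 1\<^sub>m (2 * m)"
      unfolding \<iota>\<pi>[OF pg] using group.r_inv[OF group_orth_unip, of "?\<pi> g" m] pg by (simp add: orth_unip_simps)
    finally show ?thesis .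
  qed
  have SQ: "\<exists>q\<in>Q. \<exists>u\<in>carrier ?K. s = q \<otimes>\<^bsub>?G\<^esub> ?\<iota> u" if s: "s \<in> S" for s
  proof -
    have sG: "s \<in> carrier ?G" using s SG by auto
    have ps: "?\<pi> s \<in> orth_unip_set m" using \<pi>.hom_closed[OF sG] by (simp add: orth_unip_simps)
    let ?q = "s \<otimes>\<^bsub>?G\<^esub> inv\<^bsub>?G\<^esub> ?\<iota> (?\<pi> s)"
    have ig: "?\<iota> (?\<pi> s) \<in> carrier ?G" using \<iota>S[OF ps] SG by auto
    have "?q \<in> Q" using s \<iota>S[OF ps] \<pi>inv[OF sG] by (auto simp: Q_def S.m_closed)
    moreover have "s = ?q \<otimes>\<^bsub>?G\<^esub> ?\<iota> (?\<pi> s)" using sG ig by (simp add: m_assoc)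
    ultimately show ?thesis using ps by (auto simp: orth_unip_simps)
  qed
  have bijS: "bij_betw (\<lambda>(q, u). q \<otimes>\<^bsub>?G\<^esub> ?\<iota> u) (Q \<times> orth_unip_set m) S"
  proof (rule bij_betw_imageI)
    show "inj_on (\<lambda>(q, u). q \<otimes>\<^bsub>?G\<^esub> ?\<iota> u) (Q \<times> orth_unip_set m)"
    proof (rule inj_onI, clarsimp simp del: orth_unip_simps)
      fix q u q' u' :: "'a mat" assume h: "q \<in> Q" "u \<in> orth_unip_set m" "q' \<in> Q" "u' \<in> orth_unip_set m"
        "q \<otimes>\<^bsub>?G\<^esub> ?\<iota> u = q' \<otimes>\<^bsub>?G\<^esub> ?\<iota> u'"
      have c: "q \<in> carrier ?G" "q' \<in> carrier ?G" "?\<iota> u \<in> carrier ?G" "?\<iota> u' \<in> carrier ?G"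
        using h \<iota>S SG by (auto simp: Q_def)
      have "?\<pi> (q \<otimes>\<^bsub>?G\<^esub> ?\<iota> u) = u" "?\<pi> (q' \<otimes>\<^bsub>?G\<^esub> ?\<iota> u') = u'"
        using \<pi>m[OF c(1,3)] \<pi>m[OF c(2,4)] h \<iota>\<pi> orth_unipD[OF h(2)] orth_unipD[OF h(4)] by (auto simp: Q_def)
      then have "u = u'" using h(5) by simp
      moreover have "q = q'"
        using inj_onD[OF inj_on_multc[OF c(3)], of q q'] c h(5) \<open>u = u'\<close> by simp
      ultimately show "q = q' \<and> u = u'" by simp
    qed
    show "(\<lambda>(q, u). q \<otimes>\<^bsub>?G\<^esub> ?\<iota> u) ` (Q \<times> orth_unip_set m) = S"
      using SQ \<iota>S by (fastforce simp: Q_def S.m_closed orth_unip_simps(1))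
  qed
  have P: "P = root_subgroup ?N (EPlus 1 2)"
  proof (rule Set.set_eqI)
    fix x :: "'a mat"
    have "(\<forall>k. 1 \<le> k \<and> k < ?N \<longrightarrow> x $$ (0, k) = 0) \<longleftrightarrow> x $$ (0, 1) = 0 \<and> (\<forall>k. 2 \<le> k \<and> k < m + 2 \<longrightarrow> x $$ (0, k) = 0)"
    proof (intro iffI conjI allI impI)
      fix k assume "x $$ (0, 1) = 0 \<and> (\<forall>k. 2 \<le> k \<and> k < m + 2 \<longrightarrow> x $$ (0, k) = 0)" "1 \<le> k \<and> k < ?N"
      then show "x $$ (0, k) = 0" by (cases "k = 1") auto
    qed auto
    then show "x \<in> P \<longleftrightarrow> x \<in> root_subgroup ?N (EPlus 1 2)"
      using root_subgroup_index(2)[of 1 2 ?N x] by (auto simp: P_def S_def polar_def)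
  qed
  have PG: "P \<subseteq> carrier ?G" using SG by (auto simp: P_def)
  let ?\<xi> = "\<lambda>g. \<eta> (?\<pi> g)"
  define F where "F h = mat_trace (\<rho> h) * cnj (\<theta> (r * h $$ (0, 2 * m + 2)) * ?\<xi> h)" for h
  have lin: "root_linear_char ?N \<theta> (EPlus 1 2) r x = \<theta> (r * x $$ (0, 2 * m + 2))" for x
    using root_linear_char_index(2)[of 1 2 ?N \<theta> r x] by simp
  have "(\<Sum>g\<in>carrier ?G. mat_trace (\<rho> g) *
      cnj (induced_char ?G P (root_linear_char ?N \<theta> (EPlus 1 2) r) g * ?\<xi> g)) =
    of_nat (card (carrier ?G)) / of_nat (card P) * (\<Sum>h\<in>P. mat_trace (\<rho> h) * cnj (root_linear_char ?N \<theta> (EPlus 1 2) r h * ?\<xi> h))"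
  proof (rule frobenius_reciprocity[OF group_orth_unip _ PG])
    show "mat_trace (\<rho> (x \<otimes>\<^bsub>?G\<^esub> g \<otimes>\<^bsub>?G\<^esub> inv\<^bsub>?G\<^esub> x)) = mat_trace (\<rho> g)" if "g \<in> carrier ?G" "x \<in> carrier ?G" for g x
      by (rule mat_trace_conj[OF group_orth_unip \<rho> that])
    show "?\<xi> (x \<otimes>\<^bsub>?G\<^esub> g \<otimes>\<^bsub>?G\<^esub> inv\<^bsub>?G\<^esub> x) = ?\<xi> g" if "g \<in> carrier ?G" "x \<in> carrier ?G" for g x
    proof -
      have "?\<pi> (x \<otimes>\<^bsub>?G\<^esub> g \<otimes>\<^bsub>?G\<^esub> inv\<^bsub>?G\<^esub> x) = ?\<pi> x \<otimes>\<^bsub>?K\<^esub> ?\<pi> g \<otimes>\<^bsub>?K\<^esub> inv\<^bsub>?K\<^esub> ?\<pi> x" using that by simp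
      moreover have "?\<pi> g \<in> orth_unip_set m" "?\<pi> x \<in> orth_unip_set m"
        using \<pi>.hom_closed[OF that(1)] \<pi>.hom_closed[OF that(2)] by (simp_all add: orth_unip_simps)
      ultimately show ?thesis using \<eta> by simp
    qed
  qed (simp add: orth_unip_simps finU)
  then have FP: "(\<Sum>h\<in>P. F h) \<noteq> 0"
    using nz unfolding elementary_char_def P[symmetric] lin F_def by (auto simp: orth_unip_simps(1))
  \<comment> \<open>Summing over all s detects the condition that entry (0, 1) vanishes, that is,
    membership in P. A nonzero total means that some s contributes.\<close>
  have "(\<Sum>s\<in>UNIV. \<Sum>h\<in>S. mat_trace (\<rho> h) * cnj (polar_char \<theta> m r s h * ?\<xi> h)) = of_nat CARD('a) * (\<Sum>h\<in>P. F h)"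
  proof -
    have "(\<Sum>s\<in>UNIV. \<Sum>h\<in>S. mat_trace (\<rho> h) * cnj (polar_char \<theta> m r s h * ?\<xi> h)) =
      (\<Sum>h\<in>S. F h * cnj (\<Sum>s\<in>UNIV. \<theta> (h $$ (0, 1) * s)))"
      unfolding cnj_sum sum_distrib_left
      by (subst sum.swap, intro sum.cong refl) (simp add: polar_char_def F_def additive_character_add[OF \<theta>] ac_simps)
    also have "\<dots> = (\<Sum>h\<in>S. if h $$ (0, 1) = 0 then of_nat CARD('a) * F h else 0)"
      unfolding additive_character_sum[OF \<theta>] by (intro sum.cong) auto
    also have "\<dots> = (\<Sum>h\<in>P. of_nat CARD('a) * F h)"
      unfolding P_def by (rule sum.inter_filter[OF finS, symmetric])
    finally show ?thesis by (simp add: sum_distrib_left)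
  qed
  then have "(\<Sum>s\<in>UNIV. \<Sum>h\<in>S. mat_trace (\<rho> h) * cnj (polar_char \<theta> m r s h * ?\<xi> h)) \<noteq> 0" using FP by simp
  then obtain s where s: "(\<Sum>h\<in>S. mat_trace (\<rho> h) * cnj (polar_char \<theta> m r s h * ?\<xi> h)) \<noteq> 0"
    using sum.not_neutral_contains_not_neutral by blast
  let ?f = "polar_char \<theta> m r s"
  define E where "E = mat_sum d d (\<lambda>q. (inverse (?f q) / of_nat (card Q)) \<cdot>\<^sub>m \<rho> q) Q"
  have QG: "Q \<subseteq> carrier ?G" using SG by (auto simp: Q_def)
  have trE: "mat_trace (E * \<rho> (?\<iota> u)) = (\<Sum>q\<in>Q. inverse (?f q) * mat_trace (\<rho> (q \<otimes>\<^bsub>?G\<^esub> ?\<iota> u))) / of_nat (card Q)"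
    if u: "u \<in> orth_unip_set m" for u
  proof -
    have uG: "?\<iota> u \<in> carrier ?G" using \<iota>S[OF u] SG by auto
    have "E * \<rho> (?\<iota> u) = mat_sum d d (\<lambda>q. (inverse (?f q) / of_nat (card Q)) \<cdot>\<^sub>m \<rho> q * \<rho> (?\<iota> u)) Q"
      unfolding E_def using r(1) QG uG by (intro mat_sum_mult_right) auto
    then have "mat_trace (E * \<rho> (?\<iota> u)) = (\<Sum>q\<in>Q. mat_trace ((inverse (?f q) / of_nat (card Q)) \<cdot>\<^sub>m \<rho> q * \<rho> (?\<iota> u)))"
      using r(1) QG uG by (subst mat_trace_sum[symmetric]) (auto intro!: mult_carrier_mat[of _ d d _ d])
    also have "\<dots> = (\<Sum>q\<in>Q. inverse (?f q) * mat_trace (\<rho> (q \<otimes>\<^bsub>?G\<^esub> ?\<iota> u)) / of_nat (card Q))"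
    proof (rule sum.cong[OF refl])
      fix q assume "q \<in> Q"
      then have q: "q \<in> carrier ?G" using QG by auto
      show "mat_trace ((inverse (?f q) / of_nat (card Q)) \<cdot>\<^sub>m \<rho> q * \<rho> (?\<iota> u)) = inverse (?f q) * mat_trace (\<rho> (q \<otimes>\<^bsub>?G\<^esub> ?\<iota> u)) / of_nat (card Q)"
        using r(1)[OF q] r(1)[OF uG]
        by (simp add: mult_smult_assoc_mat[of _ d d _ d] mat_trace_smult[of _ d] is_rep_mult[OF \<rho> q uG])
    qed
    finally show ?thesis by (simp add: sum_divide_distrib)
  qed
  have f\<iota>q: "?f (q \<otimes>\<^bsub>?G\<^esub> ?\<iota> u) = ?f q" "?\<pi> (q \<otimes>\<^bsub>?G\<^esub> ?\<iota> u) = u" if "q \<in> Q" "u \<in> orth_unip_set m" for q u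
  proof -
    have q: "q \<in> polar m" "?\<pi> q = 1\<^sub>m (2 * m)" using that(1) by (auto simp: Q_def S_def)
    show "?f (q \<otimes>\<^bsub>?G\<^esub> ?\<iota> u) = ?f q"
      using polar_char_mult[OF two \<theta> q(1) \<iota>S[OF that(2), unfolded S_def], of r s] f\<iota>[OF that(2), of s] by (simp add: orth_unip_simps)
    show "?\<pi> (q \<otimes>\<^bsub>?G\<^esub> ?\<iota> u) = u"
      using \<pi>m[of q "?\<iota> u"] q(2) \<iota>\<pi>[OF that(2)] that(1) QG \<iota>S[OF that(2)] SG orth_unipD[OF that(2)] by auto
  qed
  \<comment> \<open>Since S = Q U_m and f is trivial on U_m, the sum over Q collects into |Q| times
    the trace of \<open>E\<close> against the element of U_m. Hence \<open>E\<close> is nonzero and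
    its part pairs nontrivially with \<open>\<eta>\<close>.\<close>
  have "(\<Sum>h\<in>S. mat_trace (\<rho> h) * cnj (?f h * ?\<xi> h)) =
    (\<Sum>(q, u)\<in>Q \<times> orth_unip_set m. mat_trace (\<rho> (q \<otimes>\<^bsub>?G\<^esub> ?\<iota> u)) * cnj (?f (q \<otimes>\<^bsub>?G\<^esub> ?\<iota> u) * ?\<xi> (q \<otimes>\<^bsub>?G\<^esub> ?\<iota> u)))"
    by (subst sum.reindex_bij_betw[OF bijS, symmetric]) (simp add: case_prod_unfold)
  also have "\<dots> = (\<Sum>(q, u)\<in>Q \<times> orth_unip_set m. inverse (?f q) * mat_trace (\<rho> (q \<otimes>\<^bsub>?G\<^esub> ?\<iota> u)) * cnj (\<eta> u))"
  proof (rule sum.cong[OF refl], clarify)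
    fix q u :: "'a mat" assume qu: "q \<in> Q" "u \<in> orth_unip_set m"
    have "cnj (?f q) = inverse (?f q)" unfolding polar_char_def by (rule additive_character_cnj[OF \<theta>])
    then show "mat_trace (\<rho> (q \<otimes>\<^bsub>?G\<^esub> ?\<iota> u)) * cnj (?f (q \<otimes>\<^bsub>?G\<^esub> ?\<iota> u) * ?\<xi> (q \<otimes>\<^bsub>?G\<^esub> ?\<iota> u)) =
      inverse (?f q) * mat_trace (\<rho> (q \<otimes>\<^bsub>?G\<^esub> ?\<iota> u)) * cnj (\<eta> u)"
      unfolding f\<iota>q[OF qu] by simp
  qed
  also have "\<dots> = (\<Sum>u\<in>orth_unip_set m. \<Sum>q\<in>Q. inverse (?f q) * mat_trace (\<rho> (q \<otimes>\<^bsub>?G\<^esub> ?\<iota> u)) * cnj (\<eta> u))"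
    by (subst sum.swap) (simp add: sum.cartesian_product)
  finally have sumS: "(\<Sum>u\<in>orth_unip_set m. \<Sum>q\<in>Q. inverse (?f q) * mat_trace (\<rho> (q \<otimes>\<^bsub>?G\<^esub> ?\<iota> u)) * cnj (\<eta> u)) \<noteq> 0"
    using s by simp
  have cQ: "of_nat (card Q) \<noteq> (0 :: complex)"
    using subgroup.one_closed[OF Qsub] finite_subset[OF QG] finU
    by (metis card_eq_0_iff empty_iff of_nat_eq_0_iff orth_unip_simps(1))
  have sumE: "(\<Sum>u\<in>orth_unip_set m. mat_trace (E * \<rho> (?\<iota> u)) * cnj (\<eta> u)) \<noteq> 0"
  proof -
    have "(\<Sum>u\<in>orth_unip_set m. mat_trace (E * \<rho> (?\<iota> u)) * cnj (\<eta> u)) =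
      (\<Sum>u\<in>orth_unip_set m. \<Sum>q\<in>Q. inverse (?f q) * mat_trace (\<rho> (q \<otimes>\<^bsub>?G\<^esub> ?\<iota> u)) * cnj (\<eta> u)) / of_nat (card Q)"
      unfolding sum_divide_distrib by (rule sum.cong) (simp_all add: trE sum_distrib_right sum_divide_distrib)
    then show ?thesis using sumS cQ by simp
  qed
  have E0: "E \<noteq> 0\<^sub>m d d"
  proof
    assume Ez: "E = 0\<^sub>m d d"
    have "mat_trace (E * \<rho> (?\<iota> u)) = 0" if "u \<in> orth_unip_set m" for u
    proof -
      have "?\<iota> u \<in> carrier ?G" using \<iota>S[OF that] SG by auto
      then show ?thesis using r[of "?\<iota> u"] by (simp add: Ez mat_trace_def)
    qed
    then show False using sumE by simp
  qed
  obtain k \<sigma> where \<sigma>: "irr_rep ?K k \<sigma>" "d * card S = card (carrier ?G) * k"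
    "\<And>u. u \<in> carrier ?K \<Longrightarrow> mat_trace (\<sigma> u) = mat_trace (E * \<rho> (?\<iota> u))"
  proof (rule isotypic_component_irreducible[OF group_orth_unip _ irr Ssub Qsub _ _ _ _ group_orth_unip emb_hom2 _ SQ _ E_def E0])
    show "?f (s \<otimes>\<^bsub>?G\<^esub> t) = ?f s * ?f t" if "s \<in> S" "t \<in> S" for s t
      using polar_char_mult[OF two \<theta>] that by (simp add: S_def orth_unip_simps)
    show "?f s \<noteq> 0" if "s \<in> S" for s
      using \<theta> by (simp add: polar_char_def nontrivial_additive_character_def)
    show "s \<otimes>\<^bsub>?G\<^esub> q \<otimes>\<^bsub>?G\<^esub> inv\<^bsub>?G\<^esub> s \<in> Q" if sq: "s \<in> S" "q \<in> Q" for s q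
    proof -
      have c: "s \<in> carrier ?G" "q \<in> carrier ?G" "q \<in> S" using sq SG by (auto simp: Q_def)
      have i: "inv\<^bsub>?G\<^esub> s \<in> carrier ?G" using c by simp
      have ps: "?\<pi> s \<in> carrier_mat (2 * m) (2 * m)"
        using orth_unipD(1)[of "?\<pi> s" m] \<pi>.hom_closed[OF c(1)] by (simp add: orth_unip_simps)
      have "?\<pi> (s \<otimes>\<^bsub>?G\<^esub> q \<otimes>\<^bsub>?G\<^esub> inv\<^bsub>?G\<^esub> s) = ?\<pi> s * ?\<pi> q * ?\<pi> (inv\<^bsub>?G\<^esub> s)"
        unfolding \<pi>m[OF m_closed[OF c(1,2)] i] \<pi>m[OF c(1,2)] ..
      also have "?\<pi> s * ?\<pi> q = ?\<pi> s" using sq ps by (simp add: Q_def)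
      also have "?\<pi> s * ?\<pi> (inv\<^bsub>?G\<^esub> s) = ?\<pi> (s \<otimes>\<^bsub>?G\<^esub> inv\<^bsub>?G\<^esub> s)" unfolding \<pi>m[OF c(1) i] ..
      also have "\<dots> = 1\<^sub>m (2 * m)" unfolding r_inv[OF c(1)] \<pi>.hom_one by (simp add: orth_unip_simps)
      finally show ?thesis using c sq by (simp add: Q_def S.m_closed)
    qed
    show "\<exists>a\<in>Q. g \<otimes>\<^bsub>?G\<^esub> a \<otimes>\<^bsub>?G\<^esub> inv\<^bsub>?G\<^esub> g \<in> Q \<and> ?f (g \<otimes>\<^bsub>?G\<^esub> a \<otimes>\<^bsub>?G\<^esub> inv\<^bsub>?G\<^esub> g) \<noteq> ?f a"
      if "g \<in> carrier ?G" "g \<notin> S" for g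
      using polar_char_separates[OF two \<theta> r0, of g m s] that by (simp add: Q_def S_def orth_unip_simps)
  qed (use finU \<iota>S in \<open>auto simp: orth_unip_simps Q_def\<close>)
  have "d * card S = CARD('a) ^ (2 * m) * k * card S"
    using \<sigma>(2) card_polar[OF two, of m] by (simp add: S_def orth_unip_simps ac_simps)
  moreover have "card S > 0" using S.one_closed finS by (metis card_gt_0_iff empty_iff)
  ultimately have "d = CARD('a) ^ (2 * m) * k" by simp
  moreover have "(\<Sum>u\<in>orth_unip_set m. mat_trace (\<sigma> u) * cnj (\<eta> u)) \<noteq> 0"
    using sumE \<sigma>(3) by (simp add: orth_unip_simps)
  ultimately show thesis using that \<sigma>(1) by blast
qed

text \<open>If the average T over the central family were 0, the sum against c, which is invariant
  under that family, would be 0. So T has a nonzero image; its vectors are fixed by the family, and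
  by centrality the fixed space is invariant.\<close>

lemma central_acts_trivially:
  fixes G (structure) and z :: "'b::{ab_group_add,finite} \<Rightarrow> 'g"
  assumes "group G" "finite (carrier G)" and irr: "irr_rep G d \<rho>"
    and z: "\<And>t. z t \<in> carrier G" "\<And>s t. z s \<otimes> z t = z (s + t)" "\<And>t g. g \<in> carrier G \<Longrightarrow> z t \<otimes> g = g \<otimes> z t"
    and c: "\<And>t g. g \<in> carrier G \<Longrightarrow> c (z t \<otimes> g) = c g" and nz: "(\<Sum>g\<in>carrier G. mat_trace (\<rho> g) * c g) \<noteq> 0"
  shows "\<rho> (z t) = 1\<^sub>m d"
proof -
  interpret group G by fact
  have \<rho>: "is_rep G d \<rho>" using irr by (simp add: irr_rep_def)
  note r = is_repD[OF \<rho>]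
  define T where "T = mat_sum d d (\<lambda>t. \<rho> (z t)) UNIV"
  have Tc: "T \<in> carrier_mat d d" by (simp add: T_def)
  have zT: "\<rho> (z s) * T = T" for s
  proof -
    have "\<rho> (z s) * T = mat_sum d d (\<lambda>t. \<rho> (z s) * \<rho> (z t)) UNIV"
      unfolding T_def using r(1) z(1) by (intro mat_sum_mult_left) auto
    also have "\<dots> = mat_sum d d (\<lambda>t. \<rho> (z (s + t))) UNIV"
      by (rule mat_sum_cong) (simp add: is_rep_mult[OF \<rho> z(1) z(1), symmetric] z(2))
    also have "\<dots> = T"
      unfolding T_def
      by (rule mat_sum_reindex[symmetric, of "\<lambda>t. s + t"]) (rule bij_betw_byWitness[of _ "\<lambda>t. t - s"], auto)
    finally show ?thesis .
  qed
  have "T \<noteq> 0\<^sub>m d d"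
  proof
    assume T0: "T = 0\<^sub>m d d"
    have "(\<Sum>g\<in>carrier G. mat_trace (\<rho> g) * c g) = (\<Sum>g\<in>carrier G. mat_trace (\<rho> (z t \<otimes> g)) * c g)" for t
    proof -
      have "(\<Sum>g\<in>carrier G. mat_trace (\<rho> g) * c g) = (\<Sum>g\<in>carrier G. mat_trace (\<rho> (z t \<otimes> g)) * c (z t \<otimes> g))"
        by (rule sum.reindex_bij_witness[of _ "\<lambda>g. z t \<otimes> g" "\<lambda>g. inv (z t) \<otimes> g"]) (auto simp: z(1) m_assoc[symmetric])
      then show ?thesis using c by simp
    qed
    then have "of_nat CARD('b) * (\<Sum>g\<in>carrier G. mat_trace (\<rho> g) * c g) =
      (\<Sum>t\<in>UNIV. \<Sum>g\<in>carrier G. mat_trace (\<rho> (z t \<otimes> g)) * c g)" by simp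
    also have "\<dots> = (\<Sum>g\<in>carrier G. (\<Sum>t\<in>UNIV. mat_trace (\<rho> (z t \<otimes> g))) * c g)"
      by (subst sum.swap) (simp add: sum_distrib_right)
    also have "\<dots> = (\<Sum>g\<in>carrier G. mat_trace (T * \<rho> g) * c g)"
    proof (rule sum.cong[OF refl])
      fix g assume g: "g \<in> carrier G"
      have "T * \<rho> g = mat_sum d d (\<lambda>t. \<rho> (z t \<otimes> g)) UNIV"
        unfolding T_def is_rep_mult[OF \<rho> z(1) g] using r(1) z(1) g by (intro mat_sum_mult_right) auto
      then show "(\<Sum>t\<in>UNIV. mat_trace (\<rho> (z t \<otimes> g))) * c g = mat_trace (T * \<rho> g) * c g"
        using r(1) z(1) g by (simp add: mat_trace_sum)
    qed
    also have "\<dots> = 0" using r by (auto simp: T0 mat_trace_def intro!: sum.neutral)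
    finally show False using nz by simp
  qed
  then obtain v where v: "v \<in> carrier_vec d" "T *\<^sub>v v \<noteq> 0\<^sub>v d"
    using mat_eqI_vec[OF Tc, of "0\<^sub>m d d"] zero_mat_mult_vec[of _ d d] by (metis zero_carrier_mat)
  let ?W = "{w \<in> carrier_vec d. \<forall>t\<in>UNIV. \<rho> (z t) *\<^sub>v w = 1 \<cdot>\<^sub>v w}"
  have "lin_subspace d ?W" using r(1) z(1) by (intro lin_subspace_eigen) auto
  moreover have "\<forall>g\<in>carrier G. \<forall>w\<in>?W. \<rho> g *\<^sub>v w \<in> ?W"
  proof (intro ballI)
    fix g w assume g: "g \<in> carrier G" and w: "w \<in> ?W"
    then have wc: "w \<in> carrier_vec d" and wz: "\<rho> (z t) *\<^sub>v w = w" for t by simp_all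
    have "\<rho> (z t) *\<^sub>v (\<rho> g *\<^sub>v w) = \<rho> g *\<^sub>v w" for t
    proof -
      have "\<rho> (z t) *\<^sub>v (\<rho> g *\<^sub>v w) = \<rho> (z t) * \<rho> g *\<^sub>v w"
        using carrier_vecD[OF wc] r[OF g] r[OF z(1)] by (simp add: mat_vec_assoc)
      also have "\<rho> (z t) * \<rho> g = \<rho> g * \<rho> (z t)"
        unfolding is_rep_mult[OF \<rho> z(1) g, symmetric] is_rep_mult[OF \<rho> g z(1), symmetric] z(3)[OF g] ..
      also have "\<dots> *\<^sub>v w = \<rho> g *\<^sub>v w"
        using wz carrier_vecD[OF wc] r[OF g] r[OF z(1)] by (simp add: mat_vec_assoc)
      finally show ?thesis .
    qed
    then show "\<rho> g *\<^sub>v w \<in> ?W" using r[OF g] w by auto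
  qed
  moreover have "T *\<^sub>v v \<in> ?W"
    using zT v(1) Tc r[OF z(1)] by (auto simp: mat_vec_assoc[symmetric])
  ultimately have "?W = carrier_vec d" using v(2) by (rule irr_rep_cases[OF irr])
  then have *: "\<rho> (z t) *\<^sub>v w = w" if "w \<in> carrier_vec d" for w using that by auto
  show ?thesis by (rule mat_eqI_vec[OF r(1)[OF z(1)]]) (auto simp: *)
qed

section \<open>Basic sets\<close>

lemma finite_Phi: "finite (Phi n)"
proof (rule finite_subset)
  show "Phi n \<subseteq> (\<lambda>(i, j). EMinus i j) ` ({..n} \<times> {..n}) \<union> (\<lambda>(i, j). EPlus i j) ` ({..n} \<times> {..n})"
    by (auto simp: Phi_def)
qed simp

lemma basicD:
  assumes "basic n D"
  shows "D \<subseteq> Phi n"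
    and "\<alpha> \<in> D \<Longrightarrow> \<beta> \<in> D \<Longrightarrow> (i, j) \<in> root_entries \<alpha> \<Longrightarrow> (i, j') \<in> root_entries \<beta> \<Longrightarrow> j = j'"
    and "\<alpha> \<in> D \<Longrightarrow> \<beta> \<in> D \<Longrightarrow> (i, j) \<in> root_entries \<alpha> \<Longrightarrow> (i', j) \<in> root_entries \<beta> \<Longrightarrow> i = i'"
  using assms unfolding basic_def Let_def by blast+

lemma basicI:
  assumes "D \<subseteq> Phi n"
    and "\<And>\<alpha> \<beta> i j j'. \<alpha> \<in> D \<Longrightarrow> \<beta> \<in> D \<Longrightarrow> (i, j) \<in> root_entries \<alpha> \<Longrightarrow> (i, j') \<in> root_entries \<beta> \<Longrightarrow> j = j'"
    and "\<And>\<alpha> \<beta> i i' j. \<alpha> \<in> D \<Longrightarrow> \<beta> \<in> D \<Longrightarrow> (i, j) \<in> root_entries \<alpha> \<Longrightarrow> (i', j) \<in> root_entries \<beta> \<Longrightarrow> i = i'"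
  shows "basic n D"
  using assms unfolding basic_def Let_def by blast

definition unshift :: "nat \<Rightarrow> eps_root set \<Rightarrow> eps_root set" where
  "unshift n D = {\<beta> \<in> Phi n. shift_root \<beta> \<in> D}"

lemma shift_root_Phi: "\<beta> \<in> Phi n \<Longrightarrow> shift_root \<beta> \<in> Phi (Suc n)"
  by (erule Phi_cases) (auto simp: Phi_def)

text \<open>Labels lie on both sides of 0 and the shift moves them away from 0, hence the
  sign.\<close>

lemma root_entries_shift:
  assumes "\<beta> \<in> Phi n" "(i, j) \<in> root_entries \<beta>"
  shows "(i + sgn i, j + sgn j) \<in> root_entries (shift_root \<beta>)"
  using assms by (elim Phi_cases) (auto simp: sgn_if)

lemma basic_unshift:
  assumes "basic (Suc n) D"
  shows "basic n (unshift n D)"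
proof -
  have inj: "x = y" if "x + sgn x = y + sgn y" for x y :: int
    using that by (auto simp: sgn_if split: if_splits)
  show ?thesis
  proof (rule basicI)
    fix \<alpha> \<beta> assume "\<alpha> \<in> unshift n D" "\<beta> \<in> unshift n D"
    then have \<alpha>: "\<alpha> \<in> Phi n" "shift_root \<alpha> \<in> D" and \<beta>: "\<beta> \<in> Phi n" "shift_root \<beta> \<in> D" by (auto simp: unshift_def)
    note D = basicD(2,3)[OF assms \<alpha>(2) \<beta>(2) root_entries_shift[OF \<alpha>(1)]]
    show "j = j'" if "(i, j) \<in> root_entries \<alpha>" "(i, j') \<in> root_entries \<beta>" for i j j'
      by (rule inj[OF D(1)[OF that(1) root_entries_shift[OF \<beta>(1) that(2)]]])
    show "i = i'" if "(i, j) \<in> root_entries \<alpha>" "(i', j) \<in> root_entries \<beta>" for i i' j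
      by (rule inj[OF D(2)[OF that(1) root_entries_shift[OF \<beta>(1) that(2)]]])
  qed (auto simp: unshift_def)
qed

text \<open>The entries (1, -2) and (2, -1) occupy rows 1 and 2, so no other root of D has smaller
  index 1 or 2; all the others are shifted twice.\<close>

lemma basic_decomp:
  assumes D: "basic (Suc (Suc m)) D" "EPlus 1 2 \<in> D"
  shows "D = insert (EPlus 1 2) ((\<lambda>\<beta>. shift_root (shift_root \<beta>)) ` unshift m (unshift (Suc m) D))"
proof (intro equalityI subsetI)
  fix \<alpha> assume \<alpha>: "\<alpha> \<in> D"
  have ne: "False" if "(1, j) \<in> root_entries \<alpha>" "j \<noteq> -2" for j
    using basicD(2)[OF D(1) \<alpha> D(2) that(1), of "-2"] that(2) by simp
  have ne': "False" if "(2, j) \<in> root_entries \<alpha>" "j \<noteq> -1" for j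
    using basicD(2)[OF D(1) \<alpha> D(2) that(1), of "-1"] that(2) by simp
  have "\<alpha> = EPlus 1 2 \<or> (\<exists>\<beta>\<in>Phi m. \<alpha> = shift_root (shift_root \<beta>))"
    using basicD(1)[OF D(1)] \<alpha>
  proof (elim subsetD[elim_format] Phi_cases)
    fix i j assume a: "\<alpha> = EMinus i j" "1 \<le> i" "i < j" "j \<le> Suc (Suc m)"
    have "i \<noteq> 1" "i \<noteq> 2" using ne[of "int j"] ne'[of "int j"] a by auto
    then have "EMinus (i - 2) (j - 2) \<in> Phi m" "\<alpha> = shift_root (shift_root (EMinus (i - 2) (j - 2)))"
      using a by (auto simp: Phi_def)
    then show ?thesis by blast
  next
    fix i j assume a: "\<alpha> = EPlus i j" "1 \<le> i" "i < j" "j \<le> Suc (Suc m)"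
    show ?thesis
    proof (cases "i = 1")
      case True
      then have "j = 2" using ne[of "- int j"] a by auto
      then show ?thesis using a True by simp
    next
      case False
      have "i \<noteq> 2" using ne'[of "- int j"] a by auto
      then have "EPlus (i - 2) (j - 2) \<in> Phi m" "\<alpha> = shift_root (shift_root (EPlus (i - 2) (j - 2)))"
        using a False by (auto simp: Phi_def)
      then show ?thesis by blast
    qed
  qed
  then show "\<alpha> \<in> insert (EPlus 1 2) ((\<lambda>\<beta>. shift_root (shift_root \<beta>)) ` unshift m (unshift (Suc m) D))"
    using \<alpha> by (auto simp: unshift_def shift_root_Phi)
qed (use D in \<open>auto simp: unshift_def\<close>)

lemma shift_root_neq: "EPlus 1 2 \<noteq> shift_root (shift_root \<beta>)"
  by (cases \<beta>) auto

lemma inj_shift_root2: "inj (\<lambda>\<beta>. shift_root (shift_root \<beta>))"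
  using inj_compose[OF inj_shift_root inj_shift_root] by (simp add: comp_def)

lemma supercharacter_conj:
  fixes g :: "'a::field mat"
  assumes "g \<in> orth_unip_set n" "x \<in> orth_unip_set n"
  shows "supercharacter n \<theta> D \<phi> (x \<otimes>\<^bsub>orth_unip n\<^esub> g \<otimes>\<^bsub>orth_unip n\<^esub> inv\<^bsub>orth_unip n\<^esub> x) = supercharacter n \<theta> D \<phi> g"
  unfolding supercharacter_def elementary_char_conj[OF assms] ..

lemma supercharacter_decomp:
  fixes g :: "'a::{field,finite} mat"
  assumes two: "(2 :: 'a) \<noteq> 0" and D: "basic (Suc (Suc m)) D" "EPlus 1 2 \<in> D" and g: "g \<in> orth_unip_set (Suc (Suc m))"
  shows "supercharacter (Suc (Suc m)) \<theta> D \<phi> g = elementary_char (Suc (Suc m)) \<theta> (EPlus 1 2) (\<phi> (EPlus 1 2)) g *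
    supercharacter m \<theta> (unshift m (unshift (Suc m) D)) (\<lambda>\<beta>. \<phi> (shift_root (shift_root \<beta>))) (mid m (mid (Suc m) g))"
proof -
  let ?S = "\<lambda>\<beta>. shift_root (shift_root \<beta>)" and ?D = "unshift m (unshift (Suc m) D)"
  have fin: "finite ?D" using finite_Phi[of m] by (simp add: unshift_def)
  have "supercharacter (Suc (Suc m)) \<theta> D \<phi> g = (\<Prod>\<alpha>\<in>insert (EPlus 1 2) (?S ` ?D). elementary_char (Suc (Suc m)) \<theta> \<alpha> (\<phi> \<alpha>) g)"
    unfolding supercharacter_def basic_decomp[OF D, symmetric] ..
  also have "\<dots> = elementary_char (Suc (Suc m)) \<theta> (EPlus 1 2) (\<phi> (EPlus 1 2)) g *
      (\<Prod>\<beta>\<in>?D. elementary_char (Suc (Suc m)) \<theta> (?S \<beta>) (\<phi> (?S \<beta>)) g)"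
    using fin shift_root_neq by (subst prod.insert) (auto simp: prod.reindex[OF inj_on_subset[OF inj_shift_root2 subset_UNIV]])
  also have "(\<Prod>\<beta>\<in>?D. elementary_char (Suc (Suc m)) \<theta> (?S \<beta>) (\<phi> (?S \<beta>)) g) =
      supercharacter m \<theta> ?D (\<lambda>\<beta>. \<phi> (?S \<beta>)) (mid m (mid (Suc m) g))"
    unfolding supercharacter_def
  proof (rule prod.cong[OF refl])
    fix \<beta> assume "\<beta> \<in> ?D"
    then have \<beta>: "\<beta> \<in> Phi m" by (simp add: unshift_def)
    show "elementary_char (Suc (Suc m)) \<theta> (?S \<beta>) (\<phi> (?S \<beta>)) g = elementary_char m \<theta> \<beta> (\<phi> (?S \<beta>)) (mid m (mid (Suc m) g))"
      unfolding elementary_char_shift[OF two shift_root_Phi[OF \<beta>] g] elementary_char_shift[OF two \<beta> mid_closed[OF g]] ..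
  qed
  finally show ?thesis .
qed

section \<open>The sets of maximal degree\<close>

definition plus_chain :: "nat \<Rightarrow> eps_root set" where
  "plus_chain c = {EPlus (2 * k - 1) (2 * k) | k. 1 \<le> k \<and> 2 * k \<le> c}"

text \<open>One predicate for both parities, since the induction goes in steps of two and treats
  them alike.\<close>

definition max_degree_set :: "nat \<Rightarrow> eps_root set \<Rightarrow> bool" where
  "max_degree_set n D \<longleftrightarrow>
     (if even n then \<exists>D1. D1 \<subset> {EMinus (n - 1) n, EPlus (n - 1) n} \<and> D = plus_chain (n - 2) \<union> D1
      else D = plus_chain (n - 1))"

lemma plus_chain_0: "plus_chain 0 = {}"
  by (auto simp: plus_chain_def)

lemma plus_chain_step:
  "plus_chain (Suc (Suc c)) = insert (EPlus 1 2) ((\<lambda>\<beta>. shift_root (shift_root \<beta>)) ` plus_chain c)"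
proof (intro equalityI subsetI)
  fix \<alpha> assume "\<alpha> \<in> plus_chain (Suc (Suc c))"
  then obtain k where k: "1 \<le> k" "2 * k \<le> Suc (Suc c)" "\<alpha> = EPlus (2 * k - 1) (2 * k)" by (auto simp: plus_chain_def)
  show "\<alpha> \<in> insert (EPlus 1 2) ((\<lambda>\<beta>. shift_root (shift_root \<beta>)) ` plus_chain c)"
  proof (cases "k = 1")
    case False
    define l where "l = k - 1"
    have "\<alpha> = shift_root (shift_root (EPlus (2 * l - 1) (2 * l)))" "1 \<le> l" "2 * l \<le> c" using k False by (auto simp: l_def)
    then show ?thesis unfolding plus_chain_def by blast
  qed (use k in simp)
next
  fix \<alpha> assume "\<alpha> \<in> insert (EPlus 1 2) ((\<lambda>\<beta>. shift_root (shift_root \<beta>)) ` plus_chain c)"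
  then consider "\<alpha> = EPlus 1 2" | k where "1 \<le> k" "2 * k \<le> c" "\<alpha> = EPlus (2 * k - 1 + 2) (2 * k + 2)"
    by (auto simp: plus_chain_def)
  then show "\<alpha> \<in> plus_chain (Suc (Suc c))"
  proof cases
    case 1
    then show ?thesis unfolding plus_chain_def by (intro CollectI exI[of _ 1]) auto
  next
    case (2 k)
    then show ?thesis unfolding plus_chain_def by (intro CollectI exI[of _ "Suc k"]) auto
  qed
qed

lemma basic_plus_chain: "c \<le> n \<Longrightarrow> basic n (plus_chain c)"
  by (rule basicI) (auto simp: plus_chain_def Phi_def, presburger+)

lemma max_degree_set_exists: "\<exists>D. basic n D \<and> max_degree_set n D"
proof (cases "even n")
  case True
  then show ?thesis using basic_plus_chain[of "n - 2" n]
    by (intro exI[of _ "plus_chain (n - 2)"]) (auto simp: max_degree_set_def intro!: exI[of _ "{}"])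
next
  case False
  then show ?thesis using basic_plus_chain[of "n - 1" n]
    by (intro exI[of _ "plus_chain (n - 1)"]) (auto simp: max_degree_set_def)
qed

lemma max_degree_set_contains:
  assumes "max_degree_set (Suc (Suc m)) D" "m \<ge> 1"
  shows "EPlus 1 2 \<in> D"
proof -
  have "EPlus 1 2 \<in> plus_chain c" if "c \<ge> 2" for c
    unfolding plus_chain_def using that by (intro CollectI exI[of _ 1]) auto
  moreover have "even m \<Longrightarrow> m \<ge> 2" using \<open>m \<ge> 1\<close> by presburger
  ultimately show ?thesis using assms by (auto simp: max_degree_set_def split: if_splits)
qed

text \<open>Shifting twice and adding \<epsilon>_1 + \<epsilon>_2 is injective on sets of roots and
  lengthens the chain by one link; for even m the shift also carries the proper subset
  \<open>D1\<close> along.\<close>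

lemma max_degree_set_step:
  assumes "m \<ge> 1" "D = insert (EPlus 1 2) ((\<lambda>\<beta>. shift_root (shift_root \<beta>)) ` D')"
  shows "max_degree_set (Suc (Suc m)) D \<longleftrightarrow> max_degree_set m D'"
proof -
  let ?S = "\<lambda>\<beta>. shift_root (shift_root \<beta>)"
  have S: "insert (EPlus 1 2) (?S ` A) = insert (EPlus 1 2) (?S ` B) \<longleftrightarrow> A = B" for A B
  proof -
    have "insert (EPlus 1 2) (?S ` A) = insert (EPlus 1 2) (?S ` B) \<longleftrightarrow> ?S ` A = ?S ` B"
      using shift_root_neq by (intro insert_ident) auto
    then show ?thesis by (simp only: inj_image_eq_iff[OF inj_shift_root2])
  qed
  show ?thesis
  proof (cases "even m")
    case True
    then obtain c where m: "m = Suc (Suc c)" using \<open>m \<ge> 1\<close> by (cases m rule: mexp.cases) auto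
    let ?P = "{EMinus (m - 1) m, EPlus (m - 1) m}"
    have P: "{EMinus (Suc (Suc m) - 1) (Suc (Suc m)), EPlus (Suc (Suc m) - 1) (Suc (Suc m))} = ?S ` ?P" by (simp add: m)
    have ch: "plus_chain (Suc (Suc m) - 2) \<union> ?S ` D1 = insert (EPlus 1 2) (?S ` (plus_chain c \<union> D1))" for D1
      by (simp add: m plus_chain_step image_Un)
    have "max_degree_set (Suc (Suc m)) D \<longleftrightarrow> (\<exists>D1. D1 \<subset> ?S ` ?P \<and> D = plus_chain (Suc (Suc m) - 2) \<union> D1)"
      unfolding max_degree_set_def P using True by simp
    also have "\<dots> \<longleftrightarrow> (\<exists>D1. D1 \<subset> ?P \<and> D = plus_chain (Suc (Suc m) - 2) \<union> ?S ` D1)"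
    proof
      assume "\<exists>D1. D1 \<subset> ?S ` ?P \<and> D = plus_chain (Suc (Suc m) - 2) \<union> D1"
      then obtain D1 where D1: "D1 \<subset> ?S ` ?P" "D = plus_chain (Suc (Suc m) - 2) \<union> D1" by auto
      obtain D1' where D1': "D1' \<subseteq> ?P" "D1 = ?S ` D1'" by (rule subset_imageE[OF psubset_imp_subset[OF D1(1)]])
      then show "\<exists>D1. D1 \<subset> ?P \<and> D = plus_chain (Suc (Suc m) - 2) \<union> ?S ` D1" using D1 by blast
    next
      assume "\<exists>D1. D1 \<subset> ?P \<and> D = plus_chain (Suc (Suc m) - 2) \<union> ?S ` D1"
      then obtain D1 where D1: "D1 \<subset> ?P" "D = plus_chain (Suc (Suc m) - 2) \<union> ?S ` D1" by auto
      have "?S ` D1 \<subset> ?S ` ?P" using D1(1) by (simp only: image_strict_mono[OF inj_on_subset[OF inj_shift_root2 subset_UNIV]])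
      then show "\<exists>D1. D1 \<subset> ?S ` ?P \<and> D = plus_chain (Suc (Suc m) - 2) \<union> D1" using D1(2) by blast
    qed
    also have "\<dots> \<longleftrightarrow> max_degree_set m D'"
      unfolding ch assms(2) S max_degree_set_def using True by (simp add: m)
    finally show ?thesis .
  next
    case False
    then obtain c where m: "m = Suc c" by (cases m) auto
    have "max_degree_set (Suc (Suc m)) D \<longleftrightarrow> D = insert (EPlus 1 2) (?S ` plus_chain c)"
      using False by (simp add: max_degree_set_def m plus_chain_step)
    also have "\<dots> \<longleftrightarrow> max_degree_set m D'"
      unfolding assms(2) S using False by (simp add: max_degree_set_def m)
    finally show ?thesis .
  qed
qed

text \<open>For n at most 2 all degrees are 1, so every basic set has to qualify. For n = 2 the two
  roots share row 1 and cannot occur together, which is why \<open>D1\<close> is a proper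
  subset.\<close>

lemma max_degree_set_small:
  assumes "basic n D" "n = 1 \<or> n = 2"
  shows "max_degree_set n D"
  using assms(2)
proof
  assume n: "n = 1"
  then have "D = {}" using basicD(1)[OF assms(1)] by (auto simp: Phi_def)
  then show ?thesis by (simp add: max_degree_set_def n plus_chain_0)
next
  assume n: "n = 2"
  have D: "D \<subseteq> {EMinus 1 2, EPlus 1 2}" using basicD(1)[OF assms(1)] n by (auto simp: Phi_def)
  have "\<not> (EMinus 1 2 \<in> D \<and> EPlus 1 2 \<in> D)"
    using basicD(2)[OF assms(1), of "EMinus 1 2" "EPlus 1 2" 1 2 "-2"] by auto
  then have "D \<subset> {EMinus 1 2, EPlus 1 2}" using D by auto
  then show ?thesis by (simp add: max_degree_set_def n plus_chain_0)
qed

section \<open>Characters of maximal degree\<close>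

text \<open>Formulated with the number q^\<open>mexp n\<close> instead of maximality, because
  attainment of the bound is derived from this equivalence.\<close>

lemma degree_maximal_iff:
  fixes \<rho> :: "'a::{field,finite} mat \<Rightarrow> complex mat"
  assumes two: "(2 :: 'a) \<noteq> 0" and \<theta>: "nontrivial_additive_character (\<theta> :: 'a \<Rightarrow> complex)"
  shows "n \<ge> 1 \<Longrightarrow> irr_rep (orth_unip n) d \<rho> \<Longrightarrow> basic n D \<Longrightarrow> \<forall>\<alpha>\<in>D. \<phi> \<alpha> \<noteq> 0 \<Longrightarrow>
    (\<Sum>g\<in>orth_unip_set n. mat_trace (\<rho> g) * cnj (supercharacter n \<theta> D \<phi> g)) \<noteq> 0 \<Longrightarrow>
    d = CARD('a) ^ mexp n \<longleftrightarrow> max_degree_set n D"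
proof (induction n arbitrary: d \<rho> D \<phi> rule: less_induct)
  case (less n)
  note irr = less.prems(2) and D = less.prems(3)
  consider "n = 1 \<or> n = 2" | m where "n = Suc (Suc m)" "m \<ge> 1" "m < n"
    using less.prems(1) by (cases n rule: mexp.cases) force+
  then show ?case
  proof cases
    case 1
    then have "mexp n = 0" by (auto simp: numeral_2_eq_2)
    then have "d = 1" using degree_le[OF two \<theta> irr] irr by (simp add: irr_rep_def)
    then show ?thesis using max_degree_set_small[OF D 1] \<open>mexp n = 0\<close> by simp
  next
    case (2 m)
    note irr = irr[unfolded 2(1)] and D = D[unfolded 2(1)] and nz = less.prems(5)[unfolded 2(1)]
    show ?thesis
    proof (cases "EPlus 1 2 \<in> D")
      case False
      have "\<rho> (central_elem m t) = 1\<^sub>m d" for t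
      proof (rule central_acts_trivially[OF group_orth_unip _ irr])
        show "cnj (supercharacter (Suc (Suc m)) \<theta> D \<phi> (central_elem m t \<otimes>\<^bsub>orth_unip (Suc (Suc m))\<^esub> g)) =
          cnj (supercharacter (Suc (Suc m)) \<theta> D \<phi> g)" if "g \<in> carrier (orth_unip (Suc (Suc m)))" for t g
          unfolding supercharacter_def orth_unip_simps(2)
          using that basicD(1)[OF D] False
          by (intro arg_cong[of _ _ cnj] prod.cong refl elementary_char_central[OF two]) (auto simp: orth_unip_simps)
      qed (use nz in \<open>auto simp: orth_unip_simps orth_unip_finite[OF two] central_elem_closed[OF two] central_elem_add[OF two]
          central_elem_commute[OF two]\<close>)
      then have "d < CARD('a) ^ mexp (Suc (Suc m))"
        by (intro degree_less[OF two \<theta> irr 2(2)]) (simp add: central_elem_def)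
      then show ?thesis using max_degree_set_contains[OF _ 2(2)] False 2(1) by auto
    next
      case True
      let ?D = "unshift m (unshift (Suc m) D)" and ?\<phi> = "\<lambda>\<beta>. \<phi> (shift_root (shift_root \<beta>))"
      have nz': "(\<Sum>g\<in>orth_unip_set (Suc (Suc m)). mat_trace (\<rho> g) *
        cnj (elementary_char (Suc (Suc m)) \<theta> (EPlus 1 2) (\<phi> (EPlus 1 2)) g * supercharacter m \<theta> ?D ?\<phi> (mid m (mid (Suc m) g)))) \<noteq> 0"
        using nz by (simp add: supercharacter_decomp[OF two D True])
      obtain k \<sigma> where \<sigma>: "irr_rep (orth_unip m :: 'a mat monoid) k \<sigma>" "d = CARD('a) ^ (2 * m) * k"
        "(\<Sum>u\<in>orth_unip_set m. mat_trace (\<sigma> u) * cnj (supercharacter m \<theta> ?D ?\<phi> u)) \<noteq> 0"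
        by (rule reduction_step[OF two \<theta> _ irr supercharacter_conj nz']) (use less.prems(4) True in auto)
      \<comment> \<open>Both exponents differ by 2m, so d reaches the bound for m + 2 exactly if k
        reaches the bound for m.\<close>
      have "k = CARD('a) ^ mexp m \<longleftrightarrow> max_degree_set m ?D"
      proof (rule less.IH[OF 2(3,2) \<sigma>(1) _ _ \<sigma>(3)])
        show "basic m ?D" by (intro basic_unshift D)
        show "\<forall>\<beta>\<in>?D. ?\<phi> \<beta> \<noteq> 0" using less.prems(4) by (auto simp: unshift_def)
      qed
      then show ?thesis
        unfolding 2(1) max_degree_set_step[OF 2(2) basic_decomp[OF D True]] by (simp add: \<sigma>(2) power_add)
    qed
  qed
qed

text \<open>A supercharacter is nonzero at the identity, so pairing it with the regular
  representation gives a nonzero sum and hence an irreducible constituent. For D of the maximal type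
  its degree is forced.\<close>

lemma maximal_degree_attained:
  assumes two: "(2 :: 'a::{field,finite}) \<noteq> 0" and \<theta>: "nontrivial_additive_character (\<theta> :: 'a \<Rightarrow> complex)" and n: "n \<ge> 1"
  shows "\<exists>\<rho>. irr_rep (orth_unip n :: 'a mat monoid) (CARD('a) ^ mexp n) \<rho>"
proof -
  let ?G = "orth_unip n :: 'a mat monoid"
  interpret group ?G by (rule group_orth_unip)
  have fin: "finite (carrier ?G)" using orth_unip_finite[OF two] by (simp add: orth_unip_simps)
  obtain D where D: "basic n D" "max_degree_set n D" using max_degree_set_exists by blast
  let ?c = "\<lambda>g :: 'a mat. cnj (supercharacter n \<theta> D (\<lambda>_. 1) g)"
  obtain \<rho> where \<rho>: "is_rep ?G (card (carrier ?G)) \<rho>"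
    "\<And>g. g \<in> carrier ?G \<Longrightarrow> mat_trace (\<rho> g) = (if g = \<one>\<^bsub>?G\<^esub> then of_nat (card (carrier ?G)) else 0)"
    by (rule regular_representation[OF group_orth_unip fin]) (rule that)
  have "(\<Sum>g\<in>carrier ?G. mat_trace (\<rho> g) * ?c g) = (\<Sum>g\<in>carrier ?G. if g = \<one>\<^bsub>?G\<^esub> then of_nat (card (carrier ?G)) * ?c g else 0)"
    by (rule sum.cong) (auto simp: \<rho>(2))
  also have "\<dots> = of_nat (card (carrier ?G)) * ?c \<one>\<^bsub>?G\<^esub>" by (simp add: sum.delta[OF fin])
  also have "\<dots> \<noteq> 0"
  proof -
    have "supercharacter n \<theta> D (\<lambda>_. 1) (1\<^sub>m (2 * n) :: 'a mat) \<noteq> 0"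
      unfolding supercharacter_def
      using finite_subset[OF basicD(1)[OF D(1)] finite_Phi] elementary_char_one[OF two \<theta>] basicD(1)[OF D(1)] by (auto simp: prod_zero_iff)
    moreover have "card (carrier ?G) \<noteq> 0" using fin one_closed by (metis card_eq_0_iff empty_iff)
    ultimately show ?thesis by (simp add: orth_unip_simps(3))
  qed
  finally obtain k \<sigma> where \<sigma>: "irr_rep ?G k \<sigma>" "(\<Sum>g\<in>carrier ?G. mat_trace (\<sigma> g) * ?c g) \<noteq> 0"
    using irreducible_constituent[OF group_orth_unip \<rho>(1), of ?c] by blast
  have "k = CARD('a) ^ mexp n"
    using degree_maximal_iff[OF two \<theta> n \<sigma>(1) D(1), of "\<lambda>_. 1"] \<sigma>(2) D(2) by (simp add: orth_unip_simps)
  then show ?thesis using \<sigma>(1) by blast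
qed

theorem theorem7p2:
  fixes p e n :: nat
    and \<theta> :: "'a::{field,finite} \<Rightarrow> complex"
    and \<chi> :: "'a mat \<Rightarrow> complex"
    and D :: "eps_root set" and \<phi> :: "eps_root \<Rightarrow> 'a"
  assumes "prime p" "p \<ge> 3" "e \<ge> 1" "CARD('a) = p ^ e" "n \<ge> 1"
    and "nontrivial_additive_character \<theta>"
    and "\<chi> \<in> irr_characters (orth_unip n)"
    and "basic n D" "\<forall>\<alpha>\<in>D. \<phi> \<alpha> \<noteq> 0"
    and "char_inner (orth_unip n) \<chi> (supercharacter n \<theta> D \<phi>) \<noteq> 0"
  shows "(even n \<longrightarrow>
            (has_max_degree (orth_unip n) \<chi> \<longleftrightarrow>
              (\<exists>D1. D1 \<subset> {EMinus (n - 1) n, EPlus (n - 1) n} \<and>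
                 D = {EPlus (2 * k - 1) (2 * k) | k. 1 \<le> k \<and> 2 * k \<le> n - 2} \<union> D1))) \<and>
         (odd n \<longrightarrow>
            (has_max_degree (orth_unip n) \<chi> \<longleftrightarrow>
              D = {EPlus (2 * k - 1) (2 * k) | k. 1 \<le> k \<and> 2 * k \<le> n - 1}))"
proof -
  let ?G = "orth_unip n :: 'a mat monoid"
  have "odd p" using assms(1,2) by (intro prime_odd_nat) auto
  then have two: "(2 :: 'a) \<noteq> 0" using assms(4) by (intro two_neq_0) simp
  note \<theta> = assms(6)
  have deg: "char_degree ?G (\<lambda>g\<in>carrier ?G. mat_trace (\<sigma> g)) = real k" if "irr_rep ?G k \<sigma>" for k \<sigma>
    using that char_degree_irr[OF group_orth_unip] irreducible_representation_iff[OF group_orth_unip] by blast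
  have irr: "irr_characters ?G = {\<chi>. \<exists>d \<rho>. irr_rep ?G d \<rho> \<and> \<chi> = (\<lambda>g\<in>carrier ?G. mat_trace (\<rho> g))}"
    by (simp add: irr_characters_def irreducible_representation_iff[OF group_orth_unip])
  obtain d \<rho> where \<rho>: "irr_rep ?G d \<rho>" "\<chi> = (\<lambda>g\<in>carrier ?G. mat_trace (\<rho> g))"
    using assms(7) unfolding irr by blast
  \<comment> \<open>Upper bound and attainment together turn maximality among characters into an
    equation for the single degree d.\<close>
  have max: "has_max_degree ?G \<chi> \<longleftrightarrow> d = CARD('a) ^ mexp n"
  proof
    assume m: "has_max_degree ?G \<chi>"
    obtain \<sigma> where \<sigma>: "irr_rep ?G (CARD('a) ^ mexp n) \<sigma>" using maximal_degree_attained[OF two \<theta> assms(5)] by blast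
    then have "(\<lambda>g\<in>carrier ?G. mat_trace (\<sigma> g)) \<in> irr_characters ?G" unfolding irr by blast
    then have "real (CARD('a) ^ mexp n) \<le> real d" using m deg[OF \<sigma>] deg[OF \<rho>(1)] \<rho>(2) unfolding has_max_degree_def by metis
    then show "d = CARD('a) ^ mexp n" using degree_le[OF two \<theta> \<rho>(1)] by linarith
  next
    assume "d = CARD('a) ^ mexp n"
    then have "real k \<le> real d" if "irr_rep ?G k \<sigma>" for k \<sigma> using degree_le[OF two \<theta> that] by simp
    then show "has_max_degree ?G \<chi>" unfolding has_max_degree_def irr using deg \<rho> by auto
  qed
  have "(\<Sum>g\<in>orth_unip_set n. mat_trace (\<rho> g) * cnj (supercharacter n \<theta> D \<phi> g)) \<noteq> 0"
    using assms(10) by (auto simp: char_inner_def \<rho>(2) orth_unip_simps)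
  then have "has_max_degree ?G \<chi> \<longleftrightarrow> max_degree_set n D"
    unfolding max by (rule degree_maximal_iff[OF two \<theta> assms(5) \<rho>(1) assms(8,9)])
  then show ?thesis unfolding max_degree_set_def plus_chain_def by auto
qed

end
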